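(* Let $v,w$ be submultiplicative weights on $\mathbb{R}^{2d}$, let $m\in\mathcal{M}_v$, $\mu\in\mathcal{M}_w$, and let $1\le p,q\le\infty$. Assume that the symbol $a$ on $\mathbb{R}^{2d}$ and the windows $\varphi_1,\varphi_2$ on $\mathbb{R}^d$ satisfy: (i) $|a|\asymp 1/m$, i.e. there is $c\ge1$ with $c^{-1}/m\le|a|\le c/m$ (in particular $a\in L^\infty_m(\mathbb{R}^{2d})$); (ii) $(\partial_ja)\,m\in L^0(\mathbb{R}^{2d})$ for $j=1,\dots,2d$; (iii) $\varphi_1,\varphi_2\in M^1_{wv^2(\langle\cdot\rangle\otimes\langle\cdot\rangle)}(\mathbb{R}^d)$ and $|\langle\varphi_1,\varphi_2\rangle|=1$. Then the operators $$A_a^{\varphi_1,\varphi_2}:M^{p,q}_\mu(\mathbb{R}^d)\to M^{p,q}_{\mu m}(\mathbb{R}^d)\qquad\text{and}\qquad A_{1/a}^{\varphi_2,\varphi_1}:M^{p,q}_{\mu m}(\mathbb{R}^d)\to M^{p,q}_\mu(\mathbb{R}^d)$$ are Fredholm operators.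
   Context: A bounded operator $A:B_1\to B_2$ between Banach spaces is Fredholm if $\dim\ker A<\infty$ and $\dim\mathrm{Coker}\,A<\infty$. Weights. A submultiplicative weight is a continuous, positive, even function $v$ on $\mathbb{R}^{2d}$ with $v(0)=1$, $v(z_1+z_2)\le v(z_1)v(z_2)$, which moreover satisfies the GRS-condition $\lim_{n\to\infty}v(nz)^{1/n}=1$ for all $z$, and $\int_0^1v(tz)\,dt\le C\,v(z)$ for a constant $C$. For such $v$, $\mathcal{M}_v$ is the set of positive even weight functions $m$ on $\mathbb{R}^{2d}$ such that $m(z_1+z_2)\le C\,v(z_1)m(z_2)$ for all $z_1,z_2$ and some constant $C$. Put $\langle z\rangle=(1+|z|^2)^{1/2}$; $\langle\cdot\rangle\otimes\langle\cdot\rangle$ is the weight $(x,\omega)\mapsto\langle x\rangle\langle\omega\rangle$ on $\mathbb{R}^{2d}$. Time-frequency notation. For $z=(x,\omega)\in\mathbb{R}^{2d}$, $\pi(z)f(t)=M_\omega T_xf(t)=e^{2\pi i\omega t}f(t-x)$. The short-time Fourier transform is $V_gf(z)=\langle f,\pi(z)g\rangle$, where $\langle\cdot,\cdot\rangle$ is the bracket extending the inner product $\int f\bar g$ (linear in the first argument) by duality. Function spaces. $\|F\|_{L^{p,q}_m}=\big(\int_{\mathbb{R}^d}(\int_{\mathbb{R}^d}|F(x,\omega)|^pm(x,\omega)^p\,dx)^{q/p}d\omega\big)^{1/q}$ (usual modification if $p$ or $q$ is $\infty$); $L^\infty_m=\{F: Fm\in L^\infty(\mathbb{R}^{2d})\}$.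 $L^0(\mathbb{R}^{2d})$ is the space of $F\in L^\infty(\mathbb{R}^{2d})$ vanishing at infinity: for every $\varepsilon>0$ there is $R>0$ with $|F(z)|<\varepsilon$ for a.a. $|z|>R$. Partial derivatives $\partial_ja$ of the symbol are in the sense of distributions and required to be functions as stated. Modulation spaces: let $\varphi_0(t)=e^{-\pi t^2}$ and $\mathcal{S}_{\mathcal{C}}=\mathrm{span}\{\pi(z)\varphi_0:z\in\mathbb{R}^{2d}\}$. For $m\in\mathcal{M}_v$ and $1\le p,q\le\infty$ put $\|f\|_{M^{p,q}_m}=\|V_{\varphi_0}f\|_{L^{p,q}_m}$; $M^{p,q}_m(\mathbb{R}^d)$ is the completion of $\mathcal{S}_{\mathcal{C}}$ in this norm if $p,q<\infty$, and the completion of $\mathcal{S}_{\mathcal{C}}$ in the $\sigma(\mathcal{S}_{\mathcal{C}},\mathcal{S}_{\mathcal{C}})$-topology if $p=\infty$ or $q=\infty$. (Equivalently, $M^\infty_{1/v}$ is the antidual of $M^1_v$, and $M^{p,q}_m$ consists of the $f\in M^\infty_{1/v}$ with $V_{\varphi_0}f\in L^{p,q}_m$.) $M^p_m=M^{p,p}_m$. Localization operators. For a symbol $a$ on $\mathbb{R}^{2d}$ and windows $\varphi,\psi$ on $\mathbb{R}^d$, $A_a^{\varphi,\psi}f=\int_{\mathbb{R}^{2d}}a(z)\,V_\varphi f(z)\,\pi(z)\psi\,dz$, understood weakly: $\langle A_a^{\varphi,\psi}f,g\rangle=\langle a\,V_\varphi f,V_\psi g\rangle$. *)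

theory Defs
  imports "HOL-Analysis.Analysis" "HOL-Probability.Essential_Supremum"
    "HOL-Library.Function_Algebras"
begin

section \<open>Weights\<close>

definition submult_weight :: "('a::euclidean_space \<Rightarrow> real) \<Rightarrow> bool" where
  "submult_weight v \<longleftrightarrow>
     continuous_on UNIV v \<and> (\<forall>z. 0 < v z) \<and> (\<forall>z. v (- z) = v z) \<and> v 0 = 1 \<and>
     (\<forall>z1 z2. v (z1 + z2) \<le> v z1 * v z2) \<and>
     (\<forall>z. (\<lambda>n. v (real n *\<^sub>R z) powr (1 / real n)) \<longlonglongrightarrow> 1) \<and>
     (\<exists>C. \<forall>z. integral {0..1} (\<lambda>t. v (t *\<^sub>R z)) \<le> C * v z)"

text \<open>Measurability is part of the notion of a weight function: it is what gives the weighted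
  norms below their meaning.\<close>

definition moderate_weights :: "('a::euclidean_space \<Rightarrow> real) \<Rightarrow> ('a \<Rightarrow> real) set" where
  "moderate_weights v = {m. m \<in> borel_measurable borel \<and> (\<forall>z. 0 < m z) \<and> (\<forall>z. m (- z) = m z) \<and>
     (\<exists>C. \<forall>z1 z2. m (z1 + z2) \<le> C * v z1 * m z2)}"

definition japanese :: "'a::euclidean_space \<Rightarrow> real" where
  "japanese x = sqrt (1 + (norm x)\<^sup>2)"

section \<open>Complex spaces of functions, and Fredholm operators between them\<close>

definition cscale :: "complex \<Rightarrow> ('x \<Rightarrow> complex) \<Rightarrow> 'x \<Rightarrow> complex" where
  "cscale c f = (\<lambda>x. c * f x)"

interpretation cfun: vector_space "cscale :: complex \<Rightarrow> ('x \<Rightarrow> complex) \<Rightarrow> 'x \<Rightarrow> complex"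
  by unfold_locales (auto simp: cscale_def algebra_simps fun_eq_iff)

definition banach_on :: "('x \<Rightarrow> complex) set \<Rightarrow> (('x \<Rightarrow> complex) \<Rightarrow> real) \<Rightarrow> bool" where
  "banach_on X N \<longleftrightarrow>
     cfun.subspace X \<and>
     (\<forall>f\<in>X. 0 \<le> N f \<and> (N f = 0 \<longleftrightarrow> f = 0)) \<and>
     (\<forall>f\<in>X. \<forall>g\<in>X. N (f + g) \<le> N f + N g) \<and>
     (\<forall>c. \<forall>f\<in>X. N (cscale c f) = cmod c * N f) \<and>
     (\<forall>s. (\<forall>n. s n \<in> X) \<and> (\<forall>e>0. \<exists>k. \<forall>i\<ge>k. \<forall>j\<ge>k. N (s i - s j) < e) \<longrightarrow>
        (\<exists>f\<in>X. (\<lambda>n. N (s n - f)) \<longlonglongrightarrow> 0))"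

definition bounded_operator_on ::
  "('x \<Rightarrow> complex) set \<Rightarrow> (('x \<Rightarrow> complex) \<Rightarrow> real) \<Rightarrow>
   ('y \<Rightarrow> complex) set \<Rightarrow> (('y \<Rightarrow> complex) \<Rightarrow> real) \<Rightarrow>
   (('x \<Rightarrow> complex) \<Rightarrow> 'y \<Rightarrow> complex) \<Rightarrow> bool" where
  "bounded_operator_on X NX Y NY A \<longleftrightarrow>
     (\<forall>f\<in>X. A f \<in> Y) \<and>
     (\<forall>f\<in>X. \<forall>g\<in>X. A (f + g) = A f + A g) \<and>
     (\<forall>c. \<forall>f\<in>X. A (cscale c f) = cscale c (A f)) \<and>
     (\<exists>C. \<forall>f\<in>X. NY (A f) \<le> C * NX f)"

text \<open>The last two conjuncts say that the kernel is finite-dimensional and that finitely many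
  classes span the quotient of \<open>Y\<close> by the range of \<open>A\<close>.\<close>

definition fredholm_on ::
  "('x \<Rightarrow> complex) set \<Rightarrow> (('x \<Rightarrow> complex) \<Rightarrow> real) \<Rightarrow>
   ('y \<Rightarrow> complex) set \<Rightarrow> (('y \<Rightarrow> complex) \<Rightarrow> real) \<Rightarrow>
   (('x \<Rightarrow> complex) \<Rightarrow> 'y \<Rightarrow> complex) \<Rightarrow> bool" where
  "fredholm_on X NX Y NY A \<longleftrightarrow>
     banach_on X NX \<and> banach_on Y NY \<and> bounded_operator_on X NX Y NY A \<and>
     (\<exists>B. finite B \<and> {f \<in> X. A f = 0} \<subseteq> cfun.span B) \<and>
     (\<exists>B. finite B \<and> B \<subseteq> Y \<and> (\<forall>y\<in>Y. \<exists>f\<in>X. y - A f \<in> cfun.span B))"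

section \<open>Mixed-norm spaces\<close>

definition ennpowr :: "ennreal \<Rightarrow> real \<Rightarrow> ennreal" where
  "ennpowr x r = (if x = \<infinity> then \<infinity> else ennreal (enn2real x powr r))"

definition Lp_norm :: "ennreal \<Rightarrow> 'a measure \<Rightarrow> ('a \<Rightarrow> ennreal) \<Rightarrow> ennreal" where
  "Lp_norm p M f =
     (if p = \<infinity> then esssup M f
      else ennpowr (\<integral>\<^sup>+x. ennpowr (f x) (enn2real p) \<partial>M) (1 / enn2real p))"

definition mixed_norm ::
  "ennreal \<Rightarrow> ennreal \<Rightarrow> ((real^'d) \<times> (real^'d) \<Rightarrow> real) \<Rightarrow>
   ((real^'d) \<times> (real^'d) \<Rightarrow> complex) \<Rightarrow> ennreal" where
  "mixed_norm p q m F =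
     Lp_norm q lborel (\<lambda>\<omega>. Lp_norm p lborel (\<lambda>x. ennreal (cmod (F (x, \<omega>)) * m (x, \<omega>))))"

section \<open>Distributional derivatives and the space \<open>L\<^sup>0\<close>\<close>

primrec Ck :: "nat \<Rightarrow> ('a::euclidean_space \<Rightarrow> complex) \<Rightarrow> bool" where
  "Ck 0 f \<longleftrightarrow> continuous_on UNIV f"
| "Ck (Suc k) f \<longleftrightarrow> (\<forall>x. f differentiable (at x)) \<and>
     (\<forall>b\<in>Basis. Ck k (\<lambda>x. frechet_derivative f (at x) b))"

definition test_function :: "('a::euclidean_space \<Rightarrow> complex) \<Rightarrow> bool" where
  "test_function \<eta> \<longleftrightarrow> (\<forall>k. Ck k \<eta>) \<and> compact (closure {x. \<eta> x \<noteq> 0})"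

definition locally_integrable :: "('a::euclidean_space \<Rightarrow> complex) \<Rightarrow> bool" where
  "locally_integrable f \<longleftrightarrow> (\<forall>K. compact K \<longrightarrow> set_integrable lborel K f)"

definition distributional_derivative ::
  "('a::euclidean_space \<Rightarrow> complex) \<Rightarrow> 'a \<Rightarrow> ('a \<Rightarrow> complex) \<Rightarrow> bool" where
  "distributional_derivative a b D \<longleftrightarrow>
     locally_integrable a \<and> locally_integrable D \<and>
     (\<forall>\<eta>. test_function \<eta> \<longrightarrow>
        (LINT z|lborel. a z * frechet_derivative \<eta> (at z) b) = - (LINT z|lborel. D z * \<eta> z))"

definition L0 :: "('a::euclidean_space \<Rightarrow> complex) set" where
  "L0 = {F. F \<in> borel_measurable borel \<and> (\<exists>K. AE z in lborel. cmod (F z) \<le> K) \<and>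
     (\<forall>\<epsilon>>0. \<exists>R>0. AE z in lborel. norm z > R \<longrightarrow> cmod (F z) < \<epsilon>)}"

section \<open>Time-frequency analysis of functions\<close>

definition tfshift ::
  "(real^'d) \<times> (real^'d) \<Rightarrow> (real^'d \<Rightarrow> complex) \<Rightarrow> real^'d \<Rightarrow> complex" where
  "tfshift z f = (\<lambda>t. cis (2 * pi * (snd z \<bullet> t)) * f (t - fst z))"

definition l2_inner :: "(real^'d \<Rightarrow> complex) \<Rightarrow> (real^'d \<Rightarrow> complex) \<Rightarrow> complex" where
  "l2_inner f g = (LINT t|lborel. f t * cnj (g t))"

definition stft ::
  "(real^'d \<Rightarrow> complex) \<Rightarrow> (real^'d \<Rightarrow> complex) \<Rightarrow> (real^'d) \<times> (real^'d) \<Rightarrow> complex" where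
  "stft g f z = l2_inner f (tfshift z g)"

definition gauss :: "real^'d \<Rightarrow> complex" where
  "gauss t = of_real (exp (- pi * (norm t)\<^sup>2))"

definition special_test_space :: "(real^'d \<Rightarrow> complex) set" where
  "special_test_space = cfun.span (range (\<lambda>z. tfshift z gauss))"

section \<open>Modulation spaces\<close>

text \<open>
  For a weight \<open>v\<close> bounded below by a positive constant and submultiplicative up to a constant,
  the norm of \<open>M\<^sup>1\<^sub>v\<close> dominates the \<open>L\<^sup>2\<close> norm and the supremum norm.
  The completion of the special test space is therefore
  realized by continuous square-integrable functions: those approximable by the special test space
  in the \<open>M\<^sup>1\<^sub>v\<close> norm. An element of \<open>M\<^sup>1\<^sub>v\<close>, as a class of functions modulo null sets, is
  represented by its continuous representative.
\<close>

definition M1_norm ::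
  "((real^'d) \<times> (real^'d) \<Rightarrow> real) \<Rightarrow> (real^'d \<Rightarrow> complex) \<Rightarrow> ennreal" where
  "M1_norm v g = mixed_norm 1 1 v (stft gauss g)"

definition M1_space ::
  "((real^'d) \<times> (real^'d) \<Rightarrow> real) \<Rightarrow> (real^'d \<Rightarrow> complex) set" where
  "M1_space v = {g. continuous_on UNIV g \<and> integrable lborel (\<lambda>t. (cmod (g t))\<^sup>2) \<and>
     (\<exists>s. (\<forall>n. s n \<in> special_test_space) \<and> (\<lambda>n. M1_norm v (g - s n)) \<longlonglongrightarrow> 0)}"

text \<open>
  The antidual of \<open>M\<^sup>1\<^sub>v\<close> is the space \<open>M\<^sup>\<infinity>\<close> with weight \<open>1/v\<close>. The bracket of
  \<open>f\<close> with \<open>g\<close> is the application \<open>f g\<close>, linear in \<open>f\<close> and antilinear in \<open>g\<close>. Functionals are made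
  total by the value \<open>0\<close> outside \<open>M\<^sup>1\<^sub>v\<close>, so that equality of functionals is equality in HOL.
\<close>

definition M1_antidual ::
  "((real^'d) \<times> (real^'d) \<Rightarrow> real) \<Rightarrow> ((real^'d \<Rightarrow> complex) \<Rightarrow> complex) set" where
  "M1_antidual v = {f.
     (\<forall>g\<in>M1_space v. \<forall>h\<in>M1_space v. f (g + h) = f g + f h) \<and>
     (\<forall>c. \<forall>g\<in>M1_space v. f (cscale c g) = cnj c * f g) \<and>
     (\<exists>C. \<forall>g\<in>M1_space v. cmod (f g) \<le> C * enn2real (M1_norm v g)) \<and>
     (\<forall>g. g \<notin> M1_space v \<longrightarrow> f g = 0)}"

definition stft_dual ::
  "(real^'d \<Rightarrow> complex) \<Rightarrow> ((real^'d \<Rightarrow> complex) \<Rightarrow> complex) \<Rightarrow>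
   (real^'d) \<times> (real^'d) \<Rightarrow> complex" where
  "stft_dual g f z = f (tfshift z g)"

text \<open>
  The modulation space \<open>M\<^sup>p\<^sup>,\<^sup>q\<^sub>m\<close>, for \<open>m\<close> moderate with respect to \<open>v\<close>,
  inside the antidual of \<open>M\<^sup>1\<^sub>v\<close>; for \<open>p, q < \<infinity>\<close> it is a completion of the special test space
  in its norm. The weight \<open>v\<close> only
  determines on which functions the elements are evaluated: by density, an element is determined by
  its restriction to the special test space, and the restrictions do not depend on \<open>v\<close>.
\<close>

definition modulation_space ::
  "((real^'d) \<times> (real^'d) \<Rightarrow> real) \<Rightarrow> ennreal \<Rightarrow> ennreal \<Rightarrow>
   ((real^'d) \<times> (real^'d) \<Rightarrow> real) \<Rightarrow> ((real^'d \<Rightarrow> complex) \<Rightarrow> complex) set" where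
  "modulation_space v p q m = {f \<in> M1_antidual v. mixed_norm p q m (stft_dual gauss f) < \<infinity>}"

definition modulation_norm ::
  "ennreal \<Rightarrow> ennreal \<Rightarrow> ((real^'d) \<times> (real^'d) \<Rightarrow> real) \<Rightarrow>
   ((real^'d \<Rightarrow> complex) \<Rightarrow> complex) \<Rightarrow> real" where
  "modulation_norm p q m f = enn2real (mixed_norm p q m (stft_dual gauss f))"

section \<open>Localization operators\<close>

text \<open>The weight \<open>v\<close> is the one for which the values of the operator are functionals on \<open>M\<^sup>1\<^sub>v\<close>.\<close>

definition localization_operator ::
  "((real^'d) \<times> (real^'d) \<Rightarrow> real) \<Rightarrow> ((real^'d) \<times> (real^'d) \<Rightarrow> complex) \<Rightarrow>
   (real^'d \<Rightarrow> complex) \<Rightarrow> (real^'d \<Rightarrow> complex) \<Rightarrow>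
   ((real^'d \<Rightarrow> complex) \<Rightarrow> complex) \<Rightarrow> (real^'d \<Rightarrow> complex) \<Rightarrow> complex" where
  "localization_operator v a \<phi> \<psi> f = (\<lambda>g.
     if g \<in> M1_space v then LINT z|lborel. a z * stft_dual \<phi> f z * cnj (stft \<psi> g z) else 0)"

end

theory Submission imports Defs "HOL-Probability.Characteristic_Functions" begin

text \<open>
  Let \<open>A\<close> be the operator with symbol \<open>a\<close>, and \<open>B\<close> the one with symbol \<open>1/a\<close> and exchanged
  windows. By the reproducing formula, \<open>A f\<close> and \<open>B f\<close> are syntheses of \<open>a V f\<close> and \<open>V f / a\<close>, so
  \<open>B A - I\<close> is, on the side of the short-time Fourier transform, an integral operator whose kernel
  is dominated by an integrable convolution kernel times \<open>a(u)/a(z) - 1\<close>. Integrating the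
  distributional gradient along segments shows that this factor tends to \<open>0\<close> as \<open>z \<rightarrow> \<infinity>\<close>, uniformly
  for bounded \<open>u - z\<close>. Hence, cutting off large \<open>z\<close> and large \<open>u - z\<close> costs an operator of small norm,
  and the remaining compactly supported part is approximated in norm by a finite-rank operator, as
  the time-frequency shifts of a window depend continuously on the shift. So
  \<open>B A = I + S + F\<close> with \<open>\<parallel>S\<parallel> \<le> 1/2\<close> and \<open>F\<close> of finite rank, likewise for \<open>A B\<close>, and a Neumann
  series gives the Fredholm property.
\<close>

subsection \<open>Mixed norms\<close>

text \<open>Since \<open>p\<close> or \<open>q\<close> may be \<open>\<infinity>\<close>, neither
  density of test functions nor duality of mixed-norm spaces is at hand. Every estimate is therefore
  a pointwise bound for a transform followed by Minkowski's or Young's inequality, and the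
  finite-rank approximation is made in the windows of the synthesis, not in the argument
  \<open>f\<close>. The weights explain the condition on the windows. Comparing \<open>a u\<close>
  with \<open>a z\<close> costs \<open>v (u - z)\<close>, and convolving costs the weight that
  moderates the norm: \<open>w\<close> on the first space, \<open>w * v\<close> on the second. So
  the kernel must be integrable against \<open>w * v\<close> for \<open>B A\<close> and against
  \<open>w * v * v\<close> for \<open>A B\<close>, whence the square of \<open>v\<close>. Both
  compositions are instances of one argument, with \<open>w\<close>, \<open>\<mu>\<close>,
  \<open>a\<close> traded for \<open>w * v\<close>, \<open>\<mu> * m\<close>, \<open>1 / a\<close>.
  The bounds on \<open>a\<close> and on its gradient hold almost everywhere, while the kernel
  estimates are pointwise; so both are first changed on null sets, which neither the operators nor
  the distributional derivative can see.\<close>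

lemma ennpowr_ennreal: "0 \<le> x \<Longrightarrow> ennpowr (ennreal x) r = ennreal (x powr r)"
  by (simp add: ennpowr_def)

lemma ennpowr_0 [simp]: "ennpowr 0 r = 0"
  by (simp add: ennpowr_def)

lemma ennpowr_top [simp]: "ennpowr top r = top"
  by (simp add: ennpowr_def)

lemma ennpowr_1 [simp]: "ennpowr x 1 = x"
  by (cases x) (auto simp: ennpowr_ennreal)

lemma ennpowr_one [simp]: "ennpowr 1 r = 1"
  using ennpowr_ennreal[of 1 r] by simp

lemma ennpowr_mono: "0 \<le> r \<Longrightarrow> x \<le> y \<Longrightarrow> ennpowr x r \<le> ennpowr y r"
  by (cases x; cases y) (auto simp: ennpowr_ennreal powr_mono2 top_unique)

lemma ennpowr_ennpowr: "ennpowr (ennpowr x r) s = ennpowr x (r * s)"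
  by (cases x) (auto simp: ennpowr_ennreal powr_powr)

lemma ennpowr_mult: "0 < r \<Longrightarrow> ennpowr (x * y) r = ennpowr x r * ennpowr y r"
proof (cases x; cases y)
  fix a b :: real assume "x = ennreal a" "0 \<le> a" "y = ennreal b" "0 \<le> b"
  then show ?thesis
    by (simp add: ennpowr_ennreal powr_mult flip: ennreal_mult)
qed (auto simp: ennreal_mult_top ennreal_top_mult ennpowr_ennreal)

lemma measurable_ennpowr [measurable]:
  "f \<in> borel_measurable M \<Longrightarrow> (\<lambda>x. ennpowr (f x) r) \<in> borel_measurable M"
proof -
  assume f[measurable]: "f \<in> borel_measurable M"
  have [measurable]: "Measurable.pred M (\<lambda>x. f x = \<infinity>)"
    using measurable_sets[OF f, of "{\<infinity>}"] by (simp add: pred_def vimage_def Int_def conj_commute)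
  show ?thesis unfolding ennpowr_def by measurable
qed

lemma ennpowr_le_iff:
  assumes "0 < r" shows "ennpowr x r \<le> ennpowr y r \<longleftrightarrow> x \<le> y"
  using ennpowr_mono[of r x y] ennpowr_mono[of "1 / r" "ennpowr x r" "ennpowr y r"] assms
  by (auto simp: ennpowr_ennpowr)

text \<open>A monotone map with open range is continuous; here \<open>ennpowr y (1 / r)\<close> is a
  preimage of \<open>y\<close>, so the range is everything and the points 0 and
  \<open>\<infinity>\<close> need no separate treatment.\<close>

lemma continuous_ennpowr:
  assumes "0 < r" shows "continuous_on UNIV (\<lambda>x. ennpowr x r)"
proof (rule continuous_onI_mono)
  have "y \<in> range (\<lambda>x. ennpowr x r)" for y
    by (rule image_eqI[of _ _ "ennpowr y (1 / r)"]) (use assms in \<open>auto simp: ennpowr_ennpowr\<close>)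
  then have "range (\<lambda>x. ennpowr x r) = UNIV" by auto
  then show "open (range (\<lambda>x. ennpowr x r))" by simp
qed (use assms in \<open>auto intro: ennpowr_mono\<close>)

lemma ennpowr_liminf:
  assumes "0 < r"
  shows "liminf (\<lambda>n. ennpowr (u n) r) = ennpowr (liminf u) r"
  by (rule Liminf_compose_continuous_mono)
    (use assms continuous_ennpowr in \<open>auto intro!: monoI ennpowr_mono\<close>)

text \<open>Convexity of \<open>g powr r\<close>: the graph lies above its tangent at
  \<open>T\<close>. The terms are distributed so that no subtraction occurs, because the inequality
  is later integrated in \<open>ennreal\<close>.\<close>

lemma powr_tangent_line:
  fixes g T r :: real
  assumes "1 \<le> r" "0 < T" "0 \<le> g"
  shows "r * T powr (r - 1) * g + T powr r \<le> g powr r + r * T powr r"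
proof (cases "r = 1")
  case True then show ?thesis using assms by simp
next
  case False
  then have r: "r > 1" using assms by simp
  have "g * (T powr (r - 1)) \<le> g powr r / r + (T powr (r - 1)) powr (r / (r - 1)) / (r / (r - 1))"
    by (rule Youngs_inequality) (use r assms in \<open>auto simp: field_simps\<close>)
  also have "(T powr (r - 1)) powr (r / (r - 1)) = T powr r"
    using r by (simp add: powr_powr)
  finally have "r * (g * (T powr (r - 1))) \<le> r * (g powr r / r + T powr r / (r / (r - 1)))"
    using r by (intro mult_left_mono) auto
  also have "\<dots> = g powr r + (r - 1) * T powr r" using r by (simp add: field_simps)
  finally show ?thesis by (simp add: algebra_simps)
qed

text \<open>Integrating the tangent at \<open>?T\<close> against \<open>c\<close> gives Jensen's
  inequality for a probability density. A total mass \<open>s\<close> below 1 only helps, since the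
  extra term is \<open>(r - 1) * (1 - s)\<close> times a power.\<close>

lemma ennpowr_jensen:
  assumes r: "1 \<le> r" and [measurable]: "g \<in> borel_measurable M" "c \<in> borel_measurable M"
    and c: "(\<integral>\<^sup>+x. c x \<partial>M) \<le> 1"
  shows "ennpowr (\<integral>\<^sup>+x. g x * c x \<partial>M) r \<le> (\<integral>\<^sup>+x. ennpowr (g x) r * c x \<partial>M)" (is "ennpowr ?T r \<le> ?I")
proof (cases "?I = \<infinity> \<or> ?T = 0")
  case True then show ?thesis by auto
next
  case False
  obtain i where i: "?I = ennreal i" "0 \<le> i" using False by (cases ?I) auto
  obtain s where s: "(\<integral>\<^sup>+x. c x \<partial>M) = ennreal s" "0 \<le> s" using c by (cases "\<integral>\<^sup>+x. c x \<partial>M") (auto simp: top_unique)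
  have s1: "s \<le> 1" using c s by simp
  \<comment> \<open>The tangent point has to be a real number. A value is at most 1 plus its
    \<open>r\<close>-th power, which bounds \<open>?T\<close> by the total mass plus
    \<open>?I\<close>.\<close>
  have "?T \<le> (\<integral>\<^sup>+x. c x + ennpowr (g x) r * c x \<partial>M)"
  proof (rule nn_integral_mono)
    fix x
    have "g x \<le> 1 + ennpowr (g x) r"
    proof (cases "g x \<le> 1")
      case True then show ?thesis by (simp add: add_increasing2)
    next
      case False
      have "g x \<le> ennpowr (g x) r"
      proof (cases "g x")
        case (real t)
        then have "t \<ge> 1" using False by auto
        then have "t powr 1 \<le> t powr r" using r by (intro powr_mono) auto
        then show ?thesis using real \<open>t \<ge> 1\<close> by (auto simp: ennpowr_ennreal)
      qed auto
      then show ?thesis by (simp add: add_increasing)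
    qed
    then have "g x * c x \<le> (1 + ennpowr (g x) r) * c x" by (rule mult_right_mono) simp
    then show "g x * c x \<le> c x + ennpowr (g x) r * c x" by (simp add: distrib_right)
  qed
  also have "\<dots> = ennreal s + ennreal i" using s i by (subst nn_integral_add) auto
  also have "\<dots> < top" by (simp add: s(2) i(2) flip: ennreal_plus)
  finally obtain t where t: "?T = ennreal t" "0 \<le> t" by (cases ?T) auto
  then have t0: "0 < t" using False by (cases "t = 0") auto
  have pt: "ennreal (r * t powr (r - 1)) * (g x * c x) + ennreal (t powr r) * c x
      \<le> ennpowr (g x) r * c x + ennreal (r * t powr r) * c x" for x
  proof -
    have "ennreal (r * t powr (r - 1)) * g x + ennreal (t powr r) \<le> ennpowr (g x) r + ennreal (r * t powr r)"
    proof (cases "g x")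
      case (real u)
      have "r * t powr (r - 1) * u + t powr r \<le> u powr r + r * t powr r"
        using powr_tangent_line[OF r t0 real(1)] .
      then show ?thesis using real r
        by (simp add: ennpowr_ennreal flip: ennreal_mult ennreal_plus)
    qed auto
    then have "(ennreal (r * t powr (r - 1)) * g x + ennreal (t powr r)) * c x \<le> (ennpowr (g x) r + ennreal (r * t powr r)) * c x"
      by (rule mult_right_mono) simp
    then show ?thesis by (simp add: distrib_right mult.assoc)
  qed
  have "(\<integral>\<^sup>+x. ennreal (r * t powr (r - 1)) * (g x * c x) + ennreal (t powr r) * c x \<partial>M)
      \<le> (\<integral>\<^sup>+x. ennpowr (g x) r * c x + ennreal (r * t powr r) * c x \<partial>M)"
    by (intro nn_integral_mono pt)
  then have "ennreal (r * t powr (r - 1)) * ennreal t + ennreal (t powr r) * ennreal s \<le> ennreal i + ennreal (r * t powr r) * ennreal s"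
    by (simp add: nn_integral_add nn_integral_cmult s i t)
  then have "r * t powr (r - 1) * t + t powr r * s \<le> i + r * t powr r * s"
    using r t s i by (simp flip: ennreal_mult ennreal_plus)
  moreover have "t powr (r - 1) * t = t powr r" using t0 by (simp add: powr_diff)
  ultimately have "r * t powr r + t powr r * s \<le> i + r * t powr r * s" by (simp add: mult.assoc)
  moreover have "0 \<le> (r - 1) * (1 - s) * t powr r" using r s1 by simp
  ultimately have "t powr r \<le> i" by (simp add: algebra_simps)
  then show ?thesis using t i by (simp add: ennpowr_ennreal)
qed

lemma enn2real_ge_1: "1 \<le> p \<Longrightarrow> p \<noteq> top \<Longrightarrow> 1 \<le> enn2real p"
  by (cases p) auto

lemma Lp_norm_le_iff:
  assumes "1 \<le> p" "p \<noteq> top"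
  shows "Lp_norm p M f \<le> c \<longleftrightarrow> (\<integral>\<^sup>+x. ennpowr (f x) (enn2real p) \<partial>M) \<le> ennpowr c (enn2real p)"
proof -
  have r: "0 < enn2real p" using enn2real_ge_1[OF assms] by simp
  then have "Lp_norm p M f \<le> c \<longleftrightarrow> ennpowr (Lp_norm p M f) (enn2real p) \<le> ennpowr c (enn2real p)"
    by (simp add: ennpowr_le_iff)
  then show ?thesis using r assms by (simp add: Lp_norm_def ennpowr_ennpowr)
qed

lemma Lp_norm_top_le_iff:
  assumes "f \<in> borel_measurable M"
  shows "Lp_norm top M f \<le> c \<longleftrightarrow> (AE x in M. f x \<le> c)"
proof
  assume "Lp_norm top M f \<le> c"
  then show "AE x in M. f x \<le> c"
    using esssup_AE[of f M] by (auto simp: Lp_norm_def elim!: eventually_mono)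
qed (use assms in \<open>auto simp: Lp_norm_def\<close>)

lemma Lp_norm_mono_AE:
  assumes "1 \<le> p" "f \<in> borel_measurable M" "AE x in M. f x \<le> g x"
  shows "Lp_norm p M f \<le> Lp_norm p M g"
proof (cases "p = top")
  case True then show ?thesis using assms by (auto simp: Lp_norm_def intro: esssup_AE_mono)
next
  case False
  then show ?thesis using enn2real_ge_1[OF assms(1) False] assms
    by (auto simp: Lp_norm_def intro!: ennpowr_mono nn_integral_mono_AE elim!: eventually_mono)
qed

lemma Lp_norm_mono:
  assumes "1 \<le> p" "f \<in> borel_measurable M" "\<And>x. f x \<le> g x"
  shows "Lp_norm p M f \<le> Lp_norm p M g"
  using assms by (intro Lp_norm_mono_AE) auto

lemma Lp_norm_cong_AE:
  assumes "1 \<le> p" "f \<in> borel_measurable M" "g \<in> borel_measurable M" "AE x in M. f x = g x"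
  shows "Lp_norm p M f = Lp_norm p M g"
  using assms by (intro antisym Lp_norm_mono_AE) (auto elim: eventually_mono)

text \<open>For \<open>p = \<infinity>\<close> the norm exceeds \<open>c\<close> exactly where the
  section of the set \<open>c < f\<close> has positive measure, and the measure of a section depends
  measurably on the parameter. For finite \<open>p\<close> this is the measurability part of
  Tonelli's theorem.\<close>

lemma measurable_Lp_norm:
  assumes "sigma_finite_measure M" and f: "(\<lambda>(y, x). f y x) \<in> borel_measurable (N \<Otimes>\<^sub>M M)" and p: "1 \<le> p"
  shows "(\<lambda>y. Lp_norm p M (f y)) \<in> borel_measurable N"
proof -
  interpret sigma_finite_measure M by fact
  note f[measurable]
  show ?thesis
  proof (cases "p = top")
    case False
    then show ?thesis by (simp add: Lp_norm_def)
  next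
    case True
    show ?thesis
    proof (rule borel_measurableI_greater)
      fix c
      let ?Q = "{z \<in> space (N \<Otimes>\<^sub>M M). c < (case z of (y, x) \<Rightarrow> f y x)}"
      have Q[measurable]: "?Q \<in> sets (N \<Otimes>\<^sub>M M)" by measurable
      have m[measurable]: "f y \<in> borel_measurable M" if "y \<in> space N" for y
        using measurable_Pair2[OF f that] by simp
      have "c < Lp_norm p M (f y) \<longleftrightarrow> emeasure M (Pair y -` ?Q) \<noteq> 0" if y: "y \<in> space N" for y
      proof -
        have "c < Lp_norm p M (f y) \<longleftrightarrow> \<not> (AE x in M. f y x \<le> c)"
          using Lp_norm_top_le_iff[OF m[OF y], of c] True by (simp add: not_le[symmetric])
        also have "\<dots> \<longleftrightarrow> emeasure M {x \<in> space M. \<not> f y x \<le> c} \<noteq> 0"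
          by (subst AE_iff_measurable[OF _ refl]) (use m[OF y] in measurable)
        also have "{x \<in> space M. \<not> f y x \<le> c} = Pair y -` ?Q"
          using y by (auto simp: space_pair_measure not_le)
        finally show ?thesis .
      qed
      then have "{y \<in> space N. c < Lp_norm p M (f y)} = {y \<in> space N. emeasure M (Pair y -` ?Q) \<noteq> 0}"
        by auto
      also have "\<dots> \<in> sets N" using measurable_emeasure_Pair[OF Q] by measurable
      finally show "{y \<in> space N. c < Lp_norm p M (f y)} \<in> sets N" .
    qed
  qed
qed

lemma Lp_norm_cmult:
  assumes p: "1 \<le> p" and f: "f \<in> borel_measurable M"
  shows "Lp_norm p M (\<lambda>x. ennreal c * f x) = ennreal c * Lp_norm p M f"
proof (cases "c > 0")
  case False
  then have c: "ennreal c = 0" by (simp add: ennreal_neg)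
  show ?thesis
  proof (cases "p = top")
    case True
    have "Lp_norm top M (\<lambda>x. 0) \<le> 0" by (subst Lp_norm_top_le_iff) auto
    then show ?thesis using True c by simp
  next
    case False
    then show ?thesis using c by (simp add: Lp_norm_def)
  qed
next
  case True
  have le: "Lp_norm p M (\<lambda>x. ennreal c * f x) \<le> ennreal c * Lp_norm p M f" if "c > 0" "f \<in> borel_measurable M" for c f
  proof (cases "p = top")
    case True
    have "AE x in M. f x \<le> Lp_norm top M f" using esssup_AE[of f M] by (simp add: Lp_norm_def)
    then show ?thesis using that unfolding True
      by (subst Lp_norm_top_le_iff) (auto elim!: eventually_mono intro: mult_left_mono)
  next
    case False
    have r: "0 < enn2real p" using enn2real_ge_1[OF p False] by simp
    show ?thesis using that r False
      by (simp add: Lp_norm_def ennpowr_mult nn_integral_cmult ennpowr_ennpowr)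
  qed
  have "ennreal c * Lp_norm p M f = ennreal c * Lp_norm p M (\<lambda>x. ennreal (1/c) * (ennreal c * f x))"
    using True by (simp add: mult.assoc[symmetric] flip: ennreal_mult)
  also have "\<dots> \<le> ennreal c * (ennreal (1/c) * Lp_norm p M (\<lambda>x. ennreal c * f x))"
    using True f by (intro mult_left_mono le) auto
  also have "\<dots> = Lp_norm p M (\<lambda>x. ennreal c * f x)"
    using True by (simp add: mult.assoc[symmetric] flip: ennreal_mult)
  finally show ?thesis using le[OF True f] by (rule antisym[rotated])
qed

text \<open>Minkowski's inequality for integrals is Jensen's inequality for the probability density
  \<open>c / S\<close>, where \<open>c y\<close> is the norm of the section at \<open>y\<close> and \<open>S\<close> is the integral of \<open>c\<close>.
  Adding a small strictly positive integrable function to \<open>c\<close> makes the division harmless.\<close>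

lemma Lp_norm_integral_le:
  assumes M: "sigma_finite_measure M" and N: "sigma_finite_measure N"
    and f: "(\<lambda>(x, y). f x y) \<in> borel_measurable (M \<Otimes>\<^sub>M N)" and p: "1 \<le> p"
  shows "Lp_norm p M (\<lambda>x. \<integral>\<^sup>+y. f x y \<partial>N) \<le> (\<integral>\<^sup>+y. Lp_norm p M (\<lambda>x. f x y) \<partial>N)"
proof -
  interpret M: sigma_finite_measure M by fact
  interpret N: sigma_finite_measure N by fact
  interpret pair_sigma_finite M N ..
  note f[measurable]
  define c where "c y = Lp_norm p M (\<lambda>x. f x y)" for y
  have c[measurable]: "c \<in> borel_measurable N"
    unfolding c_def by (rule measurable_Lp_norm[OF M _ p]) measurable
  have int[measurable]: "(\<lambda>x. \<integral>\<^sup>+y. f x y \<partial>N) \<in> borel_measurable M" by measurable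
  show ?thesis
  proof (cases "p = top")
    case True
    have "AE y in N. AE x in M. f x y \<le> c y"
    proof (rule AE_I2)
      fix y assume "y \<in> space N"
      show "AE x in M. f x y \<le> c y"
        using esssup_AE[of "\<lambda>x. f x y" M] by (simp add: c_def Lp_norm_def True)
    qed
    then have "AE x in M. AE y in N. f x y \<le> c y"
      by (subst AE_commute) measurable
    then have "AE x in M. (\<integral>\<^sup>+y. f x y \<partial>N) \<le> (\<integral>\<^sup>+y. c y \<partial>N)"
      by (auto elim!: eventually_mono intro: nn_integral_mono_AE)
    then show ?thesis unfolding True using Lp_norm_top_le_iff[OF int]
      by (simp add: c_def[unfolded True])
  next
    case False
    define r where "r = enn2real p"
    have r: "1 \<le> r" using enn2real_ge_1[OF p False] by (simp add: r_def)
    define S where "S = (\<integral>\<^sup>+y. c y \<partial>N)"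
    show ?thesis
    proof (cases "S = top")
      case True then show ?thesis by (simp add: S_def c_def)
    next
      case Sfin: False
      obtain h where h[measurable]: "h \<in> borel_measurable N" and hint: "(\<integral>\<^sup>+y. h y \<partial>N) \<noteq> \<infinity>"
        and h0: "\<And>y. y \<in> space N \<Longrightarrow> 0 < h y" "\<And>y. y \<in> space N \<Longrightarrow> h y < \<infinity>"
        using N.Ex_finite_integrable_function by blast
      obtain H where H: "(\<integral>\<^sup>+y. h y \<partial>N) = ennreal H" "0 \<le> H" using hint by (cases "\<integral>\<^sup>+y. h y \<partial>N") auto
      have bound: "Lp_norm p M (\<lambda>x. \<integral>\<^sup>+y. f x y \<partial>N) \<le> S + ennreal (e * H)" if e: "e > 0" for e :: real
      \<comment> \<open>As \<open>h\<close> is positive everywhere, \<open>H = 0\<close> means that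
        \<open>N\<close> is the null measure, and the norm on the left vanishes. Otherwise
        \<open>S'\<close> below is a positive real number by which one may divide.\<close>
      proof (cases "H = 0")
        case True
        then have "AE y in N. h y = 0" using H by (simp add: nn_integral_0_iff_AE)
        moreover have "AE y in N. h y \<noteq> 0" by (rule AE_I2) (use h0 in force)
        ultimately have "AE y in N. False" by eventually_elim simp
        then have "(\<integral>\<^sup>+y. f x y \<partial>N) = 0" if "x \<in> space M" for x
          using that by (subst nn_integral_0_iff_AE) auto
        then have "Lp_norm p M (\<lambda>x. \<integral>\<^sup>+y. f x y \<partial>N) = Lp_norm p M (\<lambda>x. 0)"
          by (intro Lp_norm_cong_AE p) auto
        then show ?thesis using Lp_norm_cmult[OF p, of "\<lambda>x. 0" M 0] by simp
      next
        case False
        then have Hpos: "0 < H" using H by simp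
        define d where "d y = c y + ennreal e * h y" for y
        have d[measurable]: "d \<in> borel_measurable N" unfolding d_def by measurable
        define S' where "S' = S + ennreal (e * H)"
        have S': "(\<integral>\<^sup>+y. d y \<partial>N) = S'"
          unfolding d_def S'_def S_def using e H
          by (simp add: nn_integral_add nn_integral_cmult ennreal_mult)
        have S'0: "S' \<noteq> 0" "S' \<noteq> top" unfolding S'_def using e Hpos Sfin by auto
        have d0: "d y \<noteq> 0" if "y \<in> space N" for y
          using h0(1)[OF that] e unfolding d_def by auto
        have dfin: "AE y in N. d y \<noteq> top"
          by (rule nn_integral_noteq_infinite[unfolded infinity_ennreal_def]) (use S' S'0 in auto)
        have "(\<integral>\<^sup>+x. ennpowr (\<integral>\<^sup>+y. f x y \<partial>N) r \<partial>M)
            \<le> (\<integral>\<^sup>+x. ennpowr S' r * (\<integral>\<^sup>+y. ennpowr (f x y / d y) r * (d y / S') \<partial>N) \<partial>M)"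
        proof (rule nn_integral_mono)
          fix x assume x[measurable]: "x \<in> space M"
          have "(\<integral>\<^sup>+y. f x y \<partial>N) = (\<integral>\<^sup>+y. S' * (f x y / d y * (d y / S')) \<partial>N)"
          proof (rule nn_integral_cong_AE)
            show "AE y in N. f x y = S' * (f x y / d y * (d y / S'))"
              using dfin AE_space
            proof eventually_elim
              case (elim y)
              then have "f x y / d y * d y = f x y"
                using d0[of y] by (simp add: ennreal_divide_times less_top)
              moreover have "S' * (u * (v / S')) = u * v * (S' / S')" for u v
                by (simp add: divide_ennreal_def mult_ac)
              ultimately show ?case using S'0 by (simp add: less_top)
            qed
          qed
          also have "\<dots> = S' * (\<integral>\<^sup>+y. f x y / d y * (d y / S') \<partial>N)"
            by (rule nn_integral_cmult) measurable
          finally have "ennpowr (\<integral>\<^sup>+y. f x y \<partial>N) r = ennpowr S' r * ennpowr (\<integral>\<^sup>+y. f x y / d y * (d y / S') \<partial>N) r"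
            using r by (simp add: ennpowr_mult)
          also have "\<dots> \<le> ennpowr S' r * (\<integral>\<^sup>+y. ennpowr (f x y / d y) r * (d y / S') \<partial>N)"
          proof (intro mult_left_mono ennpowr_jensen r)
            show "(\<integral>\<^sup>+y. d y / S' \<partial>N) \<le> 1"
              using S' S'0 by (simp add: nn_integral_divide less_top)
          qed auto
          finally show "ennpowr (\<integral>\<^sup>+y. f x y \<partial>N) r \<le> ennpowr S' r * (\<integral>\<^sup>+y. ennpowr (f x y / d y) r * (d y / S') \<partial>N)" .
        qed
        also have "\<dots> = ennpowr S' r * (\<integral>\<^sup>+x. \<integral>\<^sup>+y. ennpowr (f x y / d y) r * (d y / S') \<partial>N \<partial>M)"
          by (rule nn_integral_cmult) measurable
        also have "(\<integral>\<^sup>+x. \<integral>\<^sup>+y. ennpowr (f x y / d y) r * (d y / S') \<partial>N \<partial>M)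
            = (\<integral>\<^sup>+y. \<integral>\<^sup>+x. ennpowr (f x y / d y) r * (d y / S') \<partial>M \<partial>N)"
          by (rule Fubini'[symmetric]) measurable
        also have "\<dots> \<le> (\<integral>\<^sup>+y. d y / S' \<partial>N)"
        proof (rule nn_integral_mono_AE)
          show "AE y in N. (\<integral>\<^sup>+x. ennpowr (f x y / d y) r * (d y / S') \<partial>M) \<le> d y / S'"
            using dfin AE_space
          proof eventually_elim
            case (elim y)
            note y[measurable] = elim(2)
            have fy[measurable]: "(\<lambda>x. f x y) \<in> borel_measurable M" by measurable
            obtain D where D: "d y = ennreal D" "0 < D" using elim d0[OF elim(2)] by (cases "d y") (auto simp: less_le)
            have "f x y / d y = ennreal (1 / D) * f x y" for x
              using D by (simp add: divide_ennreal_def inverse_ennreal divide_inverse mult.commute)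
            then have "Lp_norm p M (\<lambda>x. f x y / d y) = ennreal (1 / D) * c y"
              using Lp_norm_cmult[OF p fy, of "1/D"] by (simp add: c_def)
            also have "\<dots> \<le> ennreal (1 / D) * d y" by (intro mult_left_mono) (auto simp: d_def)
            also have "\<dots> = 1" using D by (simp flip: ennreal_mult)
            finally have "(\<integral>\<^sup>+x. ennpowr (f x y / d y) r \<partial>M) \<le> 1"
              using Lp_norm_le_iff[OF p \<open>p \<noteq> top\<close>, of M "\<lambda>x. f x y / d y" 1] by (simp add: r_def)
            then have "(\<integral>\<^sup>+x. ennpowr (f x y / d y) r \<partial>M) * (d y / S') \<le> 1 * (d y / S')"
              by (rule mult_right_mono) simp
            then show ?case by (simp add: nn_integral_multc)
          qed
        qed
        also have "\<dots> = 1" using S' S'0 by (simp add: nn_integral_divide less_top)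
        finally have "(\<integral>\<^sup>+x. ennpowr (\<integral>\<^sup>+y. f x y \<partial>N) r \<partial>M) \<le> ennpowr S' r" by (simp add: mult_left_mono)
        then show ?thesis
          using Lp_norm_le_iff[OF p \<open>p \<noteq> top\<close>] unfolding r_def S'_def by blast
      qed
      have "Lp_norm p M (\<lambda>x. \<integral>\<^sup>+y. f x y \<partial>N) \<le> S"
      proof (rule ennreal_le_epsilon)
        fix e :: real assume e: "0 < e"
        have "Lp_norm p M (\<lambda>x. \<integral>\<^sup>+y. f x y \<partial>N) \<le> S + ennreal (e / (H + 1) * H)"
          using e H by (intro bound) auto
        also have "\<dots> \<le> S + ennreal e" using e H by (intro add_left_mono ennreal_leI) (auto simp: field_simps)
        finally show "Lp_norm p M (\<lambda>x. \<integral>\<^sup>+y. f x y \<partial>N) \<le> S + ennreal e" .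
      qed
      then show ?thesis by (simp add: S_def c_def)
    qed
  qed
qed

text \<open>A sum of two functions is an integral over the counting measure on \<open>bool\<close>,
  so the integral form of Minkowski's inequality specialises to the triangle inequality.\<close>

lemma Lp_norm_add_le:
  assumes M: "sigma_finite_measure M" and p: "1 \<le> p"
    and [measurable]: "f \<in> borel_measurable M" "g \<in> borel_measurable M"
  shows "Lp_norm p M (\<lambda>x. f x + g x) \<le> Lp_norm p M f + Lp_norm p M g"
proof -
  define h where "h x b = (if b then f x else g x)" for x and b :: bool
  have [measurable]: "h x \<in> borel_measurable (count_space UNIV)" for x by simp
  have "(\<lambda>(x, b). h x b) \<in> borel_measurable (M \<Otimes>\<^sub>M count_space UNIV)"
    unfolding h_def by measurable
  from Lp_norm_integral_le[OF M sigma_finite_measure_count_space_finite this p]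
  show ?thesis
    by (simp add: h_def nn_integral_count_space_finite UNIV_bool add.commute)
qed

text \<open>Fatou's lemma for the norm. It yields completeness of the modulation spaces for all
  exponents at once.\<close>

lemma Lp_norm_liminf:
  assumes p: "1 \<le> p" and f[measurable]: "\<And>n. f n \<in> borel_measurable M"
  shows "Lp_norm p M (\<lambda>x. liminf (\<lambda>n. f n x)) \<le> liminf (\<lambda>n. Lp_norm p M (f n))"
proof (cases "p = top")
  case True
  have "AE x in M. \<forall>n. f n x \<le> Lp_norm top M (f n)"
    using esssup_AE by (auto simp: AE_all_countable Lp_norm_def)
  then have "AE x in M. liminf (\<lambda>n. f n x) \<le> liminf (\<lambda>n. Lp_norm top M (f n))"
    by (auto elim!: eventually_mono intro!: Liminf_mono)
  then show ?thesis unfolding True by (subst Lp_norm_top_le_iff) auto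
next
  case False
  have r: "0 < enn2real p" using enn2real_ge_1[OF p False] by simp
  have "(\<integral>\<^sup>+x. ennpowr (liminf (\<lambda>n. f n x)) (enn2real p) \<partial>M)
      = (\<integral>\<^sup>+x. liminf (\<lambda>n. ennpowr (f n x) (enn2real p)) \<partial>M)"
    by (simp add: ennpowr_liminf[OF r])
  also have "\<dots> \<le> liminf (\<lambda>n. \<integral>\<^sup>+x. ennpowr (f n x) (enn2real p) \<partial>M)"
    by (rule nn_integral_liminf) measurable
  finally have "ennpowr (\<integral>\<^sup>+x. ennpowr (liminf (\<lambda>n. f n x)) (enn2real p) \<partial>M) (1 / enn2real p)
     \<le> ennpowr (liminf (\<lambda>n. \<integral>\<^sup>+x. ennpowr (f n x) (enn2real p) \<partial>M)) (1 / enn2real p)"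
    using r by (intro ennpowr_mono) auto
  then show ?thesis using r False
    by (subst (asm) ennpowr_liminf[symmetric]) (auto simp: Lp_norm_def)
qed

section \<open>Translation invariance, and pairing with bounded integrable kernels\<close>

lemma AE_lborel_translate:
  fixes a :: "'a::euclidean_space"
  assumes "AE x in lborel. P x"
  shows "AE x in lborel. P (x + a)"
proof -
  have "AE x in distr lborel borel ((+) a). P x" using assms unfolding lborel_distr_plus .
  then have "AE x in lborel. P (a + x)" by (rule AE_distrD[rotated]) simp
  then show ?thesis by (simp add: add.commute)
qed

lemma nn_integral_lborel_translate:
  fixes a :: "'a::euclidean_space"
  assumes "f \<in> borel_measurable borel"
  shows "(\<integral>\<^sup>+x. f (x + a) \<partial>lborel) = (\<integral>\<^sup>+x. f x \<partial>lborel)"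
proof -
  have "(\<integral>\<^sup>+x. f x \<partial>lborel) = (\<integral>\<^sup>+x. f x \<partial>distr lborel borel ((+) a))" by (simp add: lborel_distr_plus)
  also have "\<dots> = (\<integral>\<^sup>+x. f (x + a) \<partial>lborel)" using assms by (subst nn_integral_distr) (auto simp: add.commute)
  finally show ?thesis by simp
qed

lemma Lp_norm_lborel_translate:
  fixes a :: "'a::euclidean_space"
  assumes p: "1 \<le> p" and f[measurable]: "f \<in> borel_measurable borel"
  shows "Lp_norm p lborel (\<lambda>x. f (x + a)) = Lp_norm p lborel f"
proof (cases "p = top")
  case True
  have le: "Lp_norm top lborel (\<lambda>x. g (x + b)) \<le> Lp_norm top lborel g"
    if [measurable]: "g \<in> borel_measurable borel" for g and b :: 'a
  proof -
    have "AE x in lborel. g x \<le> Lp_norm top lborel g" by (simp add: Lp_norm_def esssup_AE)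
    from AE_lborel_translate[OF this] show ?thesis by (subst Lp_norm_top_le_iff) auto
  qed
  show ?thesis
    using le[OF f, of a] le[of "\<lambda>x. f (x + a)" "- a"] f True by (simp add: antisym add.assoc)
next
  case False
  then show ?thesis
    by (simp add: Lp_norm_def nn_integral_lborel_translate[of "\<lambda>x. ennpowr (f x) (enn2real p)" a])
qed

text \<open>Takes the place of Hoelder's inequality and avoids the conjugate exponent:
  \<open>k / K\<close> is a subprobability density with values at most 1, so Jensen's inequality
  applies and the density may afterwards be dropped.\<close>

lemma nn_integral_le_Lp_norm:
  assumes p: "1 \<le> p" and [measurable]: "H \<in> borel_measurable M" "k \<in> borel_measurable M"
    and K: "0 < K" and k: "\<And>x. k x \<le> ennreal K" "(\<integral>\<^sup>+x. k x \<partial>M) \<le> ennreal K"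
  shows "(\<integral>\<^sup>+x. H x * k x \<partial>M) \<le> ennreal K * Lp_norm p M H"
proof (cases "p = top")
  case True
  have "AE x in M. H x \<le> Lp_norm p M H" by (simp add: Lp_norm_def esssup_AE True)
  then have "(\<integral>\<^sup>+x. H x * k x \<partial>M) \<le> (\<integral>\<^sup>+x. Lp_norm p M H * k x \<partial>M)"
    by (intro nn_integral_mono_AE) (auto elim!: eventually_mono intro: mult_right_mono)
  also have "\<dots> \<le> Lp_norm p M H * ennreal K" using k by (simp add: nn_integral_cmult mult_left_mono)
  finally show ?thesis by (simp add: mult.commute)
next
  case False
  define r where "r = enn2real p"
  have r: "1 \<le> r" using enn2real_ge_1[OF p False] by (simp add: r_def)
  define c where "c x = ennreal (1 / K) * k x" for x
  have KK: "ennreal K * ennreal (1 / K) = 1" using K by (simp flip: ennreal_mult)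
  have [measurable]: "c \<in> borel_measurable M" unfolding c_def by measurable
  have c1: "c x \<le> 1" for x
    using mult_left_mono[OF k(1)[of x], of "ennreal (1/K)"] KK by (simp add: c_def mult.commute)
  have c2: "(\<integral>\<^sup>+x. c x \<partial>M) \<le> 1"
    using mult_left_mono[OF k(2), of "ennreal (1/K)"] KK by (simp add: c_def mult.commute[of _ "ennreal (1/K)"] nn_integral_cmult)
  have "ennpowr (\<integral>\<^sup>+x. H x * c x \<partial>M) r \<le> (\<integral>\<^sup>+x. ennpowr (H x) r * c x \<partial>M)"
    by (rule ennpowr_jensen[OF r _ _ c2]) measurable
  also have "\<dots> \<le> (\<integral>\<^sup>+x. ennpowr (H x) r \<partial>M)"
    using mult_left_mono[OF c1] by (intro nn_integral_mono) auto
  also have "\<dots> \<le> ennpowr (Lp_norm p M H) r"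
    using Lp_norm_le_iff[OF p False, of M H "Lp_norm p M H"] by (simp add: r_def)
  finally have "(\<integral>\<^sup>+x. H x * c x \<partial>M) \<le> Lp_norm p M H" using r ennpowr_le_iff[of r] by simp
  then have "ennreal K * (\<integral>\<^sup>+x. H x * c x \<partial>M) \<le> ennreal K * Lp_norm p M H" by (rule mult_left_mono) simp
  moreover have "ennreal K * (\<integral>\<^sup>+x. H x * c x \<partial>M) = (\<integral>\<^sup>+x. (ennreal K * ennreal (1/K)) * (H x * k x) \<partial>M)"
    by (subst nn_integral_cmult[symmetric]) (auto simp: c_def mult_ac)
  ultimately show ?thesis using KK by simp
qed

lemma Lp_norm_finite:
  assumes p: "1 \<le> p" and [measurable]: "h \<in> borel_measurable M"
    and h: "\<And>x. h x \<le> 1" "(\<integral>\<^sup>+x. h x \<partial>M) < top"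
  shows "Lp_norm p M h < top"
proof (cases "p = top")
  case True
  then have "Lp_norm p M h \<le> 1" using h by (subst True, subst Lp_norm_top_le_iff) auto
  then show ?thesis using le_less_trans by fastforce
next
  case False
  define r where "r = enn2real p"
  have r: "1 \<le> r" using enn2real_ge_1[OF p False] by (simp add: r_def)
  have "ennpowr (h x) r \<le> h x" for x
  proof -
    obtain t where t: "h x = ennreal t" "0 \<le> t" using h(1)[of x] by (cases "h x") (auto simp: top_unique)
    then have "t \<le> 1" using h(1)[of x] by simp
    then show ?thesis using t r powr_mono'[of 1 r t] by (simp add: ennpowr_ennreal)
  qed
  then have "(\<integral>\<^sup>+x. ennpowr (h x) r \<partial>M) \<le> (\<integral>\<^sup>+x. h x \<partial>M)" by (intro nn_integral_mono)
  then have "(\<integral>\<^sup>+x. ennpowr (h x) r \<partial>M) < top" using h by auto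
  then show ?thesis using False
    by (cases "\<integral>\<^sup>+x. ennpowr (h x) r \<partial>M") (auto simp: Lp_norm_def ennpowr_ennreal r_def)
qed

section \<open>Mixed norms of extended nonnegative functions on a product space\<close>

definition MN :: "ennreal \<Rightarrow> ennreal \<Rightarrow> ('a::euclidean_space \<times> 'b::euclidean_space \<Rightarrow> ennreal) \<Rightarrow> ennreal" where
  "MN p q H = Lp_norm q lborel (\<lambda>\<omega>. Lp_norm p lborel (\<lambda>x. H (x, \<omega>)))"

lemma mixed_norm_MN: "mixed_norm p q m F = MN p q (\<lambda>z. ennreal (cmod (F z) * m z))"
  by (simp add: mixed_norm_def MN_def)

lemma measurable_section [measurable]:
  fixes H :: "'a::euclidean_space \<times> 'b::euclidean_space \<Rightarrow> ennreal"
  assumes [measurable]: "H \<in> borel_measurable borel"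
  shows "(\<lambda>x. H (x, \<omega>)) \<in> borel_measurable borel"
  by (rule measurable_compose[OF _ assms]) (simp add: borel_prod[symmetric])

lemma measurable_inner_norm [measurable]:
  fixes H :: "'a::euclidean_space \<times> 'b::euclidean_space \<Rightarrow> ennreal"
  assumes H: "H \<in> borel_measurable borel" and p: "1 \<le> p"
  shows "(\<lambda>\<omega>. Lp_norm p lborel (\<lambda>x. H (x, \<omega>))) \<in> borel_measurable borel"
proof -
  have [measurable]: "H \<in> borel_measurable (borel \<Otimes>\<^sub>M borel)" using H by (simp add: borel_prod)
  show ?thesis by (rule measurable_Lp_norm[OF sigma_finite_lborel _ p]) measurable
qed

context
  fixes p q :: ennreal
  assumes p: "1 \<le> p" and q: "1 \<le> q"
begin

lemma MN_mono_AE: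
  fixes H H' :: "'a::euclidean_space \<times> 'b::euclidean_space \<Rightarrow> ennreal"
  assumes [measurable]: "H \<in> borel_measurable borel" "H' \<in> borel_measurable borel"
    and le: "AE z in lborel. H z \<le> H' z"
  shows "MN p q H \<le> MN p q H'"
proof -
  have [measurable]: "H \<in> borel_measurable (borel \<Otimes>\<^sub>M borel)" "H' \<in> borel_measurable (borel \<Otimes>\<^sub>M borel)"
    by (simp_all add: borel_prod)
  have "AE z in (lborel \<Otimes>\<^sub>M lborel). H z \<le> H' z" using le unfolding lborel_prod .
  from lborel_pair.AE_pair[OF this]
  have "AE \<omega> in lborel. AE x in lborel. H (x, \<omega>) \<le> H' (x, \<omega>)"
    by (subst lborel_pair.AE_commute) measurable
  then have "AE \<omega> in lborel. Lp_norm p lborel (\<lambda>x. H (x, \<omega>)) \<le> Lp_norm p lborel (\<lambda>x. H' (x, \<omega>))"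
    by eventually_elim (intro Lp_norm_mono_AE p, auto)
  then show ?thesis unfolding MN_def
    by (intro Lp_norm_mono_AE q) (auto intro: measurable_inner_norm p)
qed

lemma MN_mono:
  fixes H H' :: "'a::euclidean_space \<times> 'b::euclidean_space \<Rightarrow> ennreal"
  assumes "H \<in> borel_measurable borel" "H' \<in> borel_measurable borel" "\<And>z. H z \<le> H' z"
  shows "MN p q H \<le> MN p q H'"
  using assms by (intro MN_mono_AE) auto

lemma MN_cmult:
  fixes H :: "'a::euclidean_space \<times> 'b::euclidean_space \<Rightarrow> ennreal"
  assumes [measurable]: "H \<in> borel_measurable borel"
  shows "MN p q (\<lambda>z. ennreal c * H z) = ennreal c * MN p q H"
  unfolding MN_def by (subst Lp_norm_cmult Lp_norm_cmult[OF q, symmetric], auto intro: measurable_inner_norm p q)+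

lemma MN_integral_le:
  fixes f :: "'a::euclidean_space \<times> 'b::euclidean_space \<Rightarrow> 'c \<Rightarrow> ennreal"
  assumes N: "sigma_finite_measure N" and f: "(\<lambda>(z, y). f z y) \<in> borel_measurable (borel \<Otimes>\<^sub>M N)"
  shows "MN p q (\<lambda>z. \<integral>\<^sup>+y. f z y \<partial>N) \<le> (\<integral>\<^sup>+y. MN p q (\<lambda>z. f z y) \<partial>N)"
proof -
  interpret N: sigma_finite_measure N by fact
  have [measurable]: "(\<lambda>(z, y). f z y) \<in> borel_measurable ((borel \<Otimes>\<^sub>M borel) \<Otimes>\<^sub>M N)"
    using f by (simp add: borel_prod)
  have 1: "(\<lambda>(x, y). f (x, \<omega>) y) \<in> borel_measurable (lborel \<Otimes>\<^sub>M N)" for \<omega> by measurable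
  have 2: "(\<lambda>(\<omega>, y). Lp_norm p lborel (\<lambda>x. f (x, \<omega>) y)) \<in> borel_measurable (lborel \<Otimes>\<^sub>M N)"
    using measurable_Lp_norm[OF sigma_finite_lborel _ p, of "\<lambda>y x. f (x, fst y) (snd y)" "lborel \<Otimes>\<^sub>M N"]
    by (simp add: case_prod_beta')
  have "MN p q (\<lambda>z. \<integral>\<^sup>+y. f z y \<partial>N) \<le> Lp_norm q lborel (\<lambda>\<omega>. \<integral>\<^sup>+y. Lp_norm p lborel (\<lambda>x. f (x, \<omega>) y) \<partial>N)"
    unfolding MN_def
  proof (rule Lp_norm_mono[OF q])
    show "(\<lambda>\<omega>. Lp_norm p lborel (\<lambda>x. \<integral>\<^sup>+ y. f (x, \<omega>) y \<partial>N)) \<in> borel_measurable lborel"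
      by (rule measurable_Lp_norm[OF sigma_finite_lborel _ p]) measurable
  qed (rule Lp_norm_integral_le[OF sigma_finite_lborel N 1 p])
  also have "\<dots> \<le> (\<integral>\<^sup>+y. MN p q (\<lambda>z. f z y) \<partial>N)"
    unfolding MN_def by (rule Lp_norm_integral_le[OF sigma_finite_lborel N 2 q])
  finally show ?thesis .
qed

lemma MN_add_le:
  fixes f g :: "'a::euclidean_space \<times> 'b::euclidean_space \<Rightarrow> ennreal"
  assumes f[measurable]: "f \<in> borel_measurable borel" and g[measurable]: "g \<in> borel_measurable borel"
  shows "MN p q (\<lambda>x. f x + g x) \<le> MN p q f + MN p q g"
proof -
  have "MN p q (\<lambda>z. f z + g z) \<le> Lp_norm q lborel (\<lambda>\<omega>. Lp_norm p lborel (\<lambda>x. f (x, \<omega>)) + Lp_norm p lborel (\<lambda>x. g (x, \<omega>)))"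
    unfolding MN_def
  proof (rule Lp_norm_mono[OF q])
    show "(\<lambda>\<omega>. Lp_norm p lborel (\<lambda>x. f (x, \<omega>) + g (x, \<omega>))) \<in> borel_measurable lborel"
      using measurable_inner_norm[of "\<lambda>z. f z + g z", OF _ p] by simp
  qed (rule Lp_norm_add_le[OF sigma_finite_lborel p], auto)
  also have "\<dots> \<le> MN p q f + MN p q g"
    unfolding MN_def by (rule Lp_norm_add_le[OF sigma_finite_lborel q]) (auto intro: measurable_inner_norm p)
  finally show ?thesis .
qed

lemma MN_liminf:
  fixes f :: "nat \<Rightarrow> 'a::euclidean_space \<times> 'b::euclidean_space \<Rightarrow> ennreal"
  assumes f[measurable]: "\<And>n. f n \<in> borel_measurable borel"
  shows "MN p q (\<lambda>z. liminf (\<lambda>n. f n z)) \<le> liminf (\<lambda>n. MN p q (f n))"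
proof -
  have "MN p q (\<lambda>z. liminf (\<lambda>n. f n z)) \<le> Lp_norm q lborel (\<lambda>\<omega>. liminf (\<lambda>n. Lp_norm p lborel (\<lambda>x. f n (x, \<omega>))))"
    unfolding MN_def
  proof (rule Lp_norm_mono[OF q])
    show "(\<lambda>\<omega>. Lp_norm p lborel (\<lambda>x. liminf (\<lambda>n. f n (x, \<omega>)))) \<in> borel_measurable lborel"
      using measurable_inner_norm[of "\<lambda>z. liminf (\<lambda>n. f n z)", OF _ p] by simp
  qed (rule Lp_norm_liminf[OF p], auto)
  also have "\<dots> \<le> liminf (\<lambda>n. MN p q (f n))"
    unfolding MN_def by (rule Lp_norm_liminf[OF q]) (auto intro: measurable_inner_norm p)
  finally show ?thesis .
qed

lemma MN_translate:
  fixes H :: "'a::euclidean_space \<times> 'b::euclidean_space \<Rightarrow> ennreal"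
  assumes [measurable]: "H \<in> borel_measurable borel"
  shows "MN p q (\<lambda>z. H (z + a)) = MN p q H"
proof -
  have "Lp_norm p lborel (\<lambda>x. H ((x, \<omega>) + a)) = Lp_norm p lborel (\<lambda>x. H (x, \<omega> + snd a))" for \<omega>
    using Lp_norm_lborel_translate[OF p, of "\<lambda>x. H (x, \<omega> + snd a)" "fst a"] by (simp add: plus_prod_def)
  then show ?thesis unfolding MN_def
    using Lp_norm_lborel_translate[OF q measurable_inner_norm[OF assms p], of "snd a"] by simp
qed

text \<open>With Gaussian factors \<open>k1\<close> and \<open>k2\<close> this converts a finite
  mixed norm into a bound at every single point, see \<open>sup_bound\<close>.\<close>

lemma nn_integral_le_MN:
  fixes H :: "'a::euclidean_space \<times> 'b::euclidean_space \<Rightarrow> ennreal"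
  assumes H[measurable]: "H \<in> borel_measurable borel" "k1 \<in> borel_measurable borel" "k2 \<in> borel_measurable borel"
    and K: "0 < K1" "0 < K2"
    and k1: "\<And>x. k1 x \<le> ennreal K1" "(\<integral>\<^sup>+x. k1 x \<partial>lborel) \<le> ennreal K1"
    and k2: "\<And>x. k2 x \<le> ennreal K2" "(\<integral>\<^sup>+x. k2 x \<partial>lborel) \<le> ennreal K2"
  shows "(\<integral>\<^sup>+z. H z * (k1 (fst z) * k2 (snd z)) \<partial>lborel) \<le> ennreal (K1 * K2) * MN p q H"
proof -
  have [measurable]: "H \<in> borel_measurable (borel \<Otimes>\<^sub>M borel)" by (simp add: borel_prod)
  have "(\<integral>\<^sup>+z. H z * (k1 (fst z) * k2 (snd z)) \<partial>lborel) = (\<integral>\<^sup>+z. H z * (k1 (fst z) * k2 (snd z)) \<partial>(lborel \<Otimes>\<^sub>M lborel))"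
    by (simp add: lborel_prod)
  also have "\<dots> = (\<integral>\<^sup>+\<omega>. \<integral>\<^sup>+x. H (x, \<omega>) * (k1 x * k2 \<omega>) \<partial>lborel \<partial>lborel)"
    by (subst lborel_pair.nn_integral_snd[symmetric]) auto
  also have "\<dots> = (\<integral>\<^sup>+\<omega>. (\<integral>\<^sup>+x. H (x, \<omega>) * k1 x \<partial>lborel) * k2 \<omega> \<partial>lborel)"
    by (subst nn_integral_multc[symmetric]) (auto simp: mult_ac)
  also have "\<dots> \<le> (\<integral>\<^sup>+\<omega>. (ennreal K1 * Lp_norm p lborel (\<lambda>x. H (x, \<omega>))) * k2 \<omega> \<partial>lborel)"
    using k1 K by (intro nn_integral_mono mult_right_mono nn_integral_le_Lp_norm p) auto
  also have "\<dots> = ennreal K1 * (\<integral>\<^sup>+\<omega>. Lp_norm p lborel (\<lambda>x. H (x, \<omega>)) * k2 \<omega> \<partial>lborel)"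
    using measurable_inner_norm[OF H(1) p]
    by (subst nn_integral_cmult[symmetric]) (auto simp: mult_ac intro!: borel_measurable_times)
  also have "\<dots> \<le> ennreal K1 * (ennreal K2 * MN p q H)"
    unfolding MN_def using k2 K measurable_inner_norm[OF H(1) p] by (intro mult_left_mono nn_integral_le_Lp_norm q) auto
  finally show ?thesis using K by (simp add: ennreal_mult mult.assoc)
qed

lemma MN_tensor_finite:
  fixes h1 :: "'a::euclidean_space \<Rightarrow> ennreal" and h2 :: "'b::euclidean_space \<Rightarrow> ennreal"
  assumes [measurable]: "h1 \<in> borel_measurable borel" "h2 \<in> borel_measurable borel"
    and h1: "\<And>x. h1 x \<le> 1" "(\<integral>\<^sup>+x. h1 x \<partial>lborel) < top"
    and h2: "\<And>x. h2 x \<le> 1" "(\<integral>\<^sup>+x. h2 x \<partial>lborel) < top"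
  shows "MN p q (\<lambda>z. h1 (fst z) * h2 (snd z)) < top"
proof -
  have f1: "Lp_norm p lborel h1 < top" "Lp_norm q lborel h2 < top"
    using h1 h2 by (auto intro!: Lp_norm_finite p q)
  obtain c where c: "Lp_norm p lborel h1 = ennreal c" "0 \<le> c" using f1 by (cases "Lp_norm p lborel h1") auto
  have "Lp_norm p lborel (\<lambda>x. h1 x * h2 \<omega>) = ennreal c * h2 \<omega>" for \<omega>
  proof -
    obtain d where d: "h2 \<omega> = ennreal d" "0 \<le> d" using h2(1)[of \<omega>] by (cases "h2 \<omega>") (auto simp: top_unique)
    then have "Lp_norm p lborel (\<lambda>x. ennreal d * h1 x) = ennreal d * ennreal c"
      using Lp_norm_cmult[OF p, of h1 lborel d] c by simp
    then show ?thesis using d by (simp add: mult.commute)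
  qed
  then have "MN p q (\<lambda>z. h1 (fst z) * h2 (snd z)) = ennreal c * Lp_norm q lborel h2"
    by (simp add: MN_def Lp_norm_cmult[OF q])
  then show ?thesis using f1 by (simp add: ennreal_mult_less_top)
qed

text \<open>The left side is a superposition of translates of \<open>H\<close>. Minkowski's
  inequality moves the norm inside, the norm is translation invariant, and \<open>mod\<close>
  charges the factor \<open>C * W x\<close> for moving the weight along.\<close>

lemma MN_Young:
  fixes H k :: "'a::euclidean_space \<times> 'b::euclidean_space \<Rightarrow> ennreal"
  assumes H[measurable]: "H \<in> borel_measurable borel" "k \<in> borel_measurable borel" "M \<in> borel_measurable borel"
     "W \<in> borel_measurable borel"
    and k: "\<And>x. k x \<noteq> top" and C: "0 \<le> C" "\<And>z. 0 \<le> M z" "\<And>z. 0 \<le> W z" and mod: "\<And>x y. M y \<le> C * W x * M (x + y)"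
  shows "MN p q (\<lambda>y. (\<integral>\<^sup>+x. k x * H (x + y) \<partial>lborel) * ennreal (M y))
     \<le> ennreal C * (\<integral>\<^sup>+x. k x * ennreal (W x) \<partial>lborel) * MN p q (\<lambda>z. H z * ennreal (M z))"
proof -
  let ?HM = "\<lambda>z. H z * ennreal (M z)"
  have "MN p q (\<lambda>y. (\<integral>\<^sup>+x. k x * H (x + y) \<partial>lborel) * ennreal (M y))
      \<le> MN p q (\<lambda>y. \<integral>\<^sup>+x. (ennreal C * (k x * ennreal (W x))) * ?HM (y + x) \<partial>lborel)"
  proof (rule MN_mono)
    fix y
    have "(\<integral>\<^sup>+x. k x * H (x + y) \<partial>lborel) * ennreal (M y) = (\<integral>\<^sup>+x. k x * H (x + y) * ennreal (M y) \<partial>lborel)"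
      by (rule nn_integral_multc[symmetric]) measurable
    also have "\<dots> \<le> (\<integral>\<^sup>+x. k x * H (x + y) * (ennreal C * ennreal (W x) * ennreal (M (x + y))) \<partial>lborel)"
      using mod[of y] C by (intro nn_integral_mono mult_left_mono) (auto simp flip: ennreal_mult)
    also have "\<dots> = (\<integral>\<^sup>+x. (ennreal C * (k x * ennreal (W x))) * ?HM (y + x) \<partial>lborel)"
      by (simp add: mult_ac add.commute)
    finally show "(\<integral>\<^sup>+x. k x * H (x + y) \<partial>lborel) * ennreal (M y) \<le> (\<integral>\<^sup>+x. (ennreal C * (k x * ennreal (W x))) * ?HM (y + x) \<partial>lborel)" .
  next
    show "(\<lambda>y. (\<integral>\<^sup>+x. k x * H (x + y) \<partial>lborel) * ennreal (M y)) \<in> borel_measurable borel" by measurable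
    show "(\<lambda>y. \<integral>\<^sup>+x. (ennreal C * (k x * ennreal (W x))) * ?HM (y + x) \<partial>lborel) \<in> borel_measurable borel" by measurable
  qed
  also have "\<dots> \<le> (\<integral>\<^sup>+x. MN p q (\<lambda>y. (ennreal C * (k x * ennreal (W x))) * ?HM (y + x)) \<partial>lborel)"
    by (rule MN_integral_le[OF sigma_finite_lborel]) measurable
  also have "\<dots> \<le> (\<integral>\<^sup>+x. (ennreal C * (k x * ennreal (W x))) * MN p q ?HM \<partial>lborel)"
  proof (rule nn_integral_mono)
    fix x
    obtain r where r: "ennreal C * (k x * ennreal (W x)) = ennreal r"
      using k[of x] C by (cases "k x") (auto simp flip: ennreal_mult)
    have [measurable]: "(\<lambda>y. ?HM (y + x)) \<in> borel_measurable borel" by measurable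
    show "MN p q (\<lambda>y. (ennreal C * (k x * ennreal (W x))) * ?HM (y + x)) \<le> (ennreal C * (k x * ennreal (W x))) * MN p q ?HM"
      unfolding r using MN_cmult[of "\<lambda>y. ?HM (y + x)" r] MN_translate[of ?HM x] by simp
  qed
  also have "\<dots> = ennreal C * (\<integral>\<^sup>+x. k x * ennreal (W x) \<partial>lborel) * MN p q ?HM"
    by (simp add: nn_integral_multc[symmetric] nn_integral_cmult mult.assoc)
  finally show ?thesis .
qed

end

subsection \<open>Gaussian integrals\<close>

lemma measurable_cis [measurable]: "cis \<in> borel_measurable borel"
  by (intro borel_measurable_continuous_onI continuous_intros)

text \<open>This is the characteristic function of the standard normal distribution after the
  substitution \<open>x = c * t\<close> with \<open>c = sqrt (2 * pi * s)\<close>, which matches the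
  two exponents and turns the frequency into \<open>u = 2 * pi * r / c\<close>.\<close>

lemma gaussian_fourier_real:
  fixes s r :: real
  assumes s: "0 < s"
  shows "integrable lborel (\<lambda>t. exp (- pi * s * t\<^sup>2) * cis (2 * pi * (t * r)))" (is "integrable _ ?f")
    and "(LINT t|lborel. exp (- pi * s * t\<^sup>2) * cis (2 * pi * (t * r))) = of_real (exp (- pi * r\<^sup>2 / s) / sqrt s)"
proof -
  define c where "c = sqrt (2 * pi * s)"
  have c: "c > 0" "c\<^sup>2 = 2 * pi * s" using s by (auto simp: c_def)
  define u where "u = 2 * pi * r / c"
  let ?g = "\<lambda>x. std_normal_density x *\<^sub>R iexp (u * x)"
  have gf: "?g (0 + c * t) = (1 / sqrt (2 * pi)) *\<^sub>R ?f t" for t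
  proof -
    have "(c * t)\<^sup>2 / 2 = pi * s * t\<^sup>2" using c by (simp add: power_mult_distrib)
    then show ?thesis using c
      by (simp add: std_normal_density_def u_def cis_conv_exp scaleR_conv_of_real mult_ac
        flip: power_mult_distrib)
  qed
  have ig: "integrable lborel ?g"
  proof (rule Bochner_Integration.integrable_bound)
    show "integrable lborel (\<lambda>x. std_normal_density x :: real)"
      using integrable_normal_moment[of 1 0 0] by simp
  qed (auto simp: norm_mult)
  have "integrable lborel (\<lambda>t. ?g (0 + c * t))"
    using c by (subst lborel_integrable_real_affine_iff) (use ig in auto)
  then have i1: "integrable lborel (\<lambda>t. (1 / sqrt (2 * pi)) *\<^sub>R ?f t)" unfolding gf .
  have "integrable lborel (\<lambda>t. sqrt (2 * pi) *\<^sub>R ((1 / sqrt (2 * pi)) *\<^sub>R ?f t))"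
    by (intro integrable_scaleR_right i1)
  then show "integrable lborel ?f" by simp
  have "char std_normal_distribution u = (LINT x|lborel. ?g x)"
    unfolding char_def by (subst integral_density) auto
  also have "\<dots> = \<bar>c\<bar> *\<^sub>R (LINT t|lborel. ?g (0 + c * t))"
    using c by (intro lborel_integral_real_affine) auto
  also have "\<dots> = (c / sqrt (2 * pi)) *\<^sub>R (LINT t|lborel. ?f t)"
    unfolding gf using c by simp
  also have "c / sqrt (2 * pi) = sqrt s" by (simp add: c_def real_sqrt_mult)
  finally have "sqrt s *\<^sub>R (LINT t|lborel. ?f t) = of_real (exp (- (u\<^sup>2) / 2))"
    by (simp add: char_std_normal_distribution)
  moreover have "u\<^sup>2 / 2 = pi * r\<^sup>2 / s"
    using s c by (simp add: u_def power_divide power_mult_distrib field_simps power2_eq_square)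
  ultimately have "(1 / sqrt s) *\<^sub>R (sqrt s *\<^sub>R (LINT t|lborel. ?f t)) = (1 / sqrt s) *\<^sub>R of_real (exp (- pi * r\<^sup>2 / s))" by simp
  then show "(LINT t|lborel. ?f t) = of_real (exp (- pi * r\<^sup>2 / s) / sqrt s)"
    using s by (simp add: scaleR_conv_of_real)
qed

lemma gaussian_as_prod:
  fixes t r :: "'a::euclidean_space"
  shows "of_real (exp (- pi * s * (norm t)\<^sup>2)) * cis (2 * pi * (t \<bullet> r))
    = (\<Prod>b\<in>Basis. of_real (exp (- pi * s * (t \<bullet> b)\<^sup>2)) * cis (2 * pi * ((t \<bullet> b) * (r \<bullet> b))))"
proof -
  have "(norm t)\<^sup>2 = (\<Sum>b\<in>Basis. (t \<bullet> b)\<^sup>2)"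
    unfolding power2_norm_eq_inner by (subst euclidean_inner) (simp add: power2_eq_square)
  then have "- pi * s * (norm t)\<^sup>2 = (\<Sum>b\<in>Basis. - pi * s * (t \<bullet> b)\<^sup>2)"
    by (simp add: sum_distrib_left sum_negf)
  then have 1: "exp (- pi * s * (norm t)\<^sup>2) = (\<Prod>b\<in>Basis. exp (- pi * s * (t \<bullet> b)\<^sup>2))"
    by (simp add: exp_sum)
  have "\<i> * of_real (2 * pi * (t \<bullet> r)) = (\<Sum>b\<in>Basis. \<i> * of_real (2 * pi * ((t \<bullet> b) * (r \<bullet> b))))"
    by (simp add: sum_distrib_left[symmetric] euclidean_inner[of t r])
  then have 2: "cis (2 * pi * (t \<bullet> r)) = (\<Prod>b\<in>Basis. cis (2 * pi * ((t \<bullet> b) * (r \<bullet> b))))"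
    unfolding cis_conv_exp by (simp only: exp_sum[OF finite_Basis])
  show ?thesis unfolding 1 2 by (simp add: prod.distrib)
qed

interpretation lborel_product: product_sigma_finite "\<lambda>_. lborel :: real measure"
  by unfold_locales

text \<open>The integrand factors over the coordinates (\<open>gaussian_as_prod\<close>) and
  \<open>lborel\<close> is an image of a product measure, so the one-dimensional formulas
  multiply.\<close>

lemma gaussian_fourier:
  fixes r :: "'a::euclidean_space"
  assumes s: "0 < s"
  shows "integrable lborel (\<lambda>t::'a. exp (- pi * s * (norm t)\<^sup>2) * cis (2 * pi * (t \<bullet> r)))"
    and "(LINT t|lborel. exp (- pi * s * (norm t)\<^sup>2) * cis (2 * pi * (t \<bullet> r)))
       = of_real (exp (- pi * (norm r)\<^sup>2 / s) / sqrt s ^ DIM('a))"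
proof -
  let ?f = "\<lambda>b x. of_real (exp (- pi * s * x\<^sup>2)) * cis (2 * pi * (x * (r \<bullet> b)))"
  have [measurable]: "(\<lambda>f. \<Sum>b\<in>Basis. f b *\<^sub>R b) \<in> (\<Pi>\<^sub>M b\<in>(Basis::'a set). lborel) \<rightarrow>\<^sub>M borel"
    by measurable
  have comp: "(\<Sum>b\<in>Basis. x b *\<^sub>R b) \<bullet> b' = x b'" if "b' \<in> Basis" for x and b' :: 'a
    using that by (simp add: inner_sum_left inner_Basis if_distrib cong: if_cong)
  have pr: "(\<Prod>b\<in>Basis. ?f b ((\<Sum>b\<in>Basis. x b *\<^sub>R b) \<bullet> b)) = (\<Prod>b\<in>Basis. ?f b (x b))" for x
    by (intro prod.cong refl) (simp add: comp)
  have "integrable (\<Pi>\<^sub>M b\<in>(Basis::'a set). lborel) (\<lambda>x. \<Prod>b\<in>Basis. ?f b (x b))"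
    by (intro lborel_product.product_integrable_prod gaussian_fourier_real s) simp
  then show "integrable lborel (\<lambda>t::'a. exp (- pi * s * (norm t)\<^sup>2) * cis (2 * pi * (t \<bullet> r)))"
    unfolding gaussian_as_prod by (subst lborel_eq, subst integrable_distr_eq) (simp_all add: pr)
  have "(LINT t|lborel. exp (- pi * s * (norm t)\<^sup>2) * cis (2 * pi * (t \<bullet> r)))
      = (LINT x|(\<Pi>\<^sub>M b\<in>(Basis::'a set). lborel). (\<Prod>b\<in>Basis. ?f b (x b)))"
    unfolding gaussian_as_prod by (subst lborel_eq, subst integral_distr) (simp_all add: pr)
  also have "\<dots> = (\<Prod>b\<in>Basis. LINT x|lborel. ?f b x)"
    by (intro lborel_product.product_integral_prod gaussian_fourier_real s) simp
  also have "\<dots> = (\<Prod>b\<in>(Basis::'a set). of_real (exp (- pi * (r \<bullet> b)\<^sup>2 / s) / sqrt s))"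
    by (simp only: gaussian_fourier_real(2)[OF s])
  also have "\<dots> = of_real (\<Prod>b\<in>(Basis::'a set). exp (- pi * (r \<bullet> b)\<^sup>2 / s) / sqrt s)" by simp
  also have "(\<Prod>b\<in>(Basis::'a set). exp (- pi * (r \<bullet> b)\<^sup>2 / s) / sqrt s)
      = (\<Prod>b\<in>(Basis::'a set). exp (- pi * (r \<bullet> b)\<^sup>2 / s)) / sqrt s ^ DIM('a)"
    by (simp add: prod_dividef)
  also have "(\<Prod>b\<in>(Basis::'a set). exp (- pi * (r \<bullet> b)\<^sup>2 / s)) = exp (\<Sum>b\<in>Basis. - pi * (r \<bullet> b)\<^sup>2 / s)"
    by (simp add: exp_sum)
  also have "(\<Sum>b\<in>Basis. - pi * (r \<bullet> b)\<^sup>2 / s) = - pi * (norm r)\<^sup>2 / s"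
    unfolding power2_norm_eq_inner euclidean_inner[of r r]
    by (simp add: sum_distrib_left[symmetric] sum_divide_distrib[symmetric] sum_negf power2_eq_square)
  finally show "(LINT t|lborel. exp (- pi * s * (norm t)\<^sup>2) * cis (2 * pi * (t \<bullet> r)))
       = of_real (exp (- pi * (norm r)\<^sup>2 / s) / sqrt s ^ DIM('a))" .
qed

lemma integrable_gaussian:
  assumes c: "0 < (c::real)"
  shows "integrable lborel (\<lambda>t::'a::euclidean_space. exp (- c * (norm t)\<^sup>2))"
proof -
  have "integrable lborel (\<lambda>t::'a. norm (complex_of_real (exp (- pi * (c / pi) * (norm t)\<^sup>2)) * cis (2 * pi * (t \<bullet> 0))))"
    using c by (intro integrable_norm gaussian_fourier) auto
  then show ?thesis by (simp add: norm_mult)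
qed

lemma integral_gaussian:
  assumes "0 < s"
  shows "(LINT t|lborel. exp (- pi * s * (norm (t::'a::euclidean_space))\<^sup>2)) = 1 / sqrt s ^ DIM('a)"
proof -
  have "complex_of_real (LINT t|lborel. exp (- pi * s * (norm (t::'a))\<^sup>2)) = of_real (1 / sqrt s ^ DIM('a))"
    using gaussian_fourier(2)[OF assms, of "0::'a"]
    by (subst integral_complex_of_real[symmetric]) simp
  then show ?thesis by (simp only: of_real_eq_iff)
qed

lemma lborel_integral_translate:
  fixes f :: "'a::euclidean_space \<Rightarrow> 'b::{banach, second_countable_topology}"
  shows "(LINT x|lborel. f (x + a)) = (LINT x|lborel. f x)"
    and "integrable lborel (\<lambda>x. f (x + a)) \<longleftrightarrow> integrable lborel f"
proof -
  have i: "integrable lborel (\<lambda>x. g (x + b))" if "integrable lborel g" for g :: "'a \<Rightarrow> 'b" and b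
  proof -
    have "integrable (distr lborel borel ((+) b)) g" using that by (simp add: lborel_distr_plus)
    then show ?thesis by (subst (asm) integrable_distr_eq) (use that in \<open>auto simp: add.commute\<close>)
  qed
  show *: "integrable lborel (\<lambda>x. f (x + a)) \<longleftrightarrow> integrable lborel f"
    using i[of f a] i[of "\<lambda>x. f (x + a)" "- a"] by (auto simp: add.assoc)
  show "(LINT x|lborel. f (x + a)) = (LINT x|lborel. f x)"
  proof (cases "integrable lborel f")
    case True
    have "(LINT x|lborel. f x) = (LINT x|distr lborel borel ((+) a). f x)" by (simp add: lborel_distr_plus)
    also have "\<dots> = (LINT x|lborel. f (x + a))" by (subst integral_distr) (use True in \<open>auto simp: add.commute\<close>)
    finally show ?thesis by simp
  next
    case False then show ?thesis using * by (simp add: not_integrable_integral_eq)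
  qed
qed

lemma lborel_integral_scale:
  fixes f :: "'a::euclidean_space \<Rightarrow> 'b::{banach, second_countable_topology}"
  assumes "c \<noteq> 0" and f: "f \<in> borel_measurable borel"
  shows "(LINT x|lborel. f x) = \<bar>c\<bar> ^ DIM('a) *\<^sub>R (LINT x|lborel. f (c *\<^sub>R x))"
proof -
  have "(LINT x|lborel. f x) = (LINT x|density (distr lborel borel (\<lambda>x. 0 + c *\<^sub>R x)) (\<lambda>_. \<bar>c\<bar> ^ DIM('a)). f x)"
    by (subst lborel_affine[OF assms(1), of 0]) simp
  also have "\<dots> = (LINT x|lborel. \<bar>c\<bar> ^ DIM('a) *\<^sub>R f (c *\<^sub>R x))"
    using f by (subst integral_density) (auto simp: integral_distr)
  finally show ?thesis by simp
qed

lemma lborel_reflect: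
  "distr lborel borel uminus = (lborel :: 'a::euclidean_space measure)"
  using lborel_affine[of "-1" "0::'a"] by (simp add: density_1 one_ennreal_def[symmetric])

lemma nn_integral_lborel_reflect:
  fixes f :: "'a::euclidean_space \<Rightarrow> ennreal"
  assumes "f \<in> borel_measurable borel"
  shows "(\<integral>\<^sup>+x. f (- x) \<partial>lborel) = (\<integral>\<^sup>+x. f x \<partial>lborel)"
proof -
  have "(\<integral>\<^sup>+x. f x \<partial>lborel) = (\<integral>\<^sup>+x. f x \<partial>distr lborel borel uminus)" by (simp add: lborel_reflect)
  also have "\<dots> = (\<integral>\<^sup>+x. f (- x) \<partial>lborel)" using assms by (subst nn_integral_distr) auto
  finally show ?thesis by simp
qed

text \<open>This factor is what a rescaled Gaussian of unit mass leaves outside a fixed ball,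
  relative to the Gaussian at scale 1; it is used in
  \<open>gaussian_approximate_identity\<close>.\<close>

lemma power_times_gaussian_tendsto_0:
  assumes c: "0 < (c::real)"
  shows "(\<lambda>n. real n ^ d * exp (- c * ((real n)\<^sup>2 - 1))) \<longlonglongrightarrow> 0"
proof -
  have "((\<lambda>x::real. x ^ d / exp x) \<longlongrightarrow> 0) at_top" by (rule tendsto_power_div_exp_0)
  moreover have "filterlim (\<lambda>n. c * real n) at_top sequentially"
    by (rule filterlim_tendsto_pos_mult_at_top[OF tendsto_const c filterlim_real_sequentially])
  ultimately have "(\<lambda>n. (c * real n) ^ d / exp (c * real n)) \<longlonglongrightarrow> 0"
    by (rule filterlim_compose)
  then have lim: "(\<lambda>n. exp c / c ^ d * ((c * real n) ^ d / exp (c * real n))) \<longlonglongrightarrow> 0"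
    by (rule tendsto_mult_right_zero)
  show ?thesis
  proof (rule Lim_null_comparison[OF _ lim], rule eventuallyI)
    fix n
    have "real n \<le> (real n)\<^sup>2" by (cases n) (auto simp: power2_eq_square)
    then have "c * real n \<le> c * (real n)\<^sup>2" using c by (intro mult_left_mono) auto
    then have "exp (- c * ((real n)\<^sup>2 - 1)) \<le> exp (c - c * real n)" by (simp add: algebra_simps)
    then have "real n ^ d * exp (- c * ((real n)\<^sup>2 - 1)) \<le> real n ^ d * exp (c - c * real n)"
      by (intro mult_left_mono) auto
    also have "\<dots> = exp c / c ^ d * ((c * real n) ^ d / exp (c * real n))"
      using c by (simp add: exp_diff power_mult_distrib)
    finally show "norm (real n ^ d * exp (- c * ((real n)\<^sup>2 - 1))) \<le> exp c / c ^ d * ((c * real n) ^ d / exp (c * real n))"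
      by (simp add: norm_mult)
  qed
qed

text \<open>In the application \<open>k\<close> contains a function that is merely
  square-integrable, so only integrability against one fixed Gaussian is assumed. Near 0 rescaling
  and dominated convergence apply; far away the sharper Gaussians are compared with the fixed
  one.\<close>

lemma gaussian_approximate_identity:
  fixes k :: "'a::euclidean_space \<Rightarrow> complex"
  assumes [measurable]: "k \<in> borel_measurable borel"
    and int: "integrable lborel (\<lambda>r. exp (- pi * (norm r)\<^sup>2) * k r)" and cont: "isCont k 0"
  shows "(\<lambda>n. LINT r|lborel. real n ^ DIM('a) * exp (- pi * (real n)\<^sup>2 * (norm r)\<^sup>2) * k r) \<longlonglongrightarrow> k 0"
proof -
  let ?D = "\<lambda>n r. real n ^ DIM('a) * exp (- pi * (real n)\<^sup>2 * (norm (r::'a))\<^sup>2)"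
  obtain d where d: "0 < d" and kd: "\<And>r. norm r < d \<Longrightarrow> cmod (k r) \<le> cmod (k 0) + 1"
  proof -
    obtain d where d: "d > 0" "\<And>r. dist r 0 < d \<Longrightarrow> dist (k r) (k 0) < 1"
      using cont unfolding continuous_at_eps_delta by (metis zero_less_one)
    have "cmod (k r) \<le> cmod (k 0) + 1" if "norm r < d" for r
      using d(2)[of r] that norm_triangle_ineq2[of "k r" "k 0"] by (simp add: dist_norm)
    then show ?thesis by (rule that[OF d(1)])
  qed
  define k1 where "k1 r = (if norm r < d then k r else 0)" for r
  define k2 where "k2 r = (if norm r < d then 0 else k r)" for r
  have [measurable]: "k1 \<in> borel_measurable borel" "k2 \<in> borel_measurable borel"
    unfolding k1_def k2_def by measurable
  define K where "K = cmod (k 0) + 1"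
  have k1b: "cmod (k1 r) \<le> K" for r using kd[of r] by (auto simp: k1_def K_def)
  have D_int: "integrable lborel (?D n)" if "n > 0" for n
    using that integrable_gaussian[of "pi * (real n)\<^sup>2", where 'a='a] by (intro integrable_mult_right) simp
  have near: "(\<lambda>n. LINT r|lborel. of_real (?D n r) * k1 r) \<longlonglongrightarrow> k 0"
  proof -
    have eq: "(LINT r|lborel. of_real (?D n r) * k1 r) = (LINT x|lborel. exp (- pi * (norm x)\<^sup>2) * k1 ((1 / real n) *\<^sub>R x))" if "n > 0" for n
    proof -
      have "(LINT r|lborel. of_real (?D n r) * k1 r) = \<bar>1 / real n\<bar> ^ DIM('a) *\<^sub>R (LINT x|lborel. of_real (?D n ((1 / real n) *\<^sub>R x)) * k1 ((1 / real n) *\<^sub>R x))"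
        using that by (intro lborel_integral_scale) auto
      also have "\<dots> = (LINT x|lborel. \<bar>1 / real n\<bar> ^ DIM('a) *\<^sub>R (of_real (?D n ((1 / real n) *\<^sub>R x)) * k1 ((1 / real n) *\<^sub>R x)))"
        by simp
      also have "\<dots> = (LINT x|lborel. exp (- pi * (norm x)\<^sup>2) * k1 ((1 / real n) *\<^sub>R x))"
        using that by (intro Bochner_Integration.integral_cong refl)
          (simp add: scaleR_conv_of_real power_divide)
      finally show ?thesis .
    qed
    have "(\<lambda>n. LINT x|lborel. exp (- pi * (norm x)\<^sup>2) * k1 ((1 / real n) *\<^sub>R x)) \<longlonglongrightarrow> (LINT x|lborel. exp (- pi * (norm (x::'a))\<^sup>2) * k 0)"
    proof (rule integral_dominated_convergence)
      show "integrable lborel (\<lambda>x::'a. exp (- pi * (norm x)\<^sup>2) * K)"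
        by (intro integrable_mult_left integrable_gaussian) simp
      show "AE x in lborel. (\<lambda>n. exp (- pi * (norm x)\<^sup>2) * k1 ((1 / real n) *\<^sub>R x)) \<longlonglongrightarrow> exp (- pi * (norm x)\<^sup>2) * k 0"
      proof (rule AE_I2, rule tendsto_mult[OF tendsto_const])
        fix x :: 'a
        have "isCont k1 0"
        proof -
          have "\<forall>\<^sub>F r in nhds 0. r \<in> ball (0::'a) d" using d by (intro eventually_nhds_in_open) auto
          then have "\<forall>\<^sub>F r in nhds 0. k1 r = k r" by (rule eventually_mono) (auto simp: k1_def)
          then show ?thesis using cont by (simp add: isCont_cong)
        qed
        moreover have "(\<lambda>n. (1 / real n) *\<^sub>R x) \<longlonglongrightarrow> 0 *\<^sub>R x"
          by (intro tendsto_scaleR lim_1_over_n tendsto_const)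
        ultimately have "(\<lambda>n. k1 ((1 / real n) *\<^sub>R x)) \<longlonglongrightarrow> k1 0"
          by (intro isCont_tendsto_compose[of 0 k1]) auto
        then show "(\<lambda>n. k1 ((1 / real n) *\<^sub>R x)) \<longlonglongrightarrow> k 0" using d by (simp add: k1_def)
      qed
      show "AE x in lborel. norm (complex_of_real (exp (- pi * (norm x)\<^sup>2)) * k1 ((1 / real i) *\<^sub>R x)) \<le> exp (- pi * (norm x)\<^sup>2) * K" for i
        using k1b by (auto simp: norm_mult)
    qed measurable
    moreover have "(LINT x|lborel. complex_of_real (exp (- pi * (norm (x::'a))\<^sup>2)) * k 0) = k 0"
    proof -
      have "(LINT x|lborel. exp (- (pi * (norm (x::'a))\<^sup>2))) = 1"
        using integral_gaussian[of 1, where 'a='a] by simp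
      then show ?thesis by simp
    qed
    ultimately have "(\<lambda>n. LINT x|lborel. exp (- pi * (norm x)\<^sup>2) * k1 ((1 / real n) *\<^sub>R x)) \<longlonglongrightarrow> k 0" by (simp only:)
    then show ?thesis
      by (rule Lim_transform_eventually)
        (rule eventually_mono[OF eventually_gt_at_top[of 0]], rule eq[symmetric])
  qed
  \<comment> \<open>For \<open>d \<le> norm r\<close> one copy of \<open>(norm r)\<^sup>2\<close> is
    kept for integrability and the other \<open>n\<^sup>2 - 1\<close> copies are bounded below by
    \<open>d\<^sup>2\<close>.\<close>
  have k2le: "cmod (of_real (?D n r) * k2 r) \<le> real n ^ DIM('a) * exp (- (pi * d\<^sup>2) * ((real n)\<^sup>2 - 1)) * cmod (exp (- pi * (norm r)\<^sup>2) * k r)"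
    if n: "n > 0" for n r
  proof (cases "norm r < d")
    case True then show ?thesis by (simp add: k2_def)
  next
    case False
    then have "d\<^sup>2 \<le> (norm r)\<^sup>2" using d by (intro power_mono) auto
    moreover have "(real n)\<^sup>2 - 1 \<ge> 0" using n by (simp add: one_le_power Suc_leI)
    ultimately have "d\<^sup>2 * ((real n)\<^sup>2 - 1) \<le> (norm r)\<^sup>2 * ((real n)\<^sup>2 - 1)" by (rule mult_right_mono)
    then have "pi * (d\<^sup>2 * ((real n)\<^sup>2 - 1)) \<le> pi * ((norm r)\<^sup>2 * ((real n)\<^sup>2 - 1))" by (rule mult_left_mono) simp
    then have "exp (- pi * (real n)\<^sup>2 * (norm r)\<^sup>2) \<le> exp (- (pi * d\<^sup>2) * ((real n)\<^sup>2 - 1)) * exp (- pi * (norm r)\<^sup>2)"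
      unfolding mult_exp_exp by (simp add: algebra_simps)
    then have "real n ^ DIM('a) * exp (- pi * (real n)\<^sup>2 * (norm r)\<^sup>2) * cmod (k r)
       \<le> real n ^ DIM('a) * (exp (- (pi * d\<^sup>2) * ((real n)\<^sup>2 - 1)) * exp (- pi * (norm r)\<^sup>2)) * cmod (k r)"
      by (intro mult_right_mono mult_left_mono) auto
    then show ?thesis using False by (simp add: k2_def norm_mult norm_power mult.assoc)
  qed
  have inorm: "integrable lborel (\<lambda>r. cmod (exp (- pi * (norm r)\<^sup>2) * k r))" using int by (rule integrable_norm)
  have k2int: "integrable lborel (\<lambda>r. of_real (?D n r) * k2 r)" if "n > 0" for n
    by (rule Bochner_Integration.integrable_bound[OF integrable_mult_right[OF inorm, of "real n ^ DIM('a) * exp (- (pi * d\<^sup>2) * ((real n)\<^sup>2 - 1))"]])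
      (use k2le[OF that] in \<open>auto intro: order_trans[OF _ abs_ge_self]\<close>)
  have k1int: "integrable lborel (\<lambda>r. of_real (?D n r) * k1 r)" if "n > 0" for n
    by (rule Bochner_Integration.integrable_bound[OF integrable_mult_left[OF D_int[OF that], of K]])
      (use k1b in \<open>auto simp: norm_mult norm_power K_def intro!: mult_left_mono\<close>)
  have far: "(\<lambda>n. LINT r|lborel. of_real (?D n r) * k2 r) \<longlonglongrightarrow> 0"
  proof (rule Lim_null_comparison)
    show "(\<lambda>n. (real n ^ DIM('a) * exp (- (pi * d\<^sup>2) * ((real n)\<^sup>2 - 1))) * (LINT r|lborel. cmod (exp (- pi * (norm r)\<^sup>2) * k r))) \<longlonglongrightarrow> 0"
      using d by (intro tendsto_mult_left_zero power_times_gaussian_tendsto_0) auto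
    show "\<forall>\<^sub>F n in sequentially. norm (LINT r|lborel. of_real (?D n r) * k2 r) \<le> (real n ^ DIM('a) * exp (- (pi * d\<^sup>2) * ((real n)\<^sup>2 - 1))) * (LINT r|lborel. cmod (exp (- pi * (norm r)\<^sup>2) * k r))"
    proof (rule eventually_mono[OF eventually_gt_at_top[of 0]])
      fix n :: nat assume n: "0 < n"
      have "norm (LINT r|lborel. of_real (?D n r) * k2 r) \<le> (LINT r|lborel. cmod (of_real (?D n r) * k2 r))"
        by (rule integral_norm_bound)
      also have "\<dots> \<le> (LINT r|lborel. real n ^ DIM('a) * exp (- (pi * d\<^sup>2) * ((real n)\<^sup>2 - 1)) * cmod (exp (- pi * (norm r)\<^sup>2) * k r))"
        by (intro integral_mono integrable_norm k2int n integrable_mult_right inorm k2le)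
      finally show "norm (LINT r|lborel. of_real (?D n r) * k2 r) \<le> (real n ^ DIM('a) * exp (- (pi * d\<^sup>2) * ((real n)\<^sup>2 - 1))) * (LINT r|lborel. cmod (exp (- pi * (norm r)\<^sup>2) * k r))"
        by simp
    qed
  qed
  have "(\<lambda>n. (LINT r|lborel. of_real (?D n r) * k1 r) + (LINT r|lborel. of_real (?D n r) * k2 r)) \<longlonglongrightarrow> k 0 + 0"
    by (intro tendsto_add near far)
  then have "(\<lambda>n. (LINT r|lborel. of_real (?D n r) * k1 r) + (LINT r|lborel. of_real (?D n r) * k2 r)) \<longlonglongrightarrow> k 0" by simp
  then show ?thesis
  proof (rule Lim_transform_eventually, intro eventually_mono[OF eventually_gt_at_top[of 0]])
    fix n :: nat assume n: "0 < n"
    have "(LINT r|lborel. of_real (?D n r) * k1 r) + (LINT r|lborel. of_real (?D n r) * k2 r) = (LINT r|lborel. of_real (?D n r) * k1 r + of_real (?D n r) * k2 r)"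
      by (rule Bochner_Integration.integral_add[symmetric, OF k1int[OF n] k2int[OF n]])
    also have "\<dots> = (LINT r|lborel. of_real (?D n r) * k r)"
      by (intro Bochner_Integration.integral_cong) (auto simp: k1_def k2_def)
    finally show "(LINT r|lborel. of_real (?D n r) * k1 r) + (LINT r|lborel. of_real (?D n r) * k2 r) = (LINT r|lborel. of_real (?D n r) * k r)" .
  qed
qed

subsection \<open>The short-time Fourier transform\<close>

lemma integrable_dominated:
  fixes g :: "'a \<Rightarrow> 'b::{banach, second_countable_topology}"
  assumes "integrable M f" "g \<in> borel_measurable M" "\<And>x. norm (g x) \<le> (f x :: real)"
  shows "integrable M g"
  by (rule Bochner_Integration.integrable_bound[OF assms(1,2)])
    (use assms(3) in \<open>auto intro: order_trans[OF _ abs_ge_self]\<close>)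

lemma measurable_fst_borel [measurable]:
  "fst \<in> borel_measurable (borel :: ('a::second_countable_topology \<times> 'b::second_countable_topology) measure)"
  by (simp add: borel_prod[symmetric])

lemma measurable_snd_borel [measurable]:
  "snd \<in> borel_measurable (borel :: ('a::second_countable_topology \<times> 'b::second_countable_topology) measure)"
  by (simp add: borel_prod[symmetric])

lemma measurable_cnj [measurable]: "f \<in> borel_measurable M \<Longrightarrow> (\<lambda>x. cnj (f x)) \<in> borel_measurable M"
  by (rule measurable_compose[of f M borel cnj]) (auto intro!: borel_measurable_continuous_onI continuous_intros)

lemma integrable_tensor:
  fixes f :: "'a::euclidean_space \<Rightarrow> 'c::{real_normed_field, banach, second_countable_topology}" and g :: "'b::euclidean_space \<Rightarrow> 'c"
  assumes f: "integrable lborel f" and g: "integrable lborel g"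
  shows "integrable (lborel \<Otimes>\<^sub>M lborel) (\<lambda>(x, y). f x * g y)"
proof (rule lborel_pair.Fubini_integrable)
  show "integrable lborel (\<lambda>x. LINT y|lborel. norm (case (x, y) of (x, y) \<Rightarrow> f x * g y))"
    using f g by (simp add: norm_mult)
qed (use f g in auto)

lemma lborel_integral_reflect:
  fixes f :: "'a::euclidean_space \<Rightarrow> 'b::{banach, second_countable_topology}"
  assumes [measurable]: "f \<in> borel_measurable borel"
  shows "(LINT x|lborel. f (a - x)) = (LINT x|lborel. f x)"
    and "integrable lborel (\<lambda>x. f (a - x)) \<longleftrightarrow> integrable lborel f"
proof -
  have "(LINT x|lborel. f x) = (LINT x|lborel. f (x + a))" by (rule lborel_integral_translate(1)[symmetric])
  also have "\<dots> = (LINT x|distr lborel borel uminus. f (x + a))" by (simp add: lborel_reflect)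
  also have "\<dots> = (LINT x|lborel. f (a - x))" by (subst integral_distr) auto
  finally show "(LINT x|lborel. f (a - x)) = (LINT x|lborel. f x)" by simp
  have "integrable lborel f \<longleftrightarrow> integrable lborel (\<lambda>x. f (x + a))" by (rule lborel_integral_translate(2)[symmetric])
  also have "\<dots> \<longleftrightarrow> integrable (distr lborel borel uminus) (\<lambda>x. f (x + a))" by (simp add: lborel_reflect)
  also have "\<dots> \<longleftrightarrow> integrable lborel (\<lambda>x. f (a - x))" by (subst integrable_distr_eq) auto
  finally show "integrable lborel (\<lambda>x. f (a - x)) \<longleftrightarrow> integrable lborel f" by simp
qed

text \<open>The class from which the representatives in \<open>M1_space\<close> are taken. It is
  closed under linear combinations and time-frequency shifts, so every bracket between its members
  is an absolutely convergent integral.\<close>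

definition L2c :: "(real^'d \<Rightarrow> complex) \<Rightarrow> bool" where
  "L2c h \<longleftrightarrow> continuous_on UNIV h \<and> integrable lborel (\<lambda>t. (cmod (h t))\<^sup>2)"

lemma L2c_measurable: "L2c h \<Longrightarrow> h \<in> borel_measurable borel"
  by (auto simp: L2c_def intro: borel_measurable_continuous_onI)

text \<open>A cheap substitute for the Cauchy-Schwarz inequality where only integrability or some
  finite bound matters.\<close>

lemma two_mult_le_squares: "(x::real) * y \<le> x\<^sup>2 + y\<^sup>2"
proof -
  have "0 \<le> (x - y)\<^sup>2 + x\<^sup>2 + y\<^sup>2" by simp
  also have "\<dots> = 2 * (x\<^sup>2 + y\<^sup>2 - x * y)" by (simp add: power2_diff)
  finally show ?thesis by simp
qed

lemma L2c_mult_integrable: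
  assumes f: "L2c f" and g: "L2c g"
  shows "integrable lborel (\<lambda>t. f t * cnj (g t))"
proof (rule Bochner_Integration.integrable_bound)
  note [measurable] = L2c_measurable[OF f] L2c_measurable[OF g]
  show "integrable lborel (\<lambda>t. (cmod (f t))\<^sup>2 + (cmod (g t))\<^sup>2)"
    using f g by (auto simp: L2c_def)
  show "AE t in lborel. norm (f t * cnj (g t)) \<le> norm ((cmod (f t))\<^sup>2 + (cmod (g t))\<^sup>2)"
    using two_mult_le_squares by (auto simp: norm_mult)
  show "(\<lambda>t. f t * cnj (g t)) \<in> borel_measurable lborel" by measurable
qed

lemma L2c_add:
  assumes f: "L2c f" and g: "L2c g" shows "L2c (f + g)"
  unfolding L2c_def
proof (intro conjI)
  note [measurable] = L2c_measurable[OF f] L2c_measurable[OF g]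
  show "continuous_on UNIV (f + g)" using f g unfolding plus_fun_def L2c_def by (auto intro: continuous_intros)
  show "integrable lborel (\<lambda>t. (cmod ((f + g) t))\<^sup>2)"
  proof (rule Bochner_Integration.integrable_bound)
    show "integrable lborel (\<lambda>t. 2 * (cmod (f t))\<^sup>2 + 2 * (cmod (g t))\<^sup>2)"
      using f g by (auto simp: L2c_def)
    have "(cmod (f t + g t))\<^sup>2 \<le> 2 * (cmod (f t))\<^sup>2 + 2 * (cmod (g t))\<^sup>2" for t
    proof -
      have "(cmod (f t + g t))\<^sup>2 \<le> (cmod (f t) + cmod (g t))\<^sup>2"
        by (intro power_mono norm_triangle_ineq) auto
      also have "\<dots> \<le> 2 * (cmod (f t))\<^sup>2 + 2 * (cmod (g t))\<^sup>2"
        using sum_squares_bound[of "cmod (f t)" "cmod (g t)"] by (simp add: power2_sum)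
      finally show ?thesis .
    qed
    then show "AE t in lborel. norm ((cmod ((f + g) t))\<^sup>2) \<le> norm (2 * (cmod (f t))\<^sup>2 + 2 * (cmod (g t))\<^sup>2)" by auto
    show "(\<lambda>t. (cmod ((f + g) t))\<^sup>2) \<in> borel_measurable lborel" unfolding plus_fun_def by measurable
  qed
qed

lemma L2c_cscale: "L2c f \<Longrightarrow> L2c (cscale c f)"
  by (auto simp: L2c_def cscale_def norm_mult power_mult_distrib intro: continuous_intros)

lemma L2c_minus: "L2c f \<Longrightarrow> L2c g \<Longrightarrow> L2c (f - g)"
  using L2c_add[of f "cscale (-1) g"] L2c_cscale[of g "-1"]
  by (simp add: cscale_def plus_fun_def fun_diff_def)

lemma L2c_tfshift:
  assumes "L2c f" shows "L2c (tfshift z f)"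
proof -
  have c: "continuous_on UNIV f" and i: "integrable lborel (\<lambda>t. (cmod (f t))\<^sup>2)"
    using assms by (auto simp: L2c_def)
  have "continuous_on UNIV (\<lambda>t. f (t - fst z))"
    by (rule continuous_on_compose2[OF c]) (auto intro: continuous_intros)
  then have "continuous_on UNIV (tfshift z f)" unfolding tfshift_def by (auto intro!: continuous_intros)
  moreover have "integrable lborel (\<lambda>t. (cmod (f (t + - fst z)))\<^sup>2)"
    using i by (subst lborel_integral_translate(2)[of "\<lambda>t. (cmod (f t))\<^sup>2"])
  ultimately show ?thesis by (simp add: L2c_def tfshift_def norm_mult)
qed

lemma cmod_tfshift: "cmod (tfshift z f t) = cmod (f (t - fst z))"
  by (simp add: tfshift_def norm_mult)

lemma measurable_tfshift [measurable]:
  assumes "Z \<in> borel_measurable M" "T \<in> borel_measurable M" "g \<in> borel_measurable borel"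
  shows "(\<lambda>x. tfshift (Z x) g (T x)) \<in> borel_measurable M"
proof -
  note [measurable] = assms
  have [measurable]: "(\<lambda>x. fst (Z x)) \<in> borel_measurable M" "(\<lambda>x. snd (Z x)) \<in> borel_measurable M"
    using assms(1) measurable_compose[OF assms(1), of fst borel] measurable_compose[OF assms(1), of snd borel]
    by (auto simp: borel_prod[symmetric])
  show ?thesis unfolding tfshift_def by measurable
qed

lemma measurable_l2_inner [measurable]:
  assumes "(\<lambda>(x, t). F x t) \<in> borel_measurable (M \<Otimes>\<^sub>M borel)" "(\<lambda>(x, t). G x t) \<in> borel_measurable (M \<Otimes>\<^sub>M borel)"
  shows "(\<lambda>x. l2_inner (F x) (G x)) \<in> borel_measurable M"
proof -
  note [measurable] = assms
  show ?thesis unfolding l2_inner_def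
    by (rule lborel.borel_measurable_lebesgue_integral) measurable
qed

lemma measurable_stft_param:
  assumes "Z \<in> borel_measurable M" "(\<lambda>(x, t). F x t) \<in> borel_measurable (M \<Otimes>\<^sub>M borel)" "g \<in> borel_measurable borel"
  shows "(\<lambda>x. stft g (F x) (Z x)) \<in> borel_measurable M"
proof -
  note [measurable] = assms
  show ?thesis unfolding stft_def by measurable
qed

lemma measurable_stft [measurable]:
  assumes "Z \<in> borel_measurable M" "f \<in> borel_measurable borel" "g \<in> borel_measurable borel"
  shows "(\<lambda>x. stft g f (Z x)) \<in> borel_measurable M"
  using assms by (intro measurable_stft_param) (auto simp: case_prod_beta')

lemma l2_inner_cnj: "l2_inner g f = cnj (l2_inner f g)"
proof -
  have "cnj (LINT t|lborel. f t * cnj (g t)) = (LINT t|lborel. cnj (f t * cnj (g t)))"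
    by (rule Bochner_Integration.integral_cnj[symmetric])
  then show ?thesis by (simp add: l2_inner_def mult.commute)
qed

lemma l2_inner_add_left: "L2c f \<Longrightarrow> L2c g \<Longrightarrow> L2c h \<Longrightarrow> l2_inner (f + g) h = l2_inner f h + l2_inner g h"
  unfolding l2_inner_def
  by (subst Bochner_Integration.integral_add[symmetric])
    (auto intro: L2c_mult_integrable simp: algebra_simps plus_fun_def)

lemma l2_inner_diff_left: "L2c f \<Longrightarrow> L2c g \<Longrightarrow> L2c h \<Longrightarrow> l2_inner (f - g) h = l2_inner f h - l2_inner g h"
  unfolding l2_inner_def
  by (subst Bochner_Integration.integral_diff[symmetric])
    (auto intro: L2c_mult_integrable simp: algebra_simps fun_diff_def)

lemma l2_inner_cscale_left: "l2_inner (cscale c f) g = c * l2_inner f g"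
  unfolding l2_inner_def cscale_def by (simp add: mult.assoc)

text \<open>Both terms on the right are invariant under time-frequency shifts, so this crude bound
  controls a short-time Fourier transform uniformly in its argument.\<close>

lemma l2_inner_le:
  assumes f: "L2c f" and g: "L2c g"
  shows "cmod (l2_inner f g) \<le> (LINT t|lborel. (cmod (f t))\<^sup>2) + (LINT t|lborel. (cmod (g t))\<^sup>2)"
proof -
  have "cmod (l2_inner f g) \<le> (LINT t|lborel. cmod (f t * cnj (g t)))"
    unfolding l2_inner_def by (rule integral_norm_bound)
  also have "\<dots> \<le> (LINT t|lborel. (cmod (f t))\<^sup>2 + (cmod (g t))\<^sup>2)"
    using f g two_mult_le_squares L2c_mult_integrable[OF f g]
    by (intro integral_mono integrable_norm) (auto simp: L2c_def norm_mult)
  also have "\<dots> = (LINT t|lborel. (cmod (f t))\<^sup>2) + (LINT t|lborel. (cmod (g t))\<^sup>2)"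
    using f g by (intro Bochner_Integration.integral_add) (auto simp: L2c_def)
  finally show ?thesis .
qed

lemma stft_add: "L2c f \<Longrightarrow> L2c g \<Longrightarrow> L2c h \<Longrightarrow> stft h (f + g) z = stft h f z + stft h g z"
  by (simp add: stft_def l2_inner_add_left L2c_tfshift)

lemma stft_diff: "L2c f \<Longrightarrow> L2c g \<Longrightarrow> L2c h \<Longrightarrow> stft h (f - g) z = stft h f z - stft h g z"
  by (simp add: stft_def l2_inner_diff_left L2c_tfshift)

lemma stft_cscale: "stft h (cscale c f) z = c * stft h f z"
  by (simp add: stft_def l2_inner_cscale_left)

text \<open>Time-frequency shifts compose only up to a unimodular phase, which modulation past
  translation produces. The phase depends on \<open>u\<close>, so continuity arguments in
  \<open>u\<close> have to follow it.\<close>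

lemma tfshift_tfshift:
  "tfshift u (tfshift z g) = cscale (cis (- 2 * pi * (snd z \<bullet> fst u))) (tfshift (u + z) g)"
proof (rule ext)
  fix t
  have e: "cis (2 * pi * (snd u \<bullet> t)) * cis (2 * pi * (snd z \<bullet> (t - fst u)))
    = cis (- 2 * pi * (snd z \<bullet> fst u)) * cis (2 * pi * ((snd u + snd z) \<bullet> t))"
    unfolding cis_mult by (simp add: inner_diff_right inner_add_left right_diff_distrib distrib_left add_diff_eq)
  have "t - fst u - fst z = t - (fst u + fst z)" by (simp add: diff_diff_eq)
  then show "tfshift u (tfshift z g) t = cscale (cis (- 2 * pi * (snd z \<bullet> fst u))) (tfshift (u + z) g) t"
    unfolding tfshift_def cscale_def fst_add snd_add mult.assoc[symmetric] e by (simp add: diff_diff_eq)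
qed

lemma tfshift_add: "tfshift u (f + g) = tfshift u f + tfshift u g"
  by (rule ext) (simp add: tfshift_def algebra_simps)

lemma tfshift_diff: "tfshift u (f - g) = tfshift u f - tfshift u g"
  by (rule ext) (simp add: tfshift_def algebra_simps)

lemma tfshift_cscale: "tfshift u (cscale c f) = cscale c (tfshift u f)"
  by (rule ext) (simp add: tfshift_def cscale_def algebra_simps)

text \<open>Covariance: translate the integration variable by \<open>fst u\<close> and collect the
  phases. Estimates only need its modulus, in which the phase disappears and a plain translation
  remains.\<close>

lemma stft_tfshift:
  "stft g (tfshift u f) z = cis (2 * pi * ((snd u - snd z) \<bullet> fst u)) * stft g f (z - u)"
proof -
  let ?F = "\<lambda>t. tfshift u f t * cnj (tfshift z g t)"
  have "stft g (tfshift u f) z = (LINT t|lborel. ?F (t + fst u))"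
    unfolding stft_def l2_inner_def by (rule lborel_integral_translate(1)[symmetric])
  also have "\<dots> = (LINT t|lborel. cis (2 * pi * ((snd u - snd z) \<bullet> fst u)) * (f t * cnj (tfshift (z - u) g t)))"
  proof (rule Bochner_Integration.integral_cong[OF refl])
    fix t
    have e: "cis (2 * pi * (snd u \<bullet> (t + fst u))) * cis (- (2 * pi * (snd z \<bullet> (t + fst u))))
      = cis (2 * pi * ((snd u - snd z) \<bullet> fst u)) * cis (- (2 * pi * ((snd z - snd u) \<bullet> t)))"
      unfolding cis_mult by (rule arg_cong[of _ _ cis]) (simp add: inner_diff_left inner_add_right right_diff_distrib distrib_left)
    have "?F (t + fst u) = (cis (2 * pi * (snd u \<bullet> (t + fst u))) * cis (- (2 * pi * (snd z \<bullet> (t + fst u))))) * (f t * cnj (g (t + fst u - fst z)))"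
      by (simp add: tfshift_def cis_cnj)
    then show "?F (t + fst u) = cis (2 * pi * ((snd u - snd z) \<bullet> fst u)) * (f t * cnj (tfshift (z - u) g t))"
      unfolding e by (simp add: tfshift_def cis_cnj diff_add_eq diff_diff_eq2)
  qed
  finally show ?thesis by (simp add: stft_def l2_inner_def)
qed

lemma cmod_stft_tfshift: "cmod (stft g (tfshift u f) z) = cmod (stft g f (z - u))"
  by (simp add: stft_tfshift norm_mult)

text \<open>Exchanging window and argument conjugates the bracket. This lets a kernel be read as a
  function of either of its two phase-space variables.\<close>

lemma stft_swap: "stft f (tfshift z g) u = cnj (stft g (tfshift u f) z)"
  unfolding stft_def by (rule l2_inner_cnj)

lemma cmod_stft_swap: "cmod (stft f (tfshift z g) u) = cmod (stft g f (z - u))"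
  by (simp add: stft_swap[of f] cmod_stft_tfshift)

lemma L2c_gauss: "L2c (gauss :: real^'d \<Rightarrow> complex)"
proof -
  have "(cmod (gauss t))\<^sup>2 = exp (- (2 * pi) * (norm t)\<^sup>2)" for t :: "real^'d"
    by (simp add: gauss_def power2_eq_square flip: exp_add)
  moreover have "integrable lborel (\<lambda>t::real^'d. exp (- (2 * pi) * (norm t)\<^sup>2))" by (rule integrable_gaussian) simp
  ultimately show ?thesis by (auto simp: L2c_def gauss_def intro!: continuous_intros)
qed

text \<open>The squared \<open>L\<^sup>2\<close> norm of \<open>gauss\<close>
  (\<open>l2_inner_gauss\<close>), the constant that appears whenever the Gaussian serves both for
  analysis and for synthesis.\<close>

definition gmass :: "'d::finite itself \<Rightarrow> real" where "gmass _ = 1 / sqrt 2 ^ DIM(real^'d)"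

lemma gmass_pos [simp]: "0 < gmass TYPE('d::finite)" by (simp add: gmass_def)

lemma cmod_stft_gauss_gauss:
  fixes z :: "(real^'d) \<times> (real^'d)"
  shows "cmod (stft gauss gauss z) = gmass TYPE('d) * exp (- (pi / 2) * (norm z)\<^sup>2)"
proof -
  obtain x w where z: "z = (x, w)" by (cases z)
  let ?F = "\<lambda>t. gauss t * cnj (tfshift z gauss t)"
  \<comment> \<open>Moving the origin to the midpoint \<open>x / 2\<close> makes the product of the
    two Gaussians symmetric. By the parallelogram law a factor depending on \<open>x\<close> alone
    splits off, and a Gaussian Fourier integral in \<open>- w\<close> remains.\<close>
  have "stft gauss gauss z = (LINT t|lborel. ?F (t + (1/2) *\<^sub>R x))"
    unfolding stft_def l2_inner_def by (rule lborel_integral_translate(1)[symmetric])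
  also have "\<dots> = (LINT t|lborel. (of_real (exp (- (pi / 2) * (norm x)\<^sup>2)) * cis (- pi * (w \<bullet> x))) * (exp (- pi * 2 * (norm t)\<^sup>2) * cis (2 * pi * (t \<bullet> (- w)))))"
  proof (rule Bochner_Integration.integral_cong[OF refl])
    fix t :: "real^'d"
    have n: "(norm (t + (1/2) *\<^sub>R x))\<^sup>2 + (norm (t - (1/2) *\<^sub>R x))\<^sup>2 = 2 * (norm t)\<^sup>2 + (norm x)\<^sup>2 / 2"
      unfolding power2_norm_eq_inner by (simp add: inner_add_left inner_add_right inner_diff_left inner_diff_right inner_commute)
    have t: "t + (1/2) *\<^sub>R x - x = t - (1/2) *\<^sub>R x" by (simp add: algebra_simps flip: scaleR_add_left)
    have "gauss (t + (1/2) *\<^sub>R x) * gauss (t - (1/2) *\<^sub>R x) = of_real (exp (- pi * (2 * (norm t)\<^sup>2 + (norm x)\<^sup>2 / 2)))"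
      unfolding n[symmetric] gauss_def by (simp add: distrib_left mult_exp_exp flip: of_real_mult)
    also have "\<dots> = of_real (exp (- (pi / 2) * (norm x)\<^sup>2) * exp (- pi * 2 * (norm t)\<^sup>2))"
      by (simp add: mult_exp_exp algebra_simps)
    finally have g: "gauss (t + (1/2) *\<^sub>R x) * gauss (t - (1/2) *\<^sub>R x) = of_real (exp (- (pi / 2) * (norm x)\<^sup>2) * exp (- pi * 2 * (norm t)\<^sup>2))" .
    have c: "cis (- (2 * pi * (w \<bullet> (t + (1/2) *\<^sub>R x)))) = cis (- pi * (w \<bullet> x)) * cis (2 * pi * (t \<bullet> (- w)))"
      unfolding cis_mult by (simp add: inner_add_right inner_commute algebra_simps)
    have "cnj (gauss s) = gauss s" for s :: "real^'d" by (simp add: gauss_def)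
    then have "?F (t + (1/2) *\<^sub>R x) = (gauss (t + (1/2) *\<^sub>R x) * gauss (t - (1/2) *\<^sub>R x)) * cis (- (2 * pi * (w \<bullet> (t + (1/2) *\<^sub>R x))))"
      by (simp add: tfshift_def z cis_cnj t)
    then show "?F (t + (1/2) *\<^sub>R x) = (of_real (exp (- (pi / 2) * (norm x)\<^sup>2)) * cis (- pi * (w \<bullet> x))) * (exp (- pi * 2 * (norm t)\<^sup>2) * cis (2 * pi * (t \<bullet> (- w))))"
      unfolding g c by (simp add: mult_ac)
  qed
  also have "\<dots> = (of_real (exp (- (pi / 2) * (norm x)\<^sup>2)) * cis (- pi * (w \<bullet> x))) * (exp (- pi * (norm (- w))\<^sup>2 / 2) / sqrt 2 ^ DIM(real^'d))"
    by (subst integral_mult_right_zero, subst gaussian_fourier(2)) auto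
  finally have "cmod (stft gauss gauss z) = exp (- (pi / 2) * (norm x)\<^sup>2) * exp (- (pi / 2) * (norm w)\<^sup>2) / sqrt 2 ^ DIM(real^'d)"
    by (simp add: norm_mult norm_divide norm_power)
  also have "exp (- (pi / 2) * (norm x)\<^sup>2) * exp (- (pi / 2) * (norm w)\<^sup>2) = exp (- (pi / 2) * (norm z)\<^sup>2)"
    unfolding mult_exp_exp z by (simp add: norm_Pair algebra_simps)
  finally show ?thesis by (simp add: gmass_def)
qed

lemma l2_inner_gauss: "l2_inner gauss (gauss :: real^'d \<Rightarrow> complex) = of_real (gmass TYPE('d))"
proof -
  have "gauss t * cnj (gauss t) = of_real (exp (- pi * 2 * (norm t)\<^sup>2))" for t :: "real^'d"
    by (simp add: gauss_def mult_exp_exp flip: of_real_mult)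
  then have "l2_inner gauss (gauss :: real^'d \<Rightarrow> complex) = (LINT t|lborel. of_real (exp (- pi * 2 * (norm (t::real^'d))\<^sup>2)))"
    by (simp add: l2_inner_def)
  also have "\<dots> = of_real (LINT t|lborel. exp (- pi * 2 * (norm (t::real^'d))\<^sup>2))"
    by (rule integral_complex_of_real)
  also have "\<dots> = of_real (gmass TYPE('d))" by (subst integral_gaussian) (auto simp: gmass_def)
  finally show ?thesis .
qed

text \<open>Boundedness and integrability are what Fubini's theorem asks of the windows in the
  inversion formula. By \<open>nice_window\<close> every function of finite \<open>M\<^sup>1\<close>
  norm qualifies.\<close>

definition window :: "(real^'d \<Rightarrow> complex) \<Rightarrow> bool" where
  "window f \<longleftrightarrow> continuous_on UNIV f \<and> integrable lborel f \<and> (\<exists>B. \<forall>t. cmod (f t) \<le> B)"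

lemma window_L2c: assumes "window f" shows "L2c f"
proof -
  obtain B where B: "\<And>t. cmod (f t) \<le> B" using assms by (auto simp: window_def)
  have c: "continuous_on UNIV f" and i: "integrable lborel f" using assms by (auto simp: window_def)
  have [measurable]: "f \<in> borel_measurable borel" by (rule borel_measurable_continuous_onI[OF c])
  have "integrable lborel (\<lambda>t. (cmod (f t))\<^sup>2)"
  proof (rule Bochner_Integration.integrable_bound)
    show "integrable lborel (\<lambda>t. B * cmod (f t))" using i by auto
    have "(cmod (f t))\<^sup>2 \<le> B * cmod (f t)" for t
      unfolding power2_eq_square by (intro mult_right_mono B) auto
    then show "AE t in lborel. norm ((cmod (f t))\<^sup>2) \<le> norm (B * cmod (f t))"
      by (auto intro: order_trans[OF _ abs_ge_self])
  qed measurable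
  with c show ?thesis by (simp add: L2c_def)
qed

lemma window_gauss: "window (gauss :: real^'d \<Rightarrow> complex)"
proof -
  have "integrable lborel (\<lambda>t::real^'d. exp (- pi * (norm t)\<^sup>2))" by (rule integrable_gaussian) simp
  then have "integrable lborel (\<lambda>t::real^'d. complex_of_real (exp (- pi * (norm t)\<^sup>2)))" by (rule integrable_of_real)
  moreover have g: "gauss = (\<lambda>t::real^'d. complex_of_real (exp (- pi * (norm t)\<^sup>2)))" by (rule ext) (simp add: gauss_def)
  ultimately show ?thesis unfolding window_def g by (auto intro!: continuous_intros exI[of _ 1])
qed

lemma integrable_fst_snd:
  fixes F :: "'a::euclidean_space \<times> 'b::euclidean_space \<Rightarrow> 'c::{banach, second_countable_topology}"
  assumes "integrable lborel F"
  shows "(LINT z|lborel. F z) = (LINT x|lborel. LINT y|lborel. F (x, y))"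
  using lborel_pair.integral_fst'[of F] assms by (simp add: lborel_prod)

text \<open>Inserting the factor \<open>exp (- \<pi> |\<omega>|\<^sup>2 / n\<^sup>2)\<close> makes the integral over \<open>\<omega>\<close> converge
  to a Gaussian approximate identity, so that only continuity of \<open>h\<close> at \<open>t\<close> matters.\<close>

lemma stft_inversion:
  fixes h \<phi>1 \<phi>2 :: "real^'d \<Rightarrow> complex"
  assumes h: "L2c h" and w1: "window \<phi>1" and w2: "window \<phi>2" and V: "integrable lborel (stft \<phi>2 h)"
  shows "(LINT z|lborel. stft \<phi>2 h z * tfshift z \<phi>1 t) = l2_inner \<phi>1 \<phi>2 * h t"
proof -
  note [measurable] = L2c_measurable[OF h] L2c_measurable[OF window_L2c[OF w1]] L2c_measurable[OF window_L2c[OF w2]]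
  obtain B1 where B1: "\<And>t. cmod (\<phi>1 t) \<le> B1" using w1 by (auto simp: window_def)
  obtain B2 where B2: "\<And>t. cmod (\<phi>2 t) \<le> B2" using w2 by (auto simp: window_def)
  have B0: "0 \<le> B1" "0 \<le> B2" using B1 B2 norm_ge_zero order_trans by blast+
  have i1: "integrable lborel \<phi>1" and c2: "continuous_on UNIV \<phi>2" using w1 w2 by (auto simp: window_def)
  let ?e = "\<lambda>n \<omega>. exp (- pi * (1 / (real n)\<^sup>2) * (norm (\<omega>::real^'d))\<^sup>2)"
  let ?D = "\<lambda>n r. real n ^ DIM(real^'d) * exp (- pi * (real n)\<^sup>2 * (norm (r::real^'d))\<^sup>2)"
  \<comment> \<open>The cross-correlation of the two windows. At 0 it equals
    \<open>l2_inner \<phi>1 \<phi>2\<close>, so \<open>k 0\<close> will be the right-hand side of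
    the claim.\<close>
  define c where "c r = (LINT x|lborel. cnj (\<phi>2 (x - r)) * \<phi>1 x)" for r
  have [measurable]: "c \<in> borel_measurable borel"
    unfolding c_def by measurable
  define k where "k r = h (t - r) * c r" for r
  have [measurable]: "k \<in> borel_measurable borel" unfolding k_def by measurable
  have c_le: "cmod (c r) \<le> B2 * (LINT x|lborel. cmod (\<phi>1 x))" for r
  proof -
    have "cmod (c r) \<le> (LINT x|lborel. cmod (cnj (\<phi>2 (x - r)) * \<phi>1 x))" unfolding c_def by (rule integral_norm_bound)
    also have "\<dots> \<le> (LINT x|lborel. B2 * cmod (\<phi>1 x))"
      using i1 B2 B0 by (intro integral_mono_AE' integrable_mult_right integrable_norm) (auto simp: norm_mult intro!: mult_right_mono)
    finally show ?thesis by simp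
  qed
  have "isCont c 0"
  proof -
    have "continuous_on UNIV c" unfolding c_def
    proof (rule continuous_on_sequentially[THEN iffD2], safe)
      fix X :: "nat \<Rightarrow> real^'d" and a assume X: "X \<longlonglongrightarrow> a"
      show "((\<lambda>r. LINT x|lborel. cnj (\<phi>2 (x - r)) * \<phi>1 x) \<circ> X) \<longlonglongrightarrow> (LINT x|lborel. cnj (\<phi>2 (x - a)) * \<phi>1 x)"
        unfolding comp_def
      proof (rule integral_dominated_convergence[where w="\<lambda>x. B2 * cmod (\<phi>1 x)"])
        show "AE x in lborel. (\<lambda>i. cnj (\<phi>2 (x - X i)) * \<phi>1 x) \<longlonglongrightarrow> cnj (\<phi>2 (x - a)) * \<phi>1 x"
        proof (rule AE_I2, intro tendsto_mult tendsto_const tendsto_cnj)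
          fix x show "(\<lambda>i. \<phi>2 (x - X i)) \<longlonglongrightarrow> \<phi>2 (x - a)"
            using c2 X by (intro continuous_on_tendsto_compose[OF c2] tendsto_intros) auto
        qed
      qed (use i1 B2 in \<open>auto simp: norm_mult intro!: mult_right_mono\<close>)
    qed
    then show ?thesis by (simp add: continuous_on_eq_continuous_at)
  qed
  moreover have "isCont (\<lambda>r. h (t - r)) 0"
  proof -
    have "isCont h (t - 0)" using h by (simp add: L2c_def continuous_on_eq_continuous_at)
    then show ?thesis by (intro isCont_o2[of 0 "\<lambda>r. t - r" h]) auto
  qed
  ultimately have kcont: "isCont k 0" unfolding k_def by (rule isCont_mult[rotated])
  \<comment> \<open>\<open>h\<close> is only square-integrable; multiplied by a Gaussian it becomes
    integrable. Both the assumption of the approximate identity and the later use of Fubini's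
    theorem rest on this.\<close>
  have hg: "integrable lborel (\<lambda>s. exp (- a * (norm (t - s))\<^sup>2) * cmod (h s))" if a: "0 < a" for a :: real
  proof (rule Bochner_Integration.integrable_bound)
    have "integrable lborel (\<lambda>s. exp (- (2 * a) * (norm (t - s))\<^sup>2))"
      using integrable_gaussian[of "2 * a", where 'a="real^'d"] a
      by (subst lborel_integral_reflect(2)[of "\<lambda>s. exp (- (2 * a) * (norm s)\<^sup>2)" t]) auto
    then show "integrable lborel (\<lambda>s. exp (- (2 * a) * (norm (t - s))\<^sup>2) + (cmod (h s))\<^sup>2)"
      using h by (auto simp: L2c_def)
    have "exp (- a * (norm (t - s))\<^sup>2) * cmod (h s) \<le> exp (- (2 * a) * (norm (t - s))\<^sup>2) + (cmod (h s))\<^sup>2" for s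
      using two_mult_le_squares[of "exp (- a * (norm (t - s))\<^sup>2)" "cmod (h s)"]
      by (simp add: exp_double[symmetric] mult.assoc)
    then show "AE s in lborel. norm (exp (- a * (norm (t - s))\<^sup>2) * cmod (h s)) \<le> norm (exp (- (2 * a) * (norm (t - s))\<^sup>2) + (cmod (h s))\<^sup>2)"
      by (auto intro: order_trans[OF _ abs_ge_self])
  qed measurable
  have kint: "integrable lborel (\<lambda>r. exp (- pi * (norm r)\<^sup>2) * k r)"
  proof (rule integrable_dominated)
    have "integrable lborel (\<lambda>r. exp (- pi * (norm (t - (t - r)))\<^sup>2) * cmod (h (t - r)))"
      using hg[of pi] by (subst lborel_integral_reflect(2)[of "\<lambda>s. exp (- pi * (norm (t - s))\<^sup>2) * cmod (h s)" t]) auto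
    then show "integrable lborel (\<lambda>r. exp (- pi * (norm r)\<^sup>2) * cmod (h (t - r)) * (B2 * (LINT x|lborel. cmod (\<phi>1 x))))" by simp
    have "exp (- pi * (norm r)\<^sup>2) * cmod (h (t - r)) * cmod (c r) \<le> exp (- pi * (norm r)\<^sup>2) * cmod (h (t - r)) * (B2 * (LINT x|lborel. cmod (\<phi>1 x)))" for r
      by (intro mult_left_mono c_le) auto
    then show "norm (exp (- pi * (norm r)\<^sup>2) * k r) \<le> exp (- pi * (norm r)\<^sup>2) * cmod (h (t - r)) * (B2 * (LINT x|lborel. cmod (\<phi>1 x)))" for r
      by (simp add: k_def norm_mult mult.assoc del: mult_le_cancel_left)
  qed measurable
  have lim1: "(\<lambda>n. LINT r|lborel. ?D n r * k r) \<longlonglongrightarrow> k 0"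
    by (rule gaussian_approximate_identity[OF _ kint kcont]) measurable
  have Vs: "integrable lborel (\<lambda>z. stft \<phi>2 h z * tfshift z \<phi>1 t)"
  proof (rule integrable_dominated[OF integrable_mult_right[OF integrable_norm[OF V], of B1]])
    show "norm (stft \<phi>2 h z * tfshift z \<phi>1 t) \<le> B1 * norm (stft \<phi>2 h z)" for z
      unfolding norm_mult cmod_tfshift by (subst mult.commute) (rule mult_right_mono[OF B1], simp)
  qed measurable
  have lim2: "(\<lambda>n. LINT z|lborel. ?e n (snd z) * (stft \<phi>2 h z * tfshift z \<phi>1 t)) \<longlonglongrightarrow> (LINT z|lborel. stft \<phi>2 h z * tfshift z \<phi>1 t)"
  proof (rule integral_dominated_convergence[OF _ _ integrable_norm[OF Vs]])
    show "AE z in lborel. (\<lambda>n. ?e n (snd z) * (stft \<phi>2 h z * tfshift z \<phi>1 t)) \<longlonglongrightarrow> stft \<phi>2 h z * tfshift z \<phi>1 t"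
    proof (rule AE_I2)
      fix z :: "(real^'d) \<times> (real^'d)"
      have "(\<lambda>n. (1 / real n)\<^sup>2) \<longlonglongrightarrow> 0\<^sup>2" by (intro tendsto_intros lim_1_over_n)
      then have "(\<lambda>n. 1 / (real n)\<^sup>2) \<longlonglongrightarrow> 0" by (simp add: power_divide)
      then have "(\<lambda>n. of_real (?e n (snd z)) * (stft \<phi>2 h z * tfshift z \<phi>1 t)) \<longlonglongrightarrow> of_real (exp (- pi * 0 * (norm (snd z))\<^sup>2)) * (stft \<phi>2 h z * tfshift z \<phi>1 t)"
        by (intro tendsto_intros)
      then show "(\<lambda>n. ?e n (snd z) * (stft \<phi>2 h z * tfshift z \<phi>1 t)) \<longlonglongrightarrow> stft \<phi>2 h z * tfshift z \<phi>1 t" by simp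
    qed
    show "AE z in lborel. norm (of_real (?e n (snd z)) * (stft \<phi>2 h z * tfshift z \<phi>1 t)) \<le> norm (stft \<phi>2 h z * tfshift z \<phi>1 t)" for n
      by (auto simp: norm_mult intro!: mult_left_le_one_le)
  qed measurable
  \<comment> \<open>At a fixed \<open>n\<close> the damping factor permits Fubini's theorem: the
    integral over the frequency gives \<open>?D n (t - s)\<close>, the one over the position gives
    \<open>c (t - s)\<close>, and the variable \<open>r = t - s\<close> remains.\<close>
  have eq: "(LINT z|lborel. ?e n (snd z) * (stft \<phi>2 h z * tfshift z \<phi>1 t)) = (LINT r|lborel. ?D n r * k r)" if n: "n > 0" for n
  proof -
    have s: "0 < 1 / (real n)\<^sup>2" using n by simp
    have ei: "integrable lborel (\<lambda>\<omega>. complex_of_real (?e n \<omega>))"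
      using gaussian_fourier(1)[OF s, of "0::real^'d"] by simp
    have "integrable lborel (\<lambda>z. of_real (?e n (snd z)) * (stft \<phi>2 h z * tfshift z \<phi>1 t))"
      by (rule Bochner_Integration.integrable_bound[OF Vs]) (auto simp: norm_mult intro!: mult_left_le_one_le)
    then have "(LINT z|lborel. ?e n (snd z) * (stft \<phi>2 h z * tfshift z \<phi>1 t))
       = (LINT x|lborel. LINT \<omega>|lborel. ?e n \<omega> * (stft \<phi>2 h (x, \<omega>) * tfshift (x, \<omega>) \<phi>1 t))"
      by (subst integrable_fst_snd) auto
    also have "\<dots> = (LINT x|lborel. LINT s|lborel. (h s * cnj (\<phi>2 (s - x)) * \<phi>1 (t - x)) * of_real (?D n (t - s)))"
    proof (rule Bochner_Integration.integral_cong[OF refl])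
      fix x :: "real^'d"
      let ?f = "\<lambda>\<omega> s. of_real (?e n \<omega>) * ((h s * cnj (tfshift (x, \<omega>) \<phi>2 s)) * tfshift (x, \<omega>) \<phi>1 t)"
      have hx: "integrable lborel (\<lambda>s. h s * cnj (tfshift (x, 0) \<phi>2 s))"
        by (intro L2c_mult_integrable h L2c_tfshift window_L2c w2)
      have "integrable (lborel \<Otimes>\<^sub>M lborel) (\<lambda>(\<omega>, s). of_real (?e n \<omega>) * (h s * cnj (tfshift (x, 0) \<phi>2 s) * \<phi>1 (t - x)))"
        by (intro integrable_tensor ei integrable_mult_left hx)
      then have fi: "integrable (lborel \<Otimes>\<^sub>M lborel) (\<lambda>(\<omega>, s). ?f \<omega> s)"
        by (rule Bochner_Integration.integrable_bound) (measurable, auto simp: norm_mult cmod_tfshift mult.assoc)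
      have "(LINT \<omega>|lborel. ?e n \<omega> * (stft \<phi>2 h (x, \<omega>) * tfshift (x, \<omega>) \<phi>1 t)) = (LINT \<omega>|lborel. LINT s|lborel. ?f \<omega> s)"
        by (simp add: stft_def l2_inner_def)
      also have "\<dots> = (LINT s|lborel. LINT \<omega>|lborel. ?f \<omega> s)"
        using lborel_pair.Fubini_integral[OF fi] by simp
      also have "\<dots> = (LINT s|lborel. (h s * cnj (\<phi>2 (s - x)) * \<phi>1 (t - x)) * of_real (?D n (t - s)))"
      proof (rule Bochner_Integration.integral_cong[OF refl])
        fix s :: "real^'d"
        have cc: "cnj (cis (2 * pi * (\<omega> \<bullet> s))) * cis (2 * pi * (\<omega> \<bullet> t)) = cis (2 * pi * (\<omega> \<bullet> (t - s)))" for \<omega> :: "real^'d"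
          unfolding cis_cnj cis_mult by (simp add: inner_diff_right algebra_simps)
        have "?f \<omega> s = (h s * cnj (\<phi>2 (s - x)) * \<phi>1 (t - x)) * (of_real (?e n \<omega>) * (cnj (cis (2 * pi * (\<omega> \<bullet> s))) * cis (2 * pi * (\<omega> \<bullet> t))))" for \<omega>
          by (simp add: tfshift_def mult_ac)
        then have "(LINT \<omega>|lborel. ?f \<omega> s) = (LINT \<omega>|lborel. (h s * cnj (\<phi>2 (s - x)) * \<phi>1 (t - x)) * (of_real (?e n \<omega>) * cis (2 * pi * (\<omega> \<bullet> (t - s)))))"
          unfolding cc by (intro Bochner_Integration.integral_cong refl)
        also have "\<dots> = (h s * cnj (\<phi>2 (s - x)) * \<phi>1 (t - x)) * (LINT \<omega>|lborel. of_real (?e n \<omega>) * cis (2 * pi * (\<omega> \<bullet> (t - s))))"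
          by (rule integral_mult_right_zero)
        also have "(LINT \<omega>|lborel. of_real (?e n \<omega>) * cis (2 * pi * (\<omega> \<bullet> (t - s)))) = of_real (?D n (t - s))"
          using n by (subst gaussian_fourier(2)[OF s]) (simp add: real_sqrt_divide power_divide mult_ac)
        finally show "(LINT \<omega>|lborel. ?f \<omega> s) = (h s * cnj (\<phi>2 (s - x)) * \<phi>1 (t - x)) * of_real (?D n (t - s))" .
      qed
      finally show "(LINT \<omega>|lborel. ?e n \<omega> * (stft \<phi>2 h (x, \<omega>) * tfshift (x, \<omega>) \<phi>1 t)) = (LINT s|lborel. (h s * cnj (\<phi>2 (s - x)) * \<phi>1 (t - x)) * of_real (?D n (t - s)))" .
    qed
    also have "\<dots> = (LINT s|lborel. LINT x|lborel. (h s * cnj (\<phi>2 (s - x)) * \<phi>1 (t - x)) * of_real (?D n (t - s)))"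
    proof (rule lborel_pair.Fubini_integral[symmetric])
      have p1: "integrable lborel (\<lambda>x. B2 * cmod (\<phi>1 (t - x)))"
        using i1 by (intro integrable_mult_right integrable_norm) (subst lborel_integral_reflect(2), auto)
      have "integrable lborel (\<lambda>s. real n ^ DIM(real^'d) * (exp (- (pi * (real n)\<^sup>2) * (norm (t - s))\<^sup>2) * cmod (h s)))"
        using n by (intro integrable_mult_right hg) auto
      from integrable_tensor[OF p1 this]
      show "integrable (lborel \<Otimes>\<^sub>M lborel) (\<lambda>(x, s). (h s * cnj (\<phi>2 (s - x)) * \<phi>1 (t - x)) * of_real (?D n (t - s)))"
      proof (rule Bochner_Integration.integrable_bound)
        have "cmod (\<phi>2 (s - x)) * (cmod (\<phi>1 (t - x)) * (?D n (t - s) * cmod (h s))) \<le> B2 * (cmod (\<phi>1 (t - x)) * (?D n (t - s) * cmod (h s)))" for x s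
          by (intro mult_right_mono B2) auto
        then show "AE z in lborel \<Otimes>\<^sub>M lborel. norm (case z of (x, s) \<Rightarrow> (h s * cnj (\<phi>2 (s - x)) * \<phi>1 (t - x)) * of_real (?D n (t - s)))
            \<le> norm (case z of (x, s) \<Rightarrow> B2 * cmod (\<phi>1 (t - x)) * (real n ^ DIM(real^'d) * (exp (- (pi * (real n)\<^sup>2) * (norm (t - s))\<^sup>2) * cmod (h s))))"
          using B0 by (auto simp: norm_mult norm_power mult_ac)
      qed measurable
    qed
    also have "\<dots> = (LINT s|lborel. of_real (?D n (t - s)) * k (t - s))"
    proof (rule Bochner_Integration.integral_cong[OF refl])
      fix s :: "real^'d"
      have "c (t - s) = (LINT x|lborel. cnj (\<phi>2 (s - x)) * \<phi>1 (t - x))"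
        unfolding c_def using lborel_integral_reflect(1)[of "\<lambda>x. cnj (\<phi>2 (x - (t - s))) * \<phi>1 x" t] by simp
      moreover have "(LINT x|lborel. (h s * cnj (\<phi>2 (s - x)) * \<phi>1 (t - x)) * of_real (?D n (t - s)))
          = (LINT x|lborel. (of_real (?D n (t - s)) * h s) * (cnj (\<phi>2 (s - x)) * \<phi>1 (t - x)))"
        by (rule Bochner_Integration.integral_cong[OF refl]) (simp only: mult_ac)
      moreover have "\<dots> = (of_real (?D n (t - s)) * h s) * (LINT x|lborel. cnj (\<phi>2 (s - x)) * \<phi>1 (t - x))"
        by (rule integral_mult_right_zero)
      ultimately show "(LINT x|lborel. (h s * cnj (\<phi>2 (s - x)) * \<phi>1 (t - x)) * of_real (?D n (t - s))) = of_real (?D n (t - s)) * k (t - s)"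
        by (simp only: k_def) simp
    qed
    also have "\<dots> = (LINT r|lborel. of_real (?D n r) * k r)"
      by (rule lborel_integral_reflect(1)) measurable
    finally show ?thesis .
  qed
  have "(\<lambda>n. LINT z|lborel. ?e n (snd z) * (stft \<phi>2 h z * tfshift z \<phi>1 t)) \<longlonglongrightarrow> k 0"
    by (rule Lim_transform_eventually[OF lim1])
      (rule eventually_mono[OF eventually_gt_at_top[of 0]], rule eq[symmetric])
  from LIMSEQ_unique[OF lim2 this] show ?thesis
    by (simp add: k_def c_def l2_inner_def mult.commute)
qed

subsection \<open>Weights\<close>

text \<open>The interface contains the constant weight (\<open>weight_one\<close>) and is closed
  under products (\<open>weight_mult\<close>), so one set of estimates serves \<open>w\<close>,
  \<open>w * v\<close>, \<open>w * v * v\<close> and the unweighted case.\<close>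

locale weight =
  fixes v :: "(real^'d) \<times> (real^'d) \<Rightarrow> real"
  assumes cont: "continuous_on UNIV v" and pos: "0 < v z" and even: "v (- z) = v z"
    and zero: "v 0 = 1" and submult: "v (z1 + z2) \<le> v z1 * v z2"
begin

lemma ge_1: "1 \<le> v z"
proof -
  have "1 \<le> v z * v z" using submult[of z "- z"] by (simp add: even zero)
  then show ?thesis using pos[of z] by (metis less_imp_le mult_le_one not_le order.strict_trans1 mult_strict_mono' mult_1 less_eq_real_def)
qed

lemma nonneg [simp]: "0 \<le> v z" using pos[of z] by simp

lemma measurable_weight [measurable]: "v \<in> borel_measurable borel"
  by (rule borel_measurable_continuous_onI[OF cont])

lemma diff_le: "v (x - y) \<le> v x * v y"
  using submult[of x "- y"] by (simp add: even)

lemma le_diff: "v x \<le> v (x - y) * v y"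
  using submult[of "x - y" y] by simp

lemma local_bound: "\<exists>B\<ge>1. \<forall>z. norm z \<le> R \<longrightarrow> v z \<le> B"
proof -
  have "compact (v ` cball 0 R)"
    by (intro compact_continuous_image continuous_on_subset[OF cont]) auto
  then obtain B where B: "\<And>x. x \<in> v ` cball 0 R \<Longrightarrow> norm x \<le> B"
    using compact_imp_bounded bounded_iff by metis
  have "v z \<le> max B 1" if "norm z \<le> R" for z using B[of "v z"] that by force
  then show ?thesis by (intro exI[of _ "max B 1"]) auto
qed

text \<open>Submultiplicativity and a bound \<open>B\<close> on the unit ball force at most
  exponential growth: \<open>z\<close> is \<open>n\<close> times a vector of norm at most 1 with
  \<open>n\<close> at most \<open>norm z + 1\<close>, so \<open>v z \<le> B ^ n\<close>.\<close>

lemma exp_bound: "\<exists>B k. 0 < B \<and> 0 \<le> k \<and> (\<forall>z. v z \<le> B * exp (k * norm z))"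
proof -
  obtain B where B: "1 \<le> B" "\<And>z. norm z \<le> 1 \<Longrightarrow> v z \<le> B" using local_bound[of 1] by blast
  have pw: "v (real n *\<^sub>R y) \<le> v y ^ n" for n y
  proof (induction n)
    case (Suc n)
    have "v (real (Suc n) *\<^sub>R y) \<le> v (real n *\<^sub>R y) * v y"
      using submult[of "real n *\<^sub>R y" y] by (simp add: algebra_simps)
    also have "\<dots> \<le> v y ^ n * v y" using Suc by (intro mult_right_mono) auto
    finally show ?case by (simp add: mult.commute)
  qed (simp add: zero)
  have "v z \<le> B * exp (ln B * norm z)" for z
  proof -
    define n where "n = Suc (nat \<lfloor>norm z\<rfloor>)"
    have k: "real n = real_of_int \<lfloor>norm z\<rfloor> + 1" by (simp add: n_def)
    have n: "norm z \<le> real n" "real n \<le> norm z + 1"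
      unfolding k using real_of_int_floor_add_one_ge[of "norm z"] of_int_floor_le[of "norm z"] by simp_all
    have np: "0 < n" by (simp add: n_def)
    have "real n *\<^sub>R ((1 / real n) *\<^sub>R z) = z" unfolding scaleR_scaleR using np by simp
    then have "v z = v (real n *\<^sub>R ((1 / real n) *\<^sub>R z))" by (rule arg_cong[of _ _ v, symmetric])
    also have "\<dots> \<le> v ((1 / real n) *\<^sub>R z) ^ n" by (rule pw)
    also have "\<dots> \<le> B ^ n"
    proof (intro power_mono B nonneg)
      show "norm ((1 / real n) *\<^sub>R z) \<le> 1" using n np by simp
    qed
    also have "\<dots> = exp (ln B * real n)" using B exp_of_nat_mult[of n "ln B"] by (simp add: mult.commute)
    also have "\<dots> \<le> exp (ln B * (norm z + 1))" using n B by (intro iffD2[OF exp_le_cancel_iff] mult_left_mono) auto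
    also have "\<dots> = B * exp (ln B * norm z)" using B by (simp add: algebra_simps exp_add)
    finally show ?thesis .
  qed
  then show ?thesis using B by (intro exI[of _ B] exI[of _ "ln B"]) auto
qed

text \<open>Half of the Gaussian decay absorbs the exponential growth of the weight; completing the
  square gives the constant \<open>exp (k\<^sup>2 / (2 * c))\<close>.\<close>

lemma gaussian_bound:
  assumes c: "0 < c" shows "\<exists>B>0. \<forall>z. exp (- c * (norm z)\<^sup>2) * v z \<le> B * exp (- (c / 2) * (norm z)\<^sup>2)"
proof -
  obtain B k where B: "0 < B" "0 \<le> k" "\<And>z. v z \<le> B * exp (k * norm z)" using exp_bound by blast
  have "exp (- c * (norm z)\<^sup>2) * v z \<le> (B * exp (k\<^sup>2 / (2 * c))) * exp (- (c / 2) * (norm z)\<^sup>2)" for z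
  proof -
    have "0 \<le> (c * norm z - k)\<^sup>2 / (2 * c)" using c by simp
    then have e: "k * norm z \<le> (c / 2) * (norm z)\<^sup>2 + k\<^sup>2 / (2 * c)"
      using c by (simp add: power2_diff field_simps power2_eq_square)
    have "exp (- c * (norm z)\<^sup>2) * v z \<le> exp (- c * (norm z)\<^sup>2) * (B * exp (k * norm z))"
      by (intro mult_left_mono B) auto
    also have "\<dots> = B * exp (k * norm z - c * (norm z)\<^sup>2)" by (simp add: exp_diff exp_minus divide_simps)
    also have "\<dots> \<le> B * exp (k\<^sup>2 / (2 * c) - (c / 2) * (norm z)\<^sup>2)"
      using e B by (intro mult_left_mono) auto
    also have "\<dots> = (B * exp (k\<^sup>2 / (2 * c))) * exp (- (c / 2) * (norm z)\<^sup>2)"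
      by (simp add: mult.assoc mult_exp_exp)
    finally show ?thesis .
  qed
  then show ?thesis using B by (intro exI[of _ "B * exp (k\<^sup>2 / (2 * c))"]) auto
qed

lemma integrable_gaussian_weight:
  assumes c: "0 < c" shows "integrable lborel (\<lambda>z. exp (- c * (norm (z - u))\<^sup>2) * v z)"
proof -
  obtain B where B: "0 < B" "\<And>z. exp (- c * (norm z)\<^sup>2) * v z \<le> B * exp (- (c / 2) * (norm z)\<^sup>2)"
    using gaussian_bound[OF c] by blast
  have "integrable lborel (\<lambda>z. exp (- c * (norm z)\<^sup>2) * v z)"
  proof (rule integrable_dominated)
    show "integrable lborel (\<lambda>z::(real^'d) \<times> (real^'d). B * exp (- (c / 2) * (norm z)\<^sup>2))"
      using c by (intro integrable_mult_right integrable_gaussian) auto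
  qed (use B pos in \<open>auto simp: abs_mult less_imp_le\<close>)
  then have "integrable lborel (\<lambda>z. exp (- c * (norm (z + - u))\<^sup>2) * v (z + - u))"
    by (subst lborel_integral_translate(2))
  then have i: "integrable lborel (\<lambda>z. exp (- c * (norm (z - u))\<^sup>2) * v (z - u) * v u)" by simp
  show ?thesis
  proof (rule integrable_dominated[OF i])
    show "norm (exp (- c * (norm (z - u))\<^sup>2) * v z) \<le> exp (- c * (norm (z - u))\<^sup>2) * v (z - u) * v u" for z
      using mult_left_mono[OF le_diff[of z u], of "exp (- c * (norm (z - u))\<^sup>2)"] by (simp add: abs_mult mult.assoc)
  qed measurable
qed

end

lemma weight_submult: "submult_weight v \<Longrightarrow> weight v"
  unfolding submult_weight_def weight_def by blast

lemma weight_one: "weight (\<lambda>_. 1)"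
  by unfold_locales auto

lemma weight_mult:
  assumes "weight v" "weight w" shows "weight (\<lambda>z. w z * v z)"
proof -
  interpret v: weight v by fact
  interpret w: weight w by fact
  show ?thesis
  proof
    show "continuous_on UNIV (\<lambda>z. w z * v z)" by (intro continuous_intros v.cont w.cont)
    show "w (z1 + z2) * v (z1 + z2) \<le> w z1 * v z1 * (w z2 * v z2)" for z1 z2
      using mult_mono[OF w.submult v.submult, of z1 z2 z1 z2] by (simp add: mult_ac)
  qed (auto simp: v.pos w.pos v.even w.even v.zero w.zero)
qed

text \<open>The norm of \<open>M\<^sup>1\<^sub>v\<close> as one integral over phase space;
  \<open>M1_norm_eq\<close> identifies it with the iterated integral by Tonelli's theorem.\<close>

definition N1 :: "((real^'d) \<times> (real^'d) \<Rightarrow> real) \<Rightarrow> (real^'d \<Rightarrow> complex) \<Rightarrow> ennreal" where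
  "N1 v h = (\<integral>\<^sup>+z. ennreal (cmod (stft gauss h z)) * ennreal (v z) \<partial>lborel)"

text \<open>Finiteness of the norm alone suffices for integral estimates. Approximability by the
  special test space, the other ingredient of \<open>M1_space\<close>, is what makes shifts
  continuous in \<open>N1_tfshift_tendsto\<close>.\<close>

definition nice :: "((real^'d) \<times> (real^'d) \<Rightarrow> real) \<Rightarrow> (real^'d \<Rightarrow> complex) \<Rightarrow> bool" where
  "nice v h \<longleftrightarrow> L2c h \<and> N1 v h < top"

lemma niceD: "nice v h \<Longrightarrow> L2c h" "nice v h \<Longrightarrow> N1 v h < top" by (auto simp: nice_def)

lemma measurable_gauss [measurable]: "gauss \<in> borel_measurable borel"
  by (rule L2c_measurable[OF L2c_gauss])

lemma Lp_norm_1: "Lp_norm 1 M f = (\<integral>\<^sup>+x. f x \<partial>M)"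
  by (simp add: Lp_norm_def)

lemma M1_norm_eq:
  fixes h :: "real^'d \<Rightarrow> complex"
  assumes h: "L2c h" and [measurable]: "v \<in> borel_measurable borel" and v: "\<And>z. 0 \<le> v z"
  shows "M1_norm v h = N1 v h"
proof -
  note [measurable] = L2c_measurable[OF h]
  have m: "(\<lambda>z. ennreal (cmod (stft gauss h z) * v z)) \<in> borel_measurable borel" by measurable
  then have "(\<lambda>z. ennreal (cmod (stft gauss h z) * v z)) \<in> borel_measurable (lborel \<Otimes>\<^sub>M lborel)"
    by (simp add: lborel_prod)
  from lborel_pair.nn_integral_snd[OF this]
  show ?thesis
    by (simp add: M1_norm_def N1_def mixed_norm_def Lp_norm_1 lborel_prod ennreal_mult' v)
qed

lemma N1_mono: "(\<And>z. v z \<le> w z) \<Longrightarrow> N1 v h \<le> N1 w h"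
  unfolding N1_def by (intro nn_integral_mono mult_left_mono ennreal_leI) auto

lemma N1_add:
  assumes h: "L2c h" and k: "L2c k" and [measurable]: "v \<in> borel_measurable borel"
  shows "N1 v (h + k) \<le> N1 v h + N1 v k"
proof -
  note [measurable] = L2c_measurable[OF h] L2c_measurable[OF k]
  have "N1 v (h + k) \<le> (\<integral>\<^sup>+z. ennreal (cmod (stft gauss h z)) * ennreal (v z) + ennreal (cmod (stft gauss k z)) * ennreal (v z) \<partial>lborel)"
    unfolding N1_def
  proof (rule nn_integral_mono)
    fix z
    have "ennreal (cmod (stft gauss (h + k) z)) \<le> ennreal (cmod (stft gauss h z)) + ennreal (cmod (stft gauss k z))"
      by (simp add: stft_add[OF h k L2c_gauss] norm_triangle_ineq flip: ennreal_plus)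
    from mult_right_mono[OF this, of "ennreal (v z)"]
    show "ennreal (cmod (stft gauss (h + k) z)) * ennreal (v z) \<le> ennreal (cmod (stft gauss h z)) * ennreal (v z) + ennreal (cmod (stft gauss k z)) * ennreal (v z)"
      by (simp add: distrib_right)
  qed
  also have "\<dots> = N1 v h + N1 v k" unfolding N1_def by (rule nn_integral_add) auto
  finally show ?thesis .
qed

lemma N1_cscale:
  assumes h: "L2c h" and [measurable]: "v \<in> borel_measurable borel"
  shows "N1 v (cscale c h) = ennreal (cmod c) * N1 v h"
proof -
  note [measurable] = L2c_measurable[OF h]
  show ?thesis unfolding N1_def
    by (subst nn_integral_cmult[symmetric]) (auto simp: stft_cscale norm_mult ennreal_mult mult.assoc)
qed

lemma cscale_minus_one: "h - k = h + cscale (-1) k"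
  by (auto simp: fun_eq_iff cscale_def)

lemma N1_diff:
  assumes h: "L2c h" and k: "L2c k" and [measurable]: "v \<in> borel_measurable borel"
  shows "N1 v (h - k) \<le> N1 v h + N1 v k"
  using N1_add[OF h L2c_cscale[OF k] assms(3), of "-1"]
  unfolding cscale_minus_one[symmetric] N1_cscale[OF k assms(3)] by simp

lemma nice_one:
  assumes "weight v" "nice v h" shows "nice (\<lambda>_. 1) h"
  using assms N1_mono[of "\<lambda>_. 1" v h] weight.ge_1[OF assms(1)] by (auto simp: nice_def)

lemma nice_one_integrable:
  assumes "nice (\<lambda>_. 1) h" shows "integrable lborel (stft gauss h)"
  using assms L2c_measurable[of h] by (auto simp: nice_def N1_def integrable_iff_bounded)

text \<open>Inversion with Gaussian windows writes \<open>h\<close> as a superposition of shifted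
  Gaussians with integrable coefficients. Each of these is bounded by 1 and has the same integral,
  so \<open>h\<close> is bounded and integrable.\<close>

lemma nice_window:
  fixes h :: "real^'d \<Rightarrow> complex"
  assumes n: "nice (\<lambda>_. 1) h" shows "window h"
proof -
  have h: "L2c h" using n by (simp add: nice_def)
  note [measurable] = L2c_measurable[OF h]
  let ?V = "stft gauss h"
  have V: "integrable lborel ?V" by (rule nice_one_integrable[OF n])
  have g1: "cmod (gauss t) \<le> 1" for t :: "real^'d" by (simp add: gauss_def)
  have gi: "integrable lborel (gauss :: real^'d \<Rightarrow> complex)" using window_gauss[where 'd='d] by (simp add: window_def)
  have inv: "h t = of_real (1 / gmass TYPE('d)) * (LINT z|lborel. ?V z * tfshift z gauss t)" for t
  proof -
    have "gmass TYPE('d) \<noteq> 0" using gmass_pos[where 'd='d] by linarith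
    then show ?thesis using stft_inversion[OF h window_gauss window_gauss V, of t]
      by (simp add: l2_inner_gauss)
  qed
  have bd: "cmod (h t) \<le> 1 / gmass TYPE('d) * (LINT z|lborel. cmod (?V z))" for t
  proof -
    have "cmod (LINT z|lborel. ?V z * tfshift z gauss t) \<le> (LINT z|lborel. cmod (?V z * tfshift z gauss t))"
      by (rule integral_norm_bound)
    also have "\<dots> \<le> (LINT z|lborel. cmod (?V z))"
    proof (rule integral_mono_AE')
      show "integrable lborel (\<lambda>z. cmod (?V z))" by (rule integrable_norm[OF V])
      show "AE z in lborel. cmod (?V z * tfshift z gauss t) \<le> cmod (?V z)"
        using mult_left_mono[OF g1, of "cmod (?V _)"] by (intro AE_I2) (simp add: norm_mult cmod_tfshift)
    qed simp
    finally show ?thesis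
      by (subst inv) (simp add: divide_right_mono norm_mult norm_divide less_imp_le abs_of_pos)
  qed
  have "integrable (lborel \<Otimes>\<^sub>M lborel) (\<lambda>(z, t). ?V z * tfshift z gauss t)"
  proof (rule lborel_pair.Fubini_integrable)
    have "(LINT t|lborel. cmod (gauss (t - fst z))) = (LINT t|lborel. cmod (gauss (t::real^'d)))" for z :: "(real^'d) \<times> (real^'d)"
      using lborel_integral_translate(1)[of "\<lambda>t. cmod (gauss t)" "- fst z"] by simp
    then show "integrable lborel (\<lambda>z. LINT t|lborel. norm (case (z, t) of (z, t) \<Rightarrow> ?V z * tfshift z gauss t))"
      using V by (simp add: norm_mult cmod_tfshift)
    show "AE z in lborel. integrable lborel (\<lambda>t. case (z, t) of (z, t) \<Rightarrow> ?V z * tfshift z gauss t)"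
    proof (rule AE_I2)
      fix z :: "(real^'d) \<times> (real^'d)"
      have "integrable lborel (\<lambda>t::real^'d. cmod (gauss (t + - fst z)))"
        using gi by (subst lborel_integral_translate(2)[of "\<lambda>t. cmod (gauss t)"]) auto
      then have "integrable lborel (tfshift z gauss)"
        by (rule integrable_dominated) (auto simp: cmod_tfshift)
      then show "integrable lborel (\<lambda>t. case (z, t) of (z, t) \<Rightarrow> ?V z * tfshift z gauss t)" by simp
    qed
  qed measurable
  then have "integrable lborel (\<lambda>t. LINT z|lborel. ?V z * tfshift z gauss t)"
    using lborel_pair.integrable_snd by fastforce
  then have "integrable lborel (\<lambda>t. of_real (1 / gmass TYPE('d)) * (LINT z|lborel. ?V z * tfshift z gauss t))"
    by (rule integrable_mult_right)
  moreover have "h = (\<lambda>t. of_real (1 / gmass TYPE('d)) * (LINT z|lborel. ?V z * tfshift z gauss t))"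
    by (rule ext) (rule inv)
  ultimately have "integrable lborel h" by simp
  then show ?thesis using h bd unfolding window_def L2c_def by blast
qed

text \<open>The orthogonality relation follows from the pointwise inversion formula, multiplied by
  \<open>cnj (k t)\<close> and integrated over \<open>t\<close>.\<close>

lemma moyal_window:
  fixes h k \<phi>1 \<phi>2 :: "real^'d \<Rightarrow> complex"
  assumes h: "L2c h" and k: "window k" and w1: "window \<phi>1" and w2: "window \<phi>2"
    and V: "integrable lborel (stft \<phi>2 h)"
  shows "(LINT z|lborel. stft \<phi>2 h z * cnj (stft \<phi>1 k z)) = l2_inner \<phi>1 \<phi>2 * l2_inner h k"
proof -
  note [measurable] = L2c_measurable[OF h] L2c_measurable[OF window_L2c[OF w1]]
    L2c_measurable[OF window_L2c[OF w2]] L2c_measurable[OF window_L2c[OF k]]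
  obtain B where B: "\<And>t. cmod (\<phi>1 t) \<le> B" using w1 by (auto simp: window_def)
  let ?f = "\<lambda>z t. stft \<phi>2 h z * (cnj (k t) * tfshift z \<phi>1 t)"
  have "integrable lborel (\<lambda>t. B * cmod (k t))" using k by (auto simp: window_def)
  from integrable_tensor[OF integrable_norm[OF V] this]
  have fi: "integrable (lborel \<Otimes>\<^sub>M lborel) (\<lambda>(z, t). ?f z t)"
  proof (rule integrable_dominated)
    fix zt :: "((real^'d) \<times> (real^'d)) \<times> (real^'d)"
    obtain z t where zt: "zt = (z, t)" by (cases zt)
    have "cmod (k t) * cmod (\<phi>1 (t - fst z)) \<le> B * cmod (k t)"
      by (subst mult.commute) (rule mult_right_mono[OF B], simp)
    then show "norm (case zt of (z, t) \<Rightarrow> ?f z t) \<le> (case zt of (z, t) \<Rightarrow> cmod (stft \<phi>2 h z) * (B * cmod (k t)))"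
      by (auto simp: zt norm_mult cmod_tfshift intro!: mult_left_mono)
  qed measurable
  have "cnj (stft \<phi>1 k z) = (LINT t|lborel. cnj (k t) * tfshift z \<phi>1 t)" for z
    unfolding stft_def l2_inner_def by (subst Bochner_Integration.integral_cnj[symmetric]) simp
  then have "(LINT z|lborel. stft \<phi>2 h z * cnj (stft \<phi>1 k z)) = (LINT z|lborel. LINT t|lborel. ?f z t)"
    by (simp del: Bochner_Integration.integral_cnj)
  also have "\<dots> = (LINT t|lborel. LINT z|lborel. ?f z t)"
    by (rule lborel_pair.Fubini_integral[OF fi, symmetric])
  also have "\<dots> = (LINT t|lborel. l2_inner \<phi>1 \<phi>2 * (h t * cnj (k t)))"
  proof (rule Bochner_Integration.integral_cong[OF refl])
    fix t
    have "(LINT z|lborel. ?f z t) = (LINT z|lborel. cnj (k t) * (stft \<phi>2 h z * tfshift z \<phi>1 t))"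
      by (simp only: mult_ac)
    also have "\<dots> = cnj (k t) * (LINT z|lborel. stft \<phi>2 h z * tfshift z \<phi>1 t)" by (rule integral_mult_right_zero)
    also have "\<dots> = cnj (k t) * (l2_inner \<phi>1 \<phi>2 * h t)" by (simp only: stft_inversion[OF h w1 w2 V])
    finally show "(LINT z|lborel. ?f z t) = l2_inner \<phi>1 \<phi>2 * (h t * cnj (k t))" by (simp only: mult_ac)
  qed
  also have "\<dots> = l2_inner \<phi>1 \<phi>2 * l2_inner h k" unfolding l2_inner_def by (rule integral_mult_right_zero)
  finally show ?thesis .
qed

lemma N1_tfshift:
  assumes "weight v" and h: "L2c h" shows "N1 v (tfshift u h) \<le> ennreal (v u) * N1 v h"
proof -
  interpret weight v by fact
  note [measurable] = L2c_measurable[OF h]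
  have "N1 v (tfshift u h) = (\<integral>\<^sup>+z. ennreal (cmod (stft gauss h (z + - u))) * ennreal (v (z + - u + u)) \<partial>lborel)"
    unfolding N1_def by (simp add: cmod_stft_tfshift)
  also have "\<dots> = (\<integral>\<^sup>+z. ennreal (cmod (stft gauss h z)) * ennreal (v (z + u)) \<partial>lborel)"
    by (rule nn_integral_lborel_translate) measurable
  also have "\<dots> \<le> (\<integral>\<^sup>+z. ennreal (v u) * (ennreal (cmod (stft gauss h z)) * ennreal (v z)) \<partial>lborel)"
  proof (rule nn_integral_mono)
    fix z
    have "ennreal (v (z + u)) \<le> ennreal (v u) * ennreal (v z)"
      using submult[of z u] by (simp add: mult.commute flip: ennreal_mult)
    from mult_left_mono[OF this, of "ennreal (cmod (stft gauss h z))"]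
    show "ennreal (cmod (stft gauss h z)) * ennreal (v (z + u)) \<le> ennreal (v u) * (ennreal (cmod (stft gauss h z)) * ennreal (v z))"
      by (simp add: mult_ac)
  qed
  also have "\<dots> = ennreal (v u) * N1 v h" unfolding N1_def by (rule nn_integral_cmult) measurable
  finally show ?thesis .
qed

lemma nice_tfshift:
  assumes "weight v" "nice v h" shows "nice v (tfshift u h)"
proof -
  have "N1 v (tfshift u h) \<le> ennreal (v u) * N1 v h" by (rule N1_tfshift[OF assms(1) niceD(1)[OF assms(2)]])
  also have "\<dots> < top" using niceD(2)[OF assms(2)] by (simp add: ennreal_mult_less_top)
  finally show ?thesis using assms(2) L2c_tfshift[of h u] by (simp add: nice_def)
qed

lemma nice_gauss:
  assumes "weight v" shows "nice v (gauss :: real^'d \<Rightarrow> complex)"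
proof -
  interpret weight v by fact
  have "integrable lborel (\<lambda>z. gmass TYPE('d) * (exp (- (pi / 2) * (norm (z - 0))\<^sup>2) * v z))"
    by (intro integrable_mult_right integrable_gaussian_weight) simp
  then have "(\<integral>\<^sup>+z. ennreal (gmass TYPE('d) * (exp (- (pi / 2) * (norm (z - 0))\<^sup>2) * v z)) \<partial>lborel) < top"
    by (subst nn_integral_eq_integral) (auto simp: less_imp_le)
  then show ?thesis
    by (simp add: nice_def L2c_gauss N1_def cmod_stft_gauss_gauss ennreal_mult' less_imp_le mult.assoc)
qed

lemma nice_add:
  assumes "weight v" "nice v h" "nice v k" shows "nice v (h + k)"
  using N1_add[of h k v] assms weight.measurable_weight[OF assms(1)] L2c_add[of h k]
  by (auto simp: nice_def intro: le_less_trans)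

lemma nice_cscale:
  assumes "weight v" "nice v h" shows "nice v (cscale c h)"
  using N1_cscale[of h v c] assms weight.measurable_weight[OF assms(1)] L2c_cscale[of h c]
  by (auto simp: nice_def ennreal_mult_less_top)

lemma nice_zero: "weight v \<Longrightarrow> nice v 0"
  using nice_cscale[OF _ nice_gauss, of v 0] by (simp add: cscale_def zero_fun_def)

lemma nice_diff: "weight v \<Longrightarrow> nice v h \<Longrightarrow> nice v k \<Longrightarrow> nice v (h - k)"
  unfolding cscale_minus_one by (intro nice_add nice_cscale)

lemma ennreal_norm_integral_le:
  fixes f :: "'a \<Rightarrow> 'b::{banach, second_countable_topology}"
  shows "ennreal (norm (integral\<^sup>L M f)) \<le> (\<integral>\<^sup>+x. ennreal (norm (f x)) \<partial>M)"
  by (cases "integrable M f") (auto intro: integral_norm_bound_ennreal simp: not_integrable_integral_eq)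

text \<open>Change of window: the orthogonality relation with two Gaussian windows, applied to
  \<open>h\<close> and \<open>tfshift z \<phi>\<close>, expresses a transform with window
  \<open>\<phi>\<close> through Gaussian transforms, as a convolution up to phases.\<close>

lemma stft_le:
  fixes h \<phi> :: "real^'d \<Rightarrow> complex"
  assumes h: "nice (\<lambda>_. 1) h" and f: "nice (\<lambda>_. 1) \<phi>"
  shows "ennreal (gmass TYPE('d)) * ennreal (cmod (stft \<phi> h z))
    \<le> (\<integral>\<^sup>+y. ennreal (cmod (stft gauss h y)) * ennreal (cmod (stft gauss \<phi> (y - z))) \<partial>lborel)"
proof -
  have "(LINT y|lborel. stft gauss h y * cnj (stft gauss (tfshift z \<phi>) y)) = l2_inner gauss (gauss::real^'d\<Rightarrow>complex) * l2_inner h (tfshift z \<phi>)"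
    by (intro moyal_window nice_window[OF nice_tfshift] window_gauss nice_one_integrable niceD(1)[OF h] weight_one f h)
  then have "ennreal (gmass TYPE('d) * cmod (stft \<phi> h z)) = ennreal (cmod (LINT y|lborel. stft gauss h y * cnj (stft gauss (tfshift z \<phi>) y)))"
    by (simp add: l2_inner_gauss norm_mult stft_def less_imp_le)
  also have "\<dots> \<le> (\<integral>\<^sup>+y. ennreal (cmod (stft gauss h y * cnj (stft gauss (tfshift z \<phi>) y))) \<partial>lborel)"
    by (rule ennreal_norm_integral_le)
  also have "\<dots> = (\<integral>\<^sup>+y. ennreal (cmod (stft gauss h y)) * ennreal (cmod (stft gauss \<phi> (y - z))) \<partial>lborel)"
    by (simp add: norm_mult cmod_stft_tfshift ennreal_mult)
  finally show ?thesis by (simp add: ennreal_mult less_imp_le)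
qed

text \<open>The convolution estimate of \<open>stft_le\<close> in weighted \<open>L\<^sup>1\<close>:
  submultiplicativity and evenness distribute \<open>v z\<close> over the two factors at
  \<open>y\<close> and \<open>y - z\<close>, and Tonelli's theorem separates them.\<close>

lemma stft_N1_le:
  fixes h \<phi> :: "real^'d \<Rightarrow> complex"
  assumes W: "weight v" and h: "nice v h" and f: "nice v \<phi>"
  shows "ennreal (gmass TYPE('d)) * (\<integral>\<^sup>+z. ennreal (cmod (stft \<phi> h z)) * ennreal (v z) \<partial>lborel) \<le> N1 v h * N1 v \<phi>"
proof -
  interpret weight v by fact
  note [measurable] = L2c_measurable[OF niceD(1)[OF h]] L2c_measurable[OF niceD(1)[OF f]]
  let ?a = "\<lambda>y. ennreal (cmod (stft gauss h y))" and ?b = "\<lambda>y. ennreal (cmod (stft gauss \<phi> y))"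
  have "ennreal (gmass TYPE('d)) * (\<integral>\<^sup>+z. ennreal (cmod (stft \<phi> h z)) * ennreal (v z) \<partial>lborel)
     = (\<integral>\<^sup>+z. ennreal (gmass TYPE('d)) * ennreal (cmod (stft \<phi> h z)) * ennreal (v z) \<partial>lborel)"
    by (subst nn_integral_cmult[symmetric]) (auto simp: mult.assoc)
  also have "\<dots> \<le> (\<integral>\<^sup>+z. (\<integral>\<^sup>+y. ?a y * ?b (y - z) \<partial>lborel) * ennreal (v z) \<partial>lborel)"
    by (intro nn_integral_mono mult_right_mono stft_le nice_one[OF W] h f) simp
  also have "\<dots> = (\<integral>\<^sup>+z. \<integral>\<^sup>+y. ?a y * ?b (y - z) * ennreal (v z) \<partial>lborel \<partial>lborel)"
    by (subst nn_integral_multc) auto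
  also have "\<dots> \<le> (\<integral>\<^sup>+z. \<integral>\<^sup>+y. (?a y * ennreal (v y)) * (?b (y - z) * ennreal (v (y - z))) \<partial>lborel \<partial>lborel)"
  proof (intro nn_integral_mono)
    fix y z
    have "ennreal (v z) \<le> ennreal (v y) * ennreal (v (y - z))"
      using diff_le[of y "y - z"] by (simp flip: ennreal_mult)
    from mult_left_mono[OF this, of "?a y * ?b (y - z)"]
    show "?a y * ?b (y - z) * ennreal (v z) \<le> (?a y * ennreal (v y)) * (?b (y - z) * ennreal (v (y - z)))"
      by (simp add: mult_ac)
  qed
  also have "\<dots> = (\<integral>\<^sup>+y. \<integral>\<^sup>+z. (?a y * ennreal (v y)) * (?b (y - z) * ennreal (v (y - z))) \<partial>lborel \<partial>lborel)"
    by (rule lborel_pair.Fubini') measurable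
  also have "\<dots> = (\<integral>\<^sup>+y. (?a y * ennreal (v y)) * N1 v \<phi> \<partial>lborel)"
  proof (rule nn_integral_cong)
    fix y
    have "(\<integral>\<^sup>+z. ?b (y - z) * ennreal (v (y - z)) \<partial>lborel) = (\<integral>\<^sup>+z. ?b (z + y) * ennreal (v (z + y)) \<partial>lborel)"
      using nn_integral_lborel_reflect[of "\<lambda>z. ?b (z + y) * ennreal (v (z + y))"] by simp
    also have "\<dots> = N1 v \<phi>"
      unfolding N1_def using nn_integral_lborel_translate[of "\<lambda>z. ?b z * ennreal (v z)" y] by simp
    finally show "(\<integral>\<^sup>+z. (?a y * ennreal (v y)) * (?b (y - z) * ennreal (v (y - z))) \<partial>lborel) = (?a y * ennreal (v y)) * N1 v \<phi>"
      by (subst nn_integral_cmult) auto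
  qed
  also have "\<dots> = N1 v h * N1 v \<phi>" unfolding N1_def by (rule nn_integral_multc) measurable
  finally show ?thesis .
qed

lemma stft_N1_finite:
  fixes h \<phi> :: "real^'d \<Rightarrow> complex"
  assumes W: "weight v" and h: "nice v h" and f: "nice v \<phi>"
  shows "(\<integral>\<^sup>+z. ennreal (cmod (stft \<phi> h z)) * ennreal (v z) \<partial>lborel) < top"
proof -
  have "N1 v h * N1 v \<phi> < top" using niceD(2)[OF h] niceD(2)[OF f] by (simp add: ennreal_mult_less_top)
  with stft_N1_le[OF assms]
  have "ennreal (gmass TYPE('d)) * (\<integral>\<^sup>+z. ennreal (cmod (stft \<phi> h z)) * ennreal (v z) \<partial>lborel) < top"
    by (rule le_less_trans)
  then show ?thesis using gmass_pos[where 'd='d]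
    by (cases "(\<integral>\<^sup>+z. ennreal (cmod (stft \<phi> h z)) * ennreal (v z) \<partial>lborel)")
      (auto simp: ennreal_mult_top)
qed

lemma stft_integrable:
  assumes "nice (\<lambda>_. 1) h" "nice (\<lambda>_. 1) \<phi>" shows "integrable lborel (stft \<phi> h)"
  using stft_N1_finite[OF weight_one assms] L2c_measurable[OF niceD(1)[OF assms(1)]] L2c_measurable[OF niceD(1)[OF assms(2)]]
  by (auto simp: integrable_iff_bounded)

lemma moyal:
  assumes "nice (\<lambda>_. 1) h" "nice (\<lambda>_. 1) k" "nice (\<lambda>_. 1) \<phi>1" "nice (\<lambda>_. 1) \<phi>2"
  shows "(LINT z|lborel. stft \<phi>2 h z * cnj (stft \<phi>1 k z)) = l2_inner \<phi>1 \<phi>2 * l2_inner h k"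
  by (intro moyal_window niceD(1)[OF assms(1)] nice_window stft_integrable assms)

subsection \<open>The space \<open>M\<^sup>1\<close>\<close>

lemma special_test_space_tfshift:
  assumes "s \<in> special_test_space" shows "tfshift u s \<in> special_test_space"
proof -
  let ?S = "{s. tfshift u s \<in> special_test_space}"
  have "special_test_space \<subseteq> ?S" unfolding special_test_space_def
  proof (rule cfun.span_minimal)
    show "range (\<lambda>z. tfshift z gauss) \<subseteq> {s. tfshift u s \<in> cfun.span (range (\<lambda>z. tfshift z gauss))}"
      by (clarsimp simp only: mem_Collect_eq tfshift_tfshift) (intro cfun.span_scale cfun.span_base rangeI)
    have "tfshift u 0 = 0" by (simp add: tfshift_def zero_fun_def)
    then show "cfun.subspace {s. tfshift u s \<in> cfun.span (range (\<lambda>z. tfshift z gauss))}"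
      by (auto simp: cfun.subspace_def tfshift_add tfshift_cscale intro: cfun.span_add cfun.span_scale cfun.span_zero)
  qed
  with assms show ?thesis by auto
qed

context weight
begin

lemma nice_special: "s \<in> special_test_space \<Longrightarrow> nice v s"
proof -
  have "special_test_space \<subseteq> {s. nice v s}" unfolding special_test_space_def
    by (rule cfun.span_minimal)
      (auto simp: cfun.subspace_def intro: nice_zero nice_add nice_cscale nice_tfshift nice_gauss weight_axioms)
  then show "s \<in> special_test_space \<Longrightarrow> nice v s" by auto
qed

lemma M1_space_iff:
  "g \<in> M1_space v \<longleftrightarrow> L2c g \<and> (\<exists>s. (\<forall>n. s n \<in> special_test_space) \<and> (\<lambda>n. N1 v (g - s n)) \<longlonglongrightarrow> 0)"
proof -
  have "M1_norm v (g - s n) = N1 v (g - s n)" if "L2c g" "\<And>n. s n \<in> special_test_space" for s :: "nat \<Rightarrow> real^'d \<Rightarrow> complex" and n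
    using that nice_special niceD(1) by (intro M1_norm_eq L2c_minus) (auto simp: measurable_weight)
  then have "L2c g \<Longrightarrow> \<forall>n. s n \<in> special_test_space \<Longrightarrow> (\<lambda>n. M1_norm v (g - s n)) = (\<lambda>n. N1 v (g - s n))" for s :: "nat \<Rightarrow> real^'d \<Rightarrow> complex"
    by auto
  moreover have "g \<in> M1_space v \<longleftrightarrow> L2c g \<and> (\<exists>s. (\<forall>n. s n \<in> special_test_space) \<and> (\<lambda>n. M1_norm v (g - s n)) \<longlonglongrightarrow> 0)"
    by (simp add: M1_space_def L2c_def)
  ultimately show ?thesis by (metis (no_types, lifting))
qed

lemma M1_space_nice: assumes "g \<in> M1_space v" shows "nice v g"
proof -
  obtain s where s: "\<And>n. s n \<in> special_test_space" "(\<lambda>n. N1 v (g - s n)) \<longlonglongrightarrow> 0" and g: "L2c g"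
    using assms by (auto simp: M1_space_iff)
  obtain n where n: "N1 v (g - s n) < 1"
    using order_tendstoD(2)[OF s(2), of 1] by (auto simp: eventually_sequentially)
  have sn: "nice v (s n)" by (intro nice_special s)
  have "N1 v ((g - s n) + s n) \<le> N1 v (g - s n) + N1 v (s n)"
    by (intro N1_add L2c_minus g niceD(1)[OF sn] measurable_weight)
  also have "\<dots> < top" using less_trans[OF n ennreal_one_less_top] niceD(2)[OF sn] by simp
  finally show ?thesis using g by (simp add: nice_def)
qed

lemma M1_norm_M1: "g \<in> M1_space v \<Longrightarrow> M1_norm v g = N1 v g"
  using niceD(1)[OF M1_space_nice] by (intro M1_norm_eq measurable_weight) auto

lemma special_M1: assumes "s \<in> special_test_space" shows "s \<in> M1_space v"
proof -
  have "N1 v 0 = 0" by (simp add: N1_def stft_def l2_inner_def zero_fun_def)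
  then show ?thesis unfolding M1_space_iff
    using niceD(1)[OF nice_special[OF assms]] assms by (auto intro!: exI[of _ "\<lambda>_. s"])
qed

lemma M1_gauss: "gauss \<in> M1_space v"
proof (rule special_M1)
  have "tfshift 0 gauss = (gauss :: real^'d \<Rightarrow> complex)" by (rule ext) (simp add: tfshift_def)
  then show "(gauss :: real^'d \<Rightarrow> complex) \<in> special_test_space"
    unfolding special_test_space_def by (metis cfun.span_base rangeI)
qed

lemma M1_add: assumes g: "g \<in> M1_space v" and h: "h \<in> M1_space v" shows "g + h \<in> M1_space v"
proof -
  obtain s where s: "\<And>n. s n \<in> special_test_space" "(\<lambda>n. N1 v (g - s n)) \<longlonglongrightarrow> 0" and Lg: "L2c g"
    using g by (auto simp: M1_space_iff)
  obtain t where t: "\<And>n. t n \<in> special_test_space" "(\<lambda>n. N1 v (h - t n)) \<longlonglongrightarrow> 0" and Lh: "L2c h"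
    using h by (auto simp: M1_space_iff)
  have "(\<lambda>n. N1 v ((g + h) - (s n + t n))) \<longlonglongrightarrow> 0"
  proof (rule tendsto_sandwich[OF _ _ tendsto_const])
    show "(\<lambda>n. N1 v (g - s n) + N1 v (h - t n)) \<longlonglongrightarrow> 0" using tendsto_add[OF s(2) t(2)] by simp
    have e: "(g + h) - (s n + t n) = (g - s n) + (h - t n)" for n by (simp add: fun_eq_iff)
    show "\<forall>\<^sub>F n in sequentially. N1 v ((g + h) - (s n + t n)) \<le> N1 v (g - s n) + N1 v (h - t n)"
      unfolding e using niceD(1)[OF nice_special[OF s(1)]] niceD(1)[OF nice_special[OF t(1)]]
      by (intro always_eventually allI N1_add L2c_minus Lg Lh measurable_weight)
  qed auto
  moreover have "s n + t n \<in> special_test_space" for n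
    using s(1) t(1) unfolding special_test_space_def by (intro cfun.span_add)
  ultimately show ?thesis unfolding M1_space_iff using L2c_add[OF Lg Lh] by (intro conjI exI[of _ "\<lambda>n. s n + t n"]) auto
qed

text \<open>Scalings and time-frequency shifts preserve the closure of the special test space for
  one common reason: they preserve that space and are Lipschitz in the norm.\<close>

lemma M1_transform:
  assumes g: "g \<in> M1_space v" and C: "C < top" and T: "\<And>s. s \<in> special_test_space \<Longrightarrow> T s \<in> special_test_space"
    "\<And>h. L2c h \<Longrightarrow> L2c (T h)" "\<And>h k. L2c h \<Longrightarrow> L2c k \<Longrightarrow> N1 v (T h - T k) \<le> C * N1 v (h - k)"
  shows "T g \<in> M1_space v"
proof -
  obtain s where s: "\<And>n. s n \<in> special_test_space" "(\<lambda>n. N1 v (g - s n)) \<longlonglongrightarrow> 0" and Lg: "L2c g"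
    using g by (auto simp: M1_space_iff)
  have "(\<lambda>n. N1 v (T g - T (s n))) \<longlonglongrightarrow> 0"
  proof (rule tendsto_sandwich[OF _ _ tendsto_const])
    show "(\<lambda>n. C * N1 v (g - s n)) \<longlonglongrightarrow> 0" using ennreal_tendsto_cmult[OF C s(2)] by simp
    show "\<forall>\<^sub>F n in sequentially. N1 v (T g - T (s n)) \<le> C * N1 v (g - s n)"
      using niceD(1)[OF nice_special[OF s(1)]] Lg T(3) by (intro always_eventually allI) auto
  qed auto
  then show ?thesis unfolding M1_space_iff using s T Lg by (intro conjI exI[of _ "\<lambda>n. T (s n)"]) auto
qed

lemma M1_cscale: "g \<in> M1_space v \<Longrightarrow> cscale c g \<in> M1_space v"
proof (rule M1_transform[where C="ennreal (cmod c)" and T="cscale c"])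
  fix h k :: "real^'d \<Rightarrow> complex" assume "L2c h" "L2c k"
  moreover have "cscale c h - cscale c k = cscale c (h - k)" by (simp add: cscale_def fun_eq_iff algebra_simps)
  ultimately show "N1 v (cscale c h - cscale c k) \<le> ennreal (cmod c) * N1 v (h - k)"
    by (simp add: N1_cscale[OF L2c_minus measurable_weight])
qed (auto simp: special_test_space_def intro: cfun.span_scale L2c_cscale)

lemma M1_tfshift: "g \<in> M1_space v \<Longrightarrow> tfshift u g \<in> M1_space v"
  by (rule M1_transform[where C="ennreal (v u)" and T="tfshift u"])
    (auto simp: tfshift_diff[symmetric] intro: special_test_space_tfshift L2c_tfshift N1_tfshift L2c_minus weight_axioms)

lemma M1_zero: "0 \<in> M1_space v"
  using M1_cscale[OF M1_gauss, of 0] by (simp add: cscale_def zero_fun_def)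

lemma M1_diff: "g \<in> M1_space v \<Longrightarrow> h \<in> M1_space v \<Longrightarrow> g - h \<in> M1_space v"
  unfolding cscale_minus_one by (intro M1_add M1_cscale)

lemma M1_sum: "(\<And>i. i \<in> I \<Longrightarrow> g i \<in> M1_space v) \<Longrightarrow> (\<Sum>i\<in>I. g i) \<in> M1_space v"
  by (induction I rule: infinite_finite_induct) (auto intro: M1_add M1_zero)

lemma M1_space_mono:
  assumes g: "g \<in> M1_space W" and [measurable]: "W \<in> borel_measurable borel" and le: "\<And>z. v z \<le> W z"
  shows "g \<in> M1_space v"
proof -
  have Lg: "L2c g" using g by (auto simp: M1_space_def L2c_def)
  obtain s where s: "\<And>n. s n \<in> special_test_space" "(\<lambda>n. M1_norm W (g - s n)) \<longlonglongrightarrow> 0"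
    using g by (auto simp: M1_space_def)
  have "(\<lambda>n. N1 v (g - s n)) \<longlonglongrightarrow> 0"
  proof (rule tendsto_sandwich[OF _ _ tendsto_const s(2)])
    show "\<forall>\<^sub>F n in sequentially. N1 v (g - s n) \<le> M1_norm W (g - s n)"
    proof (intro always_eventually allI)
      fix n
      have "M1_norm W (g - s n) = N1 W (g - s n)"
        using order_trans[OF nonneg le] by (intro M1_norm_eq L2c_minus Lg niceD(1)[OF nice_special[OF s(1)]]) auto
      then show "N1 v (g - s n) \<le> M1_norm W (g - s n)" using N1_mono[OF le] by simp
    qed
  qed auto
  then show ?thesis unfolding M1_space_iff using Lg s(1) by blast
qed

end

subsection \<open>The reproducing formula on the antidual\<close>

lemma measurable_stft_tfshift [measurable]:
  assumes "Z \<in> borel_measurable M" "Y \<in> borel_measurable M" "f \<in> borel_measurable borel" "g \<in> borel_measurable borel"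
  shows "(\<lambda>x. stft g (tfshift (Z x) f) (Y x)) \<in> borel_measurable M"
proof -
  note [measurable] = assms
  show ?thesis by (rule measurable_stft_param) measurable
qed

lemma tendsto_tfshift:
  assumes c: "continuous_on UNIV f" and X: "X \<longlonglongrightarrow> x"
  shows "(\<lambda>n. tfshift (X n) f t) \<longlonglongrightarrow> tfshift x f t"
proof -
  have "(\<lambda>n. f (t - fst (X n))) \<longlonglongrightarrow> f (t - fst x)"
    by (rule continuous_on_tendsto_compose[OF c]) (auto intro!: tendsto_intros X)
  moreover have "(\<lambda>n. cis (2 * pi * (snd (X n) \<bullet> t))) \<longlonglongrightarrow> cis (2 * pi * (snd x \<bullet> t))"
    by (rule continuous_on_tendsto_compose[of UNIV cis]) (auto intro!: tendsto_intros continuous_intros X)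
  ultimately show ?thesis unfolding tfshift_def by (rule tendsto_mult[rotated])
qed

lemma tendsto_l2_inner_tfshift:
  assumes f: "window f" and k: "window k" and X: "X \<longlonglongrightarrow> x"
  shows "(\<lambda>n. l2_inner (tfshift (X n) f) k) \<longlonglongrightarrow> l2_inner (tfshift x f) k"
proof -
  obtain B where B: "\<And>t. cmod (f t) \<le> B" using f by (auto simp: window_def)
  note [measurable] = L2c_measurable[OF window_L2c[OF f]] L2c_measurable[OF window_L2c[OF k]]
  show ?thesis unfolding l2_inner_def
  proof (rule integral_dominated_convergence[where w="\<lambda>t. B * cmod (k t)"])
    show "integrable lborel (\<lambda>t. B * cmod (k t))" using k by (auto simp: window_def)
    show "AE t in lborel. (\<lambda>n. tfshift (X n) f t * cnj (k t)) \<longlonglongrightarrow> tfshift x f t * cnj (k t)"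
      using f by (intro AE_I2 tendsto_mult tendsto_const tendsto_tfshift X) (auto simp: window_def)
    show "AE t in lborel. norm (tfshift (X n) f t * cnj (k t)) \<le> B * cmod (k t)" for n
      by (intro AE_I2) (simp add: norm_mult cmod_tfshift mult_right_mono B)
  qed measurable
qed

text \<open>The clause on distances is not automatic for approximating simple functions; it is
  forced by the value 0 where it fails. Together with \<open>simple_weight_bound\<close> it
  dominates a weight at \<open>r n z\<close> by the weight at \<open>z\<close>, uniformly in
  \<open>n\<close>.\<close>

lemma simple_approximation:
  "\<exists>r :: nat \<Rightarrow> ('a::euclidean_space) \<Rightarrow> 'a. (\<forall>n. simple_function borel (r n)) \<and> (\<forall>z. (\<lambda>n. r n z) \<longlonglongrightarrow> z)
     \<and> (\<forall>n z. norm (r n z - z) \<le> 1 \<or> r n z = 0)"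
proof -
  obtain s :: "nat \<Rightarrow> 'a \<Rightarrow> 'a" where s: "\<And>i. simple_function borel (s i)" "\<And>x. (\<lambda>i. s i x) \<longlonglongrightarrow> x"
    using borel_measurable_implies_sequence_metric[of "\<lambda>x::'a. x" borel 0] by auto
  have [measurable]: "s i \<in> borel_measurable borel" for i using s(1) by (rule borel_measurable_simple_function)
  define r where "r n z = (if norm (s n z - z) \<le> 1 then s n z else 0)" for n z
  have "simple_function borel (r n)" for n
  proof (rule simple_function_borel_measurable)
    show "r n \<in> borel_measurable borel" unfolding r_def by measurable
    have "r n ` space borel \<subseteq> insert 0 (s n ` space borel)" by (auto simp: r_def)
    then show "finite (r n ` space borel)"
      using simple_functionD(1)[OF s(1)[of n]] by (auto intro: finite_subset)
  qed
  moreover have "(\<lambda>n. r n z) \<longlonglongrightarrow> z" for z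
  proof (rule Lim_transform_eventually[OF s(2)[of z]])
    have "\<forall>\<^sub>F n in sequentially. dist (s n z) z < 1" using s(2)[of z] by (rule tendstoD) simp
    then show "\<forall>\<^sub>F n in sequentially. s n z = r n z"
      by eventually_elim (simp add: r_def dist_norm)
  qed
  moreover have "norm (r n z - z) \<le> 1 \<or> r n z = 0" for n z by (simp add: r_def)
  ultimately show ?thesis by blast
qed

context weight
begin

text \<open>Dominated convergence: the transforms of Gaussians shifted by at most distance 1 from
  \<open>x\<close> lie below one wider Gaussian centred at \<open>x\<close>, which is integrable
  against every weight.\<close>

lemma N1_tfshift_gauss_tendsto:
  assumes X: "X \<longlonglongrightarrow> x"
  shows "(\<lambda>n. N1 v (tfshift (X n) gauss - tfshift x gauss)) \<longlonglongrightarrow> 0"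
proof -
  have *: "(\<lambda>n. N1 v (tfshift (X n) gauss - tfshift x gauss)) \<longlonglongrightarrow> 0"
    if X: "X \<longlonglongrightarrow> x" and b: "\<And>n. norm (X n - x) \<le> 1" for X
  proof -
    let ?m = "gmass TYPE('d)"
    let ?w = "\<lambda>y. 2 * ?m * exp (pi / 2) * (exp (- (pi / 4) * (norm (y - x))\<^sup>2) * v y)"
    \<comment> \<open>From \<open>norm (y - x) \<le> norm (y - u) + 1\<close> the square on the left
      is at most twice the square of \<open>norm (y - u)\<close> plus 2. This halves the rate from
      \<open>pi / 2\<close> to \<open>pi / 4\<close> at the price of
      \<open>exp (pi / 2)\<close>.\<close>
    have gb: "cmod (stft gauss (tfshift u gauss) y) \<le> ?m * exp (pi / 2) * exp (- (pi / 4) * (norm (y - x))\<^sup>2)"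
      if "norm (u - x) \<le> 1" for u y
    proof -
      have "norm (y - x) \<le> norm (y - u) + 1" using norm_triangle_ineq[of "y - u" "u - x"] that by simp
      then have "(norm (y - x))\<^sup>2 \<le> (norm (y - u) + 1)\<^sup>2" by (intro power_mono) auto
      also have "\<dots> \<le> 2 * (norm (y - u))\<^sup>2 + 2"
        using sum_squares_bound[of "norm (y - u)" 1] by (simp add: power2_sum)
      finally have "- (pi / 2) * (norm (y - u))\<^sup>2 \<le> pi / 2 + - (pi / 4) * (norm (y - x))\<^sup>2"
        using mult_left_mono[of "(norm (y - x))\<^sup>2" "2 * (norm (y - u))\<^sup>2 + 2" "pi / 4"] by (simp add: field_simps)
      then have "exp (- (pi / 2) * (norm (y - u))\<^sup>2) \<le> exp (pi / 2) * exp (- (pi / 4) * (norm (y - x))\<^sup>2)"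
        unfolding mult_exp_exp by (rule iffD2[OF exp_le_cancel_iff])
      then have "?m * exp (- (pi / 2) * (norm (y - u))\<^sup>2) \<le> ?m * (exp (pi / 2) * exp (- (pi / 4) * (norm (y - x))\<^sup>2))"
        by (rule mult_left_mono) (simp add: less_imp_le)
      then show ?thesis by (simp add: cmod_stft_tfshift cmod_stft_gauss_gauss mult.assoc)
    qed
    have "(\<lambda>n. N1 v (tfshift (X n) gauss - tfshift x gauss)) \<longlonglongrightarrow> (\<integral>\<^sup>+z. (0::ennreal) \<partial>(lborel :: ((real^'d) \<times> (real^'d)) measure))"
      unfolding N1_def stft_diff[OF L2c_tfshift[OF L2c_gauss] L2c_tfshift[OF L2c_gauss] L2c_gauss]
    proof (rule nn_integral_dominated_convergence[where w="\<lambda>y. ennreal (?w y)"])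
      have "integrable lborel ?w" by (intro integrable_mult_right integrable_gaussian_weight) simp
      then show "(\<integral>\<^sup>+y. ennreal (?w y) \<partial>lborel) < \<infinity>"
        by (subst nn_integral_eq_integral) (auto simp: less_imp_le)
      show "AE y in lborel. ennreal (cmod (stft gauss (tfshift (X n) gauss) y - stft gauss (tfshift x gauss) y)) * ennreal (v y) \<le> ennreal (?w y)" for n
      proof (rule AE_I2)
        fix y :: "(real^'d) \<times> (real^'d)"
        have "cmod (stft gauss (tfshift (X n) gauss) y - stft gauss (tfshift x gauss) y)
          \<le> cmod (stft gauss (tfshift (X n) gauss) y) + cmod (stft gauss (tfshift x gauss) y)" by (rule norm_triangle_ineq4)
        also have "\<dots> \<le> 2 * ?m * exp (pi / 2) * exp (- (pi / 4) * (norm (y - x))\<^sup>2)"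
          using gb[OF b[of n], of y] gb[of x y] by simp
        finally show "ennreal (cmod (stft gauss (tfshift (X n) gauss) y - stft gauss (tfshift x gauss) y)) * ennreal (v y) \<le> ennreal (?w y)"
          by (simp add: mult.assoc[symmetric] mult_right_mono ennreal_leI flip: ennreal_mult)
      qed
      show "AE y in lborel. (\<lambda>n. ennreal (cmod (stft gauss (tfshift (X n) gauss) y - stft gauss (tfshift x gauss) y)) * ennreal (v y)) \<longlonglongrightarrow> 0"
      proof (rule AE_I2)
        fix y :: "(real^'d) \<times> (real^'d)"
        have w: "window (tfshift y gauss)"
          by (rule nice_window[OF nice_tfshift[OF weight_one nice_gauss[OF weight_one]]])
        have "(\<lambda>n. stft gauss (tfshift (X n) gauss) y - stft gauss (tfshift x gauss) y) \<longlonglongrightarrow> stft gauss (tfshift x gauss) y - stft gauss (tfshift x gauss) y"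
          unfolding stft_def by (intro tendsto_diff tendsto_const tendsto_l2_inner_tfshift window_gauss w X)
        then have "(\<lambda>n. cmod (stft gauss (tfshift (X n) gauss) y - stft gauss (tfshift x gauss) y) * v y) \<longlonglongrightarrow> 0"
          by (intro tendsto_mult_left_zero tendsto_norm_zero) simp
        then have "(\<lambda>n. ennreal (cmod (stft gauss (tfshift (X n) gauss) y - stft gauss (tfshift x gauss) y) * v y)) \<longlonglongrightarrow> ennreal 0"
          by (rule tendsto_ennrealI)
        then show "(\<lambda>n. ennreal (cmod (stft gauss (tfshift (X n) gauss) y - stft gauss (tfshift x gauss) y)) * ennreal (v y)) \<longlonglongrightarrow> 0"
          by (simp add: ennreal_mult)
      qed
    qed measurable
    then show ?thesis by simp
  qed
  have "\<forall>\<^sub>F n in sequentially. dist (X n) x < 1" using X by (rule tendstoD) simp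
  then obtain N where N: "\<And>n. n \<ge> N \<Longrightarrow> dist (X n) x < 1" by (auto simp: eventually_sequentially)
  have "(\<lambda>n. N1 v (tfshift (X (n + N)) gauss - tfshift x gauss)) \<longlonglongrightarrow> 0"
    by (rule *[OF LIMSEQ_ignore_initial_segment[OF X]]) (use N in \<open>auto simp: dist_norm less_imp_le\<close>)
  then show ?thesis by (rule LIMSEQ_offset)
qed

lemma N1_tfshift_special_tendsto:
  assumes s: "s \<in> special_test_space" and X: "X \<longlonglongrightarrow> x"
  shows "(\<lambda>n. N1 v (tfshift (X n) s - tfshift x s)) \<longlonglongrightarrow> 0"
proof -
  let ?S = "{s. nice v s \<and> (\<lambda>n. N1 v (tfshift (X n) s - tfshift x s)) \<longlonglongrightarrow> 0}"
  note L = L2c_tfshift L2c_minus L2c_cscale niceD(1)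
  have "special_test_space \<subseteq> ?S" unfolding special_test_space_def
  proof (rule cfun.span_minimal)
    show "range (\<lambda>z. tfshift z gauss) \<subseteq> ?S"
    proof safe
      fix a b :: "real^'d"
      show "nice v (tfshift (a, b) gauss)" by (intro nice_tfshift nice_gauss weight_axioms)
      let ?z = "(a, b)"
      define c where "c u = cis (- 2 * pi * (b \<bullet> fst u))" for u :: "(real^'d) \<times> (real^'d)"
      \<comment> \<open>Two shifts in a row produce a phase, so the difference splits into a
        difference of shifted Gaussians and a difference of phases. Each converges to 0.\<close>
      have eq: "tfshift (X n) (tfshift ?z gauss) - tfshift x (tfshift ?z gauss)
         = cscale (c (X n)) (tfshift (X n + ?z) gauss - tfshift (x + ?z) gauss) + cscale (c (X n) - c x) (tfshift (x + ?z) gauss)" for n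
        unfolding tfshift_tfshift c_def by (simp add: cscale_def fun_eq_iff algebra_simps)
      show "(\<lambda>n. N1 v (tfshift (X n) (tfshift ?z gauss) - tfshift x (tfshift ?z gauss))) \<longlonglongrightarrow> 0"
      proof (rule tendsto_sandwich[OF _ _ tendsto_const])
        have "N1 v (tfshift (X n) (tfshift ?z gauss) - tfshift x (tfshift ?z gauss))
           \<le> N1 v (cscale (c (X n)) (tfshift (X n + ?z) gauss - tfshift (x + ?z) gauss)) + N1 v (cscale (c (X n) - c x) (tfshift (x + ?z) gauss))" for n
          unfolding eq by (intro N1_add L measurable_weight L2c_gauss)
        then show "\<forall>\<^sub>F n in sequentially. N1 v (tfshift (X n) (tfshift ?z gauss) - tfshift x (tfshift ?z gauss))
           \<le> N1 v (tfshift (X n + ?z) gauss - tfshift (x + ?z) gauss) + ennreal (cmod (c (X n) - c x)) * N1 v (tfshift (x + ?z) gauss)"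
          by (intro always_eventually allI) (simp add: N1_cscale[OF _ measurable_weight] L L2c_gauss c_def)
        have 1: "(\<lambda>n. N1 v (tfshift (X n + ?z) gauss - tfshift (x + ?z) gauss)) \<longlonglongrightarrow> 0"
          by (intro N1_tfshift_gauss_tendsto tendsto_add X tendsto_const)
        have "(\<lambda>n. c (X n)) \<longlonglongrightarrow> c x" unfolding c_def
          by (rule continuous_on_tendsto_compose[of UNIV cis]) (auto intro!: tendsto_intros continuous_intros X)
        then have "(\<lambda>n. cmod (c (X n) - c x)) \<longlonglongrightarrow> 0" by (simp add: LIM_zero tendsto_norm_zero)
        then have "(\<lambda>n. ennreal (cmod (c (X n) - c x))) \<longlonglongrightarrow> ennreal 0" by (rule tendsto_ennrealI)
        then have "(\<lambda>n. N1 v (tfshift (x + ?z) gauss) * ennreal (cmod (c (X n) - c x))) \<longlonglongrightarrow> N1 v (tfshift (x + ?z) gauss) * ennreal 0"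
          by (intro ennreal_tendsto_cmult niceD(2) nice_tfshift nice_gauss weight_axioms)
        then have 2: "(\<lambda>n. ennreal (cmod (c (X n) - c x)) * N1 v (tfshift (x + ?z) gauss)) \<longlonglongrightarrow> 0"
          by (simp add: mult.commute)
        show "(\<lambda>n. N1 v (tfshift (X n + ?z) gauss - tfshift (x + ?z) gauss) + ennreal (cmod (c (X n) - c x)) * N1 v (tfshift (x + ?z) gauss)) \<longlonglongrightarrow> 0"
          using tendsto_add[OF 1 2] by simp
      qed auto
    qed
    show "cfun.subspace ?S"
    proof (rule cfun.subspaceI)
      have "N1 v 0 = 0" by (simp add: N1_def stft_def l2_inner_def zero_fun_def)
      moreover have "tfshift u 0 = (0 :: real^'d \<Rightarrow> complex)" for u by (simp add: tfshift_def zero_fun_def)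
      ultimately show "0 \<in> ?S" by (simp add: nice_zero weight_axioms)
    next
      fix f g assume f: "f \<in> ?S" and g: "g \<in> ?S"
      have e: "tfshift u (f + g) - tfshift x (f + g) = (tfshift u f - tfshift x f) + (tfshift u g - tfshift x g)" for u
        by (simp add: tfshift_add)
      have "(\<lambda>n. N1 v (tfshift (X n) (f + g) - tfshift x (f + g))) \<longlonglongrightarrow> 0"
      proof (rule tendsto_sandwich[OF _ _ tendsto_const])
        show "(\<lambda>n. N1 v (tfshift (X n) f - tfshift x f) + N1 v (tfshift (X n) g - tfshift x g)) \<longlonglongrightarrow> 0"
          using f g tendsto_add[of "\<lambda>n. N1 v (tfshift (X n) f - tfshift x f)" 0 _ "\<lambda>n. N1 v (tfshift (X n) g - tfshift x g)" 0] by simp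
        show "\<forall>\<^sub>F n in sequentially. N1 v (tfshift (X n) (f + g) - tfshift x (f + g)) \<le> N1 v (tfshift (X n) f - tfshift x f) + N1 v (tfshift (X n) g - tfshift x g)"
          unfolding e using f g by (intro always_eventually allI N1_add L measurable_weight) auto
      qed auto
      then show "f + g \<in> ?S" using f g by (auto intro: nice_add weight_axioms)
    next
      fix c f assume f: "f \<in> ?S"
      have e: "tfshift u (cscale c f) - tfshift x (cscale c f) = cscale c (tfshift u f - tfshift x f)" for u
        unfolding tfshift_cscale by (simp add: cscale_def fun_eq_iff algebra_simps)
      have "L2c f" using f niceD(1) by auto
      then have "N1 v (tfshift (X n) (cscale c f) - tfshift x (cscale c f)) = ennreal (cmod c) * N1 v (tfshift (X n) f - tfshift x f)" for n
        unfolding e by (simp add: N1_cscale[OF _ measurable_weight] L2c_minus L2c_tfshift)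
      moreover have "(\<lambda>n. ennreal (cmod c) * N1 v (tfshift (X n) f - tfshift x f)) \<longlonglongrightarrow> 0"
        using f ennreal_tendsto_cmult[of "ennreal (cmod c)" "\<lambda>n. N1 v (tfshift (X n) f - tfshift x f)" 0] by simp
      ultimately show "cscale c f \<in> ?S" using f by (auto intro: nice_cscale weight_axioms)
    qed
  qed
  with s show ?thesis by auto
qed

text \<open>Strong continuity of the time-frequency shifts on \<open>M\<^sup>1\<^sub>v\<close>.
  Shifts along a convergent sequence are uniformly bounded because \<open>v\<close> is continuous,
  so convergence passes from the special test space to its closure.\<close>

lemma N1_tfshift_tendsto:
  assumes g: "g \<in> M1_space v" and X: "X \<longlonglongrightarrow> x"
  shows "(\<lambda>n. N1 v (tfshift (X n) g - tfshift x g)) \<longlonglongrightarrow> 0"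
proof (rule order_tendstoI)
  fix e :: ennreal assume e: "0 < e"
  have Lg: "L2c g" using M1_space_nice[OF g] by (rule niceD)
  obtain s where s: "\<And>n. s n \<in> special_test_space" "(\<lambda>n. N1 v (g - s n)) \<longlonglongrightarrow> 0"
    using g by (auto simp: M1_space_iff)
  \<comment> \<open>Eventually \<open>v (X n) < v x + 1\<close>, so \<open>K\<close> bounds the sum
    of the two shift norms at \<open>X n\<close> and at \<open>x\<close>.\<close>
  define K where "K = v x + 1 + v x"
  have K: "0 < K" using pos[of x] by (simp add: K_def add_pos_pos)
  obtain d where d: "0 < d" "d < e" using dense[OF e] by blast
  have "(\<lambda>n. ennreal K * N1 v (g - s n)) \<longlonglongrightarrow> ennreal K * 0" by (rule ennreal_tendsto_cmult[OF _ s(2)]) simp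
  from order_tendstoD(2)[OF this, of "d / 2"] d obtain i where i: "ennreal K * N1 v (g - s i) < d / 2"
    by (auto simp: eventually_sequentially ennreal_zero_less_divide)
  have Ls: "L2c (s i)" using nice_special[OF s(1)[of i]] by (rule niceD)
  have vl: "(\<lambda>n. v (X n)) \<longlonglongrightarrow> v x" by (rule continuous_on_tendsto_compose[OF cont X]) auto
  have "\<forall>\<^sub>F n in sequentially. v (X n) < v x + 1" by (rule order_tendstoD(2)[OF vl]) simp
  moreover have "\<forall>\<^sub>F n in sequentially. N1 v (tfshift (X n) (s i) - tfshift x (s i)) < d / 2"
    using d by (intro order_tendstoD(2)[OF N1_tfshift_special_tendsto[OF s(1) X]]) (simp add: ennreal_zero_less_divide)
  ultimately show "\<forall>\<^sub>F n in sequentially. N1 v (tfshift (X n) g - tfshift x g) < e"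
  proof eventually_elim
    case (elim n)
    note L = L2c_tfshift L2c_minus Ls Lg L2c_add
    have eq: "tfshift (X n) g - tfshift x g = tfshift (X n) (g - s i) - tfshift x (g - s i) + (tfshift (X n) (s i) - tfshift x (s i))"
      by (simp add: tfshift_diff)
    have "N1 v (tfshift (X n) g - tfshift x g) \<le> N1 v (tfshift (X n) (g - s i) - tfshift x (g - s i)) + N1 v (tfshift (X n) (s i) - tfshift x (s i))"
      by (subst eq, intro N1_add L measurable_weight)
    also have "N1 v (tfshift (X n) (g - s i) - tfshift x (g - s i)) \<le> N1 v (tfshift (X n) (g - s i)) + N1 v (tfshift x (g - s i))"
      by (intro N1_diff L measurable_weight)
    also have "\<dots> \<le> ennreal (v (X n)) * N1 v (g - s i) + ennreal (v x) * N1 v (g - s i)"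
      by (intro add_mono N1_tfshift weight_axioms L)
    also have "\<dots> \<le> ennreal (v x + 1) * N1 v (g - s i) + ennreal (v x) * N1 v (g - s i)"
      using elim(1) by (intro add_mono mult_right_mono ennreal_leI) auto
    also have "\<dots> = ennreal K * N1 v (g - s i)"
      unfolding K_def by (subst ennreal_plus[of "v x + 1"]) (auto simp: distrib_right intro: add_nonneg_nonneg)
    also have "ennreal K * N1 v (g - s i) + N1 v (tfshift (X n) (s i) - tfshift x (s i)) \<le> d / 2 + d / 2"
      using i elim(2) by (intro add_mono) auto
    also have "d / 2 + d / 2 = d"
      by (simp add: add_divide_distrib_ennreal[symmetric] mult_2_right[symmetric] ennreal_divide_times)
    finally show ?case using d(2) by (rule le_less_trans) (auto intro: add_right_mono)
  qed
qed auto

lemma antidual_add: "f \<in> M1_antidual v \<Longrightarrow> g \<in> M1_space v \<Longrightarrow> h \<in> M1_space v \<Longrightarrow> f (g + h) = f g + f h"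
  by (auto simp: M1_antidual_def)

lemma antidual_cscale: "f \<in> M1_antidual v \<Longrightarrow> g \<in> M1_space v \<Longrightarrow> f (cscale c g) = cnj c * f g"
  by (auto simp: M1_antidual_def)

lemma antidual_diff: "f \<in> M1_antidual v \<Longrightarrow> g \<in> M1_space v \<Longrightarrow> h \<in> M1_space v \<Longrightarrow> f (g - h) = f g - f h"
proof -
  assume *: "f \<in> M1_antidual v" "g \<in> M1_space v" "h \<in> M1_space v"
  have "f (g + cscale (-1) h) = f g + cnj (-1) * f h"
    by (simp only: antidual_add[OF *(1,2) M1_cscale[OF *(3)]] antidual_cscale[OF *(1,3)])
  then show "f (g - h) = f g - f h" unfolding cscale_minus_one[of g] by simp
qed

lemma antidual_zero: "f \<in> M1_antidual v \<Longrightarrow> f 0 = 0"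
  using antidual_cscale[of f gauss 0] M1_gauss by (simp add: cscale_def zero_fun_def)

lemma antidual_sum:
  assumes "f \<in> M1_antidual v" "\<And>i. i \<in> I \<Longrightarrow> g i \<in> M1_space v"
  shows "f (\<Sum>i\<in>I. g i) = (\<Sum>i\<in>I. f (g i))"
  using assms(2)
  by (induction I rule: infinite_finite_induct) (auto simp: antidual_zero[OF assms(1)] antidual_add[OF assms(1)] M1_sum)

lemma antidual_bound:
  assumes f: "f \<in> M1_antidual v"
  shows "\<exists>C\<ge>0. \<forall>g\<in>M1_space v. ennreal (cmod (f g)) \<le> ennreal C * N1 v g"
proof -
  obtain C where C: "\<And>g. g \<in> M1_space v \<Longrightarrow> cmod (f g) \<le> C * enn2real (M1_norm v g)"
    using f unfolding M1_antidual_def by blast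
  have "ennreal (cmod (f g)) \<le> ennreal (max C 0) * N1 v g" if g: "g \<in> M1_space v" for g
  proof -
    have "cmod (f g) \<le> C * enn2real (N1 v g)" using C[OF g] by (simp add: M1_norm_M1[OF g])
    also have "\<dots> \<le> max C 0 * enn2real (N1 v g)" by (intro mult_right_mono) auto
    finally have "ennreal (cmod (f g)) \<le> ennreal (max C 0 * enn2real (N1 v g))" by (rule ennreal_leI)
    then show ?thesis using niceD(2)[OF M1_space_nice[OF g]] by (simp add: ennreal_mult)
  qed
  then show ?thesis by (intro exI[of _ "max C 0"]) auto
qed

lemma antidual_tendsto:
  assumes f: "f \<in> M1_antidual v" and g: "\<And>n. g n \<in> M1_space v" "h \<in> M1_space v"
    and lim: "(\<lambda>n. N1 v (g n - h)) \<longlonglongrightarrow> 0"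
  shows "(\<lambda>n. f (g n)) \<longlonglongrightarrow> f h"
proof -
  obtain C where C: "0 \<le> C" "\<And>g. g \<in> M1_space v \<Longrightarrow> ennreal (cmod (f g)) \<le> ennreal C * N1 v g"
    using antidual_bound[OF f] by blast
  have "(\<lambda>n. ennreal (cmod (f (g n) - f h))) \<longlonglongrightarrow> 0"
  proof (rule tendsto_sandwich[OF _ _ tendsto_const])
    show "(\<lambda>n. ennreal C * N1 v (g n - h)) \<longlonglongrightarrow> 0" using ennreal_tendsto_cmult[OF _ lim, of "ennreal C"] by simp
    show "\<forall>\<^sub>F n in sequentially. ennreal (cmod (f (g n) - f h)) \<le> ennreal C * N1 v (g n - h)"
      using C(2)[OF M1_diff[OF g]] by (simp add: antidual_diff[OF f g])
  qed auto
  then have "(\<lambda>n. cmod (f (g n) - f h)) \<longlonglongrightarrow> 0"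
    unfolding ennreal_0[symmetric] by (subst (asm) tendsto_ennreal_iff) auto
  then show ?thesis by (simp add: LIM_zero_iff tendsto_norm_zero_iff)
qed

text \<open>A bounded functional composed with the norm-continuous orbit of \<open>g\<close>. Borel
  measurability of all transforms of functionals rests on it.\<close>

lemma antidual_stft_continuous:
  assumes f: "f \<in> M1_antidual v" and g: "g \<in> M1_space v"
  shows "continuous_on UNIV (stft_dual g f)"
  unfolding continuous_on_sequentially stft_dual_def comp_def
proof (intro allI ballI impI, elim conjE)
  fix X :: "nat \<Rightarrow> (real^'d) \<times> (real^'d)" and a assume "X \<longlonglongrightarrow> a"
  then show "(\<lambda>n. f (tfshift (X n) g)) \<longlonglongrightarrow> f (tfshift a g)"
    by (rule antidual_tendsto[OF f M1_tfshift[OF g] M1_tfshift[OF g] N1_tfshift_tendsto[OF g]])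
qed

lemma measurable_stft_dual [measurable]:
  "f \<in> M1_antidual v \<Longrightarrow> g \<in> M1_space v \<Longrightarrow> stft_dual g f \<in> borel_measurable borel"
  by (intro borel_measurable_continuous_onI antidual_stft_continuous)

lemma stft_dual_bound:
  assumes f: "f \<in> M1_antidual v" and g: "g \<in> M1_space v"
  shows "\<exists>C\<ge>0. \<forall>z. cmod (stft_dual g f z) \<le> C * v z"
proof -
  obtain C where C: "0 \<le> C" "\<And>g. g \<in> M1_space v \<Longrightarrow> ennreal (cmod (f g)) \<le> ennreal C * N1 v g"
    using antidual_bound[OF f] by blast
  have fin: "N1 v g < top" by (rule niceD(2)[OF M1_space_nice[OF g]])
  obtain N where N: "N1 v g = ennreal N" "0 \<le> N" using fin by (cases "N1 v g") auto
  have "cmod (stft_dual g f z) \<le> (C * N) * v z" for z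
  proof -
    have "ennreal (cmod (stft_dual g f z)) \<le> ennreal C * N1 v (tfshift z g)"
      unfolding stft_dual_def by (rule C(2)[OF M1_tfshift[OF g]])
    also have "\<dots> \<le> ennreal C * (ennreal (v z) * N1 v g)"
      by (intro mult_left_mono N1_tfshift weight_axioms niceD(1)[OF M1_space_nice[OF g]]) auto
    also have "\<dots> = ennreal ((C * N) * v z)" using C N by (simp add: ennreal_mult mult_ac)
    finally show ?thesis using C N by (subst (asm) ennreal_le_iff) auto
  qed
  then show ?thesis using C N by (intro exI[of _ "C * N"]) auto
qed

lemma simple_weight_bound:
  "\<exists>K\<ge>1. \<forall>z u. norm (u - z) \<le> 1 \<or> u = 0 \<longrightarrow> v u \<le> K * v z"
proof -
  obtain K where K: "1 \<le> K" "\<And>z. norm z \<le> 1 \<Longrightarrow> v z \<le> K" using local_bound[of 1] by blast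
  have "v u \<le> K * v z" if "norm (u - z) \<le> 1 \<or> u = 0" for u z
  proof (cases "u = 0")
    case True
    then show ?thesis using K(1) ge_1[of z] mult_mono[of 1 K 1 "v z"] by (simp add: zero)
  next
    case False
    have "v u \<le> v (u - z) * v z" by (rule le_diff)
    also have "\<dots> \<le> K * v z" using False that by (intro mult_right_mono K) auto
    finally show ?thesis .
  qed
  then show ?thesis using K by blast
qed

lemma N1_tfshift_diff_le:
  assumes "L2c g"
  shows "N1 v (tfshift u g - tfshift z g) \<le> ennreal (v u + v z) * N1 v g"
proof -
  have "N1 v (tfshift u g - tfshift z g) \<le> N1 v (tfshift u g) + N1 v (tfshift z g)"
    by (intro N1_diff L2c_tfshift assms measurable_weight)
  also have "\<dots> \<le> ennreal (v u) * N1 v g + ennreal (v z) * N1 v g"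
    by (intro add_mono N1_tfshift weight_axioms assms)
  finally show ?thesis by (simp add: distrib_right)
qed

lemma measurable_N1_tfshift_diff:
  assumes g: "L2c g" and r[measurable]: "r \<in> borel_measurable borel"
  shows "(\<lambda>z. N1 v (tfshift (r z) g - tfshift z g)) \<in> borel_measurable borel"
proof -
  note [measurable] = L2c_measurable[OF g]
  have "(\<lambda>z. N1 v (tfshift (r z) g - tfshift z g)) = (\<lambda>z. \<integral>\<^sup>+y. ennreal (cmod (stft gauss (tfshift (r z) g) y - stft gauss (tfshift z g) y)) * ennreal (v y) \<partial>lborel)"
    unfolding N1_def by (simp add: stft_diff[OF L2c_tfshift[OF g] L2c_tfshift[OF g] L2c_gauss])
  also have "\<dots> \<in> borel_measurable borel" by measurable
  finally show ?thesis .
qed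

text \<open>The integral against \<open>H\<close> is replaced by the finite sums belonging to simple functions
  \<open>r n\<close> that converge to the identity; antilinearity moves \<open>f\<close> through these sums.\<close>

lemma antidual_integral:
  assumes f: "f \<in> M1_antidual v" and \<phi>: "\<phi> \<in> M1_space v" and g: "g \<in> M1_space v"
    and H[measurable]: "H \<in> borel_measurable borel" and Hfin: "(\<integral>\<^sup>+z. ennreal (cmod (H z)) * ennreal (v z) \<partial>lborel) < top"
    and eq: "\<And>y. stft gauss g y = (LINT z|lborel. H z * stft gauss (tfshift z \<phi>) y)"
  shows "f g = (LINT z|lborel. cnj (H z) * stft_dual \<phi> f z)"
proof -
  have L\<phi>: "L2c \<phi>" and Lg: "L2c g" using M1_space_nice[OF \<phi>] M1_space_nice[OF g] by (auto simp: nice_def)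
  note [measurable] = L2c_measurable[OF L\<phi>] L2c_measurable[OF Lg] measurable_stft_dual[OF f \<phi>]
  obtain r :: "nat \<Rightarrow> (real^'d) \<times> (real^'d) \<Rightarrow> (real^'d) \<times> (real^'d)"
    where r: "\<And>n. simple_function borel (r n)" "\<And>z. (\<lambda>n. r n z) \<longlonglongrightarrow> z"
      "\<And>n z. norm (r n z - z) \<le> 1 \<or> r n z = 0"
    using simple_approximation by metis
  have [measurable]: "r n \<in> borel_measurable borel" for n using r(1) by (rule borel_measurable_simple_function)
  obtain K where K: "1 \<le> K" "\<And>z u. norm (u - z) \<le> 1 \<or> u = 0 \<Longrightarrow> v u \<le> K * v z" using simple_weight_bound by blast
  obtain C where C: "0 \<le> C" "\<And>z. cmod (stft_dual \<phi> f z) \<le> C * v z" using stft_dual_bound[OF f \<phi>] by blast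
  have Hint: "integrable lborel (\<lambda>z. cmod (H z) * v z)"
    using Hfin by (auto simp: integrable_iff_bounded ennreal_mult norm_mult)
  have Hint0: "integrable lborel H"
    by (rule integrable_dominated[OF Hint]) (use mult_left_mono[OF ge_1] in \<open>auto simp: mult_le_cancel_left1 ge_1 intro: mult_le_cancel_left1[THEN iffD2]\<close>)
  define R where "R n = range (r n)" for n
  have fin: "finite (R n)" for n using simple_functionD(1)[OF r(1)[of n]] by (simp add: R_def)
  \<comment> \<open>The mass that \<open>H\<close> puts on a level set of \<open>r n\<close>. These
    are the coefficients of the finite sum \<open>S n\<close> that replaces the integral.\<close>
  define c where "c n x = (LINT z|lborel. H z * indicator (r n -` {x}) z)" for n x
  have [measurable]: "r n -` {x} \<in> sets borel" for n x
    using measurable_sets_borel[of "r n" borel "{x}"] by simp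
  have ci: "integrable lborel (\<lambda>z. H z * indicator (r n -` {x}) z)" for n x
    by (rule integrable_dominated[OF integrable_norm[OF Hint0]]) (auto simp: indicator_def norm_mult)
  have split: "G (r n z) = (\<Sum>x\<in>R n. indicator (r n -` {x}) z * G x)" for G :: "(real^'d) \<times> (real^'d) \<Rightarrow> complex" and n z
  proof -
    have "(\<Sum>x\<in>R n. indicator (r n -` {x}) z * G x) = (\<Sum>x\<in>R n. if x = r n z then G x else 0)"
      by (intro sum.cong refl) (auto simp: indicator_def)
    also have "\<dots> = G (r n z)" using fin by (simp add: R_def)
    finally show ?thesis by simp
  qed
  have sumint: "(\<Sum>x\<in>R n. c n x * G x) = (LINT z|lborel. H z * G (r n z))" for G n
  proof -
    have "(\<Sum>x\<in>R n. c n x * G x) = (\<Sum>x\<in>R n. LINT z|lborel. H z * indicator (r n -` {x}) z * G x)"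
      unfolding c_def by simp
    also have "\<dots> = (LINT z|lborel. (\<Sum>x\<in>R n. H z * indicator (r n -` {x}) z * G x))"
      by (intro Bochner_Integration.integral_sum[symmetric] integrable_mult_left ci)
    also have "\<dots> = (LINT z|lborel. H z * G (r n z))"
      by (rule Bochner_Integration.integral_cong[OF refl]) (subst split[of G], simp add: sum_distrib_left mult.assoc)
    finally show ?thesis .
  qed
  define S where "S n = (\<Sum>x\<in>R n. cscale (c n x) (tfshift x \<phi>))" for n
  have SM: "S n \<in> M1_space v" for n unfolding S_def by (intro M1_sum M1_cscale M1_tfshift \<phi>)
  have fS: "f (S n) = (LINT z|lborel. cnj (H z) * stft_dual \<phi> f (r n z))" for n
  proof -
    have "f (S n) = (\<Sum>x\<in>R n. cnj (c n x) * stft_dual \<phi> f x)"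
      unfolding S_def by (subst antidual_sum[OF f]) (auto simp: antidual_cscale[OF f] M1_tfshift \<phi> M1_cscale stft_dual_def)
    also have "\<dots> = cnj (\<Sum>x\<in>R n. c n x * cnj (stft_dual \<phi> f x))" by simp
    also have "\<dots> = (LINT z|lborel. cnj (H z) * stft_dual \<phi> f (r n z))"
      unfolding sumint by (subst Bochner_Integration.integral_cnj[symmetric]) simp
    finally show ?thesis .
  qed
  have VS: "stft gauss (S n) y = (LINT z|lborel. H z * stft gauss (tfshift (r n z) \<phi>) y)" for n y
  proof -
    have "stft gauss (\<Sum>x\<in>I. cscale (c n x) (tfshift x \<phi>)) y = (\<Sum>x\<in>I. c n x * stft gauss (tfshift x \<phi>) y) \<and> L2c (\<Sum>x\<in>I. cscale (c n x) (tfshift x \<phi>))"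
      if "finite I" for I
      using that
    proof (induction I)
      case empty
      show ?case by (simp add: stft_def l2_inner_def L2c_def zero_fun_def)
    next
      case (insert x I)
      have L: "L2c (\<Sum>x\<in>I. cscale (c n x) (tfshift x \<phi>))" using insert by blast
      show ?case unfolding sum.insert[OF insert(1,2)]
        using insert L2c_add[OF L2c_cscale[OF L2c_tfshift[OF L\<phi>]] L]
        by (simp only: stft_add[OF L2c_cscale[OF L2c_tfshift[OF L\<phi>]] L L2c_gauss] stft_cscale)
    qed
    then show ?thesis unfolding S_def using fin sumint[of n "\<lambda>x. stft gauss (tfshift x \<phi>) y"] by simp
  qed
  \<comment> \<open>The error in norm is at most the integral of \<open>cmod (H z)\<close> times the
    norm distance of two shifts of \<open>\<phi>\<close>. That distance tends to 0 by strong
    continuity and is at most a constant times \<open>v z\<close>, against which \<open>H\<close> is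
    integrable.\<close>
  have lim1: "(\<lambda>n. N1 v (S n - g)) \<longlonglongrightarrow> 0"
  proof (rule tendsto_sandwich[OF _ _ tendsto_const])
    let ?D = "\<lambda>n z. N1 v (tfshift (r n z) \<phi> - tfshift z \<phi>)"
    have DM[measurable]: "?D n \<in> borel_measurable borel" for n by (rule measurable_N1_tfshift_diff[OF L\<phi>]) measurable
    have nf: "N1 v \<phi> < top" by (rule niceD(2)[OF M1_space_nice[OF \<phi>]])
    have Dle: "?D n z \<le> ennreal ((K + 1) * v z) * N1 v \<phi>" for n z
    proof -
      have "?D n z \<le> ennreal (v (r n z) + v z) * N1 v \<phi>" by (rule N1_tfshift_diff_le[OF L\<phi>])
      also have "\<dots> \<le> ennreal ((K + 1) * v z) * N1 v \<phi>"
        using K(2)[OF r(3)[of n z]] by (intro mult_right_mono ennreal_leI) (auto simp: distrib_right)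
      finally show ?thesis .
    qed
    have int: "integrable lborel (\<lambda>z. H z * stft gauss (tfshift (s z) \<phi>) y)" if [measurable]: "s \<in> borel_measurable borel" for s y
    proof -
      have w: "window \<phi>" by (rule nice_window[OF nice_one[OF weight_axioms M1_space_nice[OF \<phi>]]])
      define B where "B = (LINT t|lborel. (cmod (\<phi> t))\<^sup>2) + (LINT t|lborel. (cmod (gauss (t::real^'d)))\<^sup>2)"
      have B: "cmod (stft gauss (tfshift u \<phi>) y) \<le> B" for u
      proof -
        have "(LINT t|lborel. (cmod (tfshift x h t))\<^sup>2) = (LINT t|lborel. (cmod (h t))\<^sup>2)" for x and h :: "real^'d \<Rightarrow> complex"
          using lborel_integral_translate(1)[of "\<lambda>t. (cmod (h t))\<^sup>2" "- fst x"] by (simp add: cmod_tfshift)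
        then show ?thesis unfolding stft_def B_def using l2_inner_le[OF L2c_tfshift[OF L\<phi>] L2c_tfshift[OF L2c_gauss], of u y] by simp
      qed
      show ?thesis
      proof (rule integrable_dominated[OF integrable_mult_left[OF integrable_norm[OF Hint0], of B]])
        show "norm (H z * stft gauss (tfshift (s z) \<phi>) y) \<le> norm (H z) * B" for z
          unfolding norm_mult by (intro mult_left_mono B) auto
      qed measurable
    qed
    have le: "N1 v (S n - g) \<le> (\<integral>\<^sup>+z. ennreal (cmod (H z)) * ?D n z \<partial>lborel)" for n
    proof -
      have LS: "L2c (S n)" by (rule niceD(1)[OF M1_space_nice[OF SM]])
      note [measurable] = L2c_measurable[OF LS]
      let ?d = "\<lambda>z y. stft gauss (tfshift (r n z) \<phi>) y - stft gauss (tfshift z \<phi>) y"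
      have "stft gauss (S n - g) y = (LINT z|lborel. H z * ?d z y)" for y
      proof -
        have "stft gauss (S n - g) y = (LINT z|lborel. H z * stft gauss (tfshift (r n z) \<phi>) y) - (LINT z|lborel. H z * stft gauss (tfshift z \<phi>) y)"
          by (simp only: stft_diff[OF LS Lg L2c_gauss] VS eq)
        also have "\<dots> = (LINT z|lborel. H z * stft gauss (tfshift (r n z) \<phi>) y - H z * stft gauss (tfshift z \<phi>) y)"
          by (rule Bochner_Integration.integral_diff[symmetric]) (rule int, measurable)+
        finally show ?thesis by (simp add: right_diff_distrib)
      qed
      then have "N1 v (S n - g) = (\<integral>\<^sup>+y. ennreal (cmod (LINT z|lborel. H z * ?d z y)) * ennreal (v y) \<partial>lborel)"
        unfolding N1_def by simp
      also have "\<dots> \<le> (\<integral>\<^sup>+y. (\<integral>\<^sup>+z. ennreal (cmod (H z * ?d z y)) \<partial>lborel) * ennreal (v y) \<partial>lborel)"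
        by (intro nn_integral_mono mult_right_mono ennreal_norm_integral_le) auto
      also have "\<dots> = (\<integral>\<^sup>+y. \<integral>\<^sup>+z. ennreal (cmod (H z)) * (ennreal (cmod (?d z y)) * ennreal (v y)) \<partial>lborel \<partial>lborel)"
        by (subst nn_integral_multc[symmetric]) (auto simp: norm_mult ennreal_mult mult.assoc)
      also have "\<dots> = (\<integral>\<^sup>+z. \<integral>\<^sup>+y. ennreal (cmod (H z)) * (ennreal (cmod (?d z y)) * ennreal (v y)) \<partial>lborel \<partial>lborel)"
        by (rule lborel_pair.Fubini') measurable
      also have "\<dots> = (\<integral>\<^sup>+z. ennreal (cmod (H z)) * ?D n z \<partial>lborel)"
        unfolding N1_def stft_diff[OF L2c_tfshift[OF L\<phi>] L2c_tfshift[OF L\<phi>] L2c_gauss]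
        by (subst nn_integral_cmult) auto
      finally show ?thesis .
    qed
    show "\<forall>\<^sub>F n in sequentially. N1 v (S n - g) \<le> (\<integral>\<^sup>+z. ennreal (cmod (H z)) * ?D n z \<partial>lborel)"
      using le by simp
    have "(\<lambda>n. \<integral>\<^sup>+z. ennreal (cmod (H z)) * ?D n z \<partial>lborel) \<longlonglongrightarrow> (\<integral>\<^sup>+z. (0::ennreal) \<partial>(lborel :: ((real^'d) \<times> (real^'d)) measure))"
    proof (rule nn_integral_dominated_convergence[where w="\<lambda>z. ennreal (cmod (H z)) * (ennreal ((K + 1) * v z) * N1 v \<phi>)"])
      have "(\<integral>\<^sup>+z. ennreal (cmod (H z)) * (ennreal ((K + 1) * v z) * N1 v \<phi>) \<partial>lborel) = (\<integral>\<^sup>+z. (ennreal (K + 1) * N1 v \<phi>) * (ennreal (cmod (H z)) * ennreal (v z)) \<partial>lborel)"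
        using K by (simp add: ennreal_mult mult_ac)
      also have "\<dots> = (ennreal (K + 1) * N1 v \<phi>) * (\<integral>\<^sup>+z. ennreal (cmod (H z)) * ennreal (v z) \<partial>lborel)"
        by (rule nn_integral_cmult) measurable
      also have "\<dots> < \<infinity>" using Hfin nf by (simp add: ennreal_mult_less_top)
      finally show "(\<integral>\<^sup>+z. ennreal (cmod (H z)) * (ennreal ((K + 1) * v z) * N1 v \<phi>) \<partial>lborel) < \<infinity>" .
      show "AE z in lborel. ennreal (cmod (H z)) * ?D n z \<le> ennreal (cmod (H z)) * (ennreal ((K + 1) * v z) * N1 v \<phi>)" for n
        by (intro AE_I2 mult_left_mono Dle) auto
      show "AE z in lborel. (\<lambda>n. ennreal (cmod (H z)) * ?D n z) \<longlonglongrightarrow> 0"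
      proof (rule AE_I2)
        fix z
        show "(\<lambda>n. ennreal (cmod (H z)) * ?D n z) \<longlonglongrightarrow> 0"
          using ennreal_tendsto_cmult[OF _ N1_tfshift_tendsto[OF \<phi> r(2)[of z]], of "ennreal (cmod (H z))"] by simp
      qed
    qed measurable
    then show "(\<lambda>n. \<integral>\<^sup>+z. ennreal (cmod (H z)) * ?D n z \<partial>lborel) \<longlonglongrightarrow> 0" by simp
  qed auto
  from antidual_tendsto[OF f SM g this]
  have l1: "(\<lambda>n. f (S n)) \<longlonglongrightarrow> f g" .
  have l2: "(\<lambda>n. f (S n)) \<longlonglongrightarrow> (LINT z|lborel. cnj (H z) * stft_dual \<phi> f z)"
    unfolding fS
  proof (rule integral_dominated_convergence[where w="\<lambda>z. cmod (H z) * v z * (C * K)"])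
    show "integrable lborel (\<lambda>z. cmod (H z) * v z * (C * K))" by (intro integrable_mult_left Hint)
    show "AE z in lborel. (\<lambda>n. cnj (H z) * stft_dual \<phi> f (r n z)) \<longlonglongrightarrow> cnj (H z) * stft_dual \<phi> f z"
      by (intro AE_I2 tendsto_mult tendsto_const continuous_on_tendsto_compose[OF antidual_stft_continuous[OF f \<phi>] r(2)]) auto
    show "AE z in lborel. norm (cnj (H z) * stft_dual \<phi> f (r n z)) \<le> cmod (H z) * v z * (C * K)" for n
    proof (rule AE_I2)
      fix z
      have "cmod (stft_dual \<phi> f (r n z)) \<le> C * v (r n z)" by (rule C(2))
      also have "\<dots> \<le> C * (K * v z)" by (intro mult_left_mono K(2) r(3) C(1))
      finally have "cmod (H z) * cmod (stft_dual \<phi> f (r n z)) \<le> cmod (H z) * (C * (K * v z))" by (rule mult_left_mono) simp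
      then show "norm (cnj (H z) * stft_dual \<phi> f (r n z)) \<le> cmod (H z) * v z * (C * K)" by (simp add: norm_mult mult_ac)
    qed
  qed measurable
  show ?thesis by (rule LIMSEQ_unique[OF l1 l2])
qed

text \<open>By the orthogonality relation \<open>g\<close> is, up to the constant
  \<open>l2_inner \<phi>1 \<phi>2\<close>, synthesised from its own transform;
  \<open>antidual_integral\<close> lets \<open>f\<close> act under that integral. Antilinearity
  conjugates the constant.\<close>

lemma antidual_reproducing:
  assumes f: "f \<in> M1_antidual v" and \<phi>1: "\<phi>1 \<in> M1_space v" and \<phi>2: "nice v \<phi>2" and g: "g \<in> M1_space v"
  shows "(LINT z|lborel. stft_dual \<phi>1 f z * cnj (stft \<phi>2 g z)) = l2_inner \<phi>2 \<phi>1 * f g"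
proof -
  have n: "nice v g" "nice v \<phi>1" using M1_space_nice g \<phi>1 by auto
  note n1 = nice_one[OF weight_axioms]
  note [measurable] = L2c_measurable[OF niceD(1)[OF n(1)]] L2c_measurable[OF niceD(1)[OF \<phi>2]]
  let ?c = "l2_inner \<phi>1 \<phi>2"
  have "f (cscale ?c g) = (LINT z|lborel. cnj (stft \<phi>2 g z) * stft_dual \<phi>1 f z)"
  proof (rule antidual_integral[OF f \<phi>1 M1_cscale[OF g]])
    show "(\<integral>\<^sup>+z. ennreal (cmod (stft \<phi>2 g z)) * ennreal (v z) \<partial>lborel) < top"
      by (rule stft_N1_finite[OF weight_axioms n(1) \<phi>2])
    fix y
    have "(LINT z|lborel. stft \<phi>2 g z * cnj (stft \<phi>1 (tfshift y gauss) z)) = ?c * l2_inner g (tfshift y gauss)"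
      by (intro moyal n1 n \<phi>2 nice_tfshift nice_gauss weight_axioms weight_one)
    moreover have "cnj (stft \<phi>1 (tfshift y gauss) z) = stft gauss (tfshift z \<phi>1) y" for z
      by (subst stft_swap) simp
    ultimately show "stft gauss (cscale ?c g) y = (LINT z|lborel. stft \<phi>2 g z * stft gauss (tfshift z \<phi>1) y)"
      by (simp add: stft_cscale stft_def[of gauss g])
  qed measurable
  then show ?thesis
    by (simp add: antidual_cscale[OF f g] mult.commute l2_inner_cnj[of \<phi>2 \<phi>1])
qed

end

subsection \<open>Modulation spaces\<close>

lemma gmass_neq_0 [simp]: "gmass TYPE('d::finite) \<noteq> 0"
  using gmass_pos[where 'd='d] by linarith

lemma ennreal_gmass_neq_0 [simp]: "ennreal (gmass TYPE('d::finite)) \<noteq> 0"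
  by (metis ennreal_eq_0_iff gmass_pos not_le)

text \<open>One modulation space with its moderation constant as a parameter. All estimates carry
  \<open>Cm\<close> explicitly, so two different spaces can be combined and their constants
  multiplied.\<close>

locale modsp = weight w for w :: "(real^'d) \<times> (real^'d) \<Rightarrow> real" +
  fixes p q :: ennreal and \<mu> :: "(real^'d) \<times> (real^'d) \<Rightarrow> real" and Cm :: real
  assumes p: "1 \<le> p" and q: "1 \<le> q"
    and \<mu>_measurable [measurable]: "\<mu> \<in> borel_measurable borel" and \<mu>_pos: "0 < \<mu> z"
    and moderate: "\<mu> (x + y) \<le> Cm * w x * \<mu> y"
begin

lemma \<mu>_nonneg [simp]: "0 \<le> \<mu> z" using \<mu>_pos[of z] by simp

lemma Cm_pos: "0 < Cm"
proof -
  have "0 < Cm * \<mu> 0" using moderate[of 0 0] \<mu>_pos[of 0] by (simp add: zero)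
  then show ?thesis using \<mu>_pos[of 0] by (simp add: zero_less_mult_iff)
qed

lemma moderate': "\<mu> y \<le> Cm * w x * \<mu> (x + y)"
  using moderate[of "- x" "x + y"] by (simp add: even)

lemma \<mu>_le: "\<mu> y \<le> Cm * \<mu> 0 * w y"
  using moderate[of y 0] by (simp add: mult_ac)

text \<open>A moderate weight cannot decay faster than the reciprocal of \<open>w\<close>: compare
  its values at \<open>- y + y\<close> and \<open>y\<close>. Hence a bound weighted by
  \<open>\<mu>\<close> becomes a growth bound in terms of \<open>w\<close>.\<close>

lemma one_le_\<mu>: "1 \<le> (Cm / \<mu> 0) * w y * \<mu> y"
  using moderate[of "- y" y] \<mu>_pos[of 0] by (simp add: even field_simps)

definition Ne :: "((real^'d) \<times> (real^'d) \<Rightarrow> ennreal) \<Rightarrow> ennreal" where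
  "Ne H = MN p q (\<lambda>z. H z * ennreal (\<mu> z))"

definition En :: "((real^'d \<Rightarrow> complex) \<Rightarrow> complex) \<Rightarrow> ennreal" where
  "En f = Ne (\<lambda>z. ennreal (cmod (stft_dual gauss f z)))"

lemma mixed_norm_Ne: "mixed_norm p q \<mu> F = Ne (\<lambda>z. ennreal (cmod (F z)))"
  by (simp add: mixed_norm_MN Ne_def ennreal_mult)

lemma modulation_space_iff: "f \<in> modulation_space w p q \<mu> \<longleftrightarrow> f \<in> M1_antidual w \<and> En f < top"
  by (simp add: modulation_space_def mixed_norm_Ne En_def)

lemma modulation_norm_En: "modulation_norm p q \<mu> f = enn2real (En f)"
  by (simp add: modulation_norm_def mixed_norm_Ne En_def)

lemma Ne_mono: "H \<in> borel_measurable borel \<Longrightarrow> H' \<in> borel_measurable borel \<Longrightarrow> (\<And>z. H z \<le> H' z) \<Longrightarrow> Ne H \<le> Ne H'"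
  unfolding Ne_def by (intro MN_mono p q mult_right_mono) auto

lemma Ne_mono_AE: "H \<in> borel_measurable borel \<Longrightarrow> H' \<in> borel_measurable borel \<Longrightarrow> (AE z in lborel. H z \<le> H' z) \<Longrightarrow> Ne H \<le> Ne H'"
  unfolding Ne_def by (intro MN_mono_AE p q) (auto elim!: eventually_mono intro: mult_right_mono)

lemma Ne_cmult: "H \<in> borel_measurable borel \<Longrightarrow> Ne (\<lambda>z. ennreal c * H z) = ennreal c * Ne H"
  unfolding Ne_def using MN_cmult[OF p q, of "\<lambda>z. H z * ennreal (\<mu> z)" c] by (simp add: mult.assoc)

lemma Ne_add: "H \<in> borel_measurable borel \<Longrightarrow> H' \<in> borel_measurable borel \<Longrightarrow> Ne (\<lambda>z. H z + H' z) \<le> Ne H + Ne H'"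
  unfolding Ne_def using MN_add_le[OF p q, of "\<lambda>z. H z * ennreal (\<mu> z)" "\<lambda>z. H' z * ennreal (\<mu> z)"]
  by (simp add: distrib_right)

lemma Ne_Young:
  assumes "H \<in> borel_measurable borel" "k \<in> borel_measurable borel" "\<And>x. k x \<noteq> top"
  shows "Ne (\<lambda>y. \<integral>\<^sup>+x. k x * H (x + y) \<partial>lborel) \<le> ennreal Cm * (\<integral>\<^sup>+x. k x * ennreal (w x) \<partial>lborel) * Ne H"
  unfolding Ne_def using assms Cm_pos by (intro MN_Young p q moderate') auto

text \<open>The counterpart of \<open>Ne_Young\<close> for a supremum over all points instead of an
  essential one. It is what makes integrals converge absolutely at every point of phase
  space.\<close>

lemma sup_Young:
  assumes [measurable]: "H \<in> borel_measurable borel" "k \<in> borel_measurable borel"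
    and S: "\<And>z. H z * ennreal (\<mu> z) \<le> S"
  shows "(\<integral>\<^sup>+x. k x * H (x + y) \<partial>lborel) * ennreal (\<mu> y) \<le> ennreal Cm * (\<integral>\<^sup>+x. k x * ennreal (w x) \<partial>lborel) * S"
proof -
  have "(\<integral>\<^sup>+x. k x * H (x + y) \<partial>lborel) * ennreal (\<mu> y) = (\<integral>\<^sup>+x. k x * H (x + y) * ennreal (\<mu> y) \<partial>lborel)"
    by (rule nn_integral_multc[symmetric]) measurable
  also have "\<dots> \<le> (\<integral>\<^sup>+x. (ennreal Cm * S) * (k x * ennreal (w x)) \<partial>lborel)"
  proof (rule nn_integral_mono)
    fix x
    have "H (x + y) * ennreal (\<mu> y) \<le> H (x + y) * (ennreal Cm * ennreal (w x) * ennreal (\<mu> (x + y)))"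
      using moderate'[of y x] Cm_pos by (intro mult_left_mono) (auto simp flip: ennreal_mult)
    also have "\<dots> = ennreal Cm * ennreal (w x) * (H (x + y) * ennreal (\<mu> (x + y)))" by (simp add: mult_ac)
    also have "\<dots> \<le> ennreal Cm * ennreal (w x) * S" by (intro mult_left_mono S) auto
    finally have "k x * (H (x + y) * ennreal (\<mu> y)) \<le> k x * (ennreal Cm * ennreal (w x) * S)" by (rule mult_left_mono) simp
    then show "k x * H (x + y) * ennreal (\<mu> y) \<le> (ennreal Cm * S) * (k x * ennreal (w x))" by (simp add: mult_ac)
  qed
  also have "\<dots> = (ennreal Cm * S) * (\<integral>\<^sup>+x. k x * ennreal (w x) \<partial>lborel)" by (rule nn_integral_cmult) measurable
  finally show ?thesis by (simp add: mult_ac)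
qed

text \<open>Change of window for functionals: the reproducing formula with Gaussian windows,
  evaluated at the shifted window \<open>tfshift u \<phi>\<close>.\<close>

lemma stft_dual_le:
  assumes f: "f \<in> M1_antidual w" and \<phi>: "\<phi> \<in> M1_space w"
  shows "ennreal (gmass TYPE('d)) * ennreal (cmod (stft_dual \<phi> f u))
    \<le> (\<integral>\<^sup>+x. ennreal (cmod (stft gauss \<phi> x)) * ennreal (cmod (stft_dual gauss f (x + u))) \<partial>lborel)"
proof -
  note [measurable] = measurable_stft_dual[OF f M1_gauss] L2c_measurable[OF niceD(1)[OF M1_space_nice[OF \<phi>]]]
  have "(LINT z|lborel. stft_dual gauss f z * cnj (stft gauss (tfshift u \<phi>) z)) = l2_inner gauss (gauss :: real^'d \<Rightarrow> complex) * f (tfshift u \<phi>)"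
    by (intro antidual_reproducing f M1_gauss nice_gauss weight_axioms M1_tfshift \<phi>)
  then have "ennreal (gmass TYPE('d) * cmod (stft_dual \<phi> f u)) = ennreal (cmod (LINT z|lborel. stft_dual gauss f z * cnj (stft gauss (tfshift u \<phi>) z)))"
    by (simp add: l2_inner_gauss norm_mult stft_dual_def less_imp_le)
  also have "\<dots> \<le> (\<integral>\<^sup>+z. ennreal (cmod (stft_dual gauss f z * cnj (stft gauss (tfshift u \<phi>) z))) \<partial>lborel)"
    by (rule ennreal_norm_integral_le)
  also have "\<dots> = (\<integral>\<^sup>+z. ennreal (cmod (stft gauss \<phi> (z - u))) * ennreal (cmod (stft_dual gauss f z)) \<partial>lborel)"
    by (simp add: norm_mult cmod_stft_tfshift ennreal_mult mult.commute)
  also have "\<dots> = (\<integral>\<^sup>+x. ennreal (cmod (stft gauss \<phi> (x + u - u))) * ennreal (cmod (stft_dual gauss f (x + u))) \<partial>lborel)"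
    by (rule nn_integral_lborel_translate[symmetric]) measurable
  finally show ?thesis by (simp add: ennreal_mult less_imp_le)
qed

lemma gaussian_tensor:
  fixes z :: "(real^'d) \<times> (real^'d)"
  shows "ennreal (exp (- c * (norm z)\<^sup>2)) = ennreal (exp (- c * (norm (fst z))\<^sup>2)) * ennreal (exp (- c * (norm (snd z))\<^sup>2))"
proof -
  have "(norm z)\<^sup>2 = (norm (fst z))\<^sup>2 + (norm (snd z))\<^sup>2" by (cases z) (simp add: norm_Pair)
  then have "exp (- c * (norm z)\<^sup>2) = exp (- c * (norm (fst z))\<^sup>2) * exp (- c * (norm (snd z))\<^sup>2)"
    unfolding mult_exp_exp by (simp add: algebra_simps)
  then show ?thesis by (simp only: ennreal_mult[OF exp_ge_zero exp_ge_zero])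
qed

text \<open>Embedding into the space with both exponents infinite. The reproducing formula averages
  the transform against a Gaussian; half of that Gaussian absorbs \<open>w\<close>, and the other
  half is a tensor product, so \<open>nn_integral_le_MN\<close> applies.\<close>

lemma sup_bound:
  "\<exists>K>0. \<forall>f\<in>M1_antidual w. \<forall>y. ennreal (cmod (stft_dual gauss f y)) * ennreal (\<mu> y) \<le> ennreal K * En f"
proof -
  let ?m = "gmass TYPE('d)"
  obtain B where B: "0 < B" "\<And>z. exp (- (pi/2) * (norm z)\<^sup>2) * w z \<le> B * exp (- (pi/2/2) * (norm z)\<^sup>2)"
    using gaussian_bound[of "pi/2"] by auto
  let ?k = "\<lambda>x::real^'d. ennreal (exp (- (pi/2/2) * (norm x)\<^sup>2))"
  \<comment> \<open>One number above both the supremum 1 and the integral of the Gaussian factor, as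
    \<open>nn_integral_le_MN\<close> requires.\<close>
  define K where "K = 1 + (LINT x|lborel. exp (- (pi/2/2) * (norm (x::real^'d))\<^sup>2))"
  have I0: "0 \<le> (LINT x|lborel. exp (- (pi/2/2) * (norm (x::real^'d))\<^sup>2))" by (rule integral_nonneg_AE) simp
  have K: "0 < K" "\<And>x. ?k x \<le> ennreal K" "(\<integral>\<^sup>+x. ?k x \<partial>lborel) \<le> ennreal K"
  proof -
    show "0 < K" using I0 unfolding K_def by linarith
    show "?k x \<le> ennreal K" for x
      by (rule ennreal_leI[OF order_trans[of _ 1]]) (use I0 in \<open>auto simp: K_def\<close>)
    show "(\<integral>\<^sup>+x. ?k x \<partial>lborel) \<le> ennreal K"
      using integrable_gaussian[of "pi/2/2", where 'a="real^'d"]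
      by (subst nn_integral_eq_integral) (auto simp: K_def intro!: ennreal_leI)
  qed
  have main: "ennreal (cmod (stft_dual gauss f y)) * ennreal (\<mu> y) \<le> ennreal (Cm * B * (K * K)) * En f" if f: "f \<in> M1_antidual w" for f y
  proof -
    note [measurable] = measurable_stft_dual[OF f M1_gauss]
    let ?F = "\<lambda>z. ennreal (cmod (stft_dual gauss f z)) * ennreal (\<mu> z)"
    have "ennreal ?m * ennreal (cmod (stft_dual gauss f y)) * ennreal (\<mu> y)
       \<le> (\<integral>\<^sup>+x. ennreal (cmod (stft gauss gauss x)) * ennreal (cmod (stft_dual gauss f (x + y))) \<partial>lborel) * ennreal (\<mu> y)"
      by (intro mult_right_mono stft_dual_le f M1_gauss) simp
    also have "\<dots> = (\<integral>\<^sup>+x. ennreal (cmod (stft gauss gauss x)) * ennreal (cmod (stft_dual gauss f (x + y))) * ennreal (\<mu> y) \<partial>lborel)"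
      by (rule nn_integral_multc[symmetric]) measurable
    also have "\<dots> \<le> (\<integral>\<^sup>+x. ennreal (?m * Cm * B) * (?F (x + y) * (?k (fst x) * ?k (snd x))) \<partial>lborel)"
    proof (rule nn_integral_mono)
      fix x
      have "cmod (stft gauss gauss x) * \<mu> y \<le> cmod (stft gauss gauss x) * (Cm * w x * \<mu> (x + y))"
        by (intro mult_left_mono moderate') auto
      also have "\<dots> = ?m * Cm * \<mu> (x + y) * (exp (- (pi/2) * (norm x)\<^sup>2) * w x)" by (simp add: cmod_stft_gauss_gauss mult_ac)
      also have "\<dots> \<le> ?m * Cm * \<mu> (x + y) * (B * exp (- (pi/2/2) * (norm x)\<^sup>2))"
        using Cm_pos by (intro mult_left_mono B) (auto simp: less_imp_le)
      finally have "ennreal (cmod (stft gauss gauss x) * \<mu> y) \<le> ennreal ((?m * Cm * B) * \<mu> (x + y) * exp (- (pi/2/2) * (norm x)\<^sup>2))"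
        by (intro ennreal_leI) (simp add: mult_ac)
      also have "\<dots> = ennreal (?m * Cm * B) * ennreal (\<mu> (x + y)) * (?k (fst x) * ?k (snd x))"
        unfolding gaussian_tensor[symmetric] using Cm_pos B gmass_pos[where 'd='d] by (simp add: ennreal_mult less_imp_le)
      finally have "ennreal (cmod (stft gauss gauss x)) * ennreal (\<mu> y) \<le> ennreal (?m * Cm * B) * ennreal (\<mu> (x + y)) * (?k (fst x) * ?k (snd x))"
        by (simp add: ennreal_mult)
      from mult_right_mono[OF this, of "ennreal (cmod (stft_dual gauss f (x + y)))"]
      show "ennreal (cmod (stft gauss gauss x)) * ennreal (cmod (stft_dual gauss f (x + y))) * ennreal (\<mu> y)
         \<le> ennreal (?m * Cm * B) * (?F (x + y) * (?k (fst x) * ?k (snd x)))" by (simp add: mult_ac)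
    qed
    also have "\<dots> = ennreal (?m * Cm * B) * (\<integral>\<^sup>+x. ?F (x + y) * (?k (fst x) * ?k (snd x)) \<partial>lborel)"
      by (rule nn_integral_cmult) measurable
    also have "\<dots> \<le> ennreal (?m * Cm * B) * (ennreal (K * K) * MN p q (\<lambda>x. ?F (x + y)))"
    proof (rule mult_left_mono)
      show "(\<integral>\<^sup>+x. ?F (x + y) * (?k (fst x) * ?k (snd x)) \<partial>lborel) \<le> ennreal (K * K) * MN p q (\<lambda>x. ?F (x + y))"
        by (rule nn_integral_le_MN[OF p q _ _ _ K(1,1,2,3,2,3)]) measurable
    qed simp
    also have "MN p q (\<lambda>x. ?F (x + y)) = En f" unfolding En_def Ne_def by (rule MN_translate[OF p q]) measurable
    also have "ennreal (?m * Cm * B) * (ennreal (K * K) * En f) = ennreal ?m * (ennreal (Cm * B * (K * K)) * En f)"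
    proof -
      have "ennreal (?m * Cm * B) * ennreal (K * K) = ennreal ?m * ennreal (Cm * B * (K * K))"
        using Cm_pos B K by (simp add: less_imp_le mult.assoc flip: ennreal_mult)
      then show ?thesis by (simp only: mult.assoc[symmetric])
    qed
    finally have "ennreal ?m * (ennreal (cmod (stft_dual gauss f y)) * ennreal (\<mu> y)) \<le> ennreal ?m * (ennreal (Cm * B * (K * K)) * En f)"
      by (simp only: mult.assoc)
    then show ?thesis by (subst (asm) ennreal_mult_le_mult_iff) auto
  qed
  show ?thesis using main Cm_pos B K by (intro exI[of _ "Cm * B * (K * K)"]) auto
qed

text \<open>With any window from \<open>M1_space w\<close> the transform of a functional is
  controlled by its norm, which is defined through the Gaussian.\<close>

lemma stft_dual_Ne_le:
  assumes f: "f \<in> M1_antidual w" and \<phi>: "\<phi> \<in> M1_space w"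
  shows "ennreal (gmass TYPE('d)) * Ne (\<lambda>u. ennreal (cmod (stft_dual \<phi> f u))) \<le> ennreal Cm * N1 w \<phi> * En f"
proof -
  note [measurable] = measurable_stft_dual[OF f M1_gauss] measurable_stft_dual[OF f \<phi>] L2c_measurable[OF niceD(1)[OF M1_space_nice[OF \<phi>]]]
  have "ennreal (gmass TYPE('d)) * Ne (\<lambda>u. ennreal (cmod (stft_dual \<phi> f u))) = Ne (\<lambda>u. ennreal (gmass TYPE('d)) * ennreal (cmod (stft_dual \<phi> f u)))"
    by (rule Ne_cmult[symmetric]) measurable
  also have "\<dots> \<le> Ne (\<lambda>u. \<integral>\<^sup>+x. ennreal (cmod (stft gauss \<phi> x)) * ennreal (cmod (stft_dual gauss f (x + u))) \<partial>lborel)"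
    by (rule Ne_mono[OF _ _ stft_dual_le[OF f \<phi>]]) measurable
  also have "\<dots> \<le> ennreal Cm * N1 w \<phi> * En f"
    unfolding N1_def En_def by (rule Ne_Young) auto
  finally show ?thesis .
qed

lemma stft_dual_sup_le:
  assumes f: "f \<in> M1_antidual w" and \<phi>: "\<phi> \<in> M1_space w"
    and S: "\<And>z. ennreal (cmod (stft_dual gauss f z)) * ennreal (\<mu> z) \<le> S"
  shows "ennreal (gmass TYPE('d)) * (ennreal (cmod (stft_dual \<phi> f u)) * ennreal (\<mu> u)) \<le> ennreal Cm * N1 w \<phi> * S"
proof -
  note [measurable] = measurable_stft_dual[OF f M1_gauss] measurable_stft_dual[OF f \<phi>] L2c_measurable[OF niceD(1)[OF M1_space_nice[OF \<phi>]]]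
  have "ennreal (gmass TYPE('d)) * ennreal (cmod (stft_dual \<phi> f u)) * ennreal (\<mu> u)
     \<le> (\<integral>\<^sup>+x. ennreal (cmod (stft gauss \<phi> x)) * ennreal (cmod (stft_dual gauss f (x + u))) \<partial>lborel) * ennreal (\<mu> u)"
    by (intro mult_right_mono stft_dual_le f \<phi>) simp
  also have "\<dots> \<le> ennreal Cm * N1 w \<phi> * S" unfolding N1_def by (rule sup_Young[OF _ _ S]) measurable
  finally show ?thesis by (simp add: mult.assoc)
qed

lemma Ne_gauss_finite: "Ne (\<lambda>y. ennreal (cmod (stft gauss gauss y))) < top"
proof -
  let ?m = "gmass TYPE('d)"
  obtain B where B: "0 < B" "\<And>z. exp (- (pi/2) * (norm z)\<^sup>2) * w z \<le> B * exp (- (pi/2/2) * (norm z)\<^sup>2)"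
    using gaussian_bound[of "pi/2"] by auto
  let ?k = "\<lambda>x::real^'d. ennreal (exp (- (pi/2/2) * (norm x)\<^sup>2))"
  have "Ne (\<lambda>y. ennreal (cmod (stft gauss gauss y))) \<le> MN p q (\<lambda>z. ennreal (?m * Cm * \<mu> 0 * B) * (?k (fst z) * ?k (snd z)))"
    unfolding Ne_def
  proof (rule MN_mono[OF p q])
    fix z :: "(real^'d) \<times> (real^'d)"
    have "cmod (stft gauss gauss z) * \<mu> z \<le> cmod (stft gauss gauss z) * (Cm * \<mu> 0 * w z)"
      by (intro mult_left_mono \<mu>_le) auto
    also have "\<dots> = ?m * Cm * \<mu> 0 * (exp (- (pi/2) * (norm z)\<^sup>2) * w z)" by (simp add: cmod_stft_gauss_gauss mult_ac)
    also have "\<dots> \<le> ?m * Cm * \<mu> 0 * (B * exp (- (pi/2/2) * (norm z)\<^sup>2))"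
      using Cm_pos by (intro mult_left_mono B) (auto simp: less_imp_le)
    finally have "ennreal (cmod (stft gauss gauss z) * \<mu> z) \<le> ennreal ((?m * Cm * \<mu> 0 * B) * exp (- (pi/2/2) * (norm z)\<^sup>2))"
      by (intro ennreal_leI) (simp add: mult_ac)
    then show "ennreal (cmod (stft gauss gauss z)) * ennreal (\<mu> z) \<le> ennreal (?m * Cm * \<mu> 0 * B) * (?k (fst z) * ?k (snd z))"
      unfolding gaussian_tensor[symmetric] using Cm_pos B gmass_pos[where 'd='d] by (simp add: ennreal_mult less_imp_le)
  qed measurable
  also have "\<dots> = ennreal (?m * Cm * \<mu> 0 * B) * MN p q (\<lambda>z. ?k (fst z) * ?k (snd z))"
    by (rule MN_cmult[OF p q]) measurable
  also have "\<dots> < top"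
  proof -
    have "(\<integral>\<^sup>+x. ?k x \<partial>lborel) < top"
      using integrable_gaussian[of "pi/2/2", where 'a="real^'d"] by (subst nn_integral_eq_integral) auto
    then have "MN p q (\<lambda>z. ?k (fst z) * ?k (snd z)) < top"
      by (intro MN_tensor_finite p q) auto
    then show ?thesis by (simp add: ennreal_mult_less_top)
  qed
  finally show ?thesis .
qed

text \<open>Embedding of \<open>M\<^sup>1\<^sub>w\<close>: the transform of \<open>h\<close> is
  dominated by a superposition of shifted Gaussian profiles, and shifting a profile to
  \<open>z\<close> costs \<open>Cm * w z\<close> in the mixed norm. Errors in a window can thus be
  measured by \<open>N1 w\<close>.\<close>

lemma stft_Ne_le:
  assumes h: "nice w h"
  shows "ennreal (gmass TYPE('d)) * Ne (\<lambda>y. ennreal (cmod (stft gauss h y)))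
    \<le> ennreal Cm * Ne (\<lambda>y. ennreal (cmod (stft gauss gauss y))) * N1 w h"
proof -
  note [measurable] = L2c_measurable[OF niceD(1)[OF h]]
  let ?G = "\<lambda>y. ennreal (cmod (stft gauss gauss y))"
  have "ennreal (gmass TYPE('d)) * Ne (\<lambda>y. ennreal (cmod (stft gauss h y))) = Ne (\<lambda>y. ennreal (gmass TYPE('d)) * ennreal (cmod (stft gauss h y)))"
    by (rule Ne_cmult[symmetric]) measurable
  also have "\<dots> \<le> Ne (\<lambda>y. \<integral>\<^sup>+z. ennreal (cmod (stft gauss h z)) * ?G (z - y) \<partial>lborel)"
    by (rule Ne_mono[OF _ _ stft_le[OF nice_one[OF weight_axioms h] nice_gauss[OF weight_one]]]) measurable
  also have "\<dots> = MN p q (\<lambda>y. \<integral>\<^sup>+z. ennreal (cmod (stft gauss h z)) * ?G (z - y) * ennreal (\<mu> y) \<partial>lborel)"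
    unfolding Ne_def by (subst nn_integral_multc) auto
  also have "\<dots> \<le> (\<integral>\<^sup>+z. MN p q (\<lambda>y. ennreal (cmod (stft gauss h z)) * ?G (z - y) * ennreal (\<mu> y)) \<partial>lborel)"
    by (rule MN_integral_le[OF p q sigma_finite_lborel]) measurable
  also have "\<dots> \<le> (\<integral>\<^sup>+z. (ennreal Cm * Ne ?G) * (ennreal (cmod (stft gauss h z)) * ennreal (w z)) \<partial>lborel)"
  proof (rule nn_integral_mono)
    fix z
    have "MN p q (\<lambda>y. ennreal (cmod (stft gauss h z)) * ?G (z - y) * ennreal (\<mu> y))
       \<le> MN p q (\<lambda>y. ennreal (cmod (stft gauss h z) * Cm * w z) * (?G (y + - z) * ennreal (\<mu> (y + - z))))"
    proof (rule MN_mono[OF p q])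
      fix y
      have "?G (z - y) = ?G (y + - z)" by (simp add: cmod_stft_gauss_gauss norm_minus_commute)
      moreover have "ennreal (\<mu> y) \<le> ennreal Cm * ennreal (w z) * ennreal (\<mu> (y + - z))"
        using moderate[of z "y - z"] Cm_pos by (simp flip: ennreal_mult)
      ultimately have "ennreal (cmod (stft gauss h z)) * ?G (z - y) * ennreal (\<mu> y) \<le> ennreal (cmod (stft gauss h z)) * ?G (y + - z) * (ennreal Cm * ennreal (w z) * ennreal (\<mu> (y + - z)))"
        by (simp add: mult_left_mono)
      then show "ennreal (cmod (stft gauss h z)) * ?G (z - y) * ennreal (\<mu> y) \<le> ennreal (cmod (stft gauss h z) * Cm * w z) * (?G (y + - z) * ennreal (\<mu> (y + - z)))"
        using Cm_pos by (simp add: ennreal_mult mult_ac)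
    qed measurable
    also have "\<dots> = ennreal (cmod (stft gauss h z) * Cm * w z) * MN p q (\<lambda>y. ?G (y + - z) * ennreal (\<mu> (y + - z)))"
      by (rule MN_cmult[OF p q]) measurable
    also have "MN p q (\<lambda>y. ?G (y + - z) * ennreal (\<mu> (y + - z))) = Ne ?G"
      unfolding Ne_def by (rule MN_translate[OF p q]) measurable
    finally show "MN p q (\<lambda>y. ennreal (cmod (stft gauss h z)) * ?G (z - y) * ennreal (\<mu> y)) \<le> (ennreal Cm * Ne ?G) * (ennreal (cmod (stft gauss h z)) * ennreal (w z))"
      using Cm_pos by (simp add: ennreal_mult mult_ac)
  qed
  also have "\<dots> = ennreal Cm * Ne ?G * N1 w h" unfolding N1_def by (rule nn_integral_cmult) measurable
  finally show ?thesis .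
qed

lemma stft_Ne_finite:
  assumes h: "nice w h" shows "Ne (\<lambda>y. ennreal (cmod (stft gauss h y))) < top"
proof -
  have "ennreal Cm * Ne (\<lambda>y. ennreal (cmod (stft gauss gauss y))) * N1 w h < top"
    using Ne_gauss_finite niceD(2)[OF h] by (simp add: ennreal_mult_less_top)
  with stft_Ne_le[OF h] have "ennreal (gmass TYPE('d)) * Ne (\<lambda>y. ennreal (cmod (stft gauss h y))) < top"
    by (rule le_less_trans)
  then show ?thesis by (cases "Ne (\<lambda>y. ennreal (cmod (stft gauss h y)))") (auto simp: ennreal_mult_top)
qed

text \<open>The mixed norm dominates the functional norm. Hence it is definite, and Cauchy sequences
  for it converge at every element of \<open>M1_space w\<close>.\<close>

lemma antidual_bound_En:
  "\<exists>C\<ge>0. \<forall>f\<in>M1_antidual w. \<forall>g\<in>M1_space w. ennreal (cmod (f g)) \<le> ennreal C * En f * N1 w g"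
proof -
  let ?m = "gmass TYPE('d)"
  obtain K where K: "K > 0" "\<And>f y. f \<in> M1_antidual w \<Longrightarrow> ennreal (cmod (stft_dual gauss f y)) * ennreal (\<mu> y) \<le> ennreal K * En f"
    using sup_bound by blast
  define D where "D = Cm / \<mu> 0"
  have D: "0 < D" "\<And>y. 1 \<le> D * w y * \<mu> y" using Cm_pos \<mu>_pos one_le_\<mu> by (auto simp: D_def)
  have "ennreal (cmod (f g)) \<le> ennreal (K * D / ?m) * En f * N1 w g" if f: "f \<in> M1_antidual w" and g: "g \<in> M1_space w" for f g
  proof -
    note [measurable] = measurable_stft_dual[OF f M1_gauss] L2c_measurable[OF niceD(1)[OF M1_space_nice[OF g]]]
    have "(LINT z|lborel. stft_dual gauss f z * cnj (stft gauss g z)) = l2_inner gauss (gauss :: real^'d \<Rightarrow> complex) * f g"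
      by (intro antidual_reproducing f M1_gauss nice_gauss weight_axioms g)
    then have "ennreal ?m * ennreal (cmod (f g)) = ennreal (cmod (LINT z|lborel. stft_dual gauss f z * cnj (stft gauss g z)))"
      by (simp add: l2_inner_gauss norm_mult ennreal_mult less_imp_le)
    also have "\<dots> \<le> (\<integral>\<^sup>+z. ennreal (cmod (stft_dual gauss f z * cnj (stft gauss g z))) \<partial>lborel)"
      by (rule ennreal_norm_integral_le)
    also have "\<dots> \<le> (\<integral>\<^sup>+z. (ennreal (K * D) * En f) * (ennreal (cmod (stft gauss g z)) * ennreal (w z)) \<partial>lborel)"
    proof (rule nn_integral_mono)
      fix z
      have "ennreal (cmod (stft_dual gauss f z)) * 1 \<le> ennreal (cmod (stft_dual gauss f z)) * ennreal (D * w z * \<mu> z)"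
        using D(2)[of z] by (intro mult_left_mono) (auto simp flip: ennreal_1 intro: ennreal_leI)
      also have "\<dots> = ennreal (D * w z) * (ennreal (cmod (stft_dual gauss f z)) * ennreal (\<mu> z))"
        using D(1) by (simp add: ennreal_mult less_imp_le mult_ac)
      also have "\<dots> \<le> ennreal (D * w z) * (ennreal K * En f)"
        by (intro mult_left_mono K f) simp
      finally have "ennreal (cmod (stft_dual gauss f z)) \<le> ennreal (D * w z) * (ennreal K * En f)" by simp
      from mult_right_mono[OF this, of "ennreal (cmod (stft gauss g z))"]
      show "ennreal (cmod (stft_dual gauss f z * cnj (stft gauss g z))) \<le> (ennreal (K * D) * En f) * (ennreal (cmod (stft gauss g z)) * ennreal (w z))"
        using D(1) K(1) by (simp add: norm_mult ennreal_mult less_imp_le mult_ac)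
    qed
    also have "\<dots> = (ennreal (K * D) * En f) * N1 w g"
      unfolding N1_def by (rule nn_integral_cmult) measurable
    finally have "ennreal ?m * ennreal (cmod (f g)) \<le> (ennreal (K * D) * En f) * N1 w g" .
    moreover have "ennreal (K * D) = ennreal ?m * ennreal (K * D / ?m)"
    proof -
      have "gmass TYPE('d) * (K * D / gmass TYPE('d)) = K * D" using less_imp_neq[OF gmass_pos[where 'd='d]] by simp
      then show ?thesis using D(1) K(1) by (simp add: less_imp_le flip: ennreal_mult)
    qed
    ultimately have "ennreal ?m * ennreal (cmod (f g)) \<le> ennreal ?m * (ennreal (K * D / ?m) * En f * N1 w g)"
      by (simp only: mult.assoc)
    then show ?thesis by (subst (asm) ennreal_mult_le_mult_iff) auto
  qed
  then show ?thesis using K D(1)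
    by (intro exI[of _ "K * D / ?m"]) (auto simp: less_imp_le)
qed

lemma antidual_plus: "f \<in> M1_antidual w \<Longrightarrow> g \<in> M1_antidual w \<Longrightarrow> f + g \<in> M1_antidual w"
proof -
  assume f: "f \<in> M1_antidual w" and g: "g \<in> M1_antidual w"
  obtain C where C: "\<And>h. h \<in> M1_space w \<Longrightarrow> cmod (f h) \<le> C * enn2real (M1_norm w h)" using f unfolding M1_antidual_def by blast
  obtain D where D: "\<And>h. h \<in> M1_space w \<Longrightarrow> cmod (g h) \<le> D * enn2real (M1_norm w h)" using g unfolding M1_antidual_def by blast
  have "cmod (f h + g h) \<le> (C + D) * enn2real (M1_norm w h)" if "h \<in> M1_space w" for h
    using norm_triangle_ineq[of "f h" "g h"] C[OF that] D[OF that] by (simp add: distrib_right)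
  then have "\<exists>E. \<forall>h\<in>M1_space w. cmod ((f + g) h) \<le> E * enn2real (M1_norm w h)" by auto
  then show "f + g \<in> M1_antidual w" using f g unfolding M1_antidual_def by (simp add: algebra_simps)
qed

lemma antidual_scale: "f \<in> M1_antidual w \<Longrightarrow> cscale c f \<in> M1_antidual w"
proof -
  assume f: "f \<in> M1_antidual w"
  obtain C where C: "\<And>h. h \<in> M1_space w \<Longrightarrow> cmod (f h) \<le> C * enn2real (M1_norm w h)" using f unfolding M1_antidual_def by blast
  have "cmod (c * f h) \<le> (cmod c * C) * enn2real (M1_norm w h)" if "h \<in> M1_space w" for h
    using mult_left_mono[OF C[OF that], of "cmod c"] by (simp add: norm_mult mult.assoc)
  then have "\<exists>E. \<forall>h\<in>M1_space w. cmod (cscale c f h) \<le> E * enn2real (M1_norm w h)" by (auto simp: cscale_def)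
  then show "cscale c f \<in> M1_antidual w" using f unfolding M1_antidual_def by (simp add: cscale_def algebra_simps)
qed

lemma stft_dual_plus: "stft_dual \<phi> (f + g) z = stft_dual \<phi> f z + stft_dual \<phi> g z" by (simp add: stft_dual_def)
lemma stft_dual_minus: "stft_dual \<phi> (f - g) z = stft_dual \<phi> f z - stft_dual \<phi> g z" by (simp add: stft_dual_def)
lemma stft_dual_scale: "stft_dual \<phi> (cscale c f) z = c * stft_dual \<phi> f z" by (simp add: stft_dual_def cscale_def)

lemma antidual_minus: "f \<in> M1_antidual w \<Longrightarrow> g \<in> M1_antidual w \<Longrightarrow> f - g \<in> M1_antidual w"
  unfolding cscale_minus_one by (intro antidual_plus antidual_scale)

lemma En_plus:
  assumes f: "f \<in> M1_antidual w" and g: "g \<in> M1_antidual w" shows "En (f + g) \<le> En f + En g"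
proof -
  note [measurable] = measurable_stft_dual[OF f M1_gauss] measurable_stft_dual[OF g M1_gauss]
  have "En (f + g) \<le> Ne (\<lambda>z. ennreal (cmod (stft_dual gauss f z)) + ennreal (cmod (stft_dual gauss g z)))"
    unfolding En_def stft_dual_plus by (rule Ne_mono) (auto simp: norm_triangle_ineq simp flip: ennreal_plus)
  also have "\<dots> \<le> En f + En g" unfolding En_def by (rule Ne_add) measurable
  finally show ?thesis .
qed

lemma En_scale:
  assumes f: "f \<in> M1_antidual w" shows "En (cscale c f) = ennreal (cmod c) * En f"
proof -
  note [measurable] = measurable_stft_dual[OF f M1_gauss]
  show ?thesis unfolding En_def stft_dual_scale norm_mult by (subst Ne_cmult[symmetric]) (auto simp: ennreal_mult)
qed

lemma antidual_0: "0 \<in> M1_antidual w"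
  by (auto simp: M1_antidual_def intro!: exI[of _ 0])

lemma En_0: "En 0 = 0"
  using En_scale[OF antidual_0, of 0] by (simp add: cscale_def zero_fun_def)

abbreviation X where "X \<equiv> modulation_space w p q \<mu>"
abbreviation NX where "NX \<equiv> modulation_norm p q \<mu>"

lemma XD: "f \<in> X \<Longrightarrow> f \<in> M1_antidual w" by (simp add: modulation_space_iff)

lemma En_NX: "f \<in> X \<Longrightarrow> En f = ennreal (NX f)"
  by (simp add: modulation_space_iff modulation_norm_En)

lemma NX_nonneg [simp]: "0 \<le> NX f" by (simp add: modulation_norm_En)

lemma X_plus: "f \<in> X \<Longrightarrow> g \<in> X \<Longrightarrow> f + g \<in> X"
  using En_plus[of f g] by (auto simp: modulation_space_iff antidual_plus intro: le_less_trans)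

lemma X_scale: "f \<in> X \<Longrightarrow> cscale c f \<in> X"
  by (simp add: modulation_space_iff antidual_scale En_scale ennreal_mult_less_top)

lemma X_0: "0 \<in> X" by (simp add: modulation_space_iff antidual_0 En_0)

lemma X_minus: "f \<in> X \<Longrightarrow> g \<in> X \<Longrightarrow> f - g \<in> X"
  unfolding cscale_minus_one by (intro X_plus X_scale)

lemma X_subspace: "cfun.subspace X"
  by (intro cfun.subspaceI X_0 X_plus X_scale)

lemma NX_plus: assumes "f \<in> X" "g \<in> X" shows "NX (f + g) \<le> NX f + NX g"
proof -
  have "ennreal (NX (f + g)) \<le> ennreal (NX f) + ennreal (NX g)"
    using En_plus[OF XD XD, OF assms] assms X_plus[OF assms] by (simp only: En_NX)
  then show ?thesis by (simp flip: ennreal_plus)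
qed

lemma NX_scale: assumes "f \<in> X" shows "NX (cscale c f) = cmod c * NX f"
proof -
  have "ennreal (NX (cscale c f)) = ennreal (cmod c) * ennreal (NX f)"
    using En_scale[OF XD, OF assms] assms X_scale[OF assms] by (simp only: En_NX)
  then show ?thesis by (simp flip: ennreal_mult)
qed

lemma X_bound: "\<exists>C\<ge>0. \<forall>f\<in>X. \<forall>g\<in>M1_space w. cmod (f g) \<le> C * NX f * enn2real (N1 w g)"
proof -
  obtain C where C: "0 \<le> C" "\<And>f g. f\<in>M1_antidual w \<Longrightarrow> g\<in>M1_space w \<Longrightarrow> ennreal (cmod (f g)) \<le> ennreal C * En f * N1 w g"
    using antidual_bound_En by blast
  have "cmod (f g) \<le> C * NX f * enn2real (N1 w g)" if f: "f \<in> X" and g: "g \<in> M1_space w" for f g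
  proof -
    have "N1 w g = ennreal (enn2real (N1 w g))" using niceD(2)[OF M1_space_nice[OF g]] by simp
    with C(2)[OF XD[OF f] g] have "ennreal (cmod (f g)) \<le> ennreal C * ennreal (NX f) * ennreal (enn2real (N1 w g))"
      by (simp only: En_NX[OF f])
    also have "\<dots> = ennreal (C * NX f * enn2real (N1 w g))" using C(1) by (simp add: ennreal_mult)
    finally show ?thesis using C(1) by (subst (asm) ennreal_le_iff) auto
  qed
  then show ?thesis using C(1) by blast
qed

lemma NX_eq_0: assumes f: "f \<in> X" shows "NX f = 0 \<longleftrightarrow> f = 0"
proof
  assume 0: "NX f = 0"
  obtain C where C: "\<And>f g. f\<in>X \<Longrightarrow> g\<in>M1_space w \<Longrightarrow> cmod (f g) \<le> C * NX f * enn2real (N1 w g)"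
    using X_bound by blast
  have "f g = 0" for g
  proof (cases "g \<in> M1_space w")
    case True then show ?thesis using C[OF f True] 0 by simp
  next
    case False then show ?thesis using XD[OF f] by (auto simp: M1_antidual_def)
  qed
  then show "f = 0" by (simp add: fun_eq_iff)
qed (simp add: modulation_norm_En En_0)

text \<open>The limit is built pointwise on \<open>M1_space w\<close>, where \<open>X_bound\<close>
  turns the Cauchy condition into one for numbers. Norm convergence follows from Fatou's lemma for
  the mixed norm, whichever exponents are infinite.\<close>

lemma X_complete:
  assumes s: "\<And>n. s n \<in> X" and cauchy: "\<And>e. e > 0 \<Longrightarrow> \<exists>k. \<forall>i\<ge>k. \<forall>j\<ge>k. NX (s i - s j) < e"
  shows "\<exists>f\<in>X. (\<lambda>n. NX (s n - f)) \<longlonglongrightarrow> 0"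
proof -
  obtain C where C: "0 \<le> C" "\<And>f g. f\<in>X \<Longrightarrow> g\<in>M1_space w \<Longrightarrow> cmod (f g) \<le> C * NX f * enn2real (N1 w g)"
    using X_bound by blast
  have conv: "convergent (\<lambda>n. s n g)" for g
  proof (cases "g \<in> M1_space w")
    case False
    then have "s n g = 0" for n using XD[OF s[of n]] by (auto simp: M1_antidual_def)
    then show ?thesis by (simp add: convergent_const)
  next
    case True
    show ?thesis
    proof (rule Cauchy_convergent, rule CauchyI)
      fix e :: real assume e: "0 < e"
      define D where "D = C * enn2real (N1 w g) + 1"
      have D: "0 < D" using C(1) by (simp add: D_def add_nonneg_pos)
      obtain k where k: "\<And>i j. i \<ge> k \<Longrightarrow> j \<ge> k \<Longrightarrow> NX (s i - s j) < e / D" using cauchy[of "e / D"] e D by auto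
      have "norm (s i g - s j g) < e" if "i \<ge> k" "j \<ge> k" for i j
      proof -
        have "norm (s i g - s j g) \<le> C * NX (s i - s j) * enn2real (N1 w g)"
          using C(2)[OF X_minus[OF s s] True, of i j] by simp
        also have "\<dots> = (C * enn2real (N1 w g)) * NX (s i - s j)" by (simp add: mult_ac)
        also have "\<dots> \<le> D * NX (s i - s j)" by (intro mult_right_mono) (auto simp: D_def)
        also have "\<dots> < D * (e / D)" using k[OF that] D by (intro mult_strict_left_mono)
        finally show ?thesis using D by simp
      qed
      then show "\<exists>M. \<forall>m\<ge>M. \<forall>n\<ge>M. norm (s m g - s n g) < e" by blast
    qed
  qed
  define f where "f g = lim (\<lambda>n. s n g)" for g
  have flim: "(\<lambda>n. s n g) \<longlonglongrightarrow> f g" for g using conv[of g] by (simp add: f_def convergent_LIMSEQ_iff)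
  obtain k1 where k1: "\<And>i j. i \<ge> k1 \<Longrightarrow> j \<ge> k1 \<Longrightarrow> NX (s i - s j) < 1" using cauchy[of 1] by auto
  define B where "B = NX (s k1) + 1"
  have bd: "NX (s n) \<le> B" if "n \<ge> k1" for n
  proof -
    have "s n = (s n - s k1) + s k1" by (simp add: fun_eq_iff)
    then have "NX (s n) \<le> NX (s n - s k1) + NX (s k1)" using NX_plus[OF X_minus[OF s s] s, of n k1 k1] by simp
    then show ?thesis using k1[OF that, of k1] by (simp add: B_def)
  qed
  have fA: "f \<in> M1_antidual w" unfolding M1_antidual_def
  proof (intro CollectI conjI ballI allI impI)
    fix g h assume g: "g \<in> M1_space w" "h \<in> M1_space w"
    have "(\<lambda>n. s n (g + h)) \<longlonglongrightarrow> f g + f h"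
      unfolding antidual_add[OF XD[OF s] g] by (intro tendsto_add flim)
    then show "f (g + h) = f g + f h" by (rule LIMSEQ_unique[OF flim])
  next
    fix c g assume g: "g \<in> M1_space w"
    have "(\<lambda>n. s n (cscale c g)) \<longlonglongrightarrow> cnj c * f g"
      unfolding antidual_cscale[OF XD[OF s] g] by (intro tendsto_mult tendsto_const flim)
    then show "f (cscale c g) = cnj c * f g" by (rule LIMSEQ_unique[OF flim])
  next
    show "\<exists>E. \<forall>g\<in>M1_space w. cmod (f g) \<le> E * enn2real (M1_norm w g)"
    proof (intro exI[of _ "C * B"] ballI)
      fix g assume g: "g \<in> M1_space w"
      have "cmod (s n g) \<le> C * B * enn2real (N1 w g)" if "n \<ge> k1" for n
      proof -
        have "C * NX (s n) * enn2real (N1 w g) \<le> C * B * enn2real (N1 w g)"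
          by (intro mult_right_mono mult_left_mono bd[OF that] C(1)) simp
        then show ?thesis by (rule order_trans[OF C(2)[OF s g]])
      qed
      then have "cmod (f g) \<le> C * B * enn2real (N1 w g)"
        by (intro LIMSEQ_le_const2[OF tendsto_norm[OF flim]]) blast
      then show "cmod (f g) \<le> C * B * enn2real (M1_norm w g)" by (simp add: M1_norm_M1[OF g])
    qed
  next
    fix g assume "g \<notin> M1_space w"
    then have "s n g = 0" for n using XD[OF s[of n]] by (auto simp: M1_antidual_def)
    then show "f g = 0" using flim[of g] LIMSEQ_unique[OF _ tendsto_const[of 0]] by simp
  qed
  \<comment> \<open>The transform at \<open>z\<close> is evaluation at a shifted Gaussian, so
    convergence of the functionals on \<open>M1_space w\<close> is convergence of the transforms at
    every point.\<close>
  have fatou: "En (s i - f) \<le> ennreal e" if e: "\<And>j. j \<ge> k \<Longrightarrow> NX (s i - s j) < e" for i k e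
  proof -
    note [measurable] = measurable_stft_dual[OF antidual_minus[OF XD[OF s] XD[OF s]] M1_gauss]
    let ?h = "\<lambda>j z. ennreal (cmod (stft_dual gauss (s i - s j) z)) * ennreal (\<mu> z)"
    have "(\<lambda>j. ?h j z) \<longlonglongrightarrow> ennreal (cmod (stft_dual gauss (s i - f) z)) * ennreal (\<mu> z)" for z
    proof -
      have "(\<lambda>j. cmod (stft_dual gauss (s i - s j) z) * \<mu> z) \<longlonglongrightarrow> cmod (stft_dual gauss (s i - f) z) * \<mu> z"
      proof -
        have "stft_dual gauss (s i - h) z = s i (tfshift z gauss) - h (tfshift z gauss)" for h by (simp add: stft_dual_def)
        then show ?thesis by (simp only:) (intro tendsto_intros flim)
      qed
      then have "(\<lambda>j. ennreal (cmod (stft_dual gauss (s i - s j) z) * \<mu> z)) \<longlonglongrightarrow> ennreal (cmod (stft_dual gauss (s i - f) z) * \<mu> z)"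
        by (rule tendsto_ennrealI)
      then show ?thesis by (simp add: ennreal_mult)
    qed
    then have "liminf (\<lambda>j. ?h j z) = ennreal (cmod (stft_dual gauss (s i - f) z)) * ennreal (\<mu> z)" for z
      by (intro lim_imp_Liminf) auto
    then have "En (s i - f) = MN p q (\<lambda>z. liminf (\<lambda>j. ?h j z))"
      unfolding En_def Ne_def by simp
    also have "\<dots> \<le> liminf (\<lambda>j. MN p q (?h j))" by (rule MN_liminf[OF p q]) measurable
    also have "\<dots> = liminf (\<lambda>j. ennreal (NX (s i - s j)))"
      using En_NX[OF X_minus[OF s s]] by (simp add: En_def Ne_def)
    also have "\<dots> \<le> liminf (\<lambda>j. ennreal e)"
      by (rule Liminf_mono, rule eventually_sequentiallyI[of k]) (use e in \<open>auto intro: ennreal_leI less_imp_le\<close>)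
    also have "\<dots> = ennreal e" by (rule Liminf_const) simp
    finally show ?thesis .
  qed
  have fX: "f \<in> X"
  proof -
    have "En (s k1 - f) \<le> ennreal 1" by (rule fatou[of k1]) (use k1 in auto)
    then have "s k1 - f \<in> X" using antidual_minus[OF XD[OF s] fA] by (auto simp: modulation_space_iff intro: le_less_trans)
    from X_minus[OF s[of k1] this] show ?thesis by (simp add: fun_diff_def)
  qed
  moreover have "(\<lambda>n. NX (s n - f)) \<longlonglongrightarrow> 0"
  proof (rule LIMSEQ_I)
    fix e :: real assume e: "0 < e"
    obtain k where k: "\<And>i j. i \<ge> k \<Longrightarrow> j \<ge> k \<Longrightarrow> NX (s i - s j) < e / 2" using cauchy[of "e / 2"] e by auto
    have "NX (s n - f) < e" if "n \<ge> k" for n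
    proof -
      have "ennreal (NX (s n - f)) \<le> ennreal (e / 2)"
        unfolding En_NX[OF X_minus[OF s fX], symmetric] by (rule fatou[of k]) (use k that in auto)
      then show ?thesis using e by (subst (asm) ennreal_le_iff) auto
    qed
    then show "\<exists>no. \<forall>n\<ge>no. norm (NX (s n - f) - 0) < e" by auto
  qed
  ultimately show ?thesis by blast
qed

lemma X_banach: "banach_on X NX"
  unfolding banach_on_def
  using X_subspace NX_eq_0 NX_plus NX_scale X_complete NX_nonneg by blast

end

section \<open>Synthesis of functionals from functions on phase space\<close>

context modsp
begin

text \<open>The weak integral of \<open>H z\<close> times \<open>tfshift z \<psi>\<close>, the
  adjoint of analysis with window \<open>\<psi>\<close>. The value 0 outside
  \<open>M1_space w\<close> follows the convention of \<open>M1_antidual\<close>.\<close>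

definition Syn :: "(real^'d \<Rightarrow> complex) \<Rightarrow> ((real^'d) \<times> (real^'d) \<Rightarrow> complex) \<Rightarrow> (real^'d \<Rightarrow> complex) \<Rightarrow> complex" where
  "Syn \<psi> H = (\<lambda>g. if g \<in> M1_space w then LINT z|lborel. H z * cnj (stft \<psi> g z) else 0)"

lemma le_weight:
  assumes S: "\<And>z. cmod (H z) * \<mu> z \<le> S"
  shows "cmod (H z) \<le> (S * (Cm / \<mu> 0)) * w z"
proof -
  have D: "0 \<le> Cm / \<mu> 0" using Cm_pos by (simp add: less_imp_le)
  have "cmod (H z) * 1 \<le> cmod (H z) * ((Cm / \<mu> 0) * w z * \<mu> z)" by (intro mult_left_mono one_le_\<mu>) simp
  also have "\<dots> = (cmod (H z) * \<mu> z) * ((Cm / \<mu> 0) * w z)" by (simp add: mult_ac)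
  also have "\<dots> \<le> S * ((Cm / \<mu> 0) * w z)" by (intro mult_right_mono S mult_nonneg_nonneg D nonneg)
  finally show ?thesis by (simp only: mult.assoc mult_1_right)
qed

lemma Syn_integrable:
  assumes [measurable]: "H \<in> borel_measurable borel" and S: "\<And>z. cmod (H z) \<le> S * w z"
    and \<psi>: "nice w \<psi>" and g: "nice w g"
  shows "integrable lborel (\<lambda>z. H z * cnj (stft \<psi> g z))"
proof -
  note [measurable] = L2c_measurable[OF niceD(1)[OF \<psi>]] L2c_measurable[OF niceD(1)[OF g]]
  have "integrable lborel (\<lambda>z. cmod (stft \<psi> g z) * w z)"
    using stft_N1_finite[OF weight_axioms g \<psi>] by (auto simp: integrable_iff_bounded ennreal_mult norm_mult)
  then have i: "integrable lborel (\<lambda>z. S * (cmod (stft \<psi> g z) * w z))" by (rule integrable_mult_right)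
  show ?thesis
  proof (rule integrable_dominated[OF i])
    show "norm (H z * cnj (stft \<psi> g z)) \<le> S * (cmod (stft \<psi> g z) * w z)" for z
      using mult_right_mono[OF S[of z], of "cmod (stft \<psi> g z)"] by (simp add: norm_mult mult_ac)
  qed measurable
qed

lemma Syn_antidual:
  assumes H[measurable]: "H \<in> borel_measurable borel" and S: "\<And>z. cmod (H z) \<le> S * w z" and \<psi>: "nice w \<psi>"
  shows "Syn \<psi> H \<in> M1_antidual w"
proof -
  note n = M1_space_nice
  note L = niceD(1)[OF n]
  note [measurable] = L2c_measurable[OF niceD(1)[OF \<psi>]]
  have S0: "0 \<le> S" using S[of 0] by (simp add: zero order_trans[OF norm_ge_zero])
  show ?thesis unfolding M1_antidual_def
  proof (intro CollectI conjI ballI allI impI)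
    fix g h assume g: "g \<in> M1_space w" and h: "h \<in> M1_space w"
    have "(LINT z|lborel. H z * cnj (stft \<psi> (g + h) z)) = (LINT z|lborel. H z * cnj (stft \<psi> g z) + H z * cnj (stft \<psi> h z))"
      by (simp add: stft_add[OF L[OF g] L[OF h] niceD(1)[OF \<psi>]] distrib_left)
    also have "\<dots> = (LINT z|lborel. H z * cnj (stft \<psi> g z)) + (LINT z|lborel. H z * cnj (stft \<psi> h z))"
      by (intro Bochner_Integration.integral_add Syn_integrable[OF H S \<psi> n] g h)
    finally show "Syn \<psi> H (g + h) = Syn \<psi> H g + Syn \<psi> H h"
      using M1_add[OF g h] g h by (simp only: Syn_def if_True)
  next
    fix c g assume g: "g \<in> M1_space w"
    have "(LINT z|lborel. H z * cnj (stft \<psi> (cscale c g) z)) = (LINT z|lborel. cnj c * (H z * cnj (stft \<psi> g z)))"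
      by (simp only: stft_cscale complex_cnj_mult mult.left_commute)
    then show "Syn \<psi> H (cscale c g) = cnj c * Syn \<psi> H g"
      using M1_cscale[OF g, of c] g by (simp add: Syn_def)
  next
    fix g assume "g \<notin> M1_space w" then show "Syn \<psi> H g = 0" by (simp add: Syn_def)
  next
    obtain N where N: "N1 w \<psi> = ennreal N" "0 \<le> N" using niceD(2)[OF \<psi>] by (cases "N1 w \<psi>") auto
    show "\<exists>C. \<forall>g\<in>M1_space w. cmod (Syn \<psi> H g) \<le> C * enn2real (M1_norm w g)"
    proof (intro exI[of _ "S * N / gmass TYPE('d)"] ballI)
      fix g assume g: "g \<in> M1_space w"
      note [measurable] = L2c_measurable[OF L[OF g]]
      let ?m = "gmass TYPE('d)"
      obtain M where M: "N1 w g = ennreal M" "0 \<le> M" using niceD(2)[OF n[OF g]] by (cases "N1 w g") auto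
      have "ennreal (cmod (Syn \<psi> H g)) \<le> (\<integral>\<^sup>+z. ennreal (cmod (H z * cnj (stft \<psi> g z))) \<partial>lborel)"
        using g by (simp add: Syn_def ennreal_norm_integral_le)
      also have "\<dots> \<le> (\<integral>\<^sup>+z. ennreal S * (ennreal (cmod (stft \<psi> g z)) * ennreal (w z)) \<partial>lborel)"
      proof (rule nn_integral_mono)
        fix z
        show "ennreal (cmod (H z * cnj (stft \<psi> g z))) \<le> ennreal S * (ennreal (cmod (stft \<psi> g z)) * ennreal (w z))"
          using mult_right_mono[OF S[of z], of "cmod (stft \<psi> g z)"] S0
          by (simp add: norm_mult mult_ac flip: ennreal_mult)
      qed
      also have "\<dots> = ennreal S * (\<integral>\<^sup>+z. ennreal (cmod (stft \<psi> g z)) * ennreal (w z) \<partial>lborel)"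
        by (rule nn_integral_cmult) measurable
      finally have "ennreal ?m * ennreal (cmod (Syn \<psi> H g)) \<le> ennreal ?m * (ennreal S * (\<integral>\<^sup>+z. ennreal (cmod (stft \<psi> g z)) * ennreal (w z) \<partial>lborel))"
        by (rule mult_left_mono) simp
      also have "\<dots> \<le> ennreal S * (N1 w g * N1 w \<psi>)"
        using mult_left_mono[OF stft_N1_le[OF weight_axioms n[OF g] \<psi>], of "ennreal S"] by (simp add: mult_ac)
      also have "\<dots> = ennreal (S * N * M)" using S0 N M by (simp add: ennreal_mult mult_ac)
      finally have "?m * cmod (Syn \<psi> H g) \<le> S * N * M"
        using S0 N M gmass_pos[where 'd='d] by (simp add: less_imp_le flip: ennreal_mult)
      then have "cmod (Syn \<psi> H g) \<le> S * N / ?m * M"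
        using gmass_pos[where 'd='d] by (simp add: field_simps)
      then show "cmod (Syn \<psi> H g) \<le> S * N / ?m * enn2real (M1_norm w g)"
        using M by (simp add: M1_norm_M1[OF g])
    qed
  qed
qed

lemma stft_dual_Syn:
  "\<phi> \<in> M1_space w \<Longrightarrow> stft_dual \<phi> (Syn \<psi> H) y = (LINT z|lborel. H z * cnj (stft \<psi> (tfshift y \<phi>) z))"
  by (simp add: stft_dual_def Syn_def M1_tfshift)

lemma Syn_add:
  assumes "H \<in> borel_measurable borel" "\<And>z. cmod (H z) \<le> S * w z"
    "H' \<in> borel_measurable borel" "\<And>z. cmod (H' z) \<le> S' * w z" "nice w \<psi>"
  shows "Syn \<psi> (\<lambda>z. H z + H' z) = Syn \<psi> H + Syn \<psi> H'"
proof (rule ext)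
  fix g show "Syn \<psi> (\<lambda>z. H z + H' z) g = (Syn \<psi> H + Syn \<psi> H') g"
    unfolding plus_fun_apply Syn_def
    using Bochner_Integration.integral_add[OF Syn_integrable[OF assms(1,2,5) M1_space_nice] Syn_integrable[OF assms(3,4,5) M1_space_nice], of g g]
    by (simp add: distrib_right)
qed

lemma Syn_scale: "Syn \<psi> (\<lambda>z. c * H z) = cscale c (Syn \<psi> H)"
  by (rule ext) (simp add: Syn_def cscale_def mult.assoc)

text \<open>The Gaussian transform of a synthesis is dominated by the convolution of
  \<open>cmod (H z)\<close> with the reflected transform of \<open>\<psi>\<close>. Young's
  inequality applies, and the reflection disappears because \<open>w\<close> is even.\<close>

lemma En_Syn:
  assumes H[measurable]: "H \<in> borel_measurable borel" and \<psi>: "\<psi> \<in> M1_space w"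
    and A: "Syn \<psi> H \<in> M1_antidual w"
  shows "En (Syn \<psi> H) \<le> ennreal Cm * N1 w \<psi> * Ne (\<lambda>z. ennreal (cmod (H z)))"
proof -
  note [measurable] = L2c_measurable[OF niceD(1)[OF M1_space_nice[OF \<psi>]]] measurable_stft_dual[OF A M1_gauss]
  have "En (Syn \<psi> H) \<le> Ne (\<lambda>y. \<integral>\<^sup>+x. ennreal (cmod (stft gauss \<psi> (- x))) * ennreal (cmod (H (x + y))) \<partial>lborel)"
    unfolding En_def
  proof (rule Ne_mono)
    fix y
    have "ennreal (cmod (stft_dual gauss (Syn \<psi> H) y)) \<le> (\<integral>\<^sup>+z. ennreal (cmod (H z * cnj (stft \<psi> (tfshift y gauss) z))) \<partial>lborel)"
      unfolding stft_dual_Syn[OF M1_gauss] by (rule ennreal_norm_integral_le)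
    also have "\<dots> = (\<integral>\<^sup>+z. ennreal (cmod (stft gauss \<psi> (y - z))) * ennreal (cmod (H z)) \<partial>lborel)"
      by (simp add: norm_mult cmod_stft_swap ennreal_mult mult.commute)
    also have "\<dots> = (\<integral>\<^sup>+x. ennreal (cmod (stft gauss \<psi> (y - (x + y)))) * ennreal (cmod (H (x + y))) \<partial>lborel)"
      by (rule nn_integral_lborel_translate[symmetric]) measurable
    finally show "ennreal (cmod (stft_dual gauss (Syn \<psi> H) y)) \<le> (\<integral>\<^sup>+x. ennreal (cmod (stft gauss \<psi> (- x))) * ennreal (cmod (H (x + y))) \<partial>lborel)"
      by simp
  qed measurable
  also have "\<dots> \<le> ennreal Cm * (\<integral>\<^sup>+x. ennreal (cmod (stft gauss \<psi> (- x))) * ennreal (w x) \<partial>lborel) * Ne (\<lambda>z. ennreal (cmod (H z)))"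
    by (rule Ne_Young) auto
  also have "(\<integral>\<^sup>+x. ennreal (cmod (stft gauss \<psi> (- x))) * ennreal (w x) \<partial>lborel) = N1 w \<psi>"
    unfolding N1_def using nn_integral_lborel_reflect[of "\<lambda>x. ennreal (cmod (stft gauss \<psi> x)) * ennreal (w x)"] by (simp add: even)
  finally show ?thesis .
qed

text \<open>Both kinds of bound are kept: the mixed norm for operator norms, and the pointwise one
  for absolute convergence at each point and for bounds on compact sets.\<close>

lemma stft_dual_estimates:
  assumes \<phi>: "\<phi> \<in> M1_space w"
  shows "\<exists>K>0. \<forall>f\<in>X. Ne (\<lambda>u. ennreal (cmod (stft_dual \<phi> f u))) \<le> ennreal (K * NX f) \<and> (\<forall>u. cmod (stft_dual \<phi> f u) * \<mu> u \<le> K * NX f)"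
proof -
  let ?m = "gmass TYPE('d)"
  obtain N where N: "N1 w \<phi> = ennreal N" "0 \<le> N" using niceD(2)[OF M1_space_nice[OF \<phi>]] by (cases "N1 w \<phi>") auto
  obtain K where K: "K > 0" "\<And>f y. f \<in> M1_antidual w \<Longrightarrow> ennreal (cmod (stft_dual gauss f y)) * ennreal (\<mu> y) \<le> ennreal K * En f"
    using sup_bound by blast
  define K1 where "K1 = Cm * N / ?m"
  have m: "0 < ?m" "0 \<le> K1" using Cm_pos N by (auto simp: K1_def intro!: divide_nonneg_pos mult_nonneg_nonneg)
  have a: "Ne (\<lambda>u. ennreal (cmod (stft_dual \<phi> f u))) \<le> ennreal (K1 * NX f)" if f: "f \<in> X" for f
  proof -
    have "ennreal ?m * Ne (\<lambda>u. ennreal (cmod (stft_dual \<phi> f u))) \<le> ennreal Cm * N1 w \<phi> * En f" by (rule stft_dual_Ne_le[OF XD[OF f] \<phi>])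
    also have "\<dots> = ennreal ?m * ennreal (K1 * NX f)"
      using m N Cm_pos by (simp add: En_NX[OF f] K1_def less_imp_le flip: ennreal_mult)
    finally show ?thesis by (subst (asm) ennreal_mult_le_mult_iff) auto
  qed
  have b: "cmod (stft_dual \<phi> f u) * \<mu> u \<le> K1 * K * NX f" if f: "f \<in> X" for f u
  proof -
    have "ennreal ?m * (ennreal (cmod (stft_dual \<phi> f u)) * ennreal (\<mu> u)) \<le> ennreal Cm * N1 w \<phi> * (ennreal K * En f)"
      by (rule stft_dual_sup_le[OF XD[OF f] \<phi> K(2)[OF XD[OF f]]])
    also have "\<dots> = ennreal ?m * ennreal (K1 * K * NX f)"
      using m N Cm_pos K by (simp add: En_NX[OF f] K1_def less_imp_le mult.assoc flip: ennreal_mult)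
    finally have "ennreal (cmod (stft_dual \<phi> f u)) * ennreal (\<mu> u) \<le> ennreal (K1 * K * NX f)"
      by (subst (asm) ennreal_mult_le_mult_iff) auto
    then show ?thesis using m K by (simp flip: ennreal_mult)
  qed
  define L where "L = K1 + K1 * K + 1"
  have L: "0 < L" "K1 \<le> L" "K1 * K \<le> L" using m K by (auto simp: L_def add_nonneg_pos)
  have "K1 * NX f \<le> L * NX f" "K1 * K * NX f \<le> L * NX f" for f using L by (auto intro!: mult_right_mono)
  then show ?thesis using a b L(1) by (intro exI[of _ L]) (meson ennreal_leI order_trans)
qed

text \<open>The functional is bracketing with \<open>tfshift x \<psi>\<close>, so it embeds shifted
  windows into the modulation space. Such functionals will span the ranges of the finite-rank
  operators.\<close>

lemma theta_X:
  assumes \<psi>: "\<psi> \<in> M1_space w"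
  shows "(\<lambda>g. if g \<in> M1_space w then cnj (stft \<psi> g x) else 0) \<in> X" (is "?t \<in> X")
proof -
  note n = M1_space_nice
  note L = niceD(1)[OF n]
  obtain N where N: "N1 w \<psi> = ennreal N" "0 \<le> N" using niceD(2)[OF n[OF \<psi>]] by (cases "N1 w \<psi>") auto
  have A: "?t \<in> M1_antidual w" unfolding M1_antidual_def
  proof (intro CollectI conjI ballI allI impI)
    fix g h assume g: "g \<in> M1_space w" and h: "h \<in> M1_space w"
    then show "?t (g + h) = ?t g + ?t h"
      using M1_add[OF g h] by (simp only: if_True stft_add[OF L[OF g] L[OF h] L[OF \<psi>]] complex_cnj_add)
  next
    fix c g assume g: "g \<in> M1_space w"
    then show "?t (cscale c g) = cnj c * ?t g" using M1_cscale[OF g, of c] by (simp add: stft_cscale)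
  next
    have w1: "window \<psi>" by (rule nice_window[OF nice_one[OF weight_axioms n[OF \<psi>]]])
    obtain B where B: "\<And>t. cmod (\<psi> t) \<le> B" using w1 by (auto simp: window_def)
    show "\<exists>C. \<forall>g\<in>M1_space w. cmod (?t g) \<le> C * enn2real (M1_norm w g)"
    proof -
      \<comment> \<open>A uniform bound for the Gaussian transform of \<open>\<psi>\<close> exists
        because \<open>l2_inner_le\<close> does not see shifts. Inserted into \<open>stft_le\<close>
        it leaves only the norm of \<open>g\<close>.\<close>
      have psup: "\<exists>S\<ge>0. \<forall>y. cmod (stft gauss \<psi> y) \<le> S"
      proof -
        define S where "S = (LINT t|lborel. (cmod (\<psi> t))\<^sup>2) + (LINT t|lborel. (cmod (gauss (t::real^'d)))\<^sup>2)"
        have "cmod (stft gauss \<psi> y) \<le> S" for y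
        proof -
          have "(LINT t|lborel. (cmod (tfshift y gauss t))\<^sup>2) = (LINT t|lborel. (cmod (gauss (t::real^'d)))\<^sup>2)"
            using lborel_integral_translate(1)[of "\<lambda>t. (cmod (gauss t))\<^sup>2" "- fst y"] by (simp add: cmod_tfshift)
          then show ?thesis unfolding stft_def S_def using l2_inner_le[OF L[OF \<psi>] L2c_tfshift[OF L2c_gauss], of y] by simp
        qed
        moreover have "0 \<le> S" using order_trans[OF norm_ge_zero calculation] .
        ultimately show ?thesis by blast
      qed
      then obtain S where S: "0 \<le> S" "\<And>y. cmod (stft gauss \<psi> y) \<le> S" by blast
      let ?m = "gmass TYPE('d)"
      have "cmod (?t g) \<le> S / ?m * enn2real (M1_norm w g)" if g: "g \<in> M1_space w" for g
      proof -
        note [measurable] = L2c_measurable[OF L[OF g]]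
        obtain M where M: "N1 w g = ennreal M" "0 \<le> M" using niceD(2)[OF n[OF g]] by (cases "N1 w g") auto
        have "ennreal ?m * ennreal (cmod (stft \<psi> g x)) \<le> (\<integral>\<^sup>+y. ennreal (cmod (stft gauss g y)) * ennreal (cmod (stft gauss \<psi> (y - x))) \<partial>lborel)"
          by (rule stft_le[OF nice_one[OF weight_axioms n[OF g]] nice_one[OF weight_axioms n[OF \<psi>]]])
        also have "\<dots> \<le> (\<integral>\<^sup>+y. ennreal S * (ennreal (cmod (stft gauss g y)) * ennreal (w y)) \<partial>lborel)"
        proof (rule nn_integral_mono)
          fix y
          have "cmod (stft gauss \<psi> (y - x)) \<le> S * w y" using S(2)[of "y - x"] mult_left_mono[OF ge_1 S(1), of y] by simp
          then have "cmod (stft gauss g y) * cmod (stft gauss \<psi> (y - x)) \<le> cmod (stft gauss g y) * (S * w y)" by (rule mult_left_mono) simp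
          then show "ennreal (cmod (stft gauss g y)) * ennreal (cmod (stft gauss \<psi> (y - x))) \<le> ennreal S * (ennreal (cmod (stft gauss g y)) * ennreal (w y))"
            using S(1) by (simp add: mult_ac flip: ennreal_mult)
        qed
        also have "\<dots> = ennreal S * N1 w g" unfolding N1_def by (rule nn_integral_cmult) measurable
        finally have "?m * cmod (stft \<psi> g x) \<le> S * M"
          using S M gmass_pos[where 'd='d] by (simp add: less_imp_le flip: ennreal_mult)
        then have "cmod (stft \<psi> g x) \<le> S / ?m * M" using gmass_pos[where 'd='d] by (simp add: field_simps)
        then show ?thesis using M g by (simp add: M1_norm_M1[OF g])
      qed
      then show ?thesis by blast
    qed
  qed auto
  have "stft_dual gauss ?t y = stft gauss (tfshift x \<psi>) y" for y
    by (simp add: stft_dual_def M1_tfshift M1_gauss stft_swap[of \<psi>])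
  then have "En ?t = Ne (\<lambda>y. ennreal (cmod (stft gauss (tfshift x \<psi>) y)))" unfolding En_def by simp
  also have "\<dots> < top" by (intro stft_Ne_finite nice_tfshift weight_axioms n \<psi>)
  finally show ?thesis using A by (simp add: modulation_space_iff)
qed

end

subsection \<open>Localization operators\<close>

lemma (in modsp) localization_operator_Syn:
  "localization_operator w a \<phi> \<psi> f = Syn \<psi> (\<lambda>z. a z * stft_dual \<phi> f z)"
  by (simp add: localization_operator_def Syn_def)

text \<open>A localization operator as analysis, multiplication, synthesis. The symbol is measured
  by the quotient of the two weights; the analysis window belongs to the domain side, the synthesis
  window to the target side.\<close>

locale mult_op = A: modsp w1 p q \<mu>1 C1 + B: modsp w2 p q \<mu>2 C2
  for w1 :: "(real^'d) \<times> (real^'d) \<Rightarrow> real" and p q and \<mu>1 :: "(real^'d) \<times> (real^'d) \<Rightarrow> real" and C1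
    and w2 \<mu>2 :: "(real^'d) \<times> (real^'d) \<Rightarrow> real" and C2 +
  fixes a :: "(real^'d) \<times> (real^'d) \<Rightarrow> complex" and \<phi> \<psi> :: "real^'d \<Rightarrow> complex" and c :: real
  assumes a_measurable [measurable]: "a \<in> borel_measurable borel"
    and a_bound: "cmod (a z) * \<mu>2 z \<le> c * \<mu>1 z"
    and \<phi>_M1: "\<phi> \<in> M1_space w1" and \<psi>_M1: "\<psi> \<in> M1_space w2"
begin

definition T :: "((real^'d \<Rightarrow> complex) \<Rightarrow> complex) \<Rightarrow> (real^'d \<Rightarrow> complex) \<Rightarrow> complex" where
  "T f = B.Syn \<psi> (\<lambda>z. a z * stft_dual \<phi> f z)"

lemma c_nonneg: "0 \<le> c"
proof -
  have "0 \<le> c * \<mu>1 0" using a_bound[of 0] by (rule order_trans[rotated]) simp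
  then show ?thesis using A.\<mu>_pos[of 0] by (simp add: zero_le_mult_iff)
qed

lemma H_measurable: "f \<in> A.X \<Longrightarrow> (\<lambda>z. a z * stft_dual \<phi> f z) \<in> borel_measurable borel"
  using A.measurable_stft_dual[OF A.XD \<phi>_M1] by (intro borel_measurable_times) auto

lemma H_estimates:
  "\<exists>K>0. \<forall>f\<in>A.X. B.Ne (\<lambda>z. ennreal (cmod (a z * stft_dual \<phi> f z))) \<le> ennreal (K * A.NX f)
     \<and> (\<forall>z. cmod (a z * stft_dual \<phi> f z) * \<mu>2 z \<le> K * A.NX f)"
proof -
  obtain K where K: "K > 0" "\<And>f. f \<in> A.X \<Longrightarrow> A.Ne (\<lambda>u. ennreal (cmod (stft_dual \<phi> f u))) \<le> ennreal (K * A.NX f)"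
    "\<And>f u. f \<in> A.X \<Longrightarrow> cmod (stft_dual \<phi> f u) * \<mu>1 u \<le> K * A.NX f"
    using A.stft_dual_estimates[OF \<phi>_M1] by blast
  have pt: "cmod (a z * stft_dual \<phi> f z) * \<mu>2 z \<le> c * (cmod (stft_dual \<phi> f z) * \<mu>1 z)" for f z
    using mult_right_mono[OF a_bound[of z], of "cmod (stft_dual \<phi> f z)"] by (simp add: norm_mult mult_ac)
  have 1: "B.Ne (\<lambda>z. ennreal (cmod (a z * stft_dual \<phi> f z))) \<le> ennreal (c * K * A.NX f)" if f: "f \<in> A.X" for f
  proof -
    note [measurable] = A.measurable_stft_dual[OF A.XD[OF f] \<phi>_M1]
    have "B.Ne (\<lambda>z. ennreal (cmod (a z * stft_dual \<phi> f z))) \<le> MN p q (\<lambda>z. ennreal c * (ennreal (cmod (stft_dual \<phi> f z)) * ennreal (\<mu>1 z)))"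
      unfolding B.Ne_def
    proof (rule MN_mono[OF A.p A.q])
      fix z show "ennreal (cmod (a z * stft_dual \<phi> f z)) * ennreal (\<mu>2 z) \<le> ennreal c * (ennreal (cmod (stft_dual \<phi> f z)) * ennreal (\<mu>1 z))"
        using ennreal_leI[OF pt[of z f]] c_nonneg by (simp add: ennreal_mult)
    qed measurable
    also have "\<dots> = ennreal c * A.Ne (\<lambda>z. ennreal (cmod (stft_dual \<phi> f z)))"
      unfolding A.Ne_def by (rule MN_cmult[OF A.p A.q]) measurable
    also have "\<dots> \<le> ennreal c * ennreal (K * A.NX f)" by (intro mult_left_mono K f) simp
    finally show ?thesis using c_nonneg K by (simp add: ennreal_mult mult.assoc)
  qed
  have 2: "cmod (a z * stft_dual \<phi> f z) * \<mu>2 z \<le> c * K * A.NX f" if f: "f \<in> A.X" for f z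
    using order_trans[OF pt mult_left_mono[OF K(3)[OF f] c_nonneg]] by (simp add: mult.assoc)
  define L where "L = c * K + 1"
  have L: "0 < L" "c * K \<le> L" using c_nonneg K(1) by (auto simp: L_def add_nonneg_pos)
  have le: "c * K * A.NX f \<le> L * A.NX f" for f using L by (intro mult_right_mono) auto
  show ?thesis
  proof (intro exI[of _ L] conjI ballI allI L(1))
    fix f z assume f: "f \<in> A.X"
    show "B.Ne (\<lambda>z. ennreal (cmod (a z * stft_dual \<phi> f z))) \<le> ennreal (L * A.NX f)"
      using order_trans[OF 1[OF f] ennreal_leI[OF le]] .
    show "cmod (a z * stft_dual \<phi> f z) * \<mu>2 z \<le> L * A.NX f" using order_trans[OF 2[OF f] le] .
  qed
qed

lemma H_weight: "f \<in> A.X \<Longrightarrow> \<exists>S. \<forall>z. cmod (a z * stft_dual \<phi> f z) \<le> S * w2 z"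
  using H_estimates B.le_weight[of "\<lambda>z. a z * stft_dual \<phi> f z"] by metis

lemma T_antidual: "f \<in> A.X \<Longrightarrow> T f \<in> M1_antidual w2"
  unfolding T_def using H_weight[of f] B.Syn_antidual[OF H_measurable _ B.M1_space_nice[OF \<psi>_M1]] by blast

lemma T_bounded: "\<exists>K\<ge>0. \<forall>f\<in>A.X. T f \<in> B.X \<and> B.NX (T f) \<le> K * A.NX f"
proof -
  obtain K where K: "K > 0" "\<And>f. f \<in> A.X \<Longrightarrow> B.Ne (\<lambda>z. ennreal (cmod (a z * stft_dual \<phi> f z))) \<le> ennreal (K * A.NX f)"
    using H_estimates by blast
  obtain N where N: "N1 w2 \<psi> = ennreal N" "0 \<le> N"
    using niceD(2)[OF B.M1_space_nice[OF \<psi>_M1]] by (cases "N1 w2 \<psi>") auto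
  have "T f \<in> B.X \<and> B.NX (T f) \<le> (C2 * N * K) * A.NX f" if f: "f \<in> A.X" for f
  proof -
    have "B.En (T f) \<le> ennreal C2 * N1 w2 \<psi> * B.Ne (\<lambda>z. ennreal (cmod (a z * stft_dual \<phi> f z)))"
      using B.En_Syn[OF H_measurable[OF f] \<psi>_M1] T_antidual[OF f] by (simp add: T_def)
    also have "\<dots> \<le> ennreal C2 * N1 w2 \<psi> * ennreal (K * A.NX f)" by (intro mult_left_mono K f) simp
    also have "\<dots> = ennreal ((C2 * N * K) * A.NX f)" using N K B.Cm_pos by (simp add: less_imp_le mult.assoc flip: ennreal_mult)
    finally have le: "B.En (T f) \<le> ennreal ((C2 * N * K) * A.NX f)" .
    then have TX: "T f \<in> B.X" using T_antidual[OF f] by (auto simp: B.modulation_space_iff intro: le_less_trans)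
    have "0 \<le> (C2 * N * K) * A.NX f" using N K B.Cm_pos by (simp add: less_imp_le)
    then have "B.NX (T f) \<le> (C2 * N * K) * A.NX f" using le by (simp add: B.En_NX[OF TX])
    with TX show ?thesis by blast
  qed
  then show ?thesis using N K B.Cm_pos by (intro exI[of _ "C2 * N * K"]) (auto simp: less_imp_le)
qed

lemma T_X: "f \<in> A.X \<Longrightarrow> T f \<in> B.X" using T_bounded by blast

lemma T_add: assumes f: "f \<in> A.X" and g: "g \<in> A.X" shows "T (f + g) = T f + T g"
proof -
  obtain S S' where S: "\<And>z. cmod (a z * stft_dual \<phi> f z) \<le> S * w2 z" "\<And>z. cmod (a z * stft_dual \<phi> g z) \<le> S' * w2 z"
    using H_weight f g by meson
  show ?thesis unfolding T_def A.stft_dual_plus distrib_left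
    by (rule B.Syn_add[OF H_measurable[OF f] S(1) H_measurable[OF g] S(2) B.M1_space_nice[OF \<psi>_M1]])
qed

lemma T_scale: "T (cscale k f) = cscale k (T f)"
  unfolding T_def A.stft_dual_scale mult.left_commute[of _ k] by (rule B.Syn_scale)

lemma T_operator: "bounded_operator_on A.X A.NX B.X B.NX T"
  unfolding bounded_operator_on_def using T_bounded T_add T_scale by blast

end

section \<open>Composition of two localization operators with reciprocal symbols\<close>

lemma integral_simple_compose:
  fixes H :: "'a::euclidean_space \<Rightarrow> complex" and G :: "'a \<Rightarrow> complex"
  assumes H: "integrable lborel H" and r: "simple_function borel r"
  shows "(\<Sum>x\<in>range r. (LINT z|lborel. H z * indicator (r -` {x}) z) * G x) = (LINT z|lborel. H z * G (r z))"
proof -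
  have [measurable]: "r \<in> borel_measurable borel" using r by (rule borel_measurable_simple_function)
  have [measurable]: "r -` {x} \<in> sets borel" for x using measurable_sets_borel[of r borel "{x}"] by simp
  have fin: "finite (range r)" using simple_functionD(1)[OF r] by simp
  have ci: "integrable lborel (\<lambda>z. H z * indicator (r -` {x}) z)" for x
    by (rule integrable_dominated[OF integrable_norm[OF H]]) (use H in \<open>auto simp: indicator_def norm_mult\<close>)
  have split: "G (r z) = (\<Sum>x\<in>range r. indicator (r -` {x}) z * G x)" for z
  proof -
    have "(\<Sum>x\<in>range r. indicator (r -` {x}) z * G x) = (\<Sum>x\<in>range r. if x = r z then G x else 0)"
      by (intro sum.cong refl) (auto simp: indicator_def)
    also have "\<dots> = G (r z)" using fin by simp
    finally show ?thesis by simp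
  qed
  have "(\<Sum>x\<in>range r. (LINT z|lborel. H z * indicator (r -` {x}) z) * G x) = (LINT z|lborel. (\<Sum>x\<in>range r. H z * indicator (r -` {x}) z * G x))"
    by (subst Bochner_Integration.integral_sum) (auto intro: integrable_mult_left ci)
  also have "\<dots> = (LINT z|lborel. H z * G (r z))"
    by (rule Bochner_Integration.integral_cong[OF refl]) (subst split, simp add: sum_distrib_left mult.assoc)
  finally show ?thesis .
qed

text \<open>\<open>b\<close> stands for \<open>1 / a\<close>, which is recorded through size bounds
  and through \<open>osc\<close>. There \<open>R'\<close> is uniform in the offset \<open>x\<close>,
  while the exceptional null set may depend on \<open>x\<close>. The locale treats one order of
  composition; the other is a second instance.\<close>

locale loc_pair = A: modsp w1 p q \<mu>1 C1 + B: modsp w2 p q \<mu>2 C2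
  for w1 :: "(real^'d) \<times> (real^'d) \<Rightarrow> real" and p q and \<mu>1 :: "(real^'d) \<times> (real^'d) \<Rightarrow> real" and C1
    and w2 \<mu>2 :: "(real^'d) \<times> (real^'d) \<Rightarrow> real" and C2 +
  fixes v :: "(real^'d) \<times> (real^'d) \<Rightarrow> real" and a b :: "(real^'d) \<times> (real^'d) \<Rightarrow> complex" and \<phi>1 \<phi>2 :: "real^'d \<Rightarrow> complex" and c :: real
  assumes v: "weight v"
    and a_meas [measurable]: "a \<in> borel_measurable borel" and b_meas [measurable]: "b \<in> borel_measurable borel"
    and a_bd: "cmod (a z) * \<mu>2 z \<le> c * \<mu>1 z" and b_bd: "cmod (b z) * \<mu>1 z \<le> c * \<mu>2 z"
    and ab_bd: "cmod (b z * a u) \<le> c * v (u - z)"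
    and osc: "\<And>R e. 0 < R \<Longrightarrow> 0 < e \<Longrightarrow> \<exists>R'. \<forall>x. norm x \<le> R \<longrightarrow> (AE z in lborel. R' < norm z \<longrightarrow> cmod (b z * a (z + x) - 1) \<le> e)"
    and \<phi>1: "\<phi>1 \<in> M1_space w1" "\<phi>1 \<in> M1_space w2" and \<phi>2: "\<phi>2 \<in> M1_space w1" "\<phi>2 \<in> M1_space w2"
    and \<phi>2v: "nice (\<lambda>z. w1 z * v z) \<phi>2"
    and inner: "cmod (l2_inner \<phi>1 \<phi>2) = 1"
begin

sublocale TA: mult_op w1 p q \<mu>1 C1 w2 \<mu>2 C2 a \<phi>1 \<phi>2 c
  by unfold_locales (auto intro: a_bd \<phi>1 \<phi>2)

sublocale TB: mult_op w2 p q \<mu>2 C2 w1 \<mu>1 C1 b \<phi>2 \<phi>1 c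
  by unfold_locales (auto intro: b_bd \<phi>1 \<phi>2)

sublocale v: weight v by (rule v)

lemma meas_\<phi> [measurable]: "\<phi>1 \<in> borel_measurable borel" "\<phi>2 \<in> borel_measurable borel"
  using \<phi>1 \<phi>2 A.M1_space_nice L2c_measurable niceD(1) by blast+

text \<open>In the composition the inner synthesis and the outer analysis both use
  \<open>\<phi>2\<close>, so its autocorrelation on phase space is the convolution kernel that
  dominates everything.\<close>

definition \<kappa> :: "(real^'d) \<times> (real^'d) \<Rightarrow> real" where "\<kappa> x = cmod (stft \<phi>2 \<phi>2 x)"

lemma \<kappa>_measurable [measurable]: "\<kappa> \<in> borel_measurable borel" unfolding \<kappa>_def by measurable

lemma \<kappa>_nonneg [simp]: "0 \<le> \<kappa> x" by (simp add: \<kappa>_def)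

definition I0 :: real where "I0 = (LINT x|lborel. \<kappa> x * (w1 x * v x))"

lemma \<kappa>_integrable: "integrable lborel (\<lambda>x. \<kappa> x * (w1 x * v x))"
proof -
  have "(\<integral>\<^sup>+z. ennreal (cmod (stft \<phi>2 \<phi>2 z)) * ennreal (w1 z * v z) \<partial>lborel) < top"
    by (rule stft_N1_finite[OF weight_mult[OF v A.weight_axioms] \<phi>2v \<phi>2v])
  then show ?thesis by (auto simp: integrable_iff_bounded \<kappa>_def ennreal_mult abs_mult)
qed

lemma I0_nonneg: "0 \<le> I0" unfolding I0_def by (rule integral_nonneg_AE) simp

lemma nn_\<kappa>: "(\<integral>\<^sup>+x. ennreal (\<kappa> x * v x) * ennreal (w1 x) \<partial>lborel) = ennreal I0"
proof -
  have "(\<integral>\<^sup>+x. ennreal (\<kappa> x * v x) * ennreal (w1 x) \<partial>lborel) = (\<integral>\<^sup>+x. ennreal (\<kappa> x * (w1 x * v x)) \<partial>lborel)"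
    by (simp add: ennreal_mult mult_ac)
  also have "\<dots> = ennreal I0" unfolding I0_def by (rule nn_integral_eq_integral[OF \<kappa>_integrable]) simp
  finally show ?thesis .
qed

definition k :: "(real^'d) \<times> (real^'d) \<Rightarrow> (real^'d) \<times> (real^'d) \<Rightarrow> complex" where
  "k z u = cnj (stft \<phi>2 (tfshift z \<phi>2) u)"

lemma cmod_k: "cmod (k z u) = \<kappa> (u - z)" by (simp add: k_def \<kappa>_def cmod_stft_tfshift)

lemma k_measurable [measurable]:
  "f \<in> borel_measurable M \<Longrightarrow> g \<in> borel_measurable M \<Longrightarrow> (\<lambda>x. k (f x) (g x)) \<in> borel_measurable M"
proof -
  assume [measurable]: "f \<in> borel_measurable M" "g \<in> borel_measurable M"
  note [measurable] = meas_\<phi>(2)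
  show ?thesis unfolding k_def by measurable
qed

text \<open>With \<open>\<rho> z u = b z * a u\<close> this describes the composition on the
  transform side; with \<open>\<rho> = 1\<close> it is reproduction through \<open>\<phi>2\<close>.
  Splitting the operator thus amounts to splitting \<open>\<rho>\<close>.\<close>

definition P :: "((real^'d) \<times> (real^'d) \<Rightarrow> (real^'d) \<times> (real^'d) \<Rightarrow> complex) \<Rightarrow> ((real^'d) \<times> (real^'d) \<Rightarrow> complex) \<Rightarrow> (real^'d) \<times> (real^'d) \<Rightarrow> complex" where
  "P \<rho> V z = (LINT u|lborel. \<rho> z u * (k z u * V u))"

lemma P_measurable:
  assumes [measurable]: "(\<lambda>(z, u). \<rho> z u) \<in> borel_measurable (borel \<Otimes>\<^sub>M borel)" "V \<in> borel_measurable borel"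
  shows "P \<rho> V \<in> borel_measurable borel"
  unfolding P_def by (rule lborel.borel_measurable_lebesgue_integral) measurable

lemma nn_P_le:
  assumes [measurable]: "(\<lambda>(z, u). \<rho> z u) \<in> borel_measurable (borel \<Otimes>\<^sub>M borel)" "V \<in> borel_measurable borel" "N \<in> borel_measurable borel"
    and N: "AE u in lborel. cmod (\<rho> z u) \<le> N (u - z)" "\<And>x. 0 \<le> N x"
  shows "(\<integral>\<^sup>+u. ennreal (cmod (\<rho> z u * (k z u * V u))) \<partial>lborel) \<le> (\<integral>\<^sup>+x. ennreal (\<kappa> x * N x) * ennreal (cmod (V (x + z))) \<partial>lborel)"
proof -
  have "(\<integral>\<^sup>+u. ennreal (cmod (\<rho> z u * (k z u * V u))) \<partial>lborel) \<le> (\<integral>\<^sup>+u. ennreal (\<kappa> (u - z) * N (u - z)) * ennreal (cmod (V u)) \<partial>lborel)"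
  proof (rule nn_integral_mono_AE, use N(1) in eventually_elim)
    fix u assume "cmod (\<rho> z u) \<le> N (u - z)"
    from mult_right_mono[OF this, of "\<kappa> (u - z) * cmod (V u)"]
    show "ennreal (cmod (\<rho> z u * (k z u * V u))) \<le> ennreal (\<kappa> (u - z) * N (u - z)) * ennreal (cmod (V u))"
      using N(2) by (simp add: norm_mult cmod_k mult_ac flip: ennreal_mult)
  qed
  also have "\<dots> = (\<integral>\<^sup>+x. ennreal (\<kappa> (x + z - z) * N (x + z - z)) * ennreal (cmod (V (x + z))) \<partial>lborel)"
    by (rule nn_integral_lborel_translate[symmetric]) measurable
  finally show ?thesis by simp
qed

text \<open>Works at every \<open>z\<close>, unlike \<open>P_Ne\<close>. It makes \<open>P\<close>
  additive in \<open>\<rho>\<close> and in the function, and supplies the growth bound needed for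
  synthesis.\<close>

lemma P_bound:
  assumes \<rho>[measurable]: "(\<lambda>(z, u). \<rho> z u) \<in> borel_measurable (borel \<Otimes>\<^sub>M borel)" and V[measurable]: "V \<in> borel_measurable borel"
    and d: "\<And>z u. cmod (\<rho> z u) \<le> d * v (u - z)" and d0: "0 \<le> d" and S: "\<And>u. cmod (V u) * \<mu>1 u \<le> S"
  shows "integrable lborel (\<lambda>u. \<rho> z u * (k z u * V u))" and "cmod (P \<rho> V z) * \<mu>1 z \<le> d * C1 * I0 * S"
proof -
  have S0: "0 \<le> S" using S[of 0] by (rule order_trans[rotated]) simp
  have m[measurable]: "(\<lambda>u. \<rho> z u) \<in> borel_measurable borel"
    using measurable_compose[OF measurable_Pair1'[of z borel borel] \<rho>] by simp
  have "(\<integral>\<^sup>+u. ennreal (cmod (\<rho> z u * (k z u * V u))) \<partial>lborel) * ennreal (\<mu>1 z)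
     \<le> (\<integral>\<^sup>+x. ennreal (\<kappa> x * (d * v x)) * ennreal (cmod (V (x + z))) \<partial>lborel) * ennreal (\<mu>1 z)"
    by (intro mult_right_mono nn_P_le \<rho> V) (use d d0 in auto)
  also have "\<dots> \<le> ennreal C1 * (\<integral>\<^sup>+x. ennreal (\<kappa> x * (d * v x)) * ennreal (w1 x) \<partial>lborel) * ennreal S"
  proof (rule A.sup_Young)
    show "ennreal (cmod (V z)) * ennreal (\<mu>1 z) \<le> ennreal S" for z using S[of z] by (simp add: ennreal_leI flip: ennreal_mult)
  qed measurable
  also have "(\<integral>\<^sup>+x. ennreal (\<kappa> x * (d * v x)) * ennreal (w1 x) \<partial>lborel) = ennreal (d * I0)"
  proof -
    have "(\<integral>\<^sup>+x. ennreal (\<kappa> x * (d * v x)) * ennreal (w1 x) \<partial>lborel) = (\<integral>\<^sup>+x. ennreal d * (ennreal (\<kappa> x * v x) * ennreal (w1 x)) \<partial>lborel)"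
      using d0 by (simp add: ennreal_mult mult_ac)
    also have "\<dots> = ennreal d * ennreal I0" unfolding nn_\<kappa>[symmetric] by (rule nn_integral_cmult) measurable
    finally show ?thesis using d0 I0_nonneg by (simp add: ennreal_mult)
  qed
  also have "ennreal C1 * ennreal (d * I0) * ennreal S = ennreal (d * C1 * I0 * S)"
    using d0 I0_nonneg A.Cm_pos S0 by (simp add: less_imp_le mult_ac flip: ennreal_mult)
  finally have *: "(\<integral>\<^sup>+u. ennreal (cmod (\<rho> z u * (k z u * V u))) \<partial>lborel) * ennreal (\<mu>1 z) \<le> ennreal (d * C1 * I0 * S)" .
  have "(\<integral>\<^sup>+u. ennreal (cmod (\<rho> z u * (k z u * V u))) \<partial>lborel) < top"
    using * A.\<mu>_pos[of z] by (cases "\<integral>\<^sup>+u. ennreal (cmod (\<rho> z u * (k z u * V u))) \<partial>lborel") (auto simp: ennreal_top_mult ennreal_eq_0_iff top_unique)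
  then show "integrable lborel (\<lambda>u. \<rho> z u * (k z u * V u))" by (auto simp: integrable_iff_bounded)
  have "ennreal (cmod (P \<rho> V z)) * ennreal (\<mu>1 z) \<le> (\<integral>\<^sup>+u. ennreal (cmod (\<rho> z u * (k z u * V u))) \<partial>lborel) * ennreal (\<mu>1 z)"
    unfolding P_def by (intro mult_right_mono ennreal_norm_integral_le) simp
  from order_trans[OF this *] show "cmod (P \<rho> V z) * \<mu>1 z \<le> d * C1 * I0 * S"
    using d0 I0_nonneg A.Cm_pos S0 by (simp add: less_imp_le flip: ennreal_mult)
qed

text \<open>The bound on \<open>\<rho>\<close> is available for each offset \<open>x\<close> and
  almost every \<open>z\<close>. Fubini's theorem exchanges the two, so that for almost every
  \<open>z\<close> it holds for almost every \<open>x\<close>, and Young's inequality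
  follows.\<close>

lemma P_Ne:
  assumes \<rho>[measurable]: "(\<lambda>(z, u). \<rho> z u) \<in> borel_measurable (borel \<Otimes>\<^sub>M borel)" and V[measurable]: "V \<in> borel_measurable borel"
    and N[measurable]: "N \<in> borel_measurable borel" and N0: "\<And>x. 0 \<le> N x"
    and le: "\<And>x. AE z in lborel. cmod (\<rho> z (z + x)) \<le> N x"
  shows "A.Ne (\<lambda>z. ennreal (cmod (P \<rho> V z))) \<le> ennreal C1 * (\<integral>\<^sup>+x. ennreal (\<kappa> x * N x) * ennreal (w1 x) \<partial>lborel) * A.Ne (\<lambda>z. ennreal (cmod (V z)))"
proof -
  note [measurable] = P_measurable[OF \<rho> V]
  have "AE x in lborel. AE z in lborel. cmod (\<rho> z (z + x)) \<le> N x" using le by simp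
  then have "AE z in lborel. AE x in lborel. cmod (\<rho> z (z + x)) \<le> N x"
    by (subst (asm) lborel_pair.AE_commute) measurable
  then have ae: "AE z in lborel. ennreal (cmod (P \<rho> V z)) \<le> (\<integral>\<^sup>+x. ennreal (\<kappa> x * N x) * ennreal (cmod (V (x + z))) \<partial>lborel)"
  proof eventually_elim
    case (elim z)
    from AE_lborel_translate[OF elim, of "- z"] have "AE u in lborel. cmod (\<rho> z u) \<le> N (u - z)" by simp
    from nn_P_le[OF \<rho> V N this N0] show ?case
      unfolding P_def by (rule order_trans[OF ennreal_norm_integral_le])
  qed
  have "A.Ne (\<lambda>z. ennreal (cmod (P \<rho> V z))) \<le> A.Ne (\<lambda>z. \<integral>\<^sup>+x. ennreal (\<kappa> x * N x) * ennreal (cmod (V (x + z))) \<partial>lborel)"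
    by (rule A.Ne_mono_AE[OF _ _ ae]) measurable
  also have "\<dots> \<le> ennreal C1 * (\<integral>\<^sup>+x. ennreal (\<kappa> x * N x) * ennreal (w1 x) \<partial>lborel) * A.Ne (\<lambda>z. ennreal (cmod (V z)))"
    by (rule A.Ne_Young) auto
  finally show ?thesis .
qed

abbreviation Vf where "Vf \<equiv> stft_dual \<phi>1"

lemma Vf_measurable: "f \<in> A.X \<Longrightarrow> Vf f \<in> borel_measurable borel"
  by (intro A.measurable_stft_dual A.XD \<phi>1)

text \<open>The part with \<open>\<rho> = 1\<close> is the identity: reproduction through
  \<open>\<phi>2\<close> gives the factor \<open>l2_inner \<phi>2 \<phi>1\<close>, synthesis with
  \<open>\<phi>1\<close> gives its conjugate, and their product is 1 by
  \<open>inner\<close>.\<close>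

lemma composition:
  assumes f: "f \<in> A.X"
  shows "TB.T (TA.T f) - f = A.Syn \<phi>1 (P (\<lambda>z u. b z * a u - 1) (Vf f))"
proof -
  note [measurable] = Vf_measurable[OF f]
  obtain K where K: "\<And>u. cmod (Vf f u) * \<mu>1 u \<le> K * A.NX f" using A.stft_dual_estimates[OF \<phi>1(1)] f by meson
  let ?\<rho> = "\<lambda>z u. b z * a u - 1"
  have c1: "0 \<le> c" by (rule TA.c_nonneg)
  have \<rho>b: "cmod (?\<rho> z u) \<le> (c + 1) * v (u - z)" for z u
    using norm_triangle_ineq4[of "b z * a u" 1] ab_bd[of z u] v.ge_1[of "u - z"] by (simp add: distrib_right)
  have 1: "cmod (1::complex) \<le> 1 * v (u - z)" for u z using v.ge_1 by simp
  have \<rho>m: "(\<lambda>(z, u). ?\<rho> z u) \<in> borel_measurable (borel \<Otimes>\<^sub>M borel)" by measurable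
  have om: "(\<lambda>(z :: (real^'d) \<times> (real^'d), u :: (real^'d) \<times> (real^'d)). 1::complex) \<in> borel_measurable (borel \<Otimes>\<^sub>M borel)" by measurable
  have c10: "0 \<le> c + 1" using c1 by simp
  note b\<rho> = P_bound[OF \<rho>m Vf_measurable[OF f] \<rho>b c10 K]
  note b1 = P_bound[OF om Vf_measurable[OF f] 1 zero_le_one K]
  have P1: "P (\<lambda>z u. 1) (Vf f) z = l2_inner \<phi>2 \<phi>1 * stft_dual \<phi>2 f z" for z
    using A.antidual_reproducing[OF A.XD[OF f] \<phi>1(1) A.M1_space_nice[OF \<phi>2(1)] A.M1_tfshift[OF \<phi>2(1)], of z]
    by (simp add: P_def k_def stft_dual_def mult.commute)
  have TB: "b z * stft_dual \<phi>2 (TA.T f) z = P ?\<rho> (Vf f) z + P (\<lambda>z u. 1) (Vf f) z" for z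
  proof -
    have "b z * stft_dual \<phi>2 (TA.T f) z = (LINT u|lborel. b z * ((a u * Vf f u) * k z u))"
      by (simp add: TA.T_def B.stft_dual_Syn[OF \<phi>2(2)] k_def)
    also have "\<dots> = (LINT u|lborel. ?\<rho> z u * (k z u * Vf f u) + 1 * (k z u * Vf f u))"
      by (rule Bochner_Integration.integral_cong) (auto simp: algebra_simps)
    also have "\<dots> = P ?\<rho> (Vf f) z + P (\<lambda>z u. 1) (Vf f) z"
      unfolding P_def by (rule Bochner_Integration.integral_add[OF b\<rho>(1) b1(1)])
    finally show ?thesis .
  qed
  have "TB.T (TA.T f) = A.Syn \<phi>1 (\<lambda>z. P ?\<rho> (Vf f) z + P (\<lambda>z u. 1) (Vf f) z)"
    unfolding TB.T_def TB ..
  also have "\<dots> = A.Syn \<phi>1 (P ?\<rho> (Vf f)) + A.Syn \<phi>1 (P (\<lambda>z u. 1) (Vf f))"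
    by (rule A.Syn_add[OF P_measurable[OF \<rho>m Vf_measurable[OF f]] A.le_weight[OF b\<rho>(2)] P_measurable[OF om Vf_measurable[OF f]] A.le_weight[OF b1(2)] A.M1_space_nice[OF \<phi>1(1)]])
  also have "A.Syn \<phi>1 (P (\<lambda>z u. 1) (Vf f)) = f"
  proof (rule ext)
    fix g
    show "A.Syn \<phi>1 (P (\<lambda>z u. 1) (Vf f)) g = f g"
    proof (cases "g \<in> M1_space w1")
      case True
      have "A.Syn \<phi>1 (P (\<lambda>z u. 1) (Vf f)) g = (LINT z|lborel. l2_inner \<phi>2 \<phi>1 * (stft_dual \<phi>2 f z * cnj (stft \<phi>1 g z)))"
        using True unfolding A.Syn_def P1 by (simp only: if_True mult.assoc)
      also have "\<dots> = l2_inner \<phi>2 \<phi>1 * (l2_inner \<phi>1 \<phi>2 * f g)"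
        using A.antidual_reproducing[OF A.XD[OF f] \<phi>2(1) A.M1_space_nice[OF \<phi>1(1)] True] by simp
      also have "\<dots> = (cnj (l2_inner \<phi>1 \<phi>2) * l2_inner \<phi>1 \<phi>2) * f g"
        by (simp only: l2_inner_cnj[of \<phi>2 \<phi>1] mult.assoc)
      also have "cnj (l2_inner \<phi>1 \<phi>2) * l2_inner \<phi>1 \<phi>2 = 1"
        using inner complex_norm_square[of "l2_inner \<phi>1 \<phi>2"] by (simp add: mult.commute)
      finally show ?thesis by simp
    next
      case False then show ?thesis using A.XD[OF f] by (auto simp: A.Syn_def M1_antidual_def)
    qed
  qed
  finally show ?thesis by (simp only: add_diff_cancel_right')
qed

text \<open>The integrand is the envelope of the kernel once the compact part is removed: at most
  \<open>e\<close> near the diagonal, and away from it the crude bound \<open>(c + 1) * v x\<close>,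
  which an integrable tail makes small.\<close>

lemma \<kappa>_cut_small:
  assumes \<eta>: "0 < \<eta>"
  shows "\<exists>R>0. \<exists>e>0. (\<integral>\<^sup>+x. ennreal (\<kappa> x * (if norm x \<le> R then e else (c + 1) * v x)) * ennreal (w1 x) \<partial>lborel) \<le> ennreal \<eta>"
proof -
  have c1: "0 \<le> c + 1" using TA.c_nonneg by simp
  let ?h = "\<lambda>x. \<kappa> x * (w1 x * v x)"
  have "(\<lambda>n. LINT x|lborel. ?h x * indicator {x. real n < norm x} x) \<longlonglongrightarrow> (LINT x|(lborel :: ((real^'d) \<times> (real^'d)) measure). 0)"
  proof (rule integral_dominated_convergence[OF _ _ \<kappa>_integrable])
    show "AE x in lborel. (\<lambda>n. ?h x * indicator {x. real n < norm x} x) \<longlonglongrightarrow> 0"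
    proof (rule AE_I2)
      fix x :: "(real^'d) \<times> (real^'d)"
      obtain n0 where n0: "norm x \<le> real n0" using real_arch_simple by blast
      have "\<forall>\<^sub>F n in sequentially. ?h x * indicator {x. real n < norm x} x = 0"
        using eventually_ge_at_top[of n0] by eventually_elim (use n0 in \<open>auto simp: indicator_def\<close>)
      then show "(\<lambda>n. ?h x * indicator {x. real n < norm x} x) \<longlonglongrightarrow> 0" by (rule tendsto_eventually)
    qed
    show "AE x in lborel. norm (?h x * indicator {x. real n < norm x} x) \<le> ?h x" for n
      by (auto simp: indicator_def)
  qed measurable
  then have lim: "(\<lambda>n. LINT x|lborel. ?h x * indicator {x. real n < norm x} x) \<longlonglongrightarrow> 0" by simp
  \<comment> \<open>\<open>\<eta>\<close> is shared equally: the tail, weighted by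
    \<open>c + 1\<close>, uses at most one half, and \<open>e\<close> is chosen below so that the
    part near the diagonal uses the other half.\<close>
  define \<delta> where "\<delta> = \<eta> / (2 * (c + 2))"
  have \<delta>: "0 < \<delta>" using \<eta> c1 by (simp add: \<delta>_def)
  obtain n0 where n0: "\<And>n. n \<ge> n0 \<Longrightarrow> (LINT x|lborel. ?h x * indicator {x. real n < norm x} x) < \<delta>"
    using order_tendstoD(2)[OF lim \<delta>] by (auto simp: eventually_sequentially)
  define R where "R = real (Suc n0)"
  define e where "e = \<eta> / (2 * (I0 + 1))"
  have e: "0 < e" "e * I0 \<le> \<eta> / 2" using I0_nonneg \<eta> by (auto simp: e_def field_simps)
  have R: "0 < R" "(LINT x|lborel. ?h x * indicator {x. R < norm x} x) \<le> \<delta>" using n0[of "Suc n0"] by (auto simp: R_def)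
  have hi: "integrable lborel (\<lambda>x. ?h x * indicator {x. R < norm x} x)"
    by (rule integrable_dominated[OF \<kappa>_integrable]) (auto simp: indicator_def)
  have "(\<integral>\<^sup>+x. ennreal (\<kappa> x * (if norm x \<le> R then e else (c + 1) * v x)) * ennreal (w1 x) \<partial>lborel)
     \<le> (\<integral>\<^sup>+x. ennreal (e * ?h x + (c + 1) * (?h x * indicator {x. R < norm x} x)) \<partial>lborel)"
  proof (rule nn_integral_mono)
    fix x
    have "\<kappa> x * (w1 x * 1) \<le> ?h x" by (intro mult_left_mono v.ge_1) auto
    then have "e * (\<kappa> x * (w1 x * 1)) \<le> e * ?h x" by (rule mult_left_mono) (use e in simp)
    then have "e * (\<kappa> x * w1 x) \<le> e * ?h x" by (simp only: mult_1_right)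
    then show "ennreal (\<kappa> x * (if norm x \<le> R then e else (c + 1) * v x)) * ennreal (w1 x) \<le> ennreal (e * ?h x + (c + 1) * (?h x * indicator {x. R < norm x} x))"
      using e c1 by (auto simp: indicator_def mult_ac intro!: ennreal_leI simp flip: ennreal_mult)
  qed
  also have "\<dots> = ennreal (LINT x|lborel. e * ?h x + (c + 1) * (?h x * indicator {x. R < norm x} x))"
    using e c1 by (intro nn_integral_eq_integral Bochner_Integration.integrable_add integrable_mult_right \<kappa>_integrable hi)
      (auto intro!: add_nonneg_nonneg mult_nonneg_nonneg simp: less_imp_le)
  also have "(LINT x|lborel. e * ?h x + (c + 1) * (?h x * indicator {x. R < norm x} x)) = e * I0 + (c + 1) * (LINT x|lborel. ?h x * indicator {x. R < norm x} x)"
    using Bochner_Integration.integral_add[OF integrable_mult_right[OF \<kappa>_integrable, of e] integrable_mult_right[OF hi, of "c + 1"]]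
    by (simp add: I0_def)
  also have "ennreal \<dots> \<le> ennreal \<eta>"
  proof (rule ennreal_leI)
    have "(c + 1) * (LINT x|lborel. ?h x * indicator {x. R < norm x} x) \<le> (c + 1) * \<delta>" using R c1 by (intro mult_left_mono)
    also have "\<dots> \<le> (c + 2) * \<delta>" using \<delta> by (intro mult_right_mono) auto
    also have "\<dots> = \<eta> / 2"
    proof -
      have "c + 2 \<noteq> 0" using c1 by simp
      moreover have "x * (\<eta> / (2 * x)) = \<eta> / 2" if "x \<noteq> 0" for x :: real using that by simp
      ultimately show ?thesis unfolding \<delta>_def by blast
    qed
    finally show "e * I0 + (c + 1) * (LINT x|lborel. ?h x * indicator {x. R < norm x} x) \<le> \<eta>" using e by simp
  qed
  finally show ?thesis using R(1) e(1) by blast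
qed

text \<open>The shifted window \<open>tfshift x \<phi>1\<close>, regarded as a functional.\<close>

definition \<theta> :: "(real^'d) \<times> (real^'d) \<Rightarrow> (real^'d \<Rightarrow> complex) \<Rightarrow> complex" where
  "\<theta> x = (\<lambda>g. if g \<in> M1_space w1 then cnj (stft \<phi>1 g x) else 0)"

lemma \<theta>_X: "\<theta> x \<in> A.X" unfolding \<theta>_def by (rule A.theta_X[OF \<phi>1(1)])

text \<open>On a ball the norm distances between the shifts of \<open>\<phi>1\<close> at
  \<open>r n z\<close> and at \<open>z\<close> are uniformly bounded and tend to 0 by strong
  continuity, so their integral becomes small for a late \<open>n\<close>.\<close>

lemma shift_average_small:
  assumes \<eta>: "0 < (\<eta>::real)"
  shows "\<exists>r. simple_function borel r \<and> (\<integral>\<^sup>+z. N1 w1 (tfshift (r z) \<phi>1 - tfshift z \<phi>1) * indicator (cball 0 R') z \<partial>lborel) \<le> ennreal \<eta>"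
proof -
  have L: "L2c \<phi>1" by (rule niceD(1)[OF A.M1_space_nice[OF \<phi>1(1)]])
  obtain r :: "nat \<Rightarrow> (real^'d) \<times> (real^'d) \<Rightarrow> (real^'d) \<times> (real^'d)"
    where r: "\<And>n. simple_function borel (r n)" "\<And>z. (\<lambda>n. r n z) \<longlonglongrightarrow> z"
      "\<And>n z. norm (r n z - z) \<le> 1 \<or> r n z = 0"
    using simple_approximation by metis
  have [measurable]: "r n \<in> borel_measurable borel" for n using r(1) by (rule borel_measurable_simple_function)
  have DM[measurable]: "(\<lambda>z. N1 w1 (tfshift (r n z) \<phi>1 - tfshift z \<phi>1)) \<in> borel_measurable borel" for n
    by (rule A.measurable_N1_tfshift_diff[OF L]) measurable
  have [measurable]: "cball (0 :: (real^'d) \<times> (real^'d)) R' \<in> sets borel" by simp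
  obtain K where K: "1 \<le> K" "\<And>z u. norm (u - z) \<le> 1 \<or> u = 0 \<Longrightarrow> w1 u \<le> K * w1 z" using A.simple_weight_bound by blast
  obtain B where B: "1 \<le> B" "\<And>z. norm z \<le> R' \<Longrightarrow> w1 z \<le> B" using A.local_bound by blast
  have "(\<lambda>n. \<integral>\<^sup>+z. N1 w1 (tfshift (r n z) \<phi>1 - tfshift z \<phi>1) * indicator (cball 0 R') z \<partial>lborel) \<longlonglongrightarrow> (\<integral>\<^sup>+z. 0 \<partial>(lborel :: ((real^'d) \<times> (real^'d)) measure))"
  proof (rule nn_integral_dominated_convergence[where w="\<lambda>z. (ennreal ((K + 1) * B) * N1 w1 \<phi>1) * indicator (cball 0 R') z"])
    have "(\<integral>\<^sup>+z. (ennreal ((K + 1) * B) * N1 w1 \<phi>1) * indicator (cball (0 :: (real^'d) \<times> (real^'d)) R') z \<partial>lborel) = (ennreal ((K + 1) * B) * N1 w1 \<phi>1) * emeasure lborel (cball (0 :: (real^'d) \<times> (real^'d)) R')"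
      by (subst nn_integral_cmult_indicator) auto
    also have "\<dots> < \<infinity>" using niceD(2)[OF A.M1_space_nice[OF \<phi>1(1)]] emeasure_lborel_cball_finite[of "0 :: (real^'d) \<times> (real^'d)" R'] by (simp add: ennreal_mult_less_top)
    finally show "(\<integral>\<^sup>+z. (ennreal ((K + 1) * B) * N1 w1 \<phi>1) * indicator (cball (0 :: (real^'d) \<times> (real^'d)) R') z \<partial>lborel) < \<infinity>" .
    show "AE z in lborel. N1 w1 (tfshift (r n z) \<phi>1 - tfshift z \<phi>1) * indicator (cball 0 R') z \<le> (ennreal ((K + 1) * B) * N1 w1 \<phi>1) * indicator (cball 0 R') z" for n
    proof (rule AE_I2)
      fix z
      show "N1 w1 (tfshift (r n z) \<phi>1 - tfshift z \<phi>1) * indicator (cball 0 R') z \<le> (ennreal ((K + 1) * B) * N1 w1 \<phi>1) * indicator (cball 0 R') z"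
      proof (cases "norm z \<le> R'")
        case True
        have "w1 (r n z) + w1 z \<le> (K + 1) * w1 z" using K(2)[OF r(3)[of n z]] by (simp add: distrib_right)
        also have "\<dots> \<le> (K + 1) * B" using K(1) B(2)[OF True] by (intro mult_left_mono) auto
        finally have "N1 w1 (tfshift (r n z) \<phi>1 - tfshift z \<phi>1) \<le> ennreal ((K + 1) * B) * N1 w1 \<phi>1"
          by (intro order_trans[OF A.N1_tfshift_diff_le[OF L]] mult_right_mono ennreal_leI) auto
        then show ?thesis by (rule mult_right_mono) simp
      qed (simp add: indicator_def)
    qed
    show "AE z in lborel. (\<lambda>n. N1 w1 (tfshift (r n z) \<phi>1 - tfshift z \<phi>1) * indicator (cball 0 R') z) \<longlonglongrightarrow> 0"
    proof (rule AE_I2)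
      fix z
      show "(\<lambda>n. N1 w1 (tfshift (r n z) \<phi>1 - tfshift z \<phi>1) * indicator (cball 0 R') z) \<longlonglongrightarrow> 0"
        using A.N1_tfshift_tendsto[OF \<phi>1(1) r(2)[of z]] by (cases "z \<in> cball 0 R'") auto
    qed
  qed measurable
  then have "(\<lambda>n. \<integral>\<^sup>+z. N1 w1 (tfshift (r n z) \<phi>1 - tfshift z \<phi>1) * indicator (cball 0 R') z \<partial>lborel) \<longlonglongrightarrow> 0" by simp
  from order_tendstoD(2)[OF this, of "ennreal \<eta>"] \<eta>
  obtain n where "(\<integral>\<^sup>+z. N1 w1 (tfshift (r n z) \<phi>1 - tfshift z \<phi>1) * indicator (cball 0 R') z \<partial>lborel) < ennreal \<eta>"
    by (auto simp: eventually_sequentially)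
  then show ?thesis using r(1) by (intro exI[of _ "r n"]) auto
qed

text \<open>Replacing \<open>z\<close> by \<open>r z\<close> in the window turns the synthesis
  integral into a finite sum, and the error is synthesised from differences of shifted windows.
  Minkowski's inequality and \<open>stft_Ne_le\<close> reduce it to an average of their
  \<open>N1\<close> norms.\<close>

lemma finite_rank_error:
  assumes r: "simple_function borel r" and H[measurable]: "H \<in> borel_measurable borel"
    and Hb: "\<And>z. cmod (H z) \<le> S * indicator (cball 0 R') z"
  defines "F \<equiv> (\<Sum>x\<in>range r. cscale (LINT z|lborel. H z * indicator (r -` {x}) z) (\<theta> x))"
  shows "A.Syn \<phi>1 H - F \<in> M1_antidual w1"
    and "ennreal (gmass TYPE('d)) * A.En (A.Syn \<phi>1 H - F) \<le> ennreal C1 * A.Ne (\<lambda>y. ennreal (cmod (stft gauss gauss y))) *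
      (ennreal S * (\<integral>\<^sup>+z. N1 w1 (tfshift (r z) \<phi>1 - tfshift z \<phi>1) * indicator (cball 0 R') z \<partial>lborel))"
proof -
  have [measurable]: "r \<in> borel_measurable borel" using r by (rule borel_measurable_simple_function)
  have n1: "nice w1 \<phi>1" by (rule A.M1_space_nice[OF \<phi>1(1)])
  have L: "L2c \<phi>1" by (rule niceD(1)[OF n1])
  have S0: "0 \<le> S * indicator (cball 0 R') z" for z :: "(real^'d) \<times> (real^'d)" using Hb[of z] by (rule order_trans[rotated]) simp
  have Hint: "integrable lborel H"
  proof (rule integrable_dominated[of _ "\<lambda>z. S * indicator (cball 0 R') z"])
    have "emeasure lborel (cball (0 :: (real^'d) \<times> (real^'d)) R') < \<infinity>" by (rule emeasure_lborel_cball_finite)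
    then show "integrable lborel (\<lambda>z :: (real^'d) \<times> (real^'d). S * indicator (cball 0 R') z)" by simp
  qed (use Hb in auto)
  have Hw: "cmod (H z) \<le> \<bar>S\<bar> * w1 z" for z
  proof -
    have "cmod (H z) \<le> \<bar>S\<bar> * 1" using Hb[of z] by (cases "z \<in> cball 0 R'") auto
    also have "\<dots> \<le> \<bar>S\<bar> * w1 z" by (intro mult_left_mono A.ge_1) simp
    finally show ?thesis .
  qed
  have FA: "F \<in> A.X" unfolding F_def by (intro cfun.subspace_sum[OF A.X_subspace] cfun.subspace_scale[OF A.X_subspace] \<theta>_X)
  show AD: "A.Syn \<phi>1 H - F \<in> M1_antidual w1" by (intro A.antidual_minus A.Syn_antidual[OF H Hw n1] A.XD FA)
  have Fg: "F g = (LINT z|lborel. H z * cnj (stft \<phi>1 g (r z)))" if g: "g \<in> M1_space w1" for g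
  proof -
    have "(\<Sum>x\<in>I. cscale (d x) (\<theta> x)) g = (\<Sum>x\<in>I. d x * cnj (stft \<phi>1 g x))" for I d
      by (induction I rule: infinite_finite_induct) (auto simp: cscale_def \<theta>_def g)
    then show ?thesis unfolding F_def by (simp only: integral_simple_compose[OF Hint r])
  qed
  let ?d = "\<lambda>z. tfshift (r z) \<phi>1 - tfshift z \<phi>1"
  have [measurable]: "cball (0 :: (real^'d) \<times> (real^'d)) R' \<in> sets borel" by simp
  have pt: "ennreal (cmod (stft_dual gauss (A.Syn \<phi>1 H - F) y)) \<le> (\<integral>\<^sup>+z. ennreal (cmod (H z)) * ennreal (cmod (stft gauss (?d z) y)) \<partial>lborel)" for y
  proof -
    have gy: "tfshift y gauss \<in> M1_space w1" by (intro A.M1_tfshift A.M1_gauss)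
    have sw: "cnj (stft \<phi>1 (tfshift y gauss) z) = stft gauss (tfshift z \<phi>1) y" for z by (subst stft_swap) simp
    have e: "stft gauss (?d z) y = stft gauss (tfshift (r z) \<phi>1) y - stft gauss (tfshift z \<phi>1) y" for z
      by (rule stft_diff[OF L2c_tfshift[OF L] L2c_tfshift[OF L] L2c_gauss])
    have i1: "integrable lborel (\<lambda>z. H z * stft gauss (tfshift z \<phi>1) y)"
      using A.Syn_integrable[OF H Hw n1 A.M1_space_nice[OF gy]] unfolding sw .
    obtain B where B: "\<And>u. cmod (stft gauss (tfshift u \<phi>1) y) \<le> B"
    proof -
      have "(LINT t|lborel. (cmod (tfshift x h t))\<^sup>2) = (LINT t|lborel. (cmod (h t))\<^sup>2)" for x and h :: "real^'d \<Rightarrow> complex"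
        using lborel_integral_translate(1)[of "\<lambda>t. (cmod (h t))\<^sup>2" "- fst x"] by (simp add: cmod_tfshift)
      then have "cmod (stft gauss (tfshift u \<phi>1) y) \<le> (LINT t|lborel. (cmod (\<phi>1 t))\<^sup>2) + (LINT t|lborel. (cmod (gauss (t::real^'d)))\<^sup>2)" for u
        unfolding stft_def using l2_inner_le[OF L2c_tfshift[OF L] L2c_tfshift[OF L2c_gauss], of u y] by simp
      then show ?thesis by (rule that)
    qed
    have i2: "integrable lborel (\<lambda>z. H z * stft gauss (tfshift (r z) \<phi>1) y)"
    proof (rule integrable_dominated[OF integrable_mult_left[OF integrable_norm[OF Hint], of B]])
      show "norm (H z * stft gauss (tfshift (r z) \<phi>1) y) \<le> norm (H z) * B" for z
        unfolding norm_mult by (intro mult_left_mono B) auto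
    qed measurable
    have "stft_dual gauss (A.Syn \<phi>1 H - F) y = (LINT z|lborel. H z * stft gauss (tfshift z \<phi>1) y) - (LINT z|lborel. H z * stft gauss (tfshift (r z) \<phi>1) y)"
      unfolding A.stft_dual_minus A.stft_dual_Syn[OF A.M1_gauss] sw unfolding stft_dual_def Fg[OF gy] sw ..
    also have "\<dots> = (LINT z|lborel. H z * stft gauss (tfshift z \<phi>1) y - H z * stft gauss (tfshift (r z) \<phi>1) y)"
      by (rule Bochner_Integration.integral_diff[symmetric, OF i1 i2])
    finally have "ennreal (cmod (stft_dual gauss (A.Syn \<phi>1 H - F) y)) \<le> (\<integral>\<^sup>+z. ennreal (cmod (H z * stft gauss (tfshift z \<phi>1) y - H z * stft gauss (tfshift (r z) \<phi>1) y)) \<partial>lborel)"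
      by (simp only: ennreal_norm_integral_le)
    also have "\<dots> = (\<integral>\<^sup>+z. ennreal (cmod (H z)) * ennreal (cmod (stft gauss (?d z) y)) \<partial>lborel)"
      unfolding e by (simp add: norm_mult norm_minus_commute flip: right_diff_distrib ennreal_mult)
    finally show ?thesis .
  qed
  have dm[measurable]: "(\<lambda>x. stft gauss (?d (Z x)) (Y x)) \<in> borel_measurable M" if [measurable]: "Z \<in> borel_measurable M" "Y \<in> borel_measurable M"
    for Z Y :: "'x \<Rightarrow> (real^'d) \<times> (real^'d)" and M
    unfolding stft_diff[OF L2c_tfshift[OF L] L2c_tfshift[OF L] L2c_gauss] by measurable
  have [measurable]: "stft_dual gauss (A.Syn \<phi>1 H - F) \<in> borel_measurable borel" by (rule A.measurable_stft_dual[OF AD A.M1_gauss])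
  let ?G = "A.Ne (\<lambda>y. ennreal (cmod (stft gauss gauss y)))"
  have "ennreal (1 / gmass TYPE('d)) * ennreal (gmass TYPE('d)) = ennreal (1 / gmass TYPE('d) * gmass TYPE('d))"
    by (rule ennreal_mult[symmetric]) (auto intro: less_imp_le)
  then have g1: "ennreal (1 / gmass TYPE('d)) * ennreal (gmass TYPE('d)) = 1" by simp
  have DM[measurable]: "(\<lambda>z. N1 w1 (?d z)) \<in> borel_measurable borel"
    by (rule A.measurable_N1_tfshift_diff[OF L]) measurable
  have "A.En (A.Syn \<phi>1 H - F) \<le> A.Ne (\<lambda>y. \<integral>\<^sup>+z. ennreal (cmod (H z)) * ennreal (cmod (stft gauss (?d z) y)) \<partial>lborel)"
    unfolding A.En_def by (rule A.Ne_mono[OF _ _ pt]) measurable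
  also have "\<dots> = MN p q (\<lambda>y. \<integral>\<^sup>+z. ennreal (cmod (H z)) * ennreal (cmod (stft gauss (?d z) y)) * ennreal (\<mu>1 y) \<partial>lborel)"
    unfolding A.Ne_def by (subst nn_integral_multc) auto
  also have "\<dots> \<le> (\<integral>\<^sup>+z. MN p q (\<lambda>y. ennreal (cmod (H z)) * ennreal (cmod (stft gauss (?d z) y)) * ennreal (\<mu>1 y)) \<partial>lborel)"
    by (rule MN_integral_le[OF A.p A.q sigma_finite_lborel]) measurable
  also have "\<dots> = (\<integral>\<^sup>+z. ennreal (cmod (H z)) * A.Ne (\<lambda>y. ennreal (cmod (stft gauss (?d z) y))) \<partial>lborel)"
  proof (rule nn_integral_cong)
    fix z
    show "MN p q (\<lambda>y. ennreal (cmod (H z)) * ennreal (cmod (stft gauss (?d z) y)) * ennreal (\<mu>1 y)) = ennreal (cmod (H z)) * A.Ne (\<lambda>y. ennreal (cmod (stft gauss (?d z) y)))"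
      unfolding A.Ne_def mult.assoc by (rule MN_cmult[OF A.p A.q]) measurable
  qed
  finally have "ennreal (gmass TYPE('d)) * A.En (A.Syn \<phi>1 H - F) \<le> ennreal (gmass TYPE('d)) * (\<integral>\<^sup>+z. ennreal (cmod (H z)) * A.Ne (\<lambda>y. ennreal (cmod (stft gauss (?d z) y))) \<partial>lborel)"
    by (rule mult_left_mono) simp
  also have "\<dots> \<le> ennreal (gmass TYPE('d)) * (\<integral>\<^sup>+z. ennreal (1 / gmass TYPE('d)) * ((ennreal C1 * ?G * ennreal S) * (N1 w1 (?d z) * indicator (cball 0 R') z)) \<partial>lborel)"
  proof (intro mult_left_mono nn_integral_mono)
    fix z
    have nd: "nice w1 (?d z)" by (intro nice_diff nice_tfshift n1 A.weight_axioms)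
    have "A.Ne (\<lambda>y. ennreal (cmod (stft gauss (?d z) y))) = ennreal (1 / gmass TYPE('d)) * (ennreal (gmass TYPE('d)) * A.Ne (\<lambda>y. ennreal (cmod (stft gauss (?d z) y))))"
      unfolding mult.assoc[symmetric] g1 by simp
    also have "\<dots> \<le> ennreal (1 / gmass TYPE('d)) * (ennreal C1 * ?G * N1 w1 (?d z))"
      by (intro mult_left_mono A.stft_Ne_le[OF nd]) simp
    finally have "ennreal (cmod (H z)) * A.Ne (\<lambda>y. ennreal (cmod (stft gauss (?d z) y))) \<le> ennreal (S * indicator (cball 0 R') z) * (ennreal (1 / gmass TYPE('d)) * (ennreal C1 * ?G * N1 w1 (?d z)))"
      by (intro mult_mono ennreal_leI Hb) auto
    also have "\<dots> = ennreal (1 / gmass TYPE('d)) * ((ennreal C1 * ?G * ennreal S) * (N1 w1 (?d z) * indicator (cball 0 R') z))"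
    proof (cases "z \<in> cball 0 R'")
      case True
      then have "indicator (cball 0 R') z = (1::real)" "indicator (cball 0 R') z = (1::ennreal)" by auto
      then show ?thesis by (simp only: mult_1_right mult_1_left mult_ac)
    next
      case False
      then have "indicator (cball 0 R') z = (0::real)" "indicator (cball 0 R') z = (0::ennreal)" by auto
      then show ?thesis by (simp only: mult_zero_right mult_zero_left ennreal_0)
    qed
    finally show "ennreal (cmod (H z)) * A.Ne (\<lambda>y. ennreal (cmod (stft gauss (?d z) y))) \<le> ennreal (1 / gmass TYPE('d)) * ((ennreal C1 * ?G * ennreal S) * (N1 w1 (?d z) * indicator (cball 0 R') z))" .
  qed simp
  also have "(\<integral>\<^sup>+z. ennreal (1 / gmass TYPE('d)) * ((ennreal C1 * ?G * ennreal S) * (N1 w1 (?d z) * indicator (cball 0 R') z)) \<partial>lborel)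
      = ennreal (1 / gmass TYPE('d)) * (\<integral>\<^sup>+z. (ennreal C1 * ?G * ennreal S) * (N1 w1 (?d z) * indicator (cball 0 R') z) \<partial>lborel)"
    by (rule nn_integral_cmult) measurable
  also have "(\<integral>\<^sup>+z. (ennreal C1 * ?G * ennreal S) * (N1 w1 (?d z) * indicator (cball 0 R') z) \<partial>lborel)
      = (ennreal C1 * ?G * ennreal S) * (\<integral>\<^sup>+z. N1 w1 (?d z) * indicator (cball 0 R') z \<partial>lborel)"
    by (rule nn_integral_cmult) measurable
  also have "ennreal (gmass TYPE('d)) * (ennreal (1 / gmass TYPE('d)) * ((ennreal C1 * ?G * ennreal S) * (\<integral>\<^sup>+z. N1 w1 (?d z) * indicator (cball 0 R') z \<partial>lborel)))
      = (ennreal (1 / gmass TYPE('d)) * ennreal (gmass TYPE('d))) * (ennreal C1 * ?G * (ennreal S * (\<integral>\<^sup>+z. N1 w1 (?d z) * indicator (cball 0 R') z \<partial>lborel)))"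
    by (simp only: mult_ac)
  finally show "ennreal (gmass TYPE('d)) * A.En (A.Syn \<phi>1 H - F) \<le> ennreal C1 * ?G * (ennreal S * (\<integral>\<^sup>+z. N1 w1 (?d z) * indicator (cball 0 R') z \<partial>lborel))"
    unfolding g1 mult_1 .
qed

text \<open>Up to an operator of norm at most one half, the remainder of the composition is synthesized from
  the part of the kernel near the diagonal over a compact set; there \<open>\<pi>(z) \<phi>1\<close> may be replaced
  by \<open>\<pi>(r z) \<phi>1\<close> with a simple function \<open>r\<close>, which leaves a finite-rank operator.\<close>

lemma decomposition:
  "\<exists>S \<Theta>. finite \<Theta> \<and> \<Theta> \<subseteq> A.X \<and> (\<forall>f\<in>A.X. S f \<in> A.X \<and> A.NX (S f) \<le> A.NX f / 2)
     \<and> (\<forall>f\<in>A.X. \<forall>g\<in>A.X. S (f + g) = S f + S g) \<and> (\<forall>k. \<forall>f\<in>A.X. S (cscale k f) = cscale k (S f))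
     \<and> (\<forall>f\<in>A.X. TB.T (TA.T f) - f - S f \<in> cfun.span \<Theta>)"
proof -
  let ?m = "gmass TYPE('d)"
  have n1: "nice w1 \<phi>1" by (rule A.M1_space_nice[OF \<phi>1(1)])
  obtain K where K: "K > 0" "\<And>f. f \<in> A.X \<Longrightarrow> A.Ne (\<lambda>u. ennreal (cmod (Vf f u))) \<le> ennreal (K * A.NX f)"
    "\<And>f u. f \<in> A.X \<Longrightarrow> cmod (Vf f u) * \<mu>1 u \<le> K * A.NX f"
    using A.stft_dual_estimates[OF \<phi>1(1)] by blast
  obtain M where M: "N1 w1 \<phi>1 = ennreal M" "0 \<le> M" using niceD(2)[OF n1] by (cases "N1 w1 \<phi>1") auto
  obtain G where G: "A.Ne (\<lambda>y. ennreal (cmod (stft gauss gauss y))) = ennreal G" "0 \<le> G"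
    using A.Ne_gauss_finite by (cases "A.Ne (\<lambda>y. ennreal (cmod (stft gauss gauss y)))") auto
  have c0: "0 \<le> c" by (rule TA.c_nonneg)
  have C10: "0 \<le> C1" using A.Cm_pos by simp
  \<comment> \<open>\<open>C1 * M\<close> is the cost of synthesis, the second \<open>C1\<close>
    that of Young's inequality for \<open>P\<close>, and \<open>K\<close> that of the transform of
    \<open>f\<close>. With \<open>\<eta> = 1 / (4 * Q)\<close> the non-compact part has norm at most
    one quarter.\<close>
  define Q where "Q = C1 * M * C1 * K + 1"
  have Q: "0 < Q" "C1 * M * C1 * K \<le> Q" using M C10 K(1) by (auto simp: Q_def intro!: add_nonneg_pos)
  define \<eta> where "\<eta> = 1 / (4 * Q)"
  have \<eta>: "0 < \<eta>" "Q * \<eta> = 1 / 4" using Q(1) by (auto simp: \<eta>_def)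
  obtain R e where R: "0 < R" and e: "0 < e"
    and J: "(\<integral>\<^sup>+x. ennreal (\<kappa> x * (if norm x \<le> R then e else (c + 1) * v x)) * ennreal (w1 x) \<partial>lborel) \<le> ennreal \<eta>"
    using \<kappa>_cut_small[OF \<eta>(1)] by blast
  obtain R' where R': "\<And>x. norm x \<le> R \<Longrightarrow> AE z in lborel. R' < norm z \<longrightarrow> cmod (b z * a (z + x) - 1) \<le> e"
    using osc[OF R e] by blast
  define \<rho> where "\<rho> z u = b z * a u - 1" for z u
  define N where "N x = (if norm x \<le> R then e else (c + 1) * v x)" for x
  \<comment> \<open>\<open>\<rho>2\<close> keeps the compact set where
    \<open>norm z \<le> R'\<close> and \<open>norm (u - z) \<le> R\<close>. On its complement
    \<open>\<rho>\<close> is at most \<open>e\<close> for small offsets, by the choice of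
    \<open>R'\<close>, and at most \<open>(c + 1) * v (u - z)\<close> for large ones;
    \<open>N\<close> is this envelope.\<close>
  define \<rho>1 where "\<rho>1 z u = (if norm z \<le> R' \<and> norm (u - z) \<le> R then 0 else \<rho> z u)" for z u
  define \<rho>2 where "\<rho>2 z u = (if norm z \<le> R' \<and> norm (u - z) \<le> R then \<rho> z u else 0)" for z u
  have \<rho>m: "(\<lambda>(z, u). \<rho> z u) \<in> borel_measurable (borel \<Otimes>\<^sub>M borel)" unfolding \<rho>_def by measurable
  have \<rho>1m: "(\<lambda>(z, u). \<rho>1 z u) \<in> borel_measurable (borel \<Otimes>\<^sub>M borel)" unfolding \<rho>1_def \<rho>_def by measurable
  have \<rho>2m: "(\<lambda>(z, u). \<rho>2 z u) \<in> borel_measurable (borel \<Otimes>\<^sub>M borel)" unfolding \<rho>2_def \<rho>_def by measurable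
  have Nm[measurable]: "N \<in> borel_measurable borel" unfolding N_def by measurable
  have N0: "0 \<le> N x" for x using e c0 by (auto simp: N_def)
  have c10: "0 \<le> c + 1" using c0 by simp
  have \<rho>b: "cmod (\<rho> z u) \<le> (c + 1) * v (u - z)" for z u
    using norm_triangle_ineq4[of "b z * a u" 1] ab_bd[of z u] v.ge_1[of "u - z"] by (simp add: distrib_right \<rho>_def)
  have v0: "0 \<le> (c + 1) * v x" for x using c10 by simp
  have \<rho>1b: "cmod (\<rho>1 z u) \<le> (c + 1) * v (u - z)" and \<rho>2b: "cmod (\<rho>2 z u) \<le> (c + 1) * v (u - z)" for z u
    using \<rho>b[of z u] v0[of "u - z"] by (auto simp: \<rho>1_def \<rho>2_def)
  have \<rho>1N: "AE z in lborel. cmod (\<rho>1 z (z + x)) \<le> N x" for x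
  proof (cases "norm x \<le> R")
    case True
    from R'[OF True] show ?thesis
      by eventually_elim (use True e in \<open>auto simp: \<rho>1_def N_def \<rho>_def\<close>)
  next
    case False
    have "cmod (\<rho>1 z (z + x)) \<le> (c + 1) * v x" for z using \<rho>1b[of z "z + x"] by simp
    with False show ?thesis by (simp add: N_def)
  qed
  have KN: "0 \<le> K * A.NX f" for f using K(1) by simp
  note Pb1 = P_bound[OF \<rho>1m Vf_measurable \<rho>1b c10 K(3)]
  note Pb2 = P_bound[OF \<rho>2m Vf_measurable \<rho>2b c10 K(3)]
  define H where "H f = P \<rho>2 (Vf f)" for f
  have Hm[measurable]: "H f \<in> borel_measurable borel" if "f \<in> A.X" for f
    unfolding H_def by (rule P_measurable[OF \<rho>2m Vf_measurable[OF that]])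
  obtain B where B: "1 \<le> B" "\<And>z. norm z \<le> R' \<Longrightarrow> w1 z \<le> B" using A.local_bound by blast
  \<comment> \<open>\<open>P_bound\<close> bounds \<open>H f\<close> relative to
    \<open>\<mu>1\<close>; the factor \<open>C1 / \<mu>1 0\<close> trades that weight for
    \<open>w1\<close>, which is at most \<open>B\<close> on the ball.\<close>
  define S3 where "S3 = (c + 1) * C1 * I0 * K * (C1 / \<mu>1 0) * B"
  have S3: "0 \<le> S3" unfolding S3_def using c10 C10 I0_nonneg K(1) B(1) by (intro mult_nonneg_nonneg divide_nonneg_nonneg) auto
  have Hb: "cmod (H f z) \<le> (S3 * A.NX f) * indicator (cball 0 R') z" if f: "f \<in> A.X" for f z
  proof (cases "norm z \<le> R'")
    case True
    have "cmod (H f z) \<le> ((c + 1) * C1 * I0 * (K * A.NX f)) * (C1 / \<mu>1 0) * w1 z"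
      unfolding H_def by (rule A.le_weight[OF Pb2(2)[OF f f]])
    also have "\<dots> \<le> ((c + 1) * C1 * I0 * (K * A.NX f)) * (C1 / \<mu>1 0) * B"
      using c10 C10 I0_nonneg KN[of f] K(1) by (intro mult_left_mono B(2)[OF True] mult_nonneg_nonneg divide_nonneg_nonneg) auto
    finally show ?thesis using True by (simp add: S3_def mult_ac)
  next
    case False
    then have "\<rho>2 z u = 0" for u by (simp add: \<rho>2_def)
    then show ?thesis using False by (simp add: H_def P_def)
  qed
  \<comment> \<open>Makes the constant of \<open>finite_rank_error\<close>, after division by
    \<open>?m\<close>, at most one quarter; the added 1 keeps the denominator positive.\<close>
  define \<eta>2 where "\<eta>2 = ?m / (4 * (C1 * G * S3 + 1))"
  have den: "0 < C1 * G * S3 + 1" using C10 G S3 by (intro add_nonneg_pos mult_nonneg_nonneg) auto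
  have \<eta>2: "0 < \<eta>2" using den by (simp add: \<eta>2_def)
  obtain r where r: "simple_function borel r"
    and rE: "(\<integral>\<^sup>+z. N1 w1 (tfshift (r z) \<phi>1 - tfshift z \<phi>1) * indicator (cball 0 R') z \<partial>lborel) \<le> ennreal \<eta>2"
    using shift_average_small[OF \<eta>2] by blast
  define d where "d f x = (LINT z|lborel. H f z * indicator (r -` {x}) z)" for f x
  define F where "F f = (\<Sum>x\<in>range r. cscale (d f x) (\<theta> x))" for f
  \<comment> \<open>\<open>S\<close> is defined as what remains, so the claim on the span is
    immediate. The content is in its norm: one quarter from \<open>\<rho>1\<close> and one quarter
    from the error of the finite-rank approximation.\<close>
  define S where "S f = TB.T (TA.T f) - f - F f" for f
  have finr: "finite (range r)" using simple_functionD(1)[OF r] by simp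
  have FX: "F f \<in> A.X" for f
    unfolding F_def by (intro cfun.subspace_sum[OF A.X_subspace] cfun.subspace_scale[OF A.X_subspace] \<theta>_X)
  have SX: "S f \<in> A.X" if "f \<in> A.X" for f
    unfolding S_def by (intro A.X_minus TB.T_X TA.T_X that FX)
  have [measurable]: "r \<in> borel_measurable borel" using r by (rule borel_measurable_simple_function)
  have rs[measurable]: "r -` {x} \<in> sets borel" for x using measurable_sets_borel[of r borel "{x}"] by simp
  have Hint: "integrable lborel (\<lambda>z. H f z * indicator (r -` {x}) z)" if f: "f \<in> A.X" for f x
  proof (rule integrable_dominated[of _ "\<lambda>z. (S3 * A.NX f) * indicator (cball 0 R') z"])
    have "emeasure lborel (cball (0 :: (real^'d) \<times> (real^'d)) R') < \<infinity>" by (rule emeasure_lborel_cball_finite)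
    then show "integrable lborel (\<lambda>z :: (real^'d) \<times> (real^'d). (S3 * A.NX f) * indicator (cball 0 R') z)" by simp
    note [measurable] = Hm[OF f]
    show "(\<lambda>z. H f z * indicator (r -` {x}) z) \<in> borel_measurable lborel" by measurable
    show "norm (H f z * indicator (r -` {x}) z) \<le> (S3 * A.NX f) * indicator (cball 0 R') z" for z
      using Hb[OF f, of z] order_trans[OF norm_ge_zero Hb[OF f, of z]] by (cases "z \<in> r -` {x}") auto
  qed
  have Hadd: "H (f + g) z = H f z + H g z" if "f \<in> A.X" "g \<in> A.X" for f g z
    unfolding H_def P_def A.stft_dual_plus distrib_left
    by (rule Bochner_Integration.integral_add[OF Pb2(1)[OF that(1,1)] Pb2(1)[OF that(2,2)]])
  have Hscale: "H (cscale t f) z = t * H f z" for t f z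
    unfolding H_def P_def A.stft_dual_scale by (simp add: mult.left_commute[of _ t])
  have Sadd: "S (f + g) = S f + S g" if f: "f \<in> A.X" and g: "g \<in> A.X" for f g
  proof -
    have da: "d (f + g) x = d f x + d g x" for x
      unfolding d_def Hadd[OF f g] distrib_right by (rule Bochner_Integration.integral_add[OF Hint[OF f] Hint[OF g]])
    have "F (f + g) = (\<Sum>x\<in>range r. cscale (d f x) (\<theta> x) + cscale (d g x) (\<theta> x))"
      unfolding F_def da by (intro sum.cong refl) (simp add: cscale_def fun_eq_iff algebra_simps)
    then have "F (f + g) = F f + F g" unfolding F_def by (simp only: sum.distrib)
    moreover have "TB.T (TA.T (f + g)) = TB.T (TA.T f) + TB.T (TA.T g)"
      by (simp only: TA.T_add[OF f g] TB.T_add[OF TA.T_X[OF f] TA.T_X[OF g]])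
    ultimately show ?thesis unfolding S_def by (simp only: fun_eq_iff plus_fun_apply fun_diff_def) simp
  qed
  have Sscale: "S (cscale t f) = cscale t (S f)" if f: "f \<in> A.X" for t f
  proof -
    have da: "d (cscale t f) x = t * d f x" for x
      unfolding d_def Hscale mult.assoc by (rule integral_mult_right_zero)
    have "F (cscale t f) = cscale t (F f)"
      unfolding F_def da cfun.scale_sum_right by (simp only: cfun.scale_scale)
    then show ?thesis unfolding S_def TA.T_scale TB.T_scale by (simp only: cfun.scale_right_diff_distrib)
  qed
  have Snorm: "A.NX (S f) \<le> A.NX f / 2" if f: "f \<in> A.X" for f
  proof -
    let ?T = "A.Syn \<phi>1 (H f) - F f"
    note fr = finite_rank_error[OF r Hm[OF f] Hb[OF f], folded d_def, folded F_def]
    have A1: "A.Syn \<phi>1 (P \<rho>1 (Vf f)) \<in> M1_antidual w1"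
      by (rule A.Syn_antidual[OF P_measurable[OF \<rho>1m Vf_measurable[OF f]] A.le_weight[OF Pb1(2)[OF f f]] n1])
    have split: "P (\<lambda>z u. b z * a u - 1) (Vf f) z = P \<rho>1 (Vf f) z + H f z" for z
    proof -
      have "P (\<lambda>z u. b z * a u - 1) (Vf f) z = (LINT u|lborel. \<rho>1 z u * (k z u * Vf f u) + \<rho>2 z u * (k z u * Vf f u))"
        unfolding P_def by (rule Bochner_Integration.integral_cong[OF refl]) (simp add: \<rho>1_def \<rho>2_def \<rho>_def)
      also have "\<dots> = P \<rho>1 (Vf f) z + H f z"
        unfolding H_def P_def by (rule Bochner_Integration.integral_add[OF Pb1(1)[OF f f] Pb2(1)[OF f f]])
      finally show ?thesis .
    qed
    have "TB.T (TA.T f) - f = A.Syn \<phi>1 (\<lambda>z. P \<rho>1 (Vf f) z + H f z)"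
      unfolding composition[OF f] split[symmetric] ..
    also have "\<dots> = A.Syn \<phi>1 (P \<rho>1 (Vf f)) + A.Syn \<phi>1 (H f)"
      by (rule A.Syn_add[OF P_measurable[OF \<rho>1m Vf_measurable[OF f]] A.le_weight[OF Pb1(2)[OF f f]] Hm[OF f] A.le_weight[OF Pb2(2)[OF f f], folded H_def] n1])
    finally have Sf: "S f = A.Syn \<phi>1 (P \<rho>1 (Vf f)) + ?T"
      unfolding S_def by (simp only: add_diff_eq)
    have E1: "A.En (A.Syn \<phi>1 (P \<rho>1 (Vf f))) \<le> ennreal (A.NX f / 4)"
    proof -
      have "A.En (A.Syn \<phi>1 (P \<rho>1 (Vf f))) \<le> ennreal C1 * N1 w1 \<phi>1 * A.Ne (\<lambda>z. ennreal (cmod (P \<rho>1 (Vf f) z)))"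
        by (rule A.En_Syn[OF P_measurable[OF \<rho>1m Vf_measurable[OF f]] \<phi>1(1) A1])
      also have "\<dots> \<le> ennreal C1 * N1 w1 \<phi>1 * (ennreal C1 * (\<integral>\<^sup>+x. ennreal (\<kappa> x * N x) * ennreal (w1 x) \<partial>lborel) * A.Ne (\<lambda>z. ennreal (cmod (Vf f z))))"
        by (intro mult_left_mono P_Ne[OF \<rho>1m Vf_measurable[OF f] Nm N0 \<rho>1N]) simp
      also have "\<dots> \<le> ennreal C1 * N1 w1 \<phi>1 * (ennreal C1 * ennreal \<eta> * ennreal (K * A.NX f))"
        using J K(2)[OF f] unfolding N_def by (intro mult_left_mono mult_mono) auto
      also have "\<dots> = ennreal (C1 * M * C1 * K * (\<eta> * A.NX f))"
        using M C10 \<eta> K(1) by (simp add: mult_ac flip: ennreal_mult)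
      also have "\<dots> \<le> ennreal (Q * (\<eta> * A.NX f))"
        using \<eta> by (intro ennreal_leI mult_right_mono Q(2)) auto
      also have "Q * (\<eta> * A.NX f) = A.NX f / 4" using \<eta>(2) by (simp only: mult.assoc[symmetric])
      finally show ?thesis .
    qed
    have E2: "A.En ?T \<le> ennreal (A.NX f / 4)"
    proof -
      have "ennreal ?m * A.En ?T \<le> ennreal C1 * ennreal G * (ennreal (S3 * A.NX f) * ennreal \<eta>2)"
        unfolding G(1)[symmetric] by (rule order_trans[OF fr(2)], intro mult_left_mono rE zero_le)
      also have "\<dots> = ennreal (C1 * G * S3 * \<eta>2 * A.NX f)"
        using C10 G(2) S3 \<eta>2 by (simp add: mult_ac flip: ennreal_mult)
      also have "\<dots> \<le> ennreal (?m * (A.NX f / 4))"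
      proof (rule ennreal_leI)
        have "C1 * G * S3 * \<eta>2 \<le> (C1 * G * S3 + 1) * \<eta>2" using \<eta>2 by (intro mult_right_mono) auto
        also have "\<dots> = ?m / 4"
        proof -
          have "x * (?m / (4 * x)) = ?m / 4" if "0 < x" for x :: real using that by simp
          then show ?thesis unfolding \<eta>2_def using den by blast
        qed
        finally have "C1 * G * S3 * \<eta>2 * A.NX f \<le> ?m / 4 * A.NX f" by (rule mult_right_mono) simp
        then show "C1 * G * S3 * \<eta>2 * A.NX f \<le> ?m * (A.NX f / 4)" by simp
      qed
      also have "\<dots> = ennreal ?m * ennreal (A.NX f / 4)" by (rule ennreal_mult) (auto intro: less_imp_le)
      finally show ?thesis by (subst (asm) ennreal_mult_le_mult_iff) auto
    qed
    have "ennreal (A.NX (S f)) \<le> ennreal (A.NX f / 4) + ennreal (A.NX f / 4)"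
      unfolding A.En_NX[OF SX[OF f], symmetric] unfolding Sf
      by (rule order_trans[OF A.En_plus[OF A1 fr(1)] add_mono[OF E1 E2]])
    also have "\<dots> = ennreal (A.NX f / 4 + A.NX f / 4)" by (rule ennreal_plus[symmetric]) auto
    finally show ?thesis by (subst (asm) ennreal_le_iff) auto
  qed
  have span: "TB.T (TA.T f) - f - S f \<in> cfun.span (\<theta> ` range r)" for f
  proof -
    have "TB.T (TA.T f) - f - S f = F f" unfolding S_def by (simp only: fun_eq_iff fun_diff_def) simp
    also have "F f \<in> cfun.span (\<theta> ` range r)"
      unfolding F_def by (intro cfun.span_sum cfun.span_scale cfun.span_base imageI)
    finally show ?thesis .
  qed
  show ?thesis
    by (intro exI[of _ S] exI[of _ "\<theta> ` range r"] conjI ballI allI SX Snorm Sadd Sscale span)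
      (use finr \<theta>_X in auto)
qed

end

subsection \<open>Fredholm operators from parametrices\<close>

lemma banach_onD:
  assumes "banach_on X N"
  shows "cfun.subspace X" "f \<in> X \<Longrightarrow> 0 \<le> N f" "f \<in> X \<Longrightarrow> N f = 0 \<longleftrightarrow> f = 0"
    "f \<in> X \<Longrightarrow> g \<in> X \<Longrightarrow> N (f + g) \<le> N f + N g" "f \<in> X \<Longrightarrow> N (cscale c f) = cmod c * N f"
    "(\<And>n. s n \<in> X) \<Longrightarrow> (\<And>e. e > 0 \<Longrightarrow> \<exists>k. \<forall>i\<ge>k. \<forall>j\<ge>k. N (s i - s j) < e) \<Longrightarrow> \<exists>f\<in>X. (\<lambda>n. N (s n - f)) \<longlonglongrightarrow> 0"
  using assms unfolding banach_on_def by blast+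

text \<open>The setting of the Neumann series for \<open>I + S\<close>. The inverse is never formed
  as an operator; injectivity and surjectivity on \<open>X\<close> are all that the Fredholm
  argument uses.\<close>

locale half_contraction =
  fixes X :: "('x \<Rightarrow> complex) set" and N :: "('x \<Rightarrow> complex) \<Rightarrow> real" and S :: "('x \<Rightarrow> complex) \<Rightarrow> 'x \<Rightarrow> complex"
  assumes ban: "banach_on X N"
    and S_mem: "f \<in> X \<Longrightarrow> S f \<in> X" and S_norm: "f \<in> X \<Longrightarrow> N (S f) \<le> N f / 2"
    and S_add: "f \<in> X \<Longrightarrow> g \<in> X \<Longrightarrow> S (f + g) = S f + S g"
    and S_scale: "f \<in> X \<Longrightarrow> S (cscale k f) = cscale k (S f)"
begin

lemmas B = banach_onD[OF ban]
lemmas sub = cfun.subspace_diff[OF B(1)] cfun.subspace_add[OF B(1)] cfun.subspace_scale[OF B(1)] cfun.subspace_0[OF B(1)]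

lemma S_diff: assumes "f \<in> X" "g \<in> X" shows "S (f - g) = S f - S g"
  unfolding cscale_minus_one by (simp only: S_add[OF assms(1) sub(3)[OF assms(2)]] S_scale[OF assms(2)])

lemma S_0: "S 0 = 0"
  using S_diff[OF sub(4) sub(4)] by (simp only: diff_self)

lemma norm_sym: assumes "f \<in> X" "g \<in> X" shows "N (f - g) = N (g - f)"
proof -
  have "N (cscale (-1) (g - f)) = cmod (-1) * N (g - f)" using assms by (intro B(5) sub)
  moreover have "cscale (-1) (g - f) = f - g" by (simp add: cscale_def fun_eq_iff)
  ultimately show ?thesis by simp
qed

lemma norm_tri: assumes "f \<in> X" "g \<in> X" "h \<in> X" shows "N (f - h) \<le> N (f - g) + N (g - h)"
proof -
  have "(f - g) + (g - h) = f - h" by (simp add: fun_eq_iff)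
  with B(4)[OF sub(1)[OF assms(1,2)] sub(1)[OF assms(2,3)]] show ?thesis by (simp only:)
qed

lemma inj: assumes x: "x \<in> X" and eq: "x + S x = 0" shows "x = 0"
proof -
  have "S x = cscale (-1) x" using eq by (simp add: fun_eq_iff cscale_def add_eq_0_iff)
  then have "N x \<le> N x / 2" using S_norm[OF x] B(5)[OF x, of "-1"] by simp
  then have "N x = 0" using B(2)[OF x] by simp
  then show ?thesis using B(3)[OF x] by simp
qed

text \<open>The Neumann series written as the iteration of \<open>x \<mapsto> y - S x\<close> from
  0. Its fixed points are the solutions, and successive differences shrink by a factor of
  two.\<close>

lemma surj: assumes y: "y \<in> X" shows "\<exists>x\<in>X. x + S x = y"
proof -
  define s where "s = rec_nat 0 (\<lambda>_ x. y - S x)"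
  have s0: "s 0 = 0" and sS: "s (Suc n) = y - S (s n)" for n by (simp_all add: s_def)
  have sX: "s n \<in> X" for n
  proof (induction n)
    case 0 show ?case unfolding s0 by (rule sub(4))
  next
    case (Suc n) then show ?case unfolding sS by (intro sub(1) y S_mem)
  qed
  define D where "D i j = N (s i - s j)" for i j
  have D_sym: "D i j = D j i" for i j unfolding D_def by (rule norm_sym[OF sX sX])
  have D_tri: "D i k \<le> D i j + D j k" for i j k unfolding D_def by (rule norm_tri[OF sX sX sX])
  have D_0: "D n n = 0" for n unfolding D_def diff_self using B(3)[OF sub(4)] by simp
  have step: "D (Suc n) n \<le> N y / 2 ^ n" for n
  proof (induction n)
    case 0
    have "s (Suc 0) - s 0 = y" unfolding sS s0 S_0 by (simp only: diff_zero)
    then show ?case by (simp add: D_def)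
  next
    case (Suc n)
    have "(y - p) - (y - q) = q - p" for p q :: "'x \<Rightarrow> complex" by (simp add: fun_eq_iff)
    then have "s (Suc (Suc n)) - s (Suc n) = S (s n) - S (s (Suc n))" unfolding sS[of "Suc n"] by (subst (2) sS[of n])
    also have "\<dots> = S (s n - s (Suc n))" by (rule S_diff[OF sX sX, symmetric])
    finally have "D (Suc (Suc n)) (Suc n) \<le> D n (Suc n) / 2" unfolding D_def using S_norm[OF sub(1)[OF sX sX], of n "Suc n"] by (simp only:)
    also have "\<dots> \<le> N y / 2 ^ n / 2" unfolding D_sym[of n] using Suc by simp
    finally show ?case by simp
  qed
  \<comment> \<open>The exact partial geometric sum, with its subtracted end term, is what makes the
    induction on \<open>k\<close> close; \<open>tail'\<close> then drops that term.\<close>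
  have tail: "D (n + k) n \<le> 2 * N y / 2 ^ n - 2 * N y / 2 ^ (n + k)" for n k
  proof (induction k)
    case 0 show ?case by (simp add: D_0)
  next
    case (Suc k)
    have "D (n + Suc k) n \<le> D (Suc (n + k)) (n + k) + D (n + k) n"
      using D_tri by simp
    also have "\<dots> \<le> N y / 2 ^ (n + k) + (2 * N y / 2 ^ n - 2 * N y / 2 ^ (n + k))" by (intro add_mono step Suc)
    also have "\<dots> = 2 * N y / 2 ^ n - 2 * N y / 2 ^ (n + Suc k)" by (simp add: field_simps)
    finally show ?case .
  qed
  have Ny: "0 \<le> N y" by (rule B(2)[OF y])
  have tail': "D i n \<le> 2 * N y / 2 ^ n" if "i \<ge> n" for i n
  proof -
    obtain k where "i = n + k" using \<open>i \<ge> n\<close> le_Suc_ex by blast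
    moreover have "0 \<le> 2 * N y / 2 ^ (n + k)" using Ny by simp
    ultimately show ?thesis using tail[of n k] by simp
  qed
  have "\<exists>k. \<forall>i\<ge>k. \<forall>j\<ge>k. N (s i - s j) < e" if e: "e > 0" for e
  proof -
    have "(\<lambda>n. 4 * N y * (1 / 2) ^ n) \<longlonglongrightarrow> 4 * N y * 0" by (intro tendsto_mult tendsto_const LIMSEQ_power_zero) simp
    from order_tendstoD(2)[OF this, of e] e obtain k where k: "4 * N y * (1 / 2) ^ k < e" by (auto simp: eventually_sequentially)
    have "N (s i - s j) < e" if "i \<ge> k" "j \<ge> k" for i j
    proof -
      have "D i j \<le> D i k + D j k" using D_tri[of i j k] D_sym[of k j] by linarith
      also have "\<dots> \<le> 2 * N y / 2 ^ k + 2 * N y / 2 ^ k" by (intro add_mono tail' that)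
      also have "\<dots> = 4 * N y * (1 / 2) ^ k" by (simp add: power_divide)
      finally show ?thesis using k unfolding D_def by linarith
    qed
    then show ?thesis by blast
  qed
  from B(6)[OF sX this] obtain x where x: "x \<in> X" and lim: "(\<lambda>n. N (s n - x)) \<longlonglongrightarrow> 0" by blast
  have bd: "N (x + S x - y) \<le> N (s (Suc n) - x) + N (s n - x)" for n
  proof -
    have "x + S x - y = (x - s (Suc n)) + (S x - S (s n))" unfolding sS by (simp add: fun_eq_iff)
    also have "\<dots> = (x - s (Suc n)) + S (x - s n)" by (simp only: S_diff[OF x sX])
    finally have "N (x + S x - y) \<le> N (x - s (Suc n)) + N (S (x - s n))"
      using B(4)[OF sub(1)[OF x sX] S_mem[OF sub(1)[OF x sX]]] by (simp only:)
    also have "\<dots> \<le> N (x - s (Suc n)) + N (x - s n)"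
      using S_norm[OF sub(1)[OF x sX], of n] B(2)[OF sub(1)[OF x sX], of n] by linarith
    finally show ?thesis by (simp only: norm_sym[OF x sX])
  qed
  have "(\<lambda>n. N (s (Suc n) - x) + N (s n - x)) \<longlonglongrightarrow> 0 + 0" by (intro tendsto_add LIMSEQ_Suc lim)
  from LIMSEQ_le_const[OF this] bd have "N (x + S x - y) \<le> 0 + 0" by blast
  moreover have xy: "x + S x - y \<in> X" by (intro sub x S_mem y)
  ultimately have "x + S x - y = 0" using B(2,3)[OF xy] by simp
  then have "x + S x = y" by (simp only: right_minus_eq)
  with x show ?thesis by blast
qed

end

text \<open>\<open>R\<close> is the identity plus a contraction, up to a remainder in a fixed
  finite-dimensional space. Linearity of the remainder is implicit in that of \<open>R\<close> and
  \<open>S\<close>.\<close>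

definition small_mod_finite :: "('x \<Rightarrow> complex) set \<Rightarrow> (('x \<Rightarrow> complex) \<Rightarrow> real) \<Rightarrow> (('x \<Rightarrow> complex) \<Rightarrow> ('x \<Rightarrow> complex)) \<Rightarrow> bool" where
  "small_mod_finite X N R \<longleftrightarrow> (\<exists>S \<Theta>. half_contraction X N S \<and> finite \<Theta> \<and> \<Theta> \<subseteq> X
     \<and> (\<forall>f\<in>X. R f - f - S f \<in> cfun.span \<Theta>))"

text \<open>If \<open>A f = 0\<close>, then \<open>f + S f\<close> lies in a finite-dimensional
  span, so \<open>f\<close> lies in its preimage under the injective \<open>I + S\<close>; this uses
  \<open>B A\<close>. For the range, \<open>y = y' + S' y'\<close> differs from
  \<open>A (B y')\<close> by an element of a finite span; this uses \<open>A B\<close>.\<close>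

lemma fredholm_parametrix:
  assumes X: "banach_on X NX" and Y: "banach_on Y NY"
    and A: "bounded_operator_on X NX Y NY A" and B: "bounded_operator_on Y NY X NX B"
    and BA: "small_mod_finite X NX (\<lambda>f. B (A f))" and AB: "small_mod_finite Y NY (\<lambda>f. A (B f))"
  shows "fredholm_on X NX Y NY A"
  unfolding fredholm_on_def
proof (intro conjI X Y A)
  note subX = banach_onD(1)[OF X] note subY = banach_onD(1)[OF Y]
  from BA[unfolded small_mod_finite_def] obtain S \<Theta> where BA': "half_contraction X NX S \<and> finite \<Theta> \<and> \<Theta> \<subseteq> X
    \<and> (\<forall>f\<in>X. B (A f) - f - S f \<in> cfun.span \<Theta>)" by (elim exE)
  have hc: "half_contraction X NX S" and \<Theta>: "finite \<Theta>" "\<Theta> \<subseteq> X" by (intro conjunct1[OF BA'] conjunct1[OF conjunct2[OF BA']] conjunct1[OF conjunct2[OF conjunct2[OF BA']]])+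
  have R: "B (A f) - f - S f \<in> cfun.span \<Theta>" if "f \<in> X" for f
    by (rule bspec[OF conjunct2[OF conjunct2[OF conjunct2[OF BA']]] that])
  interpret N: half_contraction X NX S by (rule hc)
  \<comment> \<open>Preimages under \<open>I + S\<close> of the finitely many generators. Their span
    will contain the kernel of \<open>A\<close>.\<close>
  have "\<forall>t\<in>\<Theta>. \<exists>x. x \<in> X \<and> x + S x = t" using N.surj \<Theta>(2) by blast
  then obtain g where g: "\<forall>t\<in>\<Theta>. g t \<in> X \<and> g t + S (g t) = t" by (rule bchoice[THEN exE])
  then have gX: "g t \<in> X" and gt: "g t + S (g t) = t" if "t \<in> \<Theta>" for t using that by blast+
  show "\<exists>K. finite K \<and> {f \<in> X. A f = 0} \<subseteq> cfun.span K"
  proof (intro exI[of _ "g ` \<Theta>"] conjI subsetI)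
    show "finite (g ` \<Theta>)" using \<Theta> by simp
    fix f assume "f \<in> {f \<in> X. A f = 0}"
    then have f: "f \<in> X" and Af: "A f = 0" by auto
    have "B (cscale 0 0) = cscale 0 (B 0)" using B cfun.subspace_0[OF subY] unfolding bounded_operator_on_def by blast
    then have "B 0 = 0" by (simp add: cscale_def zero_fun_def)
    then have "0 - f - S f \<in> cfun.span \<Theta>" using R[OF f] unfolding Af by (simp only:)
    moreover have "- (0 - f - S f) = f + S f" by (simp add: fun_eq_iff)
    ultimately have "f + S f \<in> cfun.span \<Theta>" using cfun.span_neg[of "0 - f - S f" \<Theta>] by (simp only:)
    then obtain u where u: "f + S f = (\<Sum>t\<in>\<Theta>. cscale (u t) t)" unfolding cfun.span_finite[OF \<Theta>(1)] by (rule imageE)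
    have sums: "(\<Sum>t\<in>I. cscale (u t) (g t)) \<in> X \<and> S (\<Sum>t\<in>I. cscale (u t) (g t)) = (\<Sum>t\<in>I. cscale (u t) (S (g t)))" if "finite I" "I \<subseteq> \<Theta>" for I
      using that
    proof (induction I)
      case empty
      show ?case unfolding sum.empty by (intro conjI cfun.subspace_0[OF subX] N.S_0)
    next
      case (insert t I)
      have t: "t \<in> \<Theta>" and I: "I \<subseteq> \<Theta>" using insert by auto
      have 1: "cscale (u t) (g t) \<in> X" by (rule cfun.subspace_scale[OF subX gX[OF t]])
      have 2: "(\<Sum>t\<in>I. cscale (u t) (g t)) \<in> X" by (rule conjunct1[OF insert.IH[OF I]])
      have "S (cscale (u t) (g t) + (\<Sum>t\<in>I. cscale (u t) (g t))) = cscale (u t) (S (g t)) + (\<Sum>t\<in>I. cscale (u t) (S (g t)))"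
        unfolding N.S_add[OF 1 2] N.S_scale[OF gX[OF t]] by (rule arg_cong[OF conjunct2[OF insert.IH[OF I]]])
      then show ?case unfolding sum.insert[OF insert(1,2)] by (rule conjI[OF cfun.subspace_add[OF subX 1 2]])
    qed
    let ?x = "\<Sum>t\<in>\<Theta>. cscale (u t) (g t)"
    have xX: "?x \<in> X" and Sx: "S ?x = (\<Sum>t\<in>\<Theta>. cscale (u t) (S (g t)))" by (rule conjunct1[OF sums[OF \<Theta>(1) subset_refl]], rule conjunct2[OF sums[OF \<Theta>(1) subset_refl]])
    have "?x + S ?x = (\<Sum>t\<in>\<Theta>. cscale (u t) (g t) + cscale (u t) (S (g t)))" unfolding Sx by (rule sum.distrib[symmetric])
    also have "\<dots> = (\<Sum>t\<in>\<Theta>. cscale (u t) t)"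
      by (rule sum.cong[OF refl]) (simp only: cfun.scale_right_distrib[symmetric] gt)
    also note u[symmetric]
    finally have eq: "?x + S ?x = f + S f" .
    \<comment> \<open>\<open>f\<close> and the combination \<open>?x\<close> of the chosen preimages
      have the same image under \<open>I + S\<close>, so injectivity identifies them.\<close>
    have "(f - ?x) + S (f - ?x) = (f + S f) - (?x + S ?x)" unfolding N.S_diff[OF f xX] by (rule add_diff_add[symmetric])
    also have "\<dots> = 0" unfolding eq by (rule diff_self)
    finally have "f - ?x = 0" by (rule N.inj[OF cfun.subspace_diff[OF subX f xX]])
    then have "f = ?x" by (rule right_minus_eq[THEN iffD1])
    also have "?x \<in> cfun.span (g ` \<Theta>)" by (intro cfun.span_sum cfun.span_scale cfun.span_base imageI)
    finally show "f \<in> cfun.span (g ` \<Theta>)" .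
  qed
  from AB[unfolded small_mod_finite_def] obtain S' \<Theta>' where AB': "half_contraction Y NY S' \<and> finite \<Theta>' \<and> \<Theta>' \<subseteq> Y
    \<and> (\<forall>f\<in>Y. A (B f) - f - S' f \<in> cfun.span \<Theta>')" by (elim exE)
  have hc': "half_contraction Y NY S'" and \<Theta>': "finite \<Theta>'" "\<Theta>' \<subseteq> Y" by (intro conjunct1[OF AB'] conjunct1[OF conjunct2[OF AB']] conjunct1[OF conjunct2[OF conjunct2[OF AB']]])+
  have R': "A (B f) - f - S' f \<in> cfun.span \<Theta>'" if "f \<in> Y" for f
    by (rule bspec[OF conjunct2[OF conjunct2[OF conjunct2[OF AB']]] that])
  interpret N': half_contraction Y NY S' by (rule hc')
  show "\<exists>K. finite K \<and> K \<subseteq> Y \<and> (\<forall>y\<in>Y. \<exists>f\<in>X. y - A f \<in> cfun.span K)"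
  proof (intro exI[of _ \<Theta>'] conjI ballI \<Theta>')
    fix y assume y: "y \<in> Y"
    obtain y' where y': "y' \<in> Y" "y' + S' y' = y" using N'.surj[OF y] by blast
    have "B y' \<in> X" using B y' by (simp add: bounded_operator_on_def)
    moreover have "A (B y') - y' - S' y' = - (y - A (B y'))" using fun_cong[OF y'(2)] by (auto simp: fun_eq_iff algebra_simps)
    then have "- (A (B y') - y' - S' y') = y - A (B y')" by (simp only: minus_minus)
    then have "y - A (B y') \<in> cfun.span \<Theta>'" using cfun.span_neg[OF R'[OF y'(1)]] by (simp only:)
    ultimately show "\<exists>f\<in>X. y - A f \<in> cfun.span \<Theta>'" by blast
  qed
qed

lemma fredholm_on_cong:
  assumes eq: "\<And>f. f \<in> X \<Longrightarrow> A f = A' f" and fr: "fredholm_on X NX Y NY A'"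
  shows "fredholm_on X NX Y NY A"
proof -
  have sub: "cfun.subspace X" using fr by (auto simp: fredholm_on_def banach_on_def)
  have b: "bounded_operator_on X NX Y NY A" using fr eq cfun.subspace_add[OF sub] cfun.subspace_scale[OF sub]
    unfolding fredholm_on_def bounded_operator_on_def by simp
  have "{f \<in> X. A f = 0} = {f \<in> X. A' f = 0}" using eq by auto
  moreover have "(\<exists>f\<in>X. y - A f \<in> V) \<longleftrightarrow> (\<exists>f\<in>X. y - A' f \<in> V)" for y V using eq by auto
  ultimately show ?thesis using fr b unfolding fredholm_on_def by simp
qed

subsection \<open>Oscillation of the symbol\<close>

text \<open>The classical flat function \<open>exp (- (1 / t))\<close> divided by powers of
  \<open>t\<close>. The powers are carried along because differentiation produces them, so the
  family is closed under derivatives.\<close>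

definition bump :: "nat \<Rightarrow> real \<Rightarrow> real" where
  "bump n t = (if t \<le> 0 then 0 else exp (- (1 / t)) / t ^ n)"

lemma bump_tendsto_0: "(bump n \<longlongrightarrow> 0) (at 0)"
proof -
  have "((\<lambda>x::real. x ^ n / exp x) \<longlongrightarrow> 0) at_top" by (rule tendsto_power_div_exp_0)
  then have "((\<lambda>t::real. inverse t ^ n / exp (inverse t)) \<longlongrightarrow> 0) (at_right 0)"
    by (rule filterlim_compose[OF _ filterlim_inverse_at_top_right])
  then have r: "(bump n \<longlongrightarrow> 0) (at_right 0)"
    by (rule Lim_transform_eventually)
      (auto simp: eventually_at_right_field bump_def exp_minus field_simps intro!: exI[of _ 1])
  have l: "(bump n \<longlongrightarrow> 0) (at_left 0)"
    by (rule tendsto_eventually) (auto simp: eventually_at_left_field bump_def intro!: exI[of _ "-1"])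
  show ?thesis using l r by (simp add: filterlim_at_split)
qed

lemma bump_deriv: "(bump n has_real_derivative bump (n + 2) t - real n * bump (n + 1) t) (at t)"
proof (cases "t = 0")
  case True
  \<comment> \<open>At 0 the difference quotient of \<open>bump n\<close> is
    \<open>bump (n + 1)\<close> itself, so flatness at 0 gives the derivative 0.\<close>
  have "(bump (Suc n) \<longlongrightarrow> 0) (at 0)" by (rule bump_tendsto_0)
  then have "((\<lambda>h. (bump n (0 + h) - bump n 0) / h) \<longlongrightarrow> 0) (at 0)"
    by (rule Lim_transform_eventually) (auto simp: bump_def eventually_at intro!: exI[of _ 1])
  then show ?thesis unfolding True DERIV_def by (simp add: bump_def)
next
  case False
  show ?thesis
  proof (cases "t > 0")
    case True
    have "((\<lambda>t. exp (- (1 / t)) / t ^ n) has_real_derivative bump (n + 2) t - real n * bump (n + 1) t) (at t)"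
      using True by (auto intro!: derivative_eq_intros simp: bump_def field_simps power2_eq_square split: nat.split)
        (cases n; simp add: field_simps)
    moreover have "\<forall>\<^sub>F s in nhds t. bump n s = exp (- (1 / s)) / s ^ n"
      using eventually_nhds_in_open[of "{0<..}" t] True by (auto elim!: eventually_mono simp: bump_def)
    ultimately show ?thesis by (subst DERIV_cong_ev[OF refl _ refl]) auto
  next
    case False
    with \<open>t \<noteq> 0\<close> have t: "t < 0" by simp
    have "((\<lambda>t. 0) has_real_derivative 0) (at t)" by simp
    moreover have "\<forall>\<^sub>F s in nhds t. bump n s = 0"
      using eventually_nhds_in_open[of "{..<0}" t] t by (auto elim!: eventually_mono simp: bump_def)
    ultimately have "(bump n has_real_derivative 0) (at t)" by (subst DERIV_cong_ev[OF refl _ refl]) auto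
    then show ?thesis using t by (simp add: bump_def)
  qed
qed

text \<open>An explicit algebra of functions closed under directional derivatives, built to make
  \<open>Ck k\<close> for all \<open>k\<close> a simple induction. It is rich enough for the test
  functions used here.\<close>

inductive_set smooth_fns :: "('a::euclidean_space \<Rightarrow> complex) set" where
  bump: "(\<lambda>x. of_real (bump n (x \<bullet> i + d))) \<in> smooth_fns"
| const: "(\<lambda>x. c) \<in> smooth_fns"
| add: "f \<in> smooth_fns \<Longrightarrow> g \<in> smooth_fns \<Longrightarrow> (\<lambda>x. f x + g x) \<in> smooth_fns"
| mult: "f \<in> smooth_fns \<Longrightarrow> g \<in> smooth_fns \<Longrightarrow> (\<lambda>x. f x * g x) \<in> smooth_fns"

lemma smooth_fns_derivative:
  "f \<in> smooth_fns \<Longrightarrow> \<exists>D. (\<forall>x. (f has_derivative D x) (at x)) \<and> (\<forall>b. (\<lambda>x. D x b) \<in> smooth_fns)"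
proof (induction rule: smooth_fns.induct)
  case (bump n i d)
  let ?D = "\<lambda>x h. of_real ((h \<bullet> i) * (bump (n + 2) (x \<bullet> i + d) - real n * bump (n + 1) (x \<bullet> i + d))) :: complex"
  have der: "((\<lambda>x. complex_of_real (bump n (x \<bullet> i + d))) has_derivative ?D x) (at x)" for x
  proof -
    have "((\<lambda>x. x \<bullet> i + d) has_derivative (\<lambda>h. h \<bullet> i)) (at x)" by (auto intro!: derivative_eq_intros)
    then have "((\<lambda>x. bump n (x \<bullet> i + d)) has_derivative (\<lambda>h. (bump (n + 2) (x \<bullet> i + d) - real n * bump (n + 1) (x \<bullet> i + d)) * (h \<bullet> i))) (at x)"
      by (rule has_derivative_compose[where f = "\<lambda>x. x \<bullet> i + d" and g = "bump n"])
        (rule bump_deriv[unfolded has_field_derivative_def])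
    from has_derivative_of_real[OF this] show ?thesis by (simp add: mult.commute)
  qed
  have smooth: "(\<lambda>x. ?D x b) \<in> smooth_fns" for b
  proof -
    have "(\<lambda>x. of_real (b \<bullet> i) * (of_real (bump (n + 2) (x \<bullet> i + d)) + of_real (- real n) * of_real (bump (n + 1) (x \<bullet> i + d)))) \<in> smooth_fns"
      by (intro smooth_fns.intros)
    then show ?thesis by simp
  qed
  show ?case by (rule exI[of _ ?D], intro conjI allI der smooth)
next
  case (const c)
  show ?case by (rule exI[of _ "\<lambda>x h. 0"]) (auto intro: smooth_fns.const)
next
  case (add f g)
  then obtain D E where "\<And>x. (f has_derivative D x) (at x)" "\<And>b. (\<lambda>x. D x b) \<in> smooth_fns"
    "\<And>x. (g has_derivative E x) (at x)" "\<And>b. (\<lambda>x. E x b) \<in> smooth_fns" by blast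
  then show ?case by (intro exI[of _ "\<lambda>x h. D x h + E x h"]) (auto intro: has_derivative_add smooth_fns.add)
next
  case (mult f g)
  then obtain D E where D: "\<And>x. (f has_derivative D x) (at x)" "\<And>b. (\<lambda>x. D x b) \<in> smooth_fns"
    "\<And>x. (g has_derivative E x) (at x)" "\<And>b. (\<lambda>x. E x b) \<in> smooth_fns" by blast
  show ?case
  proof (intro exI[of _ "\<lambda>x h. f x * E x h + D x h * g x"] conjI allI)
    show "((\<lambda>x. f x * g x) has_derivative (\<lambda>h. f x * E x h + D x h * g x)) (at x)" for x
      by (rule has_derivative_mult[OF D(1) D(3)])
    show "(\<lambda>x. f x * E x b + D x b * g x) \<in> smooth_fns" for b
      using mult D by (intro smooth_fns.add smooth_fns.mult) auto
  qed
qed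

lemma smooth_fns_deriv:
  assumes "f \<in> smooth_fns"
  shows "(f has_derivative frechet_derivative f (at x)) (at x)" and "(\<lambda>x. frechet_derivative f (at x) b) \<in> smooth_fns"
proof -
  obtain D where D: "\<And>x. (f has_derivative D x) (at x)" "\<And>b. (\<lambda>x. D x b) \<in> smooth_fns"
    using smooth_fns_derivative[OF assms] by blast
  have "D x = frechet_derivative f (at x)" for x by (rule frechet_derivative_at[OF D(1)])
  then show "(f has_derivative frechet_derivative f (at x)) (at x)" "(\<lambda>x. frechet_derivative f (at x) b) \<in> smooth_fns"
    using D by auto
qed

lemma smooth_fns_continuous: "f \<in> smooth_fns \<Longrightarrow> continuous_on UNIV f"
  unfolding continuous_on_eq_continuous_at[OF open_UNIV]
  by (intro ballI has_derivative_continuous[OF smooth_fns_deriv(1)])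

lemma smooth_fns_Ck: "f \<in> smooth_fns \<Longrightarrow> Ck k f"
proof (induction k arbitrary: f)
  case 0 then show ?case by (simp add: smooth_fns_continuous)
next
  case (Suc k)
  then show ?case using smooth_fns_deriv unfolding Ck.simps differentiable_def by blast
qed

lemma smooth_fns_prod: "finite I \<Longrightarrow> (\<And>i. i \<in> I \<Longrightarrow> f i \<in> smooth_fns) \<Longrightarrow> (\<lambda>x. \<Prod>i\<in>I. f i x) \<in> smooth_fns"
  by (induction I rule: finite_induct) (auto intro: smooth_fns.intros)

text \<open>Every factor has the form \<open>exp (- (1 / (n * s)))\<close> with \<open>s\<close> the
  distance to a face. As \<open>n\<close> grows these smooth functions, bounded by 1, converge to
  the indicator of the open box.\<close>

definition box_bump :: "nat \<Rightarrow> 'a::euclidean_space \<Rightarrow> 'a \<Rightarrow> 'a \<Rightarrow> complex" where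
  "box_bump n l u x = (\<Prod>b\<in>Basis. of_real (bump 0 (real n * (x \<bullet> b - l \<bullet> b))) * of_real (bump 0 (real n * (u \<bullet> b - x \<bullet> b))))"

lemma box_bump_smooth: "box_bump n l u \<in> smooth_fns"
proof -
  have 1: "(\<lambda>x. complex_of_real (bump 0 (real n * (x \<bullet> b - l \<bullet> b)))) \<in> smooth_fns" for b :: 'a
    using smooth_fns.bump[of 0 "real n *\<^sub>R b" "- real n * (l \<bullet> b)"] by (simp add: algebra_simps)
  have 2: "(\<lambda>x. complex_of_real (bump 0 (real n * (u \<bullet> b - x \<bullet> b)))) \<in> smooth_fns" for b :: 'a
    using smooth_fns.bump[of 0 "- real n *\<^sub>R b" "real n * (u \<bullet> b)"] by (simp add: algebra_simps)
  show ?thesis unfolding box_bump_def[abs_def] by (intro smooth_fns_prod smooth_fns.mult 1 2) auto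
qed

lemma box_bump_outside: "x \<notin> box l u \<Longrightarrow> box_bump n l u x = 0"
  unfolding box_bump_def mem_box by (auto simp: bump_def mult_le_0_iff not_less)

lemma bump_0_le: "0 \<le> bump 0 t" "bump 0 t \<le> 1" by (auto simp: bump_def)

lemma cmod_box_bump: "cmod (box_bump n l u x) \<le> 1"
  unfolding box_bump_def by (simp add: norm_mult bump_0_le abs_of_nonneg flip: prod_norm)
    (intro prod_le_1 conjI mult_nonneg_nonneg mult_le_one bump_0_le)

lemma box_bump_tendsto: "(\<lambda>n. box_bump n l u x) \<longlonglongrightarrow> indicator (box l u) x"
proof (cases "x \<in> box l u")
  case False then show ?thesis by (simp add: box_bump_outside)
next
  case True
  have b: "(\<lambda>n. bump 0 (real n * s)) \<longlonglongrightarrow> 1" if s: "0 < s" for s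
  proof -
    have "(\<lambda>n. exp (- ((1 / real n) * (1 / s)))) \<longlonglongrightarrow> exp (- (0 * (1 / s)))" by (intro tendsto_intros lim_1_over_n)
    then have "(\<lambda>n. exp (- (1 / (real n * s)))) \<longlonglongrightarrow> 1" by simp
    then show ?thesis
      by (rule Lim_transform_eventually) (use s eventually_gt_at_top[of 0] in \<open>auto elim!: eventually_mono simp: bump_def mult_le_0_iff\<close>)
  qed
  have "(\<lambda>n. box_bump n l u x) \<longlonglongrightarrow> (\<Prod>b\<in>(Basis::'a set). of_real 1 * of_real 1)"
    unfolding box_bump_def using True by (intro tendsto_prod tendsto_mult tendsto_of_real b) (auto simp: mem_box)
  then show ?thesis using True by simp
qed

lemma box_bump_test: "test_function (box_bump n l u)"
proof -
  have "{x. box_bump n l u x \<noteq> 0} \<subseteq> box l u" using box_bump_outside by blast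
  then have "bounded {x. box_bump n l u x \<noteq> 0}" using bounded_box bounded_subset by blast
  then show ?thesis by (simp add: test_function_def smooth_fns_Ck[OF box_bump_smooth] compact_closure)
qed

lemma box_bump_translate: "box_bump n l u (x - y) = box_bump n (l + y) (u + y) x"
  by (simp add: box_bump_def inner_diff_left inner_add_left algebra_simps)

text \<open>Lebesgue differentiation: off a negligible set the value is the limit of averages over
  shrinking cubes, and all these averages vanish. The null set is first one for
  \<open>lebesgue\<close> and is then transferred to \<open>lborel\<close>.\<close>

lemma AE_zero_if_box_integrals_zero:
  fixes g :: "'a::euclidean_space \<Rightarrow> complex"
  assumes int: "\<And>l u. integrable lborel (\<lambda>z. g z * indicator (box l u) z)"
    and zero: "\<And>l u. (LINT z|lborel. (g z * indicator (box l u) z)) = 0"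
  shows "AE z in lborel. g z = 0"
proof -
  have ind: "indicator A z *\<^sub>R g z = g z * indicator A z" for A z by (simp add: indicator_def)
  have set_int: "set_integrable lborel (box l u) g" for l u
    using int[of l u] unfolding set_integrable_def ind .
  have on: "g integrable_on cbox l u" and I: "integral (cbox l u) g = 0" for l u
  proof -
    show "g integrable_on cbox l u"
      using set_borel_integral_eq_integral(1)[OF set_int] unfolding integrable_on_open_interval .
    have "integral (box l u) g = (LINT z|lborel. (g z * indicator (box l u) z))"
      using set_borel_integral_eq_integral(2)[OF set_int[of l u]] unfolding set_lebesgue_integral_def ind by (rule sym)
    then show "integral (cbox l u) g = 0" unfolding zero integral_open_interval .
  qed
  obtain N where N: "negligible N"
    and lim: "\<And>x e. \<lbrakk>x \<notin> N; 0 < e\<rbrakk> \<Longrightarrow> \<exists>d>0. \<forall>h. 0 < h \<and> h < d \<longrightarrow>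
      norm (integral (cbox x (x + h *\<^sub>R One)) g /\<^sub>R h ^ DIM('a) - g x) < e"
    using integrable_ccontinuous_explicit[of g] on by metis
  have "g x = 0" if x: "x \<notin> N" for x
  proof (rule ccontr)
    assume "g x \<noteq> 0"
    then obtain d where d: "d > 0" "\<And>h. 0 < h \<Longrightarrow> h < d \<Longrightarrow> norm (integral (cbox x (x + h *\<^sub>R One)) g /\<^sub>R h ^ DIM('a) - g x) < norm (g x)"
      using lim[OF x, of "norm (g x)"] by auto
    from d(2)[of "d / 2"] d(1) show False by (simp add: I)
  qed
  then have "AE x in lebesgue. g x = 0"
    using N[unfolded negligible_iff_null_sets] by (intro AE_I'[of N]) auto
  then show ?thesis by (simp only: AE_completion_iff)
qed

lemma bounded_support_integrable:
  fixes h \<eta> :: "'a::euclidean_space \<Rightarrow> complex"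
  assumes [measurable]: "h \<in> borel_measurable borel" and cont: "continuous_on UNIV \<eta>"
    and h: "\<exists>K. \<forall>z. norm z \<le> R \<longrightarrow> cmod (h z) \<le> K" and out: "\<And>z. R < norm z \<Longrightarrow> \<eta> z = 0"
  shows "integrable lborel (\<lambda>z. h z * \<eta> z)"
proof -
  have [measurable]: "\<eta> \<in> borel_measurable borel" using cont by (rule borel_measurable_continuous_onI)
  obtain K where K: "\<And>z. norm z \<le> R \<Longrightarrow> cmod (h z) \<le> K" using h by blast
  have "bounded (\<eta> ` cball 0 R)"
    by (intro compact_imp_bounded compact_continuous_image continuous_on_subset[OF cont]) auto
  then obtain L where L: "\<And>z. norm z \<le> R \<Longrightarrow> cmod (\<eta> z) \<le> L" unfolding bounded_iff by fastforce
  have "cmod (h z * \<eta> z) \<le> K * L" if "norm z \<le> R" for z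
    unfolding norm_mult using K[OF that] L[OF that] by (intro mult_mono) (auto intro: order_trans[OF norm_ge_zero])
  moreover have "emeasure lborel (cball (0::'a) R) < \<infinity>" by (rule emeasure_bounded_finite) simp
  ultimately show ?thesis
    using out by (intro integrableI_bounded_set[of "cball 0 R" _ _ "K * L"]) auto
qed

lemma cbox_subset_cball: "\<exists>r. cbox l u \<subseteq> cball (0::'a::euclidean_space) r"
  using bounded_cbox[of l u] unfolding bounded_iff by (auto simp: subset_iff)

text \<open>Formulated with the closed box because its complement is open, so the function vanishes
  in a neighbourhood of \<open>z\<close>.\<close>

lemma box_bump_deriv_outside:
  assumes "z \<notin> cbox l u"
  shows "frechet_derivative (box_bump n l u) (at z) b = 0"
proof -
  have "\<forall>\<^sub>F y in nhds z. y \<in> - cbox l u"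
    using assms by (intro eventually_nhds_in_open) auto
  then have "\<forall>\<^sub>F y in nhds z. 0 = box_bump n l u y"
  proof (rule eventually_mono)
    fix y assume "y \<in> - cbox l u"
    then have "y \<notin> box l u" using box_subset_cbox[of l u] by blast
    from box_bump_outside[OF this] show "0 = box_bump n l u y" by simp
  qed
  then have ev: "\<forall>\<^sub>F y in at z. 0 = box_bump n l u y" and z: "0 = box_bump n l u z"
    unfolding eventually_nhds_conv_at by auto
  have "(box_bump n l u has_derivative (\<lambda>_. 0)) (at z)"
    by (rule has_derivative_transform_eventually[OF has_derivative_const ev z UNIV_I])
  from fun_cong[OF frechet_derivative_at[OF this]] show ?thesis by simp
qed

lemma linear_eq_sum_Basis:
  fixes f :: "'a::euclidean_space \<Rightarrow> 'b::real_vector"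
  assumes "linear f"
  shows "f x = (\<Sum>b\<in>Basis. (x \<bullet> b) *\<^sub>R f b)"
proof -
  have "f x = f (\<Sum>b\<in>Basis. (x \<bullet> b) *\<^sub>R b)" by (simp only: euclidean_representation)
  then show ?thesis by (simp only: linear_sum[OF assms] linear_scale[OF assms])
qed

text \<open>Local bounds are required at every point, not almost everywhere, since the gradient will
  be restricted to segments, which are null sets in higher dimensions. The data are modified on null
  sets beforehand to achieve this.\<close>

locale weak_gradient =
  fixes a :: "'a::euclidean_space \<Rightarrow> complex" and D :: "'a \<Rightarrow> 'a \<Rightarrow> complex"
  assumes a_meas[measurable]: "a \<in> borel_measurable borel" and D_meas[measurable]: "D b \<in> borel_measurable borel"
    and bd: "\<And>R. \<exists>K. \<forall>z. norm z \<le> R \<longrightarrow> cmod (a z) \<le> K \<and> (\<forall>b\<in>Basis. cmod (D b z) \<le> K)"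
    and weak: "b \<in> Basis \<Longrightarrow> test_function \<eta> \<Longrightarrow>
      (LINT z|lborel. a z * frechet_derivative \<eta> (at z) b) = - (LINT z|lborel. D b z * \<eta> z)"
begin

definition dir :: "'a \<Rightarrow> 'a \<Rightarrow> complex" where
  "dir x z = (\<Sum>b\<in>Basis. of_real (x \<bullet> b) * D b z)"

lemma dir_meas[measurable]: "dir x \<in> borel_measurable borel"
  unfolding dir_def[abs_def] by measurable

lemma loc_bd: "\<exists>K\<ge>0. \<forall>z. norm z \<le> R \<longrightarrow> cmod (a z) \<le> K \<and> cmod (dir x z) \<le> K"
proof -
  obtain K where K: "\<And>z. norm z \<le> R \<Longrightarrow> cmod (a z) \<le> K \<and> (\<forall>b\<in>Basis. cmod (D b z) \<le> K)" using bd by blast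
  define L where "L = (\<Sum>b\<in>(Basis::'a set). norm x * max K 0)"
  have "cmod (dir x z) \<le> L" if "norm z \<le> R" for z
    unfolding dir_def L_def
  proof (intro sum_norm_le)
    fix b :: 'a assume b: "b \<in> Basis"
    have "\<bar>x \<bullet> b\<bar> \<le> norm x" using b by (rule Basis_le_norm)
    moreover have "cmod (D b z) \<le> max K 0" using K[OF that] b by fastforce
    ultimately show "cmod (of_real (x \<bullet> b) * D b z) \<le> norm x * max K 0"
      unfolding norm_mult norm_of_real by (intro mult_mono) auto
  qed
  then show ?thesis using K by (intro exI[of _ "max (max K 0) L"]) (auto intro: max.coboundedI1 max.coboundedI2)
qed

text \<open>The integral of the gradient along the segment from \<open>z\<close> to
  \<open>z + x\<close>, the candidate for the increment of \<open>a\<close>.\<close>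

definition incr :: "'a \<Rightarrow> 'a \<Rightarrow> complex" where
  "incr x z = (LINT t|lborel. (indicator {0..1} t *\<^sub>R dir x (z + t *\<^sub>R x)))"

lemma incr_meas[measurable]: "incr x \<in> borel_measurable borel"
proof -
  have "(\<lambda>z. LINT t|lborel. (indicator {0..1} t *\<^sub>R dir x (z + t *\<^sub>R x))) \<in> borel_measurable lborel"
    by (rule lborel.borel_measurable_lebesgue_integral) measurable
  then show ?thesis unfolding incr_def[abs_def] by simp
qed

lemma dir_line_integrable: "integrable lborel (\<lambda>t. indicator {0..1} t *\<^sub>R dir x (z + t *\<^sub>R x))"
proof -
  obtain K where K: "K \<ge> 0" "\<And>y. norm y \<le> norm z + norm x \<Longrightarrow> cmod (dir x y) \<le> K" using loc_bd by blast
  have "norm (z + t *\<^sub>R x) \<le> norm z + norm x" if "t \<in> {0..1}" for t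
  proof -
    have "norm (t *\<^sub>R x) \<le> norm x" using that by (simp add: mult_left_le_one_le)
    then show ?thesis using norm_triangle_ineq[of z "t *\<^sub>R x"] by linarith
  qed
  then show ?thesis by (intro integrableI_bounded_set_indicator[where B = K]) (auto intro!: K AE_I2)
qed

lemma incr_bd: "\<exists>K. \<forall>z. norm z \<le> R \<longrightarrow> cmod (incr x z) \<le> K"
proof -
  obtain K where K: "K \<ge> 0" "\<And>y. norm y \<le> R + norm x \<Longrightarrow> cmod (dir x y) \<le> K" using loc_bd by blast
  have "cmod (incr x z) \<le> K" if z: "norm z \<le> R" for z
  proof -
    have le: "cmod (indicator {0..1} t *\<^sub>R dir x (z + t *\<^sub>R x)) \<le> indicator {0..1} t * K" for t
    proof (cases "t \<in> {0..1}")
      case True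
      have "norm (t *\<^sub>R x) \<le> norm x" using True by (simp add: mult_left_le_one_le)
      then have "norm (z + t *\<^sub>R x) \<le> R + norm x" using norm_triangle_ineq[of z "t *\<^sub>R x"] z by linarith
      then show ?thesis using K(2)[of "z + t *\<^sub>R x"] True by simp
    qed simp
    have "cmod (incr x z) \<le> (LINT t|lborel. cmod (indicator {0..1} t *\<^sub>R dir x (z + t *\<^sub>R x)))"
      unfolding incr_def by (rule integral_norm_bound)
    also have "\<dots> \<le> (LINT t|lborel. (indicator {0..1::real} t * K))"
    proof (rule Bochner_Integration.integral_mono)
      show "integrable lborel (\<lambda>t. cmod (indicator {0..1} t *\<^sub>R dir x (z + t *\<^sub>R x)))"
        by (intro integrable_norm dir_line_integrable)
      show "integrable lborel (\<lambda>t::real. indicator {0..1} t * K)" by simp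
    qed (rule le)
    finally show ?thesis by (simp add: measure_lborel_Icc)
  qed
  then show ?thesis by blast
qed

lemma pair_integrable:
  fixes F :: "real \<times> 'a \<Rightarrow> complex"
  assumes [measurable]: "F \<in> borel_measurable borel" and bd: "\<And>t z. t \<in> {0..1} \<Longrightarrow> norm z \<le> R \<Longrightarrow> cmod (F (t, z)) \<le> K"
    and out: "\<And>t z. t \<notin> {0..1} \<or> R < norm z \<Longrightarrow> F (t, z) = 0"
  shows "integrable (lborel \<Otimes>\<^sub>M lborel) F"
proof (rule integrableI_bounded_set[of "{0..1} \<times> cball 0 R" _ _ K])
  show "emeasure (lborel \<Otimes>\<^sub>M lborel) ({0..1::real} \<times> cball (0::'a) R) < \<infinity>"
    unfolding lborel_prod by (intro emeasure_bounded_finite bounded_Times) auto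
  show "F \<in> borel_measurable (lborel \<Otimes>\<^sub>M lborel)" unfolding lborel_prod by simp
  show "{0..1::real} \<times> cball (0::'a) R \<in> sets (lborel \<Otimes>\<^sub>M lborel)" by measurable
  show "AE x in lborel \<Otimes>\<^sub>M lborel. x \<in> {0..1} \<times> cball 0 R \<longrightarrow> cmod (F x) \<le> K"
    using bd by (intro AE_I2) auto
  show "AE x in lborel \<Otimes>\<^sub>M lborel. x \<notin> {0..1} \<times> cball 0 R \<longrightarrow> F x = 0"
  proof (intro AE_I2 impI)
    fix p :: "real \<times> 'a" assume p: "p \<notin> {0..1} \<times> cball 0 R"
    have "fst p \<notin> {0..1} \<or> R < norm (snd p)" using p by (cases p) (auto simp: not_le)
    from out[OF this] show "F p = 0" by simp
  qed
qed

text \<open>The fundamental theorem of calculus is transferred from the test function to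
  \<open>a\<close>: exchange the integrals, move the shift by \<open>t *\<^sub>R x\<close> onto the
  test function, use the weak derivative for each \<open>t\<close>, and integrate the smooth
  function along the segment.\<close>

lemma incr_weak:
  fixes l u :: 'a and n :: nat
  defines "\<eta> \<equiv> box_bump n l u"
  shows "(LINT z|lborel. ((a (z + x) - a z - incr x z) * \<eta> z)) = 0"
proof -
  define E where "E z = frechet_derivative \<eta> (at z) x" for z
  have smooth: "\<eta> \<in> smooth_fns" unfolding \<eta>_def by (rule box_bump_smooth)
  note der = smooth_fns_deriv(1)[OF smooth]
  have E_cont: "continuous_on UNIV E" unfolding E_def[abs_def] by (rule smooth_fns_continuous[OF smooth_fns_deriv(2)[OF smooth]])
  have \<eta>_cont: "continuous_on UNIV \<eta>" by (rule smooth_fns_continuous[OF smooth])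
  have [measurable]: "E \<in> borel_measurable borel" "\<eta> \<in> borel_measurable borel"
    by (rule borel_measurable_continuous_onI[OF E_cont], rule borel_measurable_continuous_onI[OF \<eta>_cont])
  obtain r where r: "cbox l u \<subseteq> cball 0 r" using cbox_subset_cball[THEN exE] .
  define R where "R = r + norm x"
  have far: "z \<notin> cbox l u" if "r < norm z" for z
    using subsetD[OF r, of z] that by (simp only: mem_cball_0) linarith
  have \<eta>_out: "\<eta> z = 0" if "r < norm z" for z
    unfolding \<eta>_def using far[OF that] subsetD[OF box_subset_cbox] by (intro box_bump_outside notI) blast
  have E_out: "E z = 0" if "r < norm z" for z
    unfolding E_def \<eta>_def by (rule box_bump_deriv_outside[OF far[OF that]])
  have \<eta>_bd: "cmod (\<eta> z) \<le> 1" for z unfolding \<eta>_def by (rule cmod_box_bump)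
  have "bounded (E ` cball 0 r)"
    by (intro compact_imp_bounded compact_continuous_image continuous_on_subset[OF E_cont]) auto
  then obtain L where L: "\<And>z. norm z \<le> r \<Longrightarrow> cmod (E z) \<le> L" unfolding bounded_iff by fastforce
  have L0: "cmod (E z) \<le> max L 0" for z using L[of z] E_out[of z] by (cases "norm z \<le> r") (simp_all add: le_max_iff_disj)
  have big: "norm y \<le> norm (y - t *\<^sub>R x) + norm x" "norm (y + t *\<^sub>R x) \<le> norm y + norm x" if "t \<in> {0..1}" for t and y :: 'a
  proof -
    have "norm (t *\<^sub>R x) \<le> norm x" using that by (simp add: mult_left_le_one_le)
    then show "norm y \<le> norm (y - t *\<^sub>R x) + norm x" "norm (y + t *\<^sub>R x) \<le> norm y + norm x"
      using norm_triangle_ineq[of y "t *\<^sub>R x"] norm_triangle_ineq[of "y - t *\<^sub>R x" "t *\<^sub>R x"]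
      unfolding diff_add_cancel by linarith+
  qed
  obtain K where K: "K \<ge> 0" "\<And>y. norm y \<le> R + norm x \<Longrightarrow> cmod (a y) \<le> K \<and> cmod (dir x y) \<le> K" using loc_bd by blast
  have r_R: "r \<le> R" by (simp add: R_def)
  let ?F = "\<lambda>t z. indicator {0..1} t *\<^sub>R (dir x (z + t *\<^sub>R x) * \<eta> z)"
  let ?G = "\<lambda>t z. indicator {0..1} t *\<^sub>R (a z * E (z - t *\<^sub>R x))"
  have F_int: "integrable (lborel \<Otimes>\<^sub>M lborel) (case_prod ?F)"
  proof (rule pair_integrable[of _ R "K * 1"])
    show "case_prod ?F \<in> borel_measurable borel"
      unfolding borel_prod[symmetric] split_beta' by measurable
    show "cmod (case_prod ?F (t, z)) \<le> K * 1" if "t \<in> {0..1}" "norm z \<le> R" for t z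
    proof -
      have "norm (z + t *\<^sub>R x) \<le> R + norm x" using big(2)[OF that(1), of z] that(2) by linarith
      then have "cmod (dir x (z + t *\<^sub>R x)) \<le> K" using K(2) by blast
      then have "cmod (dir x (z + t *\<^sub>R x)) * cmod (\<eta> z) \<le> K * 1" by (rule mult_mono[OF _ \<eta>_bd K(1) norm_ge_zero])
      then show ?thesis using that(1) by (simp add: norm_mult)
    qed
    show "case_prod ?F (t, z) = 0" if "t \<notin> {0..1} \<or> R < norm z" for t z
      using that \<eta>_out[of z] r_R by (cases "t \<in> {0..1}") simp_all
  qed
  have G_int: "integrable (lborel \<Otimes>\<^sub>M lborel) (case_prod ?G)"
  proof (rule pair_integrable[of _ R "K * max L 0"])
    show "case_prod ?G \<in> borel_measurable borel"
      unfolding borel_prod[symmetric] split_beta' by measurable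
    show "cmod (case_prod ?G (t, z)) \<le> K * max L 0" if "t \<in> {0..1}" "norm z \<le> R" for t z
    proof -
      have "norm z \<le> R + norm x" using that(2) norm_ge_zero[of x] by linarith
      then have "cmod (a z) \<le> K" using K(2) by blast
      then have "cmod (a z) * cmod (E (z - t *\<^sub>R x)) \<le> K * max L 0" by (rule mult_mono[OF _ L0 K(1) norm_ge_zero])
      then show ?thesis using that(1) by (simp add: norm_mult)
    qed
    show "case_prod ?G (t, z) = 0" if "t \<notin> {0..1} \<or> R < norm z" for t z
    proof (cases "t \<in> {0..1}")
      case True
      then have "R < norm z" using that by blast
      then have "r < norm (z - t *\<^sub>R x)" using big(1)[OF True, of z] unfolding R_def by linarith
      then show ?thesis by (simp add: E_out)
    qed simp
  qed
  \<comment> \<open>A translate of a box bump is again a box bump, so the weak derivative may be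
    applied to it in each coordinate direction.\<close>
  have slice: "(LINT z|lborel. (dir x (z + t *\<^sub>R x) * \<eta> z)) = - (LINT z|lborel. (a z * E (z - t *\<^sub>R x)))" for t
  proof -
    let ?\<eta> = "box_bump n (l + t *\<^sub>R x) (u + t *\<^sub>R x)"
    obtain \<rho> where \<rho>: "cbox (l + t *\<^sub>R x) (u + t *\<^sub>R x) \<subseteq> cball 0 \<rho>" using cbox_subset_cball[THEN exE] .
    have out: "z \<notin> box (l + t *\<^sub>R x) (u + t *\<^sub>R x)" "z \<notin> cbox (l + t *\<^sub>R x) (u + t *\<^sub>R x)" if "\<rho> < norm z" for z
    proof -
      show "z \<notin> cbox (l + t *\<^sub>R x) (u + t *\<^sub>R x)"
        using subsetD[OF \<rho>, of z] that by (simp only: mem_cball_0) linarith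
      then show "z \<notin> box (l + t *\<^sub>R x) (u + t *\<^sub>R x)" using subsetD[OF box_subset_cbox] by blast
    qed
    have \<eta>t: "\<eta> (z - t *\<^sub>R x) = ?\<eta> z" for z unfolding \<eta>_def by (rule box_bump_translate)
    have dert: "(?\<eta> has_derivative frechet_derivative \<eta> (at (z - t *\<^sub>R x))) (at z)" for z
    proof -
      have "((\<lambda>z. z - t *\<^sub>R x) has_derivative (\<lambda>h. h)) (at z)" by (auto intro!: derivative_eq_intros)
      from has_derivative_compose[OF this der] show ?thesis unfolding \<eta>t .
    qed
    have Et: "E (z - t *\<^sub>R x) = (\<Sum>b\<in>Basis. of_real (x \<bullet> b) * frechet_derivative ?\<eta> (at z) b)" for z
    proof -
      have "linear (frechet_derivative \<eta> (at (z - t *\<^sub>R x)))" using der has_derivative_linear by blast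
      then have "E (z - t *\<^sub>R x) = (\<Sum>b\<in>Basis. (x \<bullet> b) *\<^sub>R frechet_derivative \<eta> (at (z - t *\<^sub>R x)) b)"
        unfolding E_def by (rule linear_eq_sum_Basis)
      then show ?thesis unfolding frechet_derivative_at[OF dert, symmetric] scaleR_conv_of_real .
    qed
    have "(LINT z|lborel. (dir x (z + t *\<^sub>R x) * \<eta> z)) = (LINT z|lborel. (dir x z * ?\<eta> z))"
      using lborel_integral_translate(1)[of "\<lambda>z. dir x z * ?\<eta> z" "t *\<^sub>R x"] by (simp add: \<eta>t[symmetric])
    also have "\<dots> = (LINT z|lborel. (\<Sum>b\<in>Basis. of_real (x \<bullet> b) * (D b z * ?\<eta> z)))"
      unfolding dir_def by (simp add: sum_distrib_right mult.assoc)
    also have "\<dots> = (\<Sum>b\<in>Basis. (LINT z|lborel. (of_real (x \<bullet> b) * (D b z * ?\<eta> z))))"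
    proof (rule Bochner_Integration.integral_sum, rule integrable_mult_right)
      fix b :: 'a assume b: "b \<in> Basis"
      have "\<exists>K. \<forall>z. norm z \<le> \<rho> \<longrightarrow> cmod (D b z) \<le> K" using bd[of \<rho>] b by blast
      then show "integrable lborel (\<lambda>z. D b z * ?\<eta> z)"
        using out(1) by (intro bounded_support_integrable[of _ _ \<rho>] D_meas smooth_fns_continuous box_bump_smooth box_bump_outside)
    qed
    also have "\<dots> = (\<Sum>b\<in>Basis. (LINT z|lborel. (of_real (x \<bullet> b) * (- (a z * frechet_derivative ?\<eta> (at z) b)))))"
      by (simp add: weak[OF _ box_bump_test])
    also have "\<dots> = (LINT z|lborel. (\<Sum>b\<in>Basis. of_real (x \<bullet> b) * (- (a z * frechet_derivative ?\<eta> (at z) b))))"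
    proof (rule Bochner_Integration.integral_sum[symmetric], rule integrable_mult_right, rule Bochner_Integration.integrable_minus)
      fix b :: 'a assume b: "b \<in> Basis"
      have "\<exists>K. \<forall>z. norm z \<le> \<rho> \<longrightarrow> cmod (a z) \<le> K" using bd[of \<rho>] by blast
      then show "integrable lborel (\<lambda>z. a z * frechet_derivative ?\<eta> (at z) b)"
        using out(2) by (intro bounded_support_integrable[of _ _ \<rho>] a_meas smooth_fns_continuous smooth_fns_deriv box_bump_smooth box_bump_deriv_outside)
    qed
    also have "\<dots> = (LINT z|lborel. (- (a z * E (z - t *\<^sub>R x))))"
      unfolding Et by (simp add: sum_distrib_left sum_negf algebra_simps)
    finally show ?thesis by simp
  qed
  have FG: "(LINT z|lborel. (incr x z * \<eta> z)) = - (LINT z|lborel. (a z * (\<eta> z - \<eta> (z - x))))"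
  proof -
    have "(LINT z|lborel. (incr x z * \<eta> z)) = (LINT z|lborel. (LINT t|lborel. (?F t z)))"
      unfolding incr_def by (simp flip: integral_mult_left_zero)
    also have "\<dots> = (LINT t|lborel. (LINT z|lborel. (?F t z)))"
      by (rule lborel_pair.Fubini_integral[OF F_int])
    also have "\<dots> = - (LINT t|lborel. (LINT z|lborel. (?G t z)))"
      by (simp add: slice)
    also have "(LINT t|lborel. (LINT z|lborel. (?G t z))) = (LINT z|lborel. (LINT t|lborel. (?G t z)))"
      by (rule lborel_pair.Fubini_integral[OF G_int, symmetric])
    also have "\<dots> = (LINT z|lborel. (a z * (\<eta> z - \<eta> (z - x))))"
    proof (rule Bochner_Integration.integral_cong[OF refl])
      fix z
      \<comment> \<open>An antiderivative of \<open>E (z - t *\<^sub>R x)\<close> in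
        \<open>t\<close> is \<open>- \<eta> (z - t *\<^sub>R x)\<close>; the sign comes from the
        inner derivative \<open>- x\<close>.\<close>
      have "(LINT t|lborel. (indicator {0..1} t *\<^sub>R E (z - t *\<^sub>R x))) = (- \<eta> (z - 1 *\<^sub>R x)) - (- \<eta> (z - 0 *\<^sub>R x))"
      proof (rule integral_FTC_Icc)
        show "((\<lambda>t. - \<eta> (z - t *\<^sub>R x)) has_vector_derivative E (z - t *\<^sub>R x)) (at t within {0..1})" for t
        proof -
          have "((\<lambda>t. z - t *\<^sub>R x) has_derivative (\<lambda>h. - (h *\<^sub>R x))) (at t within {0..1})" by (auto intro!: derivative_eq_intros)
          from has_derivative_minus[OF has_derivative_compose[OF this der]]
          have "((\<lambda>t. - \<eta> (z - t *\<^sub>R x)) has_derivative (\<lambda>h. - frechet_derivative \<eta> (at (z - t *\<^sub>R x)) (- (h *\<^sub>R x)))) (at t within {0..1})" .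
          moreover have "linear (frechet_derivative \<eta> (at (z - t *\<^sub>R x)))" using der has_derivative_linear by blast
          ultimately show ?thesis unfolding has_vector_derivative_def E_def by (simp add: linear_neg linear_scale)
        qed
        show "continuous_on {0..1} (\<lambda>t. E (z - t *\<^sub>R x))"
          by (intro continuous_on_compose2[OF E_cont] continuous_intros) auto
      qed simp
      then have "(LINT t|lborel. (indicator {0..1} t *\<^sub>R E (z - t *\<^sub>R x))) = \<eta> z - \<eta> (z - x)" by simp
      moreover have "?G t z = a z * (indicator {0..1} t *\<^sub>R E (z - t *\<^sub>R x))" for t by simp
      ultimately show "(LINT t|lborel. (?G t z)) = a z * (\<eta> z - \<eta> (z - x))"
        by (simp only: integral_mult_right_zero)
    qed
    finally show ?thesis .
  qed
  have ai: "integrable lborel (\<lambda>z. a (z + x) * \<eta> z)"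
  proof (rule bounded_support_integrable[OF _ \<eta>_cont])
    show "\<exists>K. \<forall>z. norm z \<le> r \<longrightarrow> cmod (a (z + x)) \<le> K"
    proof (intro exI[of _ K] allI impI)
      fix z :: 'a assume "norm z \<le> r"
      then have "norm (z + x) \<le> R + norm x" using big(2)[of 1 z] r_R by simp
      then show "cmod (a (z + x)) \<le> K" using K(2) by blast
    qed
  qed (use \<eta>_out in auto)
  have a0: "integrable lborel (\<lambda>z. a z * \<eta> z)"
    using bd[of r] \<eta>_out by (intro bounded_support_integrable[OF a_meas \<eta>_cont, of r]) blast+
  have ic: "integrable lborel (\<lambda>z. incr x z * \<eta> z)"
    using incr_bd \<eta>_out by (intro bounded_support_integrable[OF incr_meas \<eta>_cont, of r]) auto
  have am: "integrable lborel (\<lambda>z. a z * \<eta> (z - x))" and am': "(LINT z|lborel. (a z * \<eta> (z - x))) = (LINT z|lborel. (a (z + x) * \<eta> z))"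
    using ai lborel_integral_translate[of "\<lambda>z. a z * \<eta> (z - x)" x] by simp_all
  have "(LINT z|lborel. ((a (z + x) - a z - incr x z) * \<eta> z))
      = (LINT z|lborel. (a (z + x) * \<eta> z)) - (LINT z|lborel. (a z * \<eta> z)) - (LINT z|lborel. (incr x z * \<eta> z))"
    unfolding left_diff_distrib using ai a0 ic by simp
  also have "(LINT z|lborel. (incr x z * \<eta> z)) = - ((LINT z|lborel. (a z * \<eta> z)) - (LINT z|lborel. (a z * \<eta> (z - x))))"
    unfolding FG right_diff_distrib using a0 am by simp
  finally show ?thesis unfolding am' by simp
qed

text \<open>\<open>incr_weak\<close> tests the difference against box bumps; dominated convergence
  replaces these by indicators of boxes, and the differentiation theorem concludes. The null set
  depends on \<open>x\<close>.\<close>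

lemma increment: "AE z in lborel. a (z + x) - a z = incr x z"
proof -
  let ?g = "\<lambda>z. a (z + x) - a z - incr x z"
  have g_bd: "\<exists>K. \<forall>z. norm z \<le> R \<longrightarrow> cmod (?g z) \<le> K" for R
  proof -
    obtain K where K: "\<And>z. norm z \<le> R + norm x \<Longrightarrow> cmod (a z) \<le> K" using loc_bd by blast
    obtain L where L: "\<And>z. norm z \<le> R \<Longrightarrow> cmod (incr x z) \<le> L" using incr_bd by blast
    have "cmod (?g z) \<le> K + K + L" if "norm z \<le> R" for z
    proof -
      have "norm (z + x) \<le> R + norm x" "norm z \<le> R + norm x" using that norm_triangle_ineq[of z x] norm_ge_zero[of x] by linarith+
      then show ?thesis
        using K L[OF that] norm_triangle_ineq4[of "a (z + x) - a z" "incr x z"] norm_triangle_ineq4[of "a (z + x)" "a z"]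
        by (smt (verit))
    qed
    then show ?thesis by blast
  qed
  have int: "integrable lborel (\<lambda>z. ?g z * indicator (box l u) z)" for l u
  proof -
    obtain r where "cbox l u \<subseteq> cball 0 r" using cbox_subset_cball[THEN exE] .
    then have r: "box l u \<subseteq> cball 0 r" using box_subset_cbox by blast
    obtain K where K: "\<And>z. norm z \<le> r \<Longrightarrow> cmod (?g z) \<le> K" using g_bd by blast
    have fin: "emeasure lborel (box l u) < \<infinity>" by (rule emeasure_bounded_finite) simp
    have "cmod (?g z * indicator (box l u) z) \<le> K" if "z \<in> box l u" for z
      using K[of z] subsetD[OF r that] that by simp
    then show ?thesis by (intro integrableI_bounded_set[of "box l u" _ _ K] fin AE_I2) auto
  qed
  have "AE z in lborel. ?g z = 0"
  proof (rule AE_zero_if_box_integrals_zero[OF int])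
    fix l u :: 'a
    have "(\<lambda>n. LINT z|lborel. (?g z * box_bump n l u z)) \<longlonglongrightarrow> (LINT z|lborel. (?g z * indicator (box l u) z))"
    proof (rule integral_dominated_convergence[OF _ _ integrable_norm[OF int]])
      show "(\<lambda>z. ?g z * box_bump n l u z) \<in> borel_measurable lborel" for n
        using borel_measurable_continuous_onI[OF smooth_fns_continuous[OF box_bump_smooth[of n l u]]] by measurable
      show "AE z in lborel. (\<lambda>n. ?g z * box_bump n l u z) \<longlonglongrightarrow> ?g z * indicator (box l u) z"
        by (intro AE_I2 tendsto_mult tendsto_const box_bump_tendsto)
      show "AE z in lborel. cmod (?g z * box_bump n l u z) \<le> cmod (?g z * indicator (box l u) z)" for n
      proof (rule AE_I2)
        fix z show "cmod (?g z * box_bump n l u z) \<le> cmod (?g z * indicator (box l u) z)"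
          using mult_left_mono[OF cmod_box_bump[of n l u z] norm_ge_zero[of "?g z"]]
          by (cases "z \<in> box l u") (auto simp: norm_mult box_bump_outside)
      qed
    qed measurable
    then show "(LINT z|lborel. (?g z * indicator (box l u) z)) = 0"
      unfolding incr_weak by (simp add: LIMSEQ_const_iff)
  qed
  then show ?thesis by (rule AE_mp) simp
qed

text \<open>For \<open>norm z > R1 + R\<close> the whole segment from \<open>z\<close> to
  \<open>z + x\<close> stays outside the ball of radius \<open>R1\<close>, where the weighted
  gradient is small. Moderateness moves the weight from the points of the segment to
  \<open>z\<close>.\<close>

lemma oscillation:
  fixes m v :: "'a \<Rightarrow> real"
  assumes [measurable]: "m \<in> borel_measurable borel" and m: "\<And>z. 0 < m z"
    and mod: "\<And>y z. m (y + z) \<le> C * v y * m z" and v: "continuous_on UNIV v" "\<And>z. 0 < v z" and C: "0 \<le> C"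
    and small: "\<And>b e. b \<in> Basis \<Longrightarrow> 0 < e \<Longrightarrow> \<exists>R. AE z in lborel. R < norm z \<longrightarrow> cmod (D b z) * m z \<le> e"
    and R: "0 < R" and e: "0 < e"
  shows "\<exists>R'. \<forall>x. norm x \<le> R \<longrightarrow> (AE z in lborel. R' < norm z \<longrightarrow> cmod (a (z + x) - a z) * m z \<le> e)"
proof -
  have "bounded (v ` cball 0 R)"
    by (intro compact_imp_bounded compact_continuous_image continuous_on_subset[OF v(1)]) auto
  then obtain B where "\<forall>y\<in>v ` cball 0 R. norm y \<le> B" unfolding bounded_iff by blast
  then have "norm (v z) \<le> B" if "norm z \<le> R" for z by (rule bspec) (use that in auto)
  then have B: "v z \<le> B" if "norm z \<le> R" for z using that by (force simp: abs_le_iff)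
  have B0: "0 < B" using B[of 0] v(2)[of 0] R by simp
  \<comment> \<open>The increment is a sum over \<open>DIM('a)\<close> directions of terms at most
    \<open>R * (C * B * \<delta>)\<close>; the added 1 keeps the denominator positive.\<close>
  define \<delta> where "\<delta> = e / (real DIM('a) * R * (C * B) + 1)"
  have den: "0 < real DIM('a) * R * (C * B) + 1" using R C B0 by (intro add_nonneg_pos mult_nonneg_nonneg) auto
  then have \<delta>: "0 < \<delta>" using e by (simp add: \<delta>_def)
  have "\<forall>b\<in>Basis. \<exists>R. AE z in lborel. R < norm z \<longrightarrow> cmod (D b z) * m z \<le> \<delta>" using small \<delta> by blast
  then obtain \<rho> where \<rho>: "\<forall>b\<in>Basis. AE z in lborel. \<rho> b < norm z \<longrightarrow> cmod (D b z) * m z \<le> \<delta>"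
    by (rule bchoice[THEN exE])
  define R1 where "R1 = Max (\<rho> ` Basis)"
  have \<rho>_R1: "\<rho> b \<le> R1" if "b \<in> Basis" for b unfolding R1_def using that by simp
  have near: "AE z in lborel. \<forall>b\<in>Basis. R1 < norm z \<longrightarrow> cmod (D b z) * m z \<le> \<delta>"
  proof (rule AE_finite_allI)
    fix b :: 'a assume b: "b \<in> Basis"
    show "AE z in lborel. R1 < norm z \<longrightarrow> cmod (D b z) * m z \<le> \<delta>"
      using bspec[OF \<rho> b] by (rule AE_mp) (use \<rho>_R1[OF b] in auto)
  qed simp
  have "AE z in lborel. R1 + R < norm z \<longrightarrow> cmod (a (z + x) - a z) * m z \<le> e" if x: "norm x \<le> R" for x
  proof -
    let ?P = "\<lambda>z. \<forall>b\<in>Basis. R1 < norm z \<longrightarrow> cmod (D b z) * m z \<le> \<delta>"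
    \<comment> \<open>A segment is null in phase space, so a bound for almost every point says
      nothing about a given one. Exchanging the quantifiers by Fubini's theorem gives, for almost
      every \<open>z\<close>, the bound at almost every point of its segment.\<close>
    have "AE t in lborel. AE z in lborel. ?P (z + t *\<^sub>R x)"
      by (intro AE_I2 AE_lborel_translate near)
    then have "AE z in lborel. AE t in (lborel :: real measure). ?P (z + t *\<^sub>R x)"
      by (subst (asm) lborel_pair.AE_commute) measurable
    then show ?thesis using increment[of x]
    proof eventually_elim
      case (elim z)
      show ?case
      proof
        assume z: "R1 + R < norm z"
        have bnd: "AE t in lborel. cmod (of_real (m z) * (indicator {0..1} t *\<^sub>R dir x (z + t *\<^sub>R x))) \<le> indicator {0..1} t * e"
          using elim(1)
        proof eventually_elim
          case (elim t)
          show ?case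
          proof (cases "t \<in> {0..1}")
            case True
            let ?w = "z + t *\<^sub>R x"
            have tx: "norm (t *\<^sub>R x) \<le> R" using True x order_trans[OF mult_left_le_one_le[of "norm x" t] x] by auto
            have "R1 < norm ?w" using z tx norm_triangle_ineq4[of ?w "t *\<^sub>R x"] by simp
            then have Dw: "cmod (D b ?w) * m ?w \<le> \<delta>" if "b \<in> Basis" for b using elim that by blast
            have "v (- (t *\<^sub>R x)) \<le> B" using B tx by simp
            then have mz: "m z \<le> C * B * m ?w"
              using mod[of "- (t *\<^sub>R x)" ?w] mult_right_mono[OF mult_left_mono[OF _ C] less_imp_le[OF m[of ?w]]] by fastforce
            have "m z * cmod (dir x ?w) \<le> m z * (\<Sum>b\<in>Basis. \<bar>x \<bullet> b\<bar> * cmod (D b ?w))"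
              using m[of z] unfolding dir_def by (intro mult_left_mono sum_norm_le) (auto simp: norm_mult)
            also have "\<dots> = (\<Sum>b\<in>Basis. \<bar>x \<bullet> b\<bar> * (cmod (D b ?w) * m z))"
              by (simp add: sum_distrib_left mult_ac)
            also have "\<dots> \<le> (\<Sum>b\<in>(Basis :: 'a set). R * (C * B * \<delta>))"
            proof (rule sum_mono)
              fix b :: 'a assume b: "b \<in> Basis"
              have "cmod (D b ?w) * m z \<le> cmod (D b ?w) * (C * B * m ?w)" by (rule mult_left_mono[OF mz norm_ge_zero])
              also have "\<dots> = C * B * (cmod (D b ?w) * m ?w)" by (simp only: mult_ac)
              also have "\<dots> \<le> C * B * \<delta>" using C B0 by (intro mult_left_mono[OF Dw[OF b]]) simp
              finally have 1: "cmod (D b ?w) * m z \<le> C * B * \<delta>" .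
              have "\<bar>x \<bullet> b\<bar> \<le> R" using Basis_le_norm[OF b, of x] x by linarith
              then show "\<bar>x \<bullet> b\<bar> * (cmod (D b ?w) * m z) \<le> R * (C * B * \<delta>)"
                by (rule mult_mono[OF _ 1]) (use R m[of z] in simp_all)
            qed
            also have "\<dots> = real DIM('a) * R * (C * B) * \<delta>" by simp
            also have "\<dots> \<le> (real DIM('a) * R * (C * B) + 1) * \<delta>" using \<delta> by (simp add: distrib_right)
            also have "\<dots> = e" using den by (simp add: \<delta>_def)
            finally show ?thesis using True m[of z] by (simp add: norm_mult)
          qed simp
        qed
        have "m z * cmod (incr x z) = cmod (LINT t|lborel. (of_real (m z) * (indicator {0..1} t *\<^sub>R dir x (z + t *\<^sub>R x))))"
          unfolding incr_def integral_mult_right_zero norm_mult norm_of_real using m[of z] by simp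
        also have "\<dots> \<le> (LINT t|lborel. (indicator {0..1::real} t * e))"
        proof (rule order_trans[OF integral_norm_bound integral_mono_AE])
          show "integrable lborel (\<lambda>t. cmod (of_real (m z) * (indicator {0..1} t *\<^sub>R dir x (z + t *\<^sub>R x))))"
            by (intro integrable_norm integrable_mult_right dir_line_integrable)
          show "integrable lborel (\<lambda>t::real. indicator {0..1} t * e)" by simp
        qed (rule bnd)
        also have "\<dots> = e" by (simp add: measure_lborel_Icc)
        finally show "cmod (a (z + x) - a z) * m z \<le> e" unfolding elim(2) by (simp only: mult.commute)
      qed
    qed
  qed
  then show ?thesis by blast
qed

end

section \<open>The Fredholm property of both localization operators\<close>

lemma (in loc_pair) composition_small_mod_finite: "small_mod_finite A.X A.NX (\<lambda>f. TB.T (TA.T f))"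
proof -
  obtain S \<Theta> where S: "finite \<Theta> \<and> \<Theta> \<subseteq> A.X \<and> (\<forall>f\<in>A.X. S f \<in> A.X \<and> A.NX (S f) \<le> A.NX f / 2)
     \<and> (\<forall>f\<in>A.X. \<forall>g\<in>A.X. S (f + g) = S f + S g) \<and> (\<forall>k. \<forall>f\<in>A.X. S (cscale k f) = cscale k (S f))
     \<and> (\<forall>f\<in>A.X. TB.T (TA.T f) - f - S f \<in> cfun.span \<Theta>)"
    using decomposition by (elim exE)
  note S1 = conjunct1[OF S] and S2 = conjunct1[OF conjunct2[OF S]] and S' = conjunct2[OF conjunct2[OF S]]
  note S3 = conjunct1[OF S'] and S4 = conjunct1[OF conjunct2[OF S']] and S5 = conjunct1[OF conjunct2[OF conjunct2[OF S']]]
    and S6 = conjunct2[OF conjunct2[OF conjunct2[OF S']]]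
  have "half_contraction A.X A.NX S"
  proof
    show "banach_on A.X A.NX" by (rule A.X_banach)
    show "S f \<in> A.X" "A.NX (S f) \<le> A.NX f / 2" if "f \<in> A.X" for f using bspec[OF S3 that] by (rule conjunct1, rule conjunct2)
    show "S (f + g) = S f + S g" if "f \<in> A.X" "g \<in> A.X" for f g by (rule bspec[OF bspec[OF S4 that(1)] that(2)])
    show "S (cscale k f) = cscale k (S f)" if "f \<in> A.X" for f k by (rule bspec[OF spec[OF S5] that])
  qed
  then show ?thesis unfolding small_mod_finite_def using S1 S2 S6 by (intro exI conjI)
qed

text \<open>The symbol enters only under an integral, so a change on a null set leaves the operator
  unchanged. This returns from the corrected symbol to the given one.\<close>

lemma (in mult_op) localization_operator_eq_T:
  assumes f: "f \<in> A.X" and [measurable]: "a' \<in> borel_measurable borel" and ae: "AE z in lborel. a' z = a z"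
  shows "localization_operator w2 a' \<phi> \<psi> f = T f"
  unfolding T_def B.localization_operator_Syn[symmetric] localization_operator_def
proof (intro ext if_cong refl)
  fix g assume g: "g \<in> M1_space w2"
  note [measurable] = A.measurable_stft_dual[OF A.XD[OF f] \<phi>_M1]
    L2c_measurable[OF niceD(1)[OF B.M1_space_nice[OF g]]] L2c_measurable[OF niceD(1)[OF B.M1_space_nice[OF \<psi>_M1]]]
  have eq: "AE z in lborel. a' z * stft_dual \<phi> f z * cnj (stft \<psi> g z) = a z * stft_dual \<phi> f z * cnj (stft \<psi> g z)"
    using ae by eventually_elim simp
  show "(LINT z|lborel. a' z * stft_dual \<phi> f z * cnj (stft \<psi> g z)) = (LINT z|lborel. a z * stft_dual \<phi> f z * cnj (stft \<psi> g z))"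
    by (rule integral_cong_AE[OF _ _ eq]) measurable
qed

lemma japanese_ge_1: "1 \<le> japanese x"
  by (simp add: japanese_def)

theorem theorem7p1:
  fixes v w m \<mu> :: "(real^'d) \<times> (real^'d) \<Rightarrow> real"
    and p q :: ennreal
    and a :: "(real^'d) \<times> (real^'d) \<Rightarrow> complex"
    and \<phi>1 \<phi>2 :: "real^'d \<Rightarrow> complex"
  assumes "submult_weight v" and "submult_weight w"
    and "m \<in> moderate_weights v" and "\<mu> \<in> moderate_weights w"
    and "1 \<le> p" and "1 \<le> q"
    and "a \<in> borel_measurable borel"
    and "\<exists>c\<ge>1. AE z in lborel. inverse c / m z \<le> cmod (a z) \<and> cmod (a z) \<le> c / m z"
    and "\<forall>b\<in>Basis. \<exists>D. distributional_derivative a b D \<and> (\<lambda>z. D z * of_real (m z)) \<in> L0"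
    and "\<phi>1 \<in> M1_space (\<lambda>z. w z * (v z)\<^sup>2 * (japanese (fst z) * japanese (snd z)))"
    and "\<phi>2 \<in> M1_space (\<lambda>z. w z * (v z)\<^sup>2 * (japanese (fst z) * japanese (snd z)))"
    and "cmod (l2_inner \<phi>1 \<phi>2) = 1"
  shows "fredholm_on
           (modulation_space w p q \<mu>) (modulation_norm p q \<mu>)
           (modulation_space (\<lambda>z. w z * v z) p q (\<lambda>z. \<mu> z * m z))
           (modulation_norm p q (\<lambda>z. \<mu> z * m z))
           (localization_operator (\<lambda>z. w z * v z) a \<phi>1 \<phi>2) \<and>
         fredholm_on
           (modulation_space (\<lambda>z. w z * v z) p q (\<lambda>z. \<mu> z * m z))
           (modulation_norm p q (\<lambda>z. \<mu> z * m z))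
           (modulation_space w p q \<mu>) (modulation_norm p q \<mu>)
           (localization_operator w (\<lambda>z. 1 / a z) \<phi>2 \<phi>1)"
proof -
  note \<phi>W = assms(10,11) and inner = assms(12)
  have vw: "weight v" "weight w" using assms(1,2) by (auto intro: weight_submult)
  interpret v: weight v by (rule vw)
  interpret w: weight w by (rule vw)
  interpret wv: weight "\<lambda>z. w z * v z" by (rule weight_mult[OF vw])
  interpret wvv: weight "\<lambda>z. w z * v z * v z" by (rule weight_mult[OF vw(1) wv.weight_axioms])
  obtain C where m_meas [measurable]: "m \<in> borel_measurable borel" and m_pos: "\<And>z. 0 < m z"
    and m_mod: "\<And>x y. m (x + y) \<le> C * v x * m y"
    using assms(3) unfolding moderate_weights_def by blast
  obtain Cw where \<mu>_meas [measurable]: "\<mu> \<in> borel_measurable borel" and \<mu>_pos: "\<And>z. 0 < \<mu> z"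
    and \<mu>_mod: "\<And>x y. \<mu> (x + y) \<le> Cw * w x * \<mu> y"
    using assms(4) unfolding moderate_weights_def by blast
  obtain c where c: "1 \<le> c" and a_ae: "AE z in lborel. inverse c / m z \<le> cmod (a z) \<and> cmod (a z) \<le> c / m z"
    using assms(8) by blast
  note [measurable] = assms(7) v.measurable_weight w.measurable_weight
  have C: "1 \<le> C"
    using m_mod[of 0 0] m_pos[of 0] v.zero by simp
  have ratio: "m x \<le> C * v (x - y) * m y" for x y
    using m_mod[of "x - y" y] by simp

  \<comment> \<open>Where the bounds fail, \<open>1 / m z\<close> is substituted; it satisfies both
    because \<open>1 \<le> c\<close>. The corrected symbol never vanishes, so its reciprocal is
    bounded everywhere too.\<close>
  define a' where "a' z = (if inverse c / m z \<le> cmod (a z) \<and> cmod (a z) \<le> c / m z then a z else of_real (1 / m z))" for z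
  define b' where "b' z = 1 / a' z" for z
  have a'_meas [measurable]: "a' \<in> borel_measurable borel" unfolding a'_def[abs_def] by measurable
  have b'_meas [measurable]: "b' \<in> borel_measurable borel" unfolding b'_def[abs_def] by measurable
  have a'_lo: "inverse c / m z \<le> cmod (a' z)" and a'_hi: "cmod (a' z) \<le> c / m z" for z
  proof -
    have "inverse c \<le> 1" using c by (simp add: inverse_le_1_iff)
    then have "inverse c / m z \<le> 1 / m z" "1 / m z \<le> c / m z" using m_pos[of z] c by (auto intro!: divide_right_mono)
    moreover have "cmod (of_real (1 / m z)) = 1 / m z" unfolding norm_of_real using m_pos[of z] by simp
    ultimately show "inverse c / m z \<le> cmod (a' z)" "cmod (a' z) \<le> c / m z" unfolding a'_def by (auto simp del: of_real_divide)
  qed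
  have ic: "0 < inverse c / m z" for z using c m_pos[of z] by simp
  have a'_nz: "a' z \<noteq> 0" for z using a'_lo[of z] ic[of z] by auto
  have b'_hi: "cmod (b' z) \<le> c * m z" for z
  proof -
    have "cmod (b' z) = inverse (cmod (a' z))" by (simp add: b'_def norm_divide inverse_eq_divide)
    also have "\<dots> \<le> inverse (inverse c / m z)" by (rule le_imp_inverse_le[OF a'_lo ic])
    also have "\<dots> = c * m z" using c m_pos[of z] by (simp add: field_simps)
    finally show ?thesis .
  qed
  have aa': "AE z in lborel. a z = a' z" using a_ae by eventually_elim (simp add: a'_def)
  then have bb': "AE z in lborel. 1 / a z = b' z" by eventually_elim (simp add: b'_def)
  \<comment> \<open>Moderateness bounds \<open>1 / m\<close> by a multiple of \<open>v\<close>,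
    hence locally. This gives the local bounds for the symbol and its gradient, which are controlled
    only relative to \<open>1 / m\<close>.\<close>
  have m_inv: "1 / m z \<le> C * v z / m 0" for z
    using ratio[of 0 z] v.even[of z] m_pos[of z] m_pos[of 0] by (simp add: field_simps)

  obtain D0 where D0: "\<forall>b\<in>Basis. distributional_derivative a b (D0 b) \<and> (\<lambda>z. D0 b z * of_real (m z)) \<in> L0"
    using assms(9) by (rule bchoice[THEN exE])
  have "\<forall>b\<in>Basis. \<exists>K. AE z in lborel. cmod (D0 b z * of_real (m z)) \<le> K"
    using D0 unfolding L0_def by blast
  then obtain K where K: "\<forall>b\<in>Basis. AE z in lborel. cmod (D0 b z * of_real (m z)) \<le> K b"
    by (rule bchoice[THEN exE])
  \<comment> \<open>The weak derivatives are set to 0 where their essential bound fails, so that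
    they are at most a constant times \<open>1 / m\<close> at every point.\<close>
  define D where "D b z = (if b \<in> Basis \<and> cmod (D0 b z * of_real (m z)) \<le> K b then D0 b z else 0)" for b z
  have D0_meas: "D0 b \<in> borel_measurable borel" if "b \<in> Basis" for b
  proof -
    have [measurable]: "(\<lambda>z. D0 b z * of_real (m z)) \<in> borel_measurable borel" using D0 that unfolding L0_def by blast
    have "(\<lambda>z. (D0 b z * of_real (m z)) / of_real (m z)) \<in> borel_measurable borel" by measurable
    moreover have "(\<lambda>z. (D0 b z * of_real (m z)) / of_real (m z)) = D0 b"
    proof
      fix z show "(D0 b z * of_real (m z)) / of_real (m z) = D0 b z" using m_pos[of z] by simp
    qed
    ultimately show ?thesis by simp
  qed
  have D_meas: "D b \<in> borel_measurable borel" for b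
  proof (cases "b \<in> Basis")
    case True
    note [measurable] = D0_meas[OF True]
    show ?thesis unfolding D_def[abs_def] by measurable
  next
    case False then show ?thesis by (simp add: D_def[abs_def])
  qed
  have D_ae: "AE z in lborel. D0 b z = D b z" if "b \<in> Basis" for b
    using bspec[OF K that] by eventually_elim (simp add: D_def that)
  have D_bd: "cmod (D b z) \<le> max (K b) 0 * (1 / m z)" if "b \<in> Basis" for b z
    using m_pos[of z] by (simp add: D_def norm_mult pos_le_divide_eq le_max_iff_disj)
  have weak: "(LINT z|lborel. a' z * frechet_derivative \<eta> (at z) b) = - (LINT z|lborel. D b z * \<eta> z)"
    if b: "b \<in> Basis" and \<eta>: "test_function \<eta>" for b \<eta>
  proof -
    have "Ck (Suc 0) \<eta>" "Ck 0 \<eta>" using \<eta> unfolding test_function_def by blast+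
    then have cont: "continuous_on UNIV (\<lambda>z. frechet_derivative \<eta> (at z) b)" "continuous_on UNIV \<eta>" using b by auto
    note [measurable] = cont[THEN borel_measurable_continuous_onI]
    note [measurable] = D_meas D0_meas[OF b]
    have 1: "AE z in lborel. a' z * frechet_derivative \<eta> (at z) b = a z * frechet_derivative \<eta> (at z) b"
      using aa' by eventually_elim simp
    have 2: "AE z in lborel. D0 b z * \<eta> z = D b z * \<eta> z" using D_ae[OF b] by eventually_elim simp
    have "(LINT z|lborel. a' z * frechet_derivative \<eta> (at z) b) = (LINT z|lborel. a z * frechet_derivative \<eta> (at z) b)"
      by (rule integral_cong_AE[OF _ _ 1]) measurable
    also have "\<dots> = - (LINT z|lborel. D0 b z * \<eta> z)" using D0 b \<eta> unfolding distributional_derivative_def by blast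
    also have "(LINT z|lborel. D0 b z * \<eta> z) = (LINT z|lborel. D b z * \<eta> z)"
      by (rule integral_cong_AE[OF _ _ 2]) measurable
    finally show ?thesis .
  qed
  have bd: "\<exists>L. \<forall>z. norm z \<le> R \<longrightarrow> cmod (a' z) \<le> L \<and> (\<forall>b\<in>Basis. cmod (D b z) \<le> L)" for R
  proof -
    obtain B where B: "1 \<le> B" "\<And>z. norm z \<le> R \<Longrightarrow> v z \<le> B" using v.local_bound[of R] by blast
    define M where "M = C * B / m 0"
    have M: "1 / m z \<le> M" if "norm z \<le> R" for z
      using order_trans[OF m_inv divide_right_mono[OF mult_left_mono[OF B(2)[OF that]]]] C m_pos[of 0] unfolding M_def by simp
    have M0: "0 \<le> M" using C B m_pos[of 0] by (simp add: M_def)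
    define k where "k = (\<Sum>b\<in>(Basis :: ((real^'d) \<times> (real^'d)) set). max (K b) 0)"
    have k: "0 \<le> k" unfolding k_def by (intro sum_nonneg) simp
    have k': "max (K b) 0 \<le> k" if "b \<in> Basis" for b unfolding k_def by (rule member_le_sum[OF that]) auto
    have "cmod (a' z) \<le> (c + k) * M \<and> (\<forall>b\<in>Basis. cmod (D b z) \<le> (c + k) * M)" if z: "norm z \<le> R" for z
    proof (intro conjI ballI)
      have "cmod (a' z) \<le> c * (1 / m z)" using a'_hi[of z] by simp
      also have "\<dots> \<le> (c + k) * M" using c k M[OF z] M0 m_pos[of z] by (intro mult_mono) auto
      finally show "cmod (a' z) \<le> (c + k) * M" .
      fix b :: "(real^'d) \<times> (real^'d)" assume b: "b \<in> Basis"
      note D_bd[OF b, of z]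
      also have "max (K b) 0 * (1 / m z) \<le> (c + k) * M" using c k k'[OF b] M[OF z] M0 m_pos[of z] by (intro mult_mono) auto
      finally show "cmod (D b z) \<le> (c + k) * M" .
    qed
    then show ?thesis by blast
  qed
  interpret G: weak_gradient a' D
    by (intro weak_gradient.intro a'_meas D_meas bd weak)
  have small: "\<exists>R. AE z in lborel. R < norm z \<longrightarrow> cmod (D b z) * m z \<le> e" if b: "b \<in> Basis" and e: "0 < e" for b e
  proof -
    obtain R where "AE z in lborel. norm z > R \<longrightarrow> cmod (D0 b z * of_real (m z)) < e"
      using D0 b e unfolding L0_def by blast
    then have "AE z in lborel. R < norm z \<longrightarrow> cmod (D b z) * m z \<le> e"
      by eventually_elim (use m_pos e in \<open>auto simp: D_def norm_mult less_imp_le\<close>)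
    then show ?thesis by blast
  qed
  have osc: "\<exists>R'. \<forall>x. norm x \<le> R \<longrightarrow> (AE z in lborel. R' < norm z \<longrightarrow> cmod (a' (z + x) - a' z) * m z \<le> e)"
    if "0 < R" "0 < e" for R e
    using C by (intro G.oscillation[OF m_meas m_pos m_mod v.cont v.pos _ small that]) auto

  \<comment> \<open>\<open>c * c\<close> comes from the bounds on \<open>1 / a\<close> at
    \<open>z\<close> and on \<open>a\<close> at \<open>u\<close>, and \<open>C\<close> from
    comparing \<open>m z\<close> with \<open>m u\<close>. As \<open>c \<le> c2\<close>, the same
    constant serves all bounds of \<open>loc_pair\<close>.\<close>
  define c2 where "c2 = c * c * C"
  have cc: "c \<le> c2"
  proof -
    have "1 * 1 \<le> c * C" using c C by (intro mult_mono) auto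
    then have "c * 1 \<le> c * (c * C)" using c by (intro mult_left_mono) auto
    then show ?thesis by (simp add: c2_def mult.assoc)
  qed
  have product: "cmod (b' z * a' u) \<le> c2 * v (u - z)" for z u
  proof -
    have "cmod (b' z * a' u) \<le> (c * m z) * (c / m u)"
      unfolding norm_mult using b'_hi[of z] a'_hi[of u] c m_pos[of z] by (intro mult_mono) auto
    also have "\<dots> = c * c * (m z / m u)" by simp
    also have "m z / m u \<le> C * v (u - z)"
      using ratio[of z u] v.even[of "u - z"] m_pos[of u] by (simp add: pos_divide_le_eq)
    finally show ?thesis using c by (simp add: c2_def mult.assoc mult_left_mono)
  qed
  have product': "cmod (a' z * b' u) \<le> c2 * v (u - z)" for z u
    using product[of u z] v.even[of "u - z"] by (simp add: mult.commute)
  \<comment> \<open>The deviation of the quotient from 1 is \<open>b' z\<close> times the increment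
    of \<open>a'\<close>, and \<open>cmod (b' z)\<close> is at most \<open>c * m z\<close>, exactly
    the weight in \<open>osc\<close>.\<close>
  have osc_b: "\<exists>R'. \<forall>x. norm x \<le> R \<longrightarrow> (AE z in lborel. R' < norm z \<longrightarrow> cmod (b' z * a' (z + x) - 1) \<le> e)"
    if R: "0 < R" and e: "0 < e" for R e
  proof -
    have "0 < e / c" using e c by simp
    from osc[OF R this] obtain R' where R': "\<And>x. norm x \<le> R \<Longrightarrow> AE z in lborel. R' < norm z \<longrightarrow> cmod (a' (z + x) - a' z) * m z \<le> e / c" by blast
    have "AE z in lborel. R' < norm z \<longrightarrow> cmod (b' z * a' (z + x) - 1) \<le> e" if "norm x \<le> R" for x
      using R'[OF that]
    proof eventually_elim
      case (elim z)
      have "b' z * a' (z + x) - 1 = b' z * (a' (z + x) - a' z)" using a'_nz[of z] by (simp add: b'_def field_simps)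
      then have "cmod (b' z * a' (z + x) - 1) \<le> c * m z * cmod (a' (z + x) - a' z)"
        unfolding norm_mult using mult_right_mono[OF b'_hi[of z] norm_ge_zero] by (simp add: norm_mult)
      also have "\<dots> = c * (cmod (a' (z + x) - a' z) * m z)" by simp
      finally show ?case using elim c by (simp add: pos_le_divide_eq mult.commute order_trans)
    qed
    then show ?thesis by blast
  qed
  \<comment> \<open>Here the reciprocal is taken at \<open>z + x\<close>, so the weight appears
    there; for \<open>norm x \<le> R\<close> it is at most \<open>C * B * m z\<close>, which
    explains the constant \<open>k\<close>.\<close>
  have osc_a: "\<exists>R'. \<forall>x. norm x \<le> R \<longrightarrow> (AE z in lborel. R' < norm z \<longrightarrow> cmod (a' z * b' (z + x) - 1) \<le> e)"
    if R: "0 < R" and e: "0 < e" for R e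
  proof -
    obtain B where B: "1 \<le> B" "\<And>z. norm z \<le> R \<Longrightarrow> v z \<le> B" using v.local_bound[of R] by blast
    define k where "k = c * C * B"
    have k: "0 < k" using c C B by (simp add: k_def)
    then have "0 < e / k" using e by simp
    from osc[OF R this] obtain R' where R': "\<And>x. norm x \<le> R \<Longrightarrow> AE z in lborel. R' < norm z \<longrightarrow> cmod (a' (z + x) - a' z) * m z \<le> e / k" by blast
    have "AE z in lborel. R' < norm z \<longrightarrow> cmod (a' z * b' (z + x) - 1) \<le> e" if x: "norm x \<le> R" for x
      using R'[OF x]
    proof eventually_elim
      case (elim z)
      have "a' z * b' (z + x) - 1 = b' (z + x) * (a' z - a' (z + x))" using a'_nz[of "z + x"] by (simp add: b'_def field_simps)
      then have "cmod (a' z * b' (z + x) - 1) \<le> c * m (z + x) * cmod (a' (z + x) - a' z)"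
        using mult_right_mono[OF b'_hi[of "z + x"] norm_ge_zero, of "a' z - a' (z + x)"] by (simp add: norm_mult norm_minus_commute)
      also have "\<dots> \<le> c * (C * B * m z) * cmod (a' (z + x) - a' z)"
      proof (intro mult_right_mono mult_left_mono)
        have "m (z + x) \<le> C * v x * m z" using m_mod[of x z] by (simp add: add.commute)
        also have "\<dots> \<le> C * B * m z" using B(2)[OF x] C m_pos[of z] by (intro mult_right_mono mult_left_mono) auto
        finally show "m (z + x) \<le> C * B * m z" .
      qed (use c in auto)
      also have "\<dots> = k * (cmod (a' (z + x) - a' z) * m z)" by (simp add: k_def)
      finally show ?case using elim k by (simp add: pos_le_divide_eq mult.commute order_trans)
    qed
    then show ?thesis by blast
  qed

  let ?W = "\<lambda>z::(real^'d) \<times> (real^'d). w z * (v z)\<^sup>2 * (japanese (fst z) * japanese (snd z))"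
  have W_meas: "?W \<in> borel_measurable borel"
    unfolding japanese_def by (intro borel_measurable_continuous_onI continuous_intros v.cont w.cont)
  have W1: "w z * v z * v z \<le> ?W z" for z
  proof -
    have "1 * 1 \<le> japanese (fst z) * japanese (snd z)" by (intro mult_mono japanese_ge_1) (use japanese_ge_1[of "fst z"] in auto)
    then have "w z * (v z)\<^sup>2 * 1 \<le> ?W z" using w.nonneg[of z] by (intro mult_left_mono) auto
    then show ?thesis by (simp add: power2_eq_square mult.assoc)
  qed
  have wv_le: "w z * v z \<le> w z * v z * v z" for z
    using mult_left_mono[OF v.ge_1[of z] wv.nonneg[of z]] by simp
  have w_le: "w z \<le> w z * v z" for z
    using mult_left_mono[OF v.ge_1[of z] w.nonneg[of z]] by simp
  \<comment> \<open>The two instances of \<open>loc_pair\<close> need their kernel window integrable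
    against \<open>w * v\<close> and \<open>w * v * v\<close>; the given weight dominates the larger
    one, since both factors \<open>japanese\<close> are at least 1.\<close>
  have \<phi>_mem: "\<phi> \<in> M1_space w" "\<phi> \<in> M1_space (\<lambda>z. w z * v z)" "nice (\<lambda>z. w z * v z) \<phi>" "nice (\<lambda>z. w z * v z * v z) \<phi>"
    if "\<phi> \<in> M1_space ?W" for \<phi>
  proof -
    show "\<phi> \<in> M1_space w" using w.M1_space_mono[OF that W_meas] order_trans[OF w_le order_trans[OF wv_le W1]] by blast
    show 1: "\<phi> \<in> M1_space (\<lambda>z. w z * v z)" using wv.M1_space_mono[OF that W_meas] order_trans[OF wv_le W1] by blast
    show "nice (\<lambda>z. w z * v z) \<phi>" by (rule wv.M1_space_nice[OF 1])
    show "nice (\<lambda>z. w z * v z * v z) \<phi>" by (rule wvv.M1_space_nice[OF wvv.M1_space_mono[OF that W_meas W1]])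
  qed
  note \<phi>1 = \<phi>_mem[OF \<phi>W(1)] and \<phi>2 = \<phi>_mem[OF \<phi>W(2)]

  have modA: "modsp w p q \<mu> Cw"
    by unfold_locales (fact assms(5) assms(6) \<mu>_meas \<mu>_pos \<mu>_mod)+
  have modB: "modsp (\<lambda>z. w z * v z) p q (\<lambda>z. \<mu> z * m z) (Cw * C)"
  proof unfold_locales
    show "1 \<le> p" "1 \<le> q" by (fact assms(5) assms(6))+
    show "0 < \<mu> z * m z" for z using \<mu>_pos[of z] m_pos[of z] by simp
    fix x y
    have "\<mu> (x + y) * m (x + y) \<le> (Cw * w x * \<mu> y) * (C * v x * m y)"
      using \<mu>_pos[of "x + y"] m_pos[of "x + y"] order_trans[OF less_imp_le[OF \<mu>_pos] \<mu>_mod[of x y]]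
      by (intro mult_mono \<mu>_mod m_mod) auto
    then show "\<mu> (x + y) * m (x + y) \<le> Cw * C * (w x * v x) * (\<mu> y * m y)" by (simp add: mult_ac)
  qed measurable
  have a_bd: "cmod (a' z) * (\<mu> z * m z) \<le> c2 * \<mu> z" for z
  proof -
    have "cmod (a' z) * (\<mu> z * m z) \<le> c / m z * (\<mu> z * m z)" using a'_hi[of z] \<mu>_pos[of z] m_pos[of z] by (intro mult_right_mono) auto
    also have "\<dots> = c * \<mu> z" using m_pos[of z] by simp
    finally show ?thesis using mult_right_mono[OF cc less_imp_le[OF \<mu>_pos[of z]]] by linarith
  qed
  have b_bd: "cmod (b' z) * \<mu> z \<le> c2 * (\<mu> z * m z)" for z
  proof -
    have "cmod (b' z) * \<mu> z \<le> c * m z * \<mu> z" using b'_hi[of z] \<mu>_pos[of z] by (intro mult_right_mono) auto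
    also have "\<dots> = c * (\<mu> z * m z)" by simp
    also have "\<dots> \<le> c2 * (\<mu> z * m z)" using cc \<mu>_pos[of z] m_pos[of z] by (intro mult_right_mono) auto
    finally show ?thesis .
  qed
  interpret P: loc_pair w p q \<mu> Cw "\<lambda>z. w z * v z" "\<lambda>z. \<mu> z * m z" "Cw * C" v a' b' \<phi>1 \<phi>2 c2
    by (intro loc_pair.intro loc_pair_axioms.intro modA modB vw(1) a'_meas b'_meas a_bd b_bd product osc_b \<phi>1 \<phi>2 inner)
  have inner': "cmod (l2_inner \<phi>2 \<phi>1) = 1" unfolding l2_inner_cnj[of \<phi>2 \<phi>1] complex_mod_cnj by (rule inner)
  \<comment> \<open>The same locale with spaces, symbols and windows exchanged. Its moderating
    weight is now \<open>w * v\<close>, so its kernel condition concerns \<open>w * v * v\<close>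
    and the window \<open>\<phi>1\<close>.\<close>
  interpret Q: loc_pair "\<lambda>z. w z * v z" p q "\<lambda>z. \<mu> z * m z" "Cw * C" w \<mu> Cw v b' a' \<phi>2 \<phi>1 c2
    by (intro loc_pair.intro loc_pair_axioms.intro modA modB vw(1) a'_meas b'_meas a_bd b_bd product' osc_a \<phi>1 \<phi>2 inner')
  note BA = P.composition_small_mod_finite and AB = Q.composition_small_mod_finite
  \<comment> \<open>Each operator is a parametrix of the other, so the two compositions serve both
    claims, with the roles of kernel and range interchanged.\<close>
  have fr: "fredholm_on P.A.X P.A.NX P.B.X P.B.NX P.TA.T" "fredholm_on P.B.X P.B.NX P.A.X P.A.NX P.TB.T"
    by (rule fredholm_parametrix[where A = P.TA.T and B = P.TB.T, OF P.A.X_banach P.B.X_banach P.TA.T_operator P.TB.T_operator BA AB],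
        rule fredholm_parametrix[where A = P.TB.T and B = P.TA.T, OF P.B.X_banach P.A.X_banach P.TB.T_operator P.TA.T_operator AB BA])
  have eqA: "localization_operator (\<lambda>z. w z * v z) a \<phi>1 \<phi>2 f = P.TA.T f" if "f \<in> P.A.X" for f
    by (rule P.TA.localization_operator_eq_T[OF that _ aa']) measurable
  have eqB: "localization_operator w (\<lambda>z. 1 / a z) \<phi>2 \<phi>1 f = P.TB.T f" if "f \<in> P.B.X" for f
    by (rule P.TB.localization_operator_eq_T[OF that _ bb']) measurable
  show ?thesis by (rule conjI[OF fredholm_on_cong[OF eqA fr(1)] fredholm_on_cong[OF eqB fr(2)]])
qed

end
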